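(* Assume $0<|\gamma|<1/3$. The quantum partial Fourier transforms $\mathcal{F}^q_x,\mathcal{F}^q_y$ and the quantum Fourier transform $\mathcal{F}^q=\mathcal{F}^q_x\mathcal{F}^q_y$ (unitaries on $\mathcal{H}=L^2(\mathbb{R}^2)^{\oplus4}$ defined in the context) satisfy: (i) $\mathcal{F}^q_x\,\mathsf{x}\,(\mathcal{F}^q_x)^{-1}=-\mathcal{D}^q_x$, $\ \mathcal{F}^q_x\mathcal{D}^q_x(\mathcal{F}^q_x)^{-1}=\mathsf{x}$, $\ \mathcal{F}^q_x\,\mathsf{y}\,(\mathcal{F}^q_x)^{-1}=\mathsf{K}_1^{-2}\mathsf{y}$, $\ \mathcal{F}^q_x\mathcal{D}^q_y(\mathcal{F}^q_x)^{-1}=\mathsf{K}_1^{-2}\mathcal{D}^q_y$. (ii) $\mathcal{F}^q_y\,\mathsf{y}\,(\mathcal{F}^q_y)^{-1}=-\mathcal{D}^q_y$, $\ \mathcal{F}^q_y\mathcal{D}^q_y(\mathcal{F}^q_y)^{-1}=\mathsf{y}$, $\ \mathcal{F}^q_y\,\mathsf{x}\,(\mathcal{F}^q_y)^{-1}=\mathsf{K}_2^{2}\mathsf{x}$, $\ \mathcal{F}^q_y\mathcal{D}^q_x(\mathcal{F}^q_y)^{-1}=\mathsf{K}_2^{2}\mathcal{D}^q_x$. (iii) $\mathcal{F}^q\,\mathsf{x}\,(\mathcal{F}^q)^{-1}=-\mathsf{K}_2^2\mathcal{D}^q_x$, $\ \mathcal{F}^q\,\mathsf{y}\,(\mathcal{F}^q)^{-1}=-\mathsf{K}_1^{-2}\mathcal{D}^q_y$,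 $\ \mathcal{F}^q\mathcal{D}^q_x(\mathcal{F}^q)^{-1}=\mathsf{K}_2^2\mathsf{x}$, $\ \mathcal{F}^q\mathcal{D}^q_y(\mathcal{F}^q)^{-1}=\mathsf{K}_1^{-2}\mathsf{y}$. Here products such as $\mathsf{K}_1^{-2}\mathsf{y}$ denote the closures of the operator products.
   Context: Parameters: $q\neq\pm1$ is a complex number of modulus one, $\gamma\in\mathbb{R}$ is fixed with $q=e^{2\pi i\gamma}$, and $\alpha,\beta\in\mathbb{R}$ satisfy $\alpha\beta=\gamma$. On $L^2(\mathbb{R})$ let $\mathcal{P}=\frac{1}{2\pi i}\frac{d}{dx}$, $\mathcal{Q}$ = multiplication by $x$, $(uf)(x)=f(-x)$. On $L^2(\mathbb{R}^2)=L^2(\mathbb{R})\otimes L^2(\mathbb{R})$, $\mathcal{P}_j,\mathcal{Q}_j$ are these operators in the variable $x_j$; $T_1\otimes T_2$ is the closure of the algebraic tensor product. Put $f_{\pm\alpha}(x)=-2\sinh\pi\beta(2x\pm\alpha i)$, $f_{\pm\beta}(x)=-2\sinh\pi\alpha(2x\pm\beta i)$, $L_\alpha=\overline{f_\alpha}(\mathcal{P})e^{-2\pi\alpha\mathcal{Q}}$, $L_\beta=\overline{f_\beta}(\mathcal{P})e^{-2\pi\beta\mathcal{Q}}$, $R_\alpha=L_\alpha^\ast=e^{-2\pi\alpha\mathcal{Q}}f_\alpha(\mathcal{P})$, $R_\beta=L_\beta^\ast=e^{-2\pi\beta\mathcal{Q}}f_\beta(\mathcal{P})$ (operator products with natural domains;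 $\overline{f}$ is the complex conjugate of $f$ on $\mathbb{R}$). The functions $w_\alpha,v_\alpha$ (known to exist and to be unique up to a common constant factor of modulus one): $w_\alpha$ is holomorphic on the strip of all $z$ with $\mathrm{Im}\,z$ strictly between $0$ and $\alpha$, $v_\alpha$ is holomorphic on $|\mathrm{Im}\,z|<|\alpha|$; on its strip each $f\in\{w_\alpha,v_\alpha\}$ satisfies $\sup_y\int|f(x+iy)|^2e^{-sx^2}dx<\infty$ for all $s>0$ (hence has a.e. boundary values); $|w_\alpha(x)|=|v_\alpha(x)|=1$ a.e. on $\mathbb{R}$; and $w_\alpha(x)=f_{-\alpha}(x)v_\alpha(x-\alpha i)$, $v_\alpha(x)=f_{-\alpha}(x)w_\alpha(x-\alpha i)$ a.e. on $\mathbb{R}$, the second relation being understood through continuation, i.e. in terms of boundary values, $v_\alpha(x+\alpha i)=f_\alpha(x)w_\alpha(x)$ (and $w_\alpha(x+\alpha i)=f_\alpha(x)v_\alpha(x)$). The functions $w_\beta,v_\beta$ are defined in the same way with $\alpha$ and $\beta$ interchanged. $\overline{w}_\alpha(\mathcal{P}_1)$ etc. are the unitaries obtained by functional calculus from the complex conjugate functions on $\mathbb{R}$. For operators $z,z_1,z_2$ on $L^2(\mathbb{R}^2)$ define operators on $\mathcal{H}=L^2(\mathbb{R}^2)^{\oplus4}$: $\sigma_1(z_1,z_2)=\mathrm{diag}(z_1,z_2,z_1,z_2)$, $\sigma_2(z_1,z_2)=\mathrm{diag}(z_1,z_1,z_2,z_2)$, $\theta_1(z)(\eta_1,\eta_2,\eta_3,\eta_4)=(z\eta_2,z^\ast\eta_1,z\eta_4,z^\ast\eta_3)$,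 $\theta_2(z)(\eta_1,\eta_2,\eta_3,\eta_4)=(z\eta_3,z\eta_4,z^\ast\eta_1,z^\ast\eta_2)$. The self-adjoint operators are $$\mathsf{x}=\theta_1(e^{2\pi\alpha\mathcal{Q}_1}\otimes e^{-\pi\alpha\mathcal{P}_2}),\quad \mathsf{y}=\theta_2(e^{\pi\beta\mathcal{P}_1}\otimes e^{2\pi\beta\mathcal{Q}_2}),$$ $$\mathcal{D}^q_x=\theta_1(L_\alpha\otimes e^{-\pi\alpha\mathcal{P}_2}),\quad \mathcal{D}^q_y=\theta_2(e^{\pi\beta\mathcal{P}_1}\otimes L_\beta),$$ and $\mathsf{K}_1$, $\mathsf{K}_2$ act componentwise as $e^{\pi\beta\mathcal{P}_1}\otimes I$ and $I\otimes e^{\pi\alpha\mathcal{P}_2}$. Finally $$\mathcal{F}^q_x=\sigma_1(u\overline{w}_\alpha(\mathcal{P}_1)\otimes I,\ u\overline{v}_\alpha(\mathcal{P}_1)\otimes I),\quad \mathcal{F}^q_y=\sigma_2(I\otimes u\overline{w}_\beta(\mathcal{P}_2),\ I\otimes u\overline{v}_\beta(\mathcal{P}_2)),\quad \mathcal{F}^q=\mathcal{F}^q_x\mathcal{F}^q_y .$$ *)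

theory Defs
  imports "HOL-Complex_Analysis.Complex_Analysis"
begin

definition square_integrable :: "('a::euclidean_space \<Rightarrow> complex) \<Rightarrow> bool" where
  "square_integrable f \<longleftrightarrow>
     f \<in> borel_measurable lborel \<and> integrable lborel (\<lambda>x. (cmod (f x))\<^sup>2)"

lemma measurable_cnj_mult:
  fixes f g :: "'a::euclidean_space \<Rightarrow> complex"
  assumes "f \<in> borel_measurable borel" "g \<in> borel_measurable borel"
  shows "(\<lambda>x. cnj (f x) * g x) \<in> borel_measurable borel"
proof -
  have "cnj \<in> borel_measurable borel"
    by (intro borel_measurable_continuous_onI continuous_intros)
  then have "(\<lambda>x. cnj (f x)) \<in> borel_measurable borel"
    using assms(1) by (rule measurable_compose_rev)
  then show ?thesis
    using assms(2) by (rule borel_measurable_times)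
qed

lemma square_integrable_prod:
  assumes "square_integrable f" "square_integrable g"
  shows "integrable lborel (\<lambda>x. cnj (f x) * g x)"
proof (rule Bochner_Integration.integrable_bound)
  show "integrable lborel (\<lambda>x. (cmod (f x))\<^sup>2 + (cmod (g x))\<^sup>2)"
    using assms by (simp add: square_integrable_def)
  show "(\<lambda>x. cnj (f x) * g x) \<in> borel_measurable lborel"
    using assms measurable_cnj_mult[of f g] by (simp add: square_integrable_def)
  have "a * b \<le> a\<^sup>2 + b\<^sup>2" if "0 \<le> a" "0 \<le> b" for a b :: real
    using sum_squares_bound[of a b] mult_nonneg_nonneg[OF that] by linarith
  then show "AE x in lborel. norm (cnj (f x) * g x)
      \<le> norm ((cmod (f x))\<^sup>2 + (cmod (g x))\<^sup>2)"
    by (auto simp: norm_mult)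
qed

lemma square_integrable_zero: "square_integrable (\<lambda>x. 0)"
  by (simp add: square_integrable_def)

lemma square_integrable_scale:
  "square_integrable f \<Longrightarrow> square_integrable (\<lambda>x. c * f x)"
  by (auto simp: square_integrable_def norm_mult power_mult_distrib)

lemma square_integrable_add:
  assumes "square_integrable f" "square_integrable g"
  shows "square_integrable (\<lambda>x. f x + g x)"
  unfolding square_integrable_def
proof
  show m: "(\<lambda>x. f x + g x) \<in> borel_measurable lborel"
    using assms by (auto simp: square_integrable_def)
  show "integrable lborel (\<lambda>x. (cmod (f x + g x))\<^sup>2)"
  proof (rule Bochner_Integration.integrable_bound)
    show "integrable lborel (\<lambda>x. 2 * (cmod (f x))\<^sup>2 + 2 * (cmod (g x))\<^sup>2)"
      using assms by (simp add: square_integrable_def)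
    show "(\<lambda>x. (cmod (f x + g x))\<^sup>2) \<in> borel_measurable lborel"
      using m by measurable
    have "(cmod (a + b))\<^sup>2 \<le> 2 * (cmod a)\<^sup>2 + 2 * (cmod b)\<^sup>2" for a b :: complex
    proof -
      have "(cmod (a + b))\<^sup>2 \<le> (cmod a + cmod b)\<^sup>2"
        by (simp add: norm_triangle_ineq power_mono)
      also have "\<dots> \<le> 2 * (cmod a)\<^sup>2 + 2 * (cmod b)\<^sup>2"
        using sum_squares_bound[of "cmod a" "cmod b"] by (simp add: power2_sum)
      finally show ?thesis .
    qed
    then show "AE x in lborel. norm ((cmod (f x + g x))\<^sup>2)
        \<le> norm (2 * (cmod (f x))\<^sup>2 + 2 * (cmod (g x))\<^sup>2)"
      by auto
  qed
qed

quotient_type (overloaded) 'a l2 = "'a::euclidean_space \<Rightarrow> complex" /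
  partial: "\<lambda>f g. square_integrable f \<and> square_integrable g \<and> (AE x in lborel. f x = g x)"
proof (rule part_equivpI)
  show "\<exists>f::'a \<Rightarrow> complex.
      square_integrable f \<and> square_integrable f \<and> (AE x in lborel. f x = f x)"
    by (rule exI[of _ "\<lambda>x. 0"]) (simp add: square_integrable_zero)
  show "symp (\<lambda>f g :: 'a \<Rightarrow> complex.
      square_integrable f \<and> square_integrable g \<and> (AE x in lborel. f x = g x))"
    by (auto intro!: sympI)
  show "transp (\<lambda>f g :: 'a \<Rightarrow> complex.
      square_integrable f \<and> square_integrable g \<and> (AE x in lborel. f x = g x))"
    by (auto intro!: transpI)
qed

lift_definition cinner :: "'a::euclidean_space l2 \<Rightarrow> 'a l2 \<Rightarrow> complex" is
  "\<lambda>f g. \<integral>x. cnj (f x) * g x \<partial>lborel"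
  using measurable_cnj_mult by (intro integral_cong_AE) (auto simp: square_integrable_def)

instantiation l2 :: (euclidean_space) real_inner
begin

lift_definition zero_l2 :: "'a l2" is "\<lambda>x. 0"
  by (simp add: square_integrable_zero)

lift_definition plus_l2 :: "'a l2 \<Rightarrow> 'a l2 \<Rightarrow> 'a l2" is "\<lambda>f g x. f x + g x"
  by (auto simp: square_integrable_add)

lift_definition scaleR_l2 :: "real \<Rightarrow> 'a l2 \<Rightarrow> 'a l2" is "\<lambda>r f x. complex_of_real r * f x"
  by (auto simp: square_integrable_scale)

definition uminus_l2 :: "'a l2 \<Rightarrow> 'a l2" where
  "uminus_l2 \<phi> = (- 1) *\<^sub>R \<phi>"

definition minus_l2 :: "'a l2 \<Rightarrow> 'a l2 \<Rightarrow> 'a l2" where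
  "minus_l2 \<phi> \<psi> = \<phi> + (- \<psi>)"

definition inner_l2 :: "'a l2 \<Rightarrow> 'a l2 \<Rightarrow> real" where
  "inner_l2 \<phi> \<psi> = Re (cinner \<phi> \<psi>)"

definition norm_l2 :: "'a l2 \<Rightarrow> real" where
  "norm_l2 \<phi> = sqrt (inner \<phi> \<phi>)"

definition sgn_l2 :: "'a l2 \<Rightarrow> 'a l2" where
  "sgn_l2 \<phi> = inverse (norm \<phi>) *\<^sub>R \<phi>"

definition dist_l2 :: "'a l2 \<Rightarrow> 'a l2 \<Rightarrow> real" where
  "dist_l2 \<phi> \<psi> = norm (\<phi> - \<psi>)"

definition uniformity_l2 :: "('a l2 \<times> 'a l2) filter" where
  "uniformity_l2 = (INF e\<in>{0<..}. principal {(\<phi>, \<psi>). dist \<phi> \<psi> < e})"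

definition open_l2 :: "'a l2 set \<Rightarrow> bool" where
  "open_l2 U \<longleftrightarrow> (\<forall>\<phi>\<in>U. \<forall>\<^sub>F (\<phi>', \<psi>) in uniformity. \<phi>' = \<phi> \<longrightarrow> \<psi> \<in> U)"

instance
proof
  fix \<phi> \<psi> \<omega> :: "'a l2" and r s :: real
  show assoc: "\<phi> + \<psi> + \<omega> = \<phi> + (\<psi> + \<omega>)"
    by transfer (auto simp: square_integrable_add add.assoc)
  show comm: "\<phi> + \<psi> = \<psi> + \<phi>"
    by transfer (auto simp: square_integrable_add add.commute)
  show "0 + \<phi> = \<phi>"
    by transfer auto
  show "- \<phi> + \<phi> = 0"
    unfolding uminus_l2_def
    by transfer (auto simp: square_integrable_zero intro!: square_integrable_add square_integrable_scale)
  show "\<phi> - \<psi> = \<phi> + - \<psi>"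
    by (simp add: minus_l2_def)
  show "r *\<^sub>R (\<phi> + \<psi>) = r *\<^sub>R \<phi> + r *\<^sub>R \<psi>"
    by transfer (auto simp: distrib_left distrib_right intro!: square_integrable_add square_integrable_scale)
  show "(r + s) *\<^sub>R \<phi> = r *\<^sub>R \<phi> + s *\<^sub>R \<phi>"
    by transfer (auto simp: distrib_left distrib_right intro!: square_integrable_add square_integrable_scale)
  show "r *\<^sub>R s *\<^sub>R \<phi> = (r * s) *\<^sub>R \<phi>"
    by transfer (auto simp: mult.assoc intro!: square_integrable_scale)
  show "1 *\<^sub>R \<phi> = \<phi>"
    by transfer auto
  show "dist \<phi> \<psi> = norm (\<phi> - \<psi>)"
    by (simp add: dist_l2_def)
  show "sgn \<phi> = inverse (norm \<phi>) *\<^sub>R \<phi>"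
    by (simp add: sgn_l2_def)
  show "uniformity = (INF e\<in>{0<..}. principal {(\<phi>::'a l2, \<psi>). dist \<phi> \<psi> < e})"
    by (simp add: uniformity_l2_def)
  show "open U \<longleftrightarrow> (\<forall>\<phi>\<in>U. \<forall>\<^sub>F (\<phi>', \<psi>) in uniformity. \<phi>' = \<phi> \<longrightarrow> \<psi> \<in> U)" for U :: "'a l2 set"
    by (simp add: open_l2_def)
  have "cinner \<phi> \<psi> = cnj (cinner \<psi> \<phi>)"
  proof transfer
    fix f g :: "'a \<Rightarrow> complex"
    assume "square_integrable f \<and> square_integrable f \<and> (AE x in lborel. f x = f x)"
      and "square_integrable g \<and> square_integrable g \<and> (AE x in lborel. g x = g x)"
    then have "integrable lborel (\<lambda>x. cnj (g x) * f x)"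
      by (simp add: square_integrable_prod)
    from integral_bounded_linear[OF bounded_linear_cnj this]
    show "(\<integral>x. cnj (f x) * g x \<partial>lborel) = cnj (\<integral>x. cnj (g x) * f x \<partial>lborel)"
      by (simp add: mult.commute)
  qed
  then show "inner \<phi> \<psi> = inner \<psi> \<phi>"
    by (simp add: inner_l2_def)
  have "cinner (\<phi> + \<psi>) \<omega> = cinner \<phi> \<omega> + cinner \<psi> \<omega>"
    by transfer (auto simp: distrib_right square_integrable_prod)
  then show "inner (\<phi> + \<psi>) \<omega> = inner \<phi> \<omega> + inner \<psi> \<omega>"
    by (simp add: inner_l2_def)
  have "cinner (r *\<^sub>R \<phi>) \<psi> = complex_of_real r * cinner \<phi> \<psi>"
    by transfer (simp add: mult.assoc)
  then show "inner (r *\<^sub>R \<phi>) \<psi> = r * inner \<phi> \<psi>"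
    by (simp add: inner_l2_def)
  have sq: "(cnj z * z) = complex_of_real ((cmod z)\<^sup>2)" for z
    by (metis complex_norm_square mult.commute)
  have "Re (cinner \<phi> \<phi>) \<ge> 0 \<and> (Re (cinner \<phi> \<phi>) = 0 \<longleftrightarrow> \<phi> = 0)"
  proof (transfer, elim conjE, intro conjI)
    fix f :: "'a \<Rightarrow> complex"
    assume f: "square_integrable f"
    have eq: "Re (\<integral>x. cnj (f x) * f x \<partial>lborel) = (\<integral>x. (cmod (f x))\<^sup>2 \<partial>lborel)"
      unfolding sq integral_complex_of_real by simp
    show "0 \<le> Re (\<integral>x. cnj (f x) * f x \<partial>lborel)"
      unfolding eq by simp
    have "(\<integral>x. (cmod (f x))\<^sup>2 \<partial>lborel) = 0 \<longleftrightarrow> (AE x in lborel. (cmod (f x))\<^sup>2 = 0)"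
      using f by (intro integral_nonneg_eq_0_iff_AE) (auto simp: square_integrable_def)
    then show "Re (\<integral>x. cnj (f x) * f x \<partial>lborel) = 0 \<longleftrightarrow>
        square_integrable f \<and> square_integrable (\<lambda>x::'a. 0) \<and> (AE x in lborel. f x = 0)"
      unfolding eq using f by (simp add: square_integrable_zero)
  qed
  then show "0 \<le> inner \<phi> \<phi>" "inner \<phi> \<phi> = 0 \<longleftrightarrow> \<phi> = 0"
    by (auto simp: inner_l2_def)
  show "norm \<phi> = sqrt (inner \<phi> \<phi>)"
    by (simp add: norm_l2_def)
qed

end

lift_definition tensor_vec :: "real l2 \<Rightarrow> real l2 \<Rightarrow> (real \<times> real) l2" is
  "\<lambda>f g p. f (fst p) * g (snd p)"
proof (elim conjE, intro conjI)
  have sq: "square_integrable (\<lambda>p. f (fst p) * g (snd p))"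
    if "square_integrable f" "square_integrable g" for f g :: "real \<Rightarrow> complex"
  proof -
    have f: "f \<in> borel_measurable lborel" "integrable lborel (\<lambda>x. (cmod (f x))\<^sup>2)"
      and g: "g \<in> borel_measurable lborel" "integrable lborel (\<lambda>x. (cmod (g x))\<^sup>2)"
      using that by (auto simp: square_integrable_def)
    have m: "(\<lambda>p. f (fst p) * g (snd p)) \<in> borel_measurable (lborel \<Otimes>\<^sub>M lborel)"
      using f(1) g(1) by measurable
    have "integrable (lborel \<Otimes>\<^sub>M lborel) (\<lambda>p. (cmod (f (fst p)))\<^sup>2 * (cmod (g (snd p)))\<^sup>2)"
    proof (rule lborel_pair.Fubini_integrable)
      show "(\<lambda>p. (cmod (f (fst p)))\<^sup>2 * (cmod (g (snd p)))\<^sup>2)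
          \<in> borel_measurable (lborel \<Otimes>\<^sub>M lborel)"
        using f(1) g(1) by measurable
    qed (use f g in auto)
    then show ?thesis
      using m unfolding square_integrable_def lborel_prod
      by (simp add: norm_mult power_mult_distrib)
  qed
  fix f f' g g' :: "real \<Rightarrow> complex"
  assume f: "square_integrable f" "square_integrable f'" "AE x in lborel. f x = f' x"
    and g: "square_integrable g" "square_integrable g'" "AE x in lborel. g x = g' x"
  show "square_integrable (\<lambda>p. f (fst p) * g (snd p))"
    and "square_integrable (\<lambda>p. f' (fst p) * g' (snd p))"
    using f g by (auto intro: sq)
  have meas: "f \<in> borel_measurable lborel" "f' \<in> borel_measurable lborel"
    "g \<in> borel_measurable lborel" "g' \<in> borel_measurable lborel"
    using f g by (auto simp: square_integrable_def)
  have "AE p in lborel \<Otimes>\<^sub>M lborel. f (fst p) * g (snd p) = f' (fst p) * g' (snd p)"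
  proof (rule lborel_pair.AE_pair_measure)
    show "{p \<in> space (lborel \<Otimes>\<^sub>M lborel). f (fst p) * g (snd p) = f' (fst p) * g' (snd p)}
        \<in> sets (lborel \<Otimes>\<^sub>M lborel)"
      using meas by measurable
    show "AE x in lborel. AE y in lborel.
        f (fst (x, y)) * g (snd (x, y)) = f' (fst (x, y)) * g' (snd (x, y))"
      using f(3)
    proof eventually_elim
      case (elim x)
      show ?case
        using g(3) by eventually_elim (simp add: elim)
    qed
  qed
  then show "AE p in lborel. f (fst p) * g (snd p) = f' (fst p) * g' (snd p)"
    unfolding lborel_prod .
qed

text \<open>
  Operators with their domains are represented by their graphs, so that equality of operators
  includes equality of domains. The closure of an operator is the topological closure of its
  graph, its inverse is the converse relation, and \<open>I\<close> is \<^const>\<open>Id\<close>.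
\<close>

type_synonym 'h operator = "('h \<times> 'h) set"

abbreviation op_prod :: "'h operator \<Rightarrow> 'h operator \<Rightarrow> 'h operator" (infixr "\<bullet>\<^sub>o" 75) where
  "A \<bullet>\<^sub>o B \<equiv> B O A"

definition op_minus :: "'h::uminus operator \<Rightarrow> 'h operator" where
  "op_minus A = {(\<phi>, - \<psi>) |\<phi> \<psi>. (\<phi>, \<psi>) \<in> A}"

definition adjoint_op :: "'a::euclidean_space l2 operator \<Rightarrow> 'a l2 operator" where
  "adjoint_op A = {(\<phi>, \<psi>). \<forall>(\<xi>, \<eta>)\<in>A. cinner \<phi> \<eta> = cinner \<psi> \<xi>}"

text \<open>
  The real span suffices here: the generating set is stable under multiplication by complex
  scalars, as these can be absorbed into the first factor.
\<close>

definition tensor_op :: "real l2 operator \<Rightarrow> real l2 operator \<Rightarrow> (real \<times> real) l2 operator"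
    (infixr "\<otimes>\<^sub>o" 72) where
  "A \<otimes>\<^sub>o B = closure (span
     {(tensor_vec \<phi> \<psi>, tensor_vec \<phi>' \<psi>') |\<phi> \<psi> \<phi>' \<psi>'. (\<phi>, \<phi>') \<in> A \<and> (\<psi>, \<psi>') \<in> B})"

definition mult_op :: "('a::euclidean_space \<Rightarrow> complex) \<Rightarrow> 'a l2 operator" where
  "mult_op m = {(\<phi>, \<psi>). AE x in lborel. rep_l2 \<psi> x = m x * rep_l2 \<phi> x}"

definition position_op :: "real l2 operator" ("\<Q>") where
  "\<Q> = mult_op complex_of_real"

text \<open>
  The operator \<open>(1 / (2 \<pi> i)) d/dx\<close> on its natural domain, the square integrable functions that
  have a locally absolutely continuous representative \<open>f\<close> with square integrable derivative.
  Here \<open>f\<close> is expressed as the indefinite integral of \<open>f' = 2 \<pi> i \<psi>\<close>.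
\<close>

definition momentum_op :: "real l2 operator" ("\<P>") where
  "\<P> = {(\<phi>, \<psi>). \<exists>f. (AE x in lborel. rep_l2 \<phi> x = f x) \<and>
     (\<forall>a b. a \<le> b \<longrightarrow>
       ((\<lambda>x. 2 * complex_of_real pi * \<i> * rep_l2 \<psi> x) has_integral f b - f a) {a..b})}"

definition reflection_op :: "real l2 operator" where
  "reflection_op = {(\<phi>, \<psi>). AE x in lborel. rep_l2 \<psi> x = rep_l2 \<phi> (- x)}"

text \<open>Linearity follows from surjectivity and preservation of the inner product.\<close>

definition unitary_map :: "('a::euclidean_space l2 \<Rightarrow> 'a l2) \<Rightarrow> bool" where
  "unitary_map U \<longleftrightarrow> surj U \<and> (\<forall>\<phi> \<psi>. cinner (U \<phi>) (U \<psi>) = cinner \<phi> \<psi>)"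

text \<open>
  The functional calculus \<open>m(T)\<close> in the multiplication operator form of the spectral theorem:
  if \<open>T = U\<^sup>* \<Q> U\<close> with \<open>U\<close> unitary, then \<open>m(T) = U\<^sup>* m(\<Q>) U\<close>, where \<open>m(\<Q>)\<close> is multiplication by
  \<open>m\<close>. The result does not depend on the choice of \<open>U\<close>. This covers \<open>\<Q>\<close>, with \<open>U\<close> the identity,
  and \<open>\<P>\<close>, with \<open>U\<close> the Fourier transform.
\<close>

definition fun_calc :: "(real \<Rightarrow> complex) \<Rightarrow> real l2 operator \<Rightarrow> real l2 operator" where
  "fun_calc m T = {(\<phi>, \<psi>). \<exists>U. unitary_map U \<and>
     T = {(\<xi>, \<eta>). (U \<xi>, U \<eta>) \<in> \<Q>} \<and> (U \<phi>, U \<psi>) \<in> mult_op m}"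

abbreviation exp_op :: "real \<Rightarrow> real l2 operator \<Rightarrow> real l2 operator" where
  "exp_op t T \<equiv> fun_calc (\<lambda>x. exp (complex_of_real (t * x))) T"

text \<open>
  With \<open>f = f_fun\<close>: \<open>f_{\<plusminus>\<alpha>} = f (\<plusminus>\<alpha>) \<beta>\<close> and \<open>f_{\<plusminus>\<beta>} = f (\<plusminus>\<beta>) \<alpha>\<close>.
\<close>

definition f_fun :: "real \<Rightarrow> real \<Rightarrow> real \<Rightarrow> complex" where
  "f_fun a b x = - 2 * sinh (complex_of_real (pi * b) * Complex (2 * x) a)"

text \<open>
  Functions on the open strip \<open>a < Im z < b\<close>; the values of \<open>f\<close> on the two boundary lines are its
  boundary values almost everywhere.
\<close>

definition strip_function :: "real \<Rightarrow> real \<Rightarrow> (complex \<Rightarrow> complex) \<Rightarrow> bool" where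
  "strip_function a b f \<longleftrightarrow>
     f holomorphic_on {z. a < Im z \<and> Im z < b} \<and>
     (\<forall>s>0. (SUP y\<in>{a<..<b}.
        \<integral>\<^sup>+ x. ennreal ((cmod (f (Complex x y)))\<^sup>2 * exp (- s * x\<^sup>2)) \<partial>lborel) < \<infinity>) \<and>
     (\<forall>c\<in>{a, b}. AE x in lborel.
        ((\<lambda>y. f (Complex x y)) \<longlongrightarrow> f (Complex x c)) (at c within {a<..<b}))"

text \<open>
  \<open>a\<close> may be negative, so \<open>w\<close> lives on the strip strictly between \<open>0\<close> and \<open>a\<close>. The last relation is
  \<open>v(x) = f_{-a}(x) w(x - a i)\<close>, read as a relation between boundary values by replacing \<open>x\<close>
  with \<open>x + a i\<close>; similarly the one before it continues \<open>w(x) = f_{-a}(x) v(x - a i)\<close>.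
\<close>

definition wv_pair :: "real \<Rightarrow> real \<Rightarrow> (complex \<Rightarrow> complex) \<Rightarrow> (complex \<Rightarrow> complex) \<Rightarrow> bool" where
  "wv_pair a b w v \<longleftrightarrow>
     strip_function (min 0 a) (max 0 a) w \<and>
     strip_function (- \<bar>a\<bar>) \<bar>a\<bar> v \<and>
     (AE x in lborel. cmod (w (of_real x)) = 1 \<and> cmod (v (of_real x)) = 1) \<and>
     (AE x in lborel. w (of_real x) = f_fun (- a) b x * v (Complex x (- a))) \<and>
     (AE x in lborel. w (Complex x a) = f_fun a b x * v (of_real x)) \<and>
     (AE x in lborel. v (Complex x a) = f_fun a b x * w (of_real x))"

type_synonym l2_2 = "(real \<times> real) l2"

type_synonym l2_2_4 = "l2_2 \<times> l2_2 \<times> l2_2 \<times> l2_2"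

definition diag_op ::
    "l2_2 operator \<Rightarrow> l2_2 operator \<Rightarrow> l2_2 operator \<Rightarrow> l2_2 operator \<Rightarrow> l2_2_4 operator" where
  "diag_op z\<^sub>1 z\<^sub>2 z\<^sub>3 z\<^sub>4 = {((\<eta>\<^sub>1, \<eta>\<^sub>2, \<eta>\<^sub>3, \<eta>\<^sub>4), (\<zeta>\<^sub>1, \<zeta>\<^sub>2, \<zeta>\<^sub>3, \<zeta>\<^sub>4)).
     (\<eta>\<^sub>1, \<zeta>\<^sub>1) \<in> z\<^sub>1 \<and> (\<eta>\<^sub>2, \<zeta>\<^sub>2) \<in> z\<^sub>2 \<and> (\<eta>\<^sub>3, \<zeta>\<^sub>3) \<in> z\<^sub>3 \<and> (\<eta>\<^sub>4, \<zeta>\<^sub>4) \<in> z\<^sub>4}"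

definition sigma1 :: "l2_2 operator \<Rightarrow> l2_2 operator \<Rightarrow> l2_2_4 operator" where
  "sigma1 z\<^sub>1 z\<^sub>2 = diag_op z\<^sub>1 z\<^sub>2 z\<^sub>1 z\<^sub>2"

definition sigma2 :: "l2_2 operator \<Rightarrow> l2_2 operator \<Rightarrow> l2_2_4 operator" where
  "sigma2 z\<^sub>1 z\<^sub>2 = diag_op z\<^sub>1 z\<^sub>1 z\<^sub>2 z\<^sub>2"

definition theta1 :: "l2_2 operator \<Rightarrow> l2_2_4 operator" where
  "theta1 z = {((\<eta>\<^sub>1, \<eta>\<^sub>2, \<eta>\<^sub>3, \<eta>\<^sub>4), (\<zeta>\<^sub>1, \<zeta>\<^sub>2, \<zeta>\<^sub>3, \<zeta>\<^sub>4)).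
     (\<eta>\<^sub>2, \<zeta>\<^sub>1) \<in> z \<and> (\<eta>\<^sub>1, \<zeta>\<^sub>2) \<in> adjoint_op z \<and> (\<eta>\<^sub>4, \<zeta>\<^sub>3) \<in> z \<and> (\<eta>\<^sub>3, \<zeta>\<^sub>4) \<in> adjoint_op z}"

definition theta2 :: "l2_2 operator \<Rightarrow> l2_2_4 operator" where
  "theta2 z = {((\<eta>\<^sub>1, \<eta>\<^sub>2, \<eta>\<^sub>3, \<eta>\<^sub>4), (\<zeta>\<^sub>1, \<zeta>\<^sub>2, \<zeta>\<^sub>3, \<zeta>\<^sub>4)).
     (\<eta>\<^sub>3, \<zeta>\<^sub>1) \<in> z \<and> (\<eta>\<^sub>4, \<zeta>\<^sub>2) \<in> z \<and> (\<eta>\<^sub>1, \<zeta>\<^sub>3) \<in> adjoint_op z \<and> (\<eta>\<^sub>2, \<zeta>\<^sub>4) \<in> adjoint_op z}"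

text \<open>\<open>L\<^sub>\<alpha> = L_op \<alpha> \<beta>\<close> and \<open>L\<^sub>\<beta> = L_op \<beta> \<alpha>\<close>.\<close>

definition L_op :: "real \<Rightarrow> real \<Rightarrow> real l2 operator" where
  "L_op a b = fun_calc (\<lambda>x. cnj (f_fun a b x)) \<P> \<bullet>\<^sub>o exp_op (- 2 * pi * a) \<Q>"

definition x_op :: "real \<Rightarrow> l2_2_4 operator" where
  "x_op \<alpha> = theta1 (exp_op (2 * pi * \<alpha>) \<Q> \<otimes>\<^sub>o exp_op (- pi * \<alpha>) \<P>)"

definition y_op :: "real \<Rightarrow> l2_2_4 operator" where
  "y_op \<beta> = theta2 (exp_op (pi * \<beta>) \<P> \<otimes>\<^sub>o exp_op (2 * pi * \<beta>) \<Q>)"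

definition Dx_op :: "real \<Rightarrow> real \<Rightarrow> l2_2_4 operator" where
  "Dx_op \<alpha> \<beta> = theta1 (L_op \<alpha> \<beta> \<otimes>\<^sub>o exp_op (- pi * \<alpha>) \<P>)"

definition Dy_op :: "real \<Rightarrow> real \<Rightarrow> l2_2_4 operator" where
  "Dy_op \<alpha> \<beta> = theta2 (exp_op (pi * \<beta>) \<P> \<otimes>\<^sub>o L_op \<beta> \<alpha>)"

definition K1_op :: "real \<Rightarrow> l2_2_4 operator" where
  "K1_op \<beta> = (let k = exp_op (pi * \<beta>) \<P> \<otimes>\<^sub>o Id in diag_op k k k k)"

definition K2_op :: "real \<Rightarrow> l2_2_4 operator" where
  "K2_op \<alpha> = (let k = Id \<otimes>\<^sub>o exp_op (pi * \<alpha>) \<P> in diag_op k k k k)"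

definition u_conj :: "(complex \<Rightarrow> complex) \<Rightarrow> real l2 operator" where
  "u_conj w = reflection_op \<bullet>\<^sub>o fun_calc (\<lambda>x. cnj (w (of_real x))) \<P>"

definition Fx_op :: "(complex \<Rightarrow> complex) \<Rightarrow> (complex \<Rightarrow> complex) \<Rightarrow> l2_2_4 operator" where
  "Fx_op w\<^sub>\<alpha> v\<^sub>\<alpha> = sigma1 (u_conj w\<^sub>\<alpha> \<otimes>\<^sub>o Id) (u_conj v\<^sub>\<alpha> \<otimes>\<^sub>o Id)"

definition Fy_op :: "(complex \<Rightarrow> complex) \<Rightarrow> (complex \<Rightarrow> complex) \<Rightarrow> l2_2_4 operator" where
  "Fy_op w\<^sub>\<beta> v\<^sub>\<beta> = sigma2 (Id \<otimes>\<^sub>o u_conj w\<^sub>\<beta>) (Id \<otimes>\<^sub>o u_conj v\<^sub>\<beta>)"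

end

theory Submission
  imports Defs "HOL-Probability.Characteristic_Functions" "HOL-Probability.Sinc_Integral"
begin

text \<open>
  On the Fourier side \<open>e\<^bsup>2 \<pi> c \<Q>\<^esup>\<close> is the shift \<open>g(p) \<mapsto> g(p + i c)\<close>. Multiplying by the conjugates of
  \<open>w\<close> and \<open>v\<close> on its two sides and reflecting therefore multiplies the opposite shift by a product of
  boundary values of \<open>w\<close> and \<open>v\<close>, which the functional equations identify. The point is the equality of
  domains. It follows from one fact, used for \<open>v(- z)\<close> and for its inverse \<open>cnj (v(- cnj z))\<close>:
  multiplication by a function \<open>m\<close> on the strip maps a pair \<open>(g, g(\<sqdot> + i c))\<close> of the shift to the pair
  \<open>(m g, m(\<sqdot> + i c) g(\<sqdot> + i c))\<close> as soon as the latter is square integrable. Pairing with Gaussians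
  reduces this to a Paley-Wiener statement for \<open>m\<close> times a Gaussian, proved by shifting contours.
  The relations with \<open>K\<^sub>1, K\<^sub>2\<close> are diagonal in one tensor factor and follow by cutting off in momentum
  space, which commutes with an arbitrary operator in the other factor and passes to adjoints.
\<close>

subsection \<open>The Hilbert space of square integrable functions\<close>

text \<open>The growth condition controls \<open>w\<close> and \<open>v\<close> only in mean square
  against Gaussian weights, so a product of such a function with a square integrable one may leave
  the space. What converges are pairings with Gaussians, and these suffice because a Gaussian
  remains one under the Fourier transform and under complex translation. The multipliers are built
  from \<open>v\<close>, which lives on both sides of the real line and hence serves shifts of
  either sign; \<open>w\<close> enters through its boundary values on the real line. Since |v| = 1
  there, Schwarz reflection supplies the inverse multiplier with the same growth bounds, without a
  discussion of zeros. The minus signs in front of D_x and D_y come from the parity f_a(-x) =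
  -f_{-a}(x). Functional calculus is defined by the existence of some diagonalising unitary, so its
  independence of that unitary and a concrete Fourier transform diagonalising \<P> must be available
  before anything can be computed. Operators being graphs, all identities of domains become
  identities of closed sets.\<close>

lemma borel_measurable_cnj [measurable]: "cnj \<in> borel_measurable borel"
  by (intro borel_measurable_continuous_onI continuous_intros)

lemma square_integrable_rep [simp]: "square_integrable (rep_l2 \<phi>)"
  using Quotient3_rep_reflp[OF Quotient3_l2, of \<phi>] by auto

lemma measurable_rep [measurable]: "rep_l2 \<phi> \<in> borel_measurable borel"
  using square_integrable_rep[of \<phi>] by (simp add: square_integrable_def)

lemma integrable_rep: "integrable lborel (\<lambda>x. (cmod (rep_l2 \<phi> x))\<^sup>2)"
  using square_integrable_rep[of \<phi>] by (simp add: square_integrable_def)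

lemma AE_rep_abs:
  assumes "square_integrable f"
  shows "AE x in lborel. rep_l2 (abs_l2 f) x = f x"
  using rep_abs_rsp_left[OF Quotient3_l2, of f f] assms by auto

lemma l2_eq_iff: "\<phi> = \<psi> \<longleftrightarrow> (AE x in lborel. rep_l2 \<phi> x = rep_l2 \<psi> x)"
  using Quotient3_rel_rep[OF Quotient3_l2, of \<phi> \<psi>] by auto

lemma l2_eqI: "AE x in lborel. rep_l2 \<phi> x = rep_l2 \<psi> x \<Longrightarrow> \<phi> = \<psi>"
  by (simp add: l2_eq_iff)

lemma abs_l2_eqI:
  assumes "square_integrable f" "AE x in lborel. f x = rep_l2 \<phi> x"
  shows "abs_l2 f = \<phi>"
  by (rule l2_eqI) (use AE_rep_abs[OF assms(1)] assms(2) in eventually_elim, simp)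

lemma abs_rep_l2 [simp]: "abs_l2 (rep_l2 \<phi>) = \<phi>"
  by (rule abs_l2_eqI) auto

lemma AE_rep_zero: "AE x in lborel. rep_l2 0 x = 0"
  using AE_rep_abs[OF square_integrable_zero] by (simp add: zero_l2_def)

lemma AE_rep_add: "AE x in lborel. rep_l2 (\<phi> + \<psi>) x = rep_l2 \<phi> x + rep_l2 \<psi> x"
proof -
  have "\<phi> + \<psi> = abs_l2 (\<lambda>x. rep_l2 \<phi> x + rep_l2 \<psi> x)"
    using plus_l2.abs_eq[of "rep_l2 \<phi>" "rep_l2 \<psi>"] by simp
  then show ?thesis
    using AE_rep_abs[OF square_integrable_add[OF square_integrable_rep square_integrable_rep]] by simp
qed

lemma AE_rep_scaleR: "AE x in lborel. rep_l2 (r *\<^sub>R \<phi>) x = of_real r * rep_l2 \<phi> x"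
proof -
  have "r *\<^sub>R \<phi> = abs_l2 (\<lambda>x. of_real r * rep_l2 \<phi> x)"
    using scaleR_l2.abs_eq[of "rep_l2 \<phi>" r] by simp
  then show ?thesis
    using AE_rep_abs[OF square_integrable_scale[OF square_integrable_rep]] by simp
qed

lemma AE_rep_uminus: "AE x in lborel. rep_l2 (- \<phi>) x = - rep_l2 \<phi> x"
  using AE_rep_scaleR[of "- 1" \<phi>] unfolding uminus_l2_def of_real_minus of_real_1 mult_minus1 .

lemma AE_rep_diff: "AE x in lborel. rep_l2 (\<phi> - \<psi>) x = rep_l2 \<phi> x - rep_l2 \<psi> x"
  using AE_rep_add[of \<phi> "- \<psi>"] AE_rep_uminus[of \<psi>] by eventually_elim simp

lemma cinner_rep: "cinner \<phi> \<psi> = (\<integral>x. cnj (rep_l2 \<phi> x) * rep_l2 \<psi> x \<partial>lborel)"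
  using cinner.abs_eq[of "rep_l2 \<phi>" "rep_l2 \<psi>"] by simp

lemma integrable_cinner: "integrable lborel (\<lambda>x. cnj (rep_l2 \<phi> x) * rep_l2 \<psi> x)"
  by (simp add: square_integrable_prod)

lemma cinner_AE:
  assumes "AE x in lborel. rep_l2 \<phi> x = f x" "AE x in lborel. rep_l2 \<psi> x = g x"
    and [measurable]: "f \<in> borel_measurable borel" "g \<in> borel_measurable borel"
  shows "cinner \<phi> \<psi> = (\<integral>x. cnj (f x) * g x \<partial>lborel)"
  unfolding cinner_rep
proof (rule integral_cong_AE)
  show "AE x in lborel. cnj (rep_l2 \<phi> x) * rep_l2 \<psi> x = cnj (f x) * g x"
    using assms(1,2) by eventually_elim simp
qed measurable

lemma norm_l2_sq: "(norm \<phi>)\<^sup>2 = (\<integral>x. (cmod (rep_l2 \<phi> x))\<^sup>2 \<partial>lborel)"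
proof -
  have sq: "(cnj z * z) = complex_of_real ((cmod z)\<^sup>2)" for z
    by (metis complex_norm_square mult.commute)
  have "(norm \<phi>)\<^sup>2 = Re (cinner \<phi> \<phi>)"
    by (simp add: power2_norm_eq_inner inner_l2_def)
  then show ?thesis
    unfolding cinner_rep sq integral_complex_of_real by simp
qed

lemma norm_l2_sq_nn: "ennreal ((norm \<phi>)\<^sup>2) = (\<integral>\<^sup>+x. ennreal ((cmod (rep_l2 \<phi> x))\<^sup>2) \<partial>lborel)"
  unfolding norm_l2_sq by (rule nn_integral_eq_integral[symmetric, OF integrable_rep]) simp

lemma Re_cinner: "Re (cinner \<phi> \<psi>) = inner \<phi> \<psi>"
  by (simp add: inner_l2_def)

lemma cinner_add_right: "cinner \<phi> (\<psi> + \<omega>) = cinner \<phi> \<psi> + cinner \<phi> \<omega>"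
  by transfer (auto simp: distrib_left square_integrable_prod)

lemma cinner_add_left: "cinner (\<phi> + \<psi>) \<omega> = cinner \<phi> \<omega> + cinner \<psi> \<omega>"
  by transfer (auto simp: distrib_right square_integrable_prod)

lemma cinner_commute: "cinner \<phi> \<psi> = cnj (cinner \<psi> \<phi>)"
proof -
  from integral_bounded_linear[OF bounded_linear_cnj integrable_cinner[of \<psi> \<phi>]]
  show ?thesis
    by (simp add: mult.commute cinner_rep)
qed

lemma cinner_scaleR_right: "cinner \<phi> (r *\<^sub>R \<psi>) = r *\<^sub>R cinner \<phi> \<psi>"
  unfolding scaleR_conv_of_real by transfer (simp add: mult.left_commute)

lemma cinner_scaleR_left: "cinner (r *\<^sub>R \<phi>) \<psi> = r *\<^sub>R cinner \<phi> \<psi>"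
  unfolding scaleR_conv_of_real by transfer (simp add: mult.assoc)

lemma cinner_self: "cinner \<phi> \<phi> = of_real ((norm \<phi>)\<^sup>2)"
proof -
  have "cinner \<phi> \<phi> \<in> \<real>"
    using cinner_commute[of \<phi> \<phi>] by (metis Reals_cnj_iff)
  then have "cinner \<phi> \<phi> = of_real (Re (cinner \<phi> \<phi>))"
    by (simp add: of_real_Re)
  then show ?thesis
    by (simp add: Re_cinner power2_norm_eq_inner)
qed

text \<open>The type has only real scalars, so complex scalars appear throughout as
  \<open>mul_l2\<close> with a constant function. The definition is meaningful when the product
  stays square integrable, which \<open>bdd_fun\<close> guarantees; unbounded multipliers are
  treated as relations by \<open>mult_op\<close>.\<close>

definition mul_l2 :: "('a::euclidean_space \<Rightarrow> complex) \<Rightarrow> 'a l2 \<Rightarrow> 'a l2" where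
  "mul_l2 g \<phi> = abs_l2 (\<lambda>x. g x * rep_l2 \<phi> x)"

definition bdd_fun :: "('a::euclidean_space \<Rightarrow> complex) \<Rightarrow> bool" where
  "bdd_fun g \<longleftrightarrow> g \<in> borel_measurable borel \<and> (\<exists>B. \<forall>x. cmod (g x) \<le> B)"

lemma bdd_funI: "g \<in> borel_measurable borel \<Longrightarrow> (\<And>x. cmod (g x) \<le> B) \<Longrightarrow> bdd_fun g"
  by (auto simp: bdd_fun_def)

lemma bdd_fun_const [simp]: "bdd_fun (\<lambda>_. c)"
  by (auto simp: bdd_fun_def)

lemma bdd_fun_measurable: "bdd_fun g \<Longrightarrow> g \<in> borel_measurable borel"
  by (simp add: bdd_fun_def)

lemma bdd_fun_indicator: "A \<in> sets borel \<Longrightarrow> bdd_fun (indicator A)"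
  by (rule bdd_funI[of _ 1]) (auto simp: indicator_def)

lemma square_integrable_bound:
  assumes "f \<in> borel_measurable borel" "integrable lborel g"
    "AE x in lborel. (cmod (f x))\<^sup>2 \<le> g x"
  shows "square_integrable f"
  unfolding square_integrable_def
proof
  show "f \<in> borel_measurable lborel" using assms by simp
  show "integrable lborel (\<lambda>x. (cmod (f x))\<^sup>2)"
  proof (rule Bochner_Integration.integrable_bound[OF assms(2)])
    show "(\<lambda>x. (cmod (f x))\<^sup>2) \<in> borel_measurable lborel"
      using assms(1) by measurable
    show "AE x in lborel. norm ((cmod (f x))\<^sup>2) \<le> norm (g x)"
      using assms(3) by eventually_elim auto
  qed
qed

lemma bdd_fun_mult:
  assumes "bdd_fun f" "bdd_fun g"
  shows "bdd_fun (\<lambda>x. f x * g x)"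
proof -
  obtain B C where B: "\<And>x. cmod (f x) \<le> B" and C: "\<And>x. cmod (g x) \<le> C"
    using assms by (auto simp: bdd_fun_def)
  have "cmod (f x * g x) \<le> B * C" for x
    unfolding norm_mult using B[of x] C[of x] by (intro mult_mono) (auto intro: order_trans[OF norm_ge_zero])
  then show ?thesis
    using assms[THEN bdd_fun_measurable]
    by (intro bdd_funI[of _ "B * C"] borel_measurable_times)
qed

lemma square_integrable_mul:
  assumes "bdd_fun g" "square_integrable f"
  shows "square_integrable (\<lambda>x. g x * f x)"
proof -
  obtain B where B: "\<And>x. cmod (g x) \<le> B" and [measurable]: "g \<in> borel_measurable borel"
    using assms by (auto simp: bdd_fun_def)
  have [measurable]: "f \<in> borel_measurable borel" and i: "integrable lborel (\<lambda>x. (cmod (f x))\<^sup>2)"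
    using assms by (auto simp: square_integrable_def)
  show ?thesis
  proof (rule square_integrable_bound)
    show "integrable lborel (\<lambda>x. B\<^sup>2 * (cmod (f x))\<^sup>2)"
      using i by simp
    show "AE x in lborel. (cmod (g x * f x))\<^sup>2 \<le> B\<^sup>2 * (cmod (f x))\<^sup>2"
      by (auto simp: norm_mult power_mult_distrib intro!: mult_right_mono power_mono B)
  qed measurable
qed

lemma AE_rep_mul: "bdd_fun g \<Longrightarrow> AE x in lborel. rep_l2 (mul_l2 g \<phi>) x = g x * rep_l2 \<phi> x"
  unfolding mul_l2_def by (rule AE_rep_abs) (simp add: square_integrable_mul)

lemma mul_l2_eqI:
  assumes "bdd_fun g" "AE x in lborel. rep_l2 \<psi> x = g x * rep_l2 \<phi> x"
  shows "mul_l2 g \<phi> = \<psi>"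
  by (rule l2_eqI) (use AE_rep_mul[OF assms(1), of \<phi>] assms(2) in eventually_elim, simp)

lemma norm_le_of_AE:
  assumes "AE x in lborel. cmod (rep_l2 \<psi> x) \<le> B * cmod (rep_l2 \<phi> x)" "0 \<le> B"
  shows "norm \<psi> \<le> B * norm \<phi>"
proof -
  have "(norm \<psi>)\<^sup>2 \<le> (\<integral>x. B\<^sup>2 * (cmod (rep_l2 \<phi> x))\<^sup>2 \<partial>lborel)"
    unfolding norm_l2_sq
  proof (rule integral_mono_AE[OF integrable_rep])
    show "integrable lborel (\<lambda>x. B\<^sup>2 * (cmod (rep_l2 \<phi> x))\<^sup>2)"
      by (intro integrable_mult_right integrable_rep)
    show "AE x in lborel. (cmod (rep_l2 \<psi> x))\<^sup>2 \<le> B\<^sup>2 * (cmod (rep_l2 \<phi> x))\<^sup>2"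
      using assms(1)
    proof eventually_elim
      case (elim x)
      then have "(cmod (rep_l2 \<psi> x))\<^sup>2 \<le> (B * cmod (rep_l2 \<phi> x))\<^sup>2"
        by (intro power_mono) auto
      then show ?case by (simp add: power_mult_distrib)
    qed
  qed
  also have "\<dots> = (B * norm \<phi>)\<^sup>2"
    by (simp add: norm_l2_sq power_mult_distrib)
  finally show ?thesis
    by (rule power2_le_imp_le) (use assms in simp)
qed

lemma bounded_linear_mul:
  assumes "bdd_fun g"
  shows "bounded_linear (mul_l2 g)"
proof -
  obtain B where B: "\<And>x. cmod (g x) \<le> B" using assms by (auto simp: bdd_fun_def)
  have B0: "0 \<le> B" using B[of 0] norm_ge_zero order_trans by blast
  note r = AE_rep_mul[OF assms]
  show ?thesis
  proof (rule bounded_linear_intro[where K=B])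
    fix \<phi> \<psi> and t :: real
    show "mul_l2 g (\<phi> + \<psi>) = mul_l2 g \<phi> + mul_l2 g \<psi>"
      by (rule mul_l2_eqI[OF assms])
        (use r[of \<phi>] r[of \<psi>] AE_rep_add[of \<phi> \<psi>] AE_rep_add[of "mul_l2 g \<phi>" "mul_l2 g \<psi>"] in
          eventually_elim, simp add: distrib_left)
    show "mul_l2 g (t *\<^sub>R \<phi>) = t *\<^sub>R mul_l2 g \<phi>"
      by (rule mul_l2_eqI[OF assms])
        (use r[of \<phi>] AE_rep_scaleR[of t \<phi>] AE_rep_scaleR[of t "mul_l2 g \<phi>"] in
          eventually_elim, simp)
    have "norm (mul_l2 g \<phi>) \<le> B * norm \<phi>"
      by (rule norm_le_of_AE[OF _ B0], use r[of \<phi>] in eventually_elim)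
        (simp add: norm_mult mult_right_mono B)
    then show "norm (mul_l2 g \<phi>) \<le> norm \<phi> * B" by (simp add: mult.commute)
  qed
qed

lemma mul_l2_mul_l2:
  assumes "bdd_fun f" "bdd_fun g"
  shows "mul_l2 f (mul_l2 g \<phi>) = mul_l2 (\<lambda>x. f x * g x) \<phi>"
  by (rule mul_l2_eqI[OF bdd_fun_mult[OF assms], symmetric])
    (use AE_rep_mul[OF assms(1), of "mul_l2 g \<phi>"] AE_rep_mul[OF assms(2), of \<phi>] in eventually_elim, simp)

lemma mul_l2_commute:
  assumes "bdd_fun f" "bdd_fun g"
  shows "mul_l2 f (mul_l2 g \<phi>) = mul_l2 g (mul_l2 f \<phi>)"
  by (simp add: mul_l2_mul_l2 assms mult.commute)

lemma bdd_fun_cnj: "bdd_fun g \<Longrightarrow> bdd_fun (\<lambda>x. cnj (g x))"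
  using measurable_cnj_mult[of g "\<lambda>_. 1"] by (auto simp: bdd_fun_def)

lemma cinner_mul_left:
  assumes "bdd_fun g"
  shows "cinner (mul_l2 g \<phi>) \<psi> = cinner \<phi> (mul_l2 (\<lambda>x. cnj (g x)) \<psi>)"
  unfolding cinner_rep
proof (rule integral_cong_AE)
  show "AE x in lborel. cnj (rep_l2 (mul_l2 g \<phi>) x) * rep_l2 \<psi> x =
      cnj (rep_l2 \<phi> x) * rep_l2 (mul_l2 (\<lambda>x. cnj (g x)) \<psi>) x"
    using AE_rep_mul[OF assms, of \<phi>] AE_rep_mul[OF bdd_fun_cnj[OF assms], of \<psi>]
    by eventually_elim (simp add: mult_ac)
qed (use bdd_fun_measurable[OF assms] in measurable)

lemma cinner_const_right: "cinner \<phi> (mul_l2 (\<lambda>_. c) \<psi>) = c * cinner \<phi> \<psi>"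
proof -
  have "cinner \<phi> (mul_l2 (\<lambda>_. c) \<psi>) = (\<integral>x. c * (cnj (rep_l2 \<phi> x) * rep_l2 \<psi> x) \<partial>lborel)"
    unfolding cinner_rep
  proof (rule integral_cong_AE)
    show "AE x in lborel. cnj (rep_l2 \<phi> x) * rep_l2 (mul_l2 (\<lambda>_. c) \<psi>) x =
        c * (cnj (rep_l2 \<phi> x) * rep_l2 \<psi> x)"
      using AE_rep_mul[OF bdd_fun_const, of c \<psi>] by eventually_elim simp
  qed measurable
  then show ?thesis by (simp add: cinner_rep)
qed

lemma cinner_const_left: "cinner (mul_l2 (\<lambda>_. c) \<phi>) \<psi> = cnj c * cinner \<phi> \<psi>"
  by (simp add: cinner_mul_left cinner_const_right)

lemma norm_const_mul: "norm (mul_l2 (\<lambda>_. c) \<phi>) = cmod c * norm \<phi>"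
proof -
  have cc: "cnj c * c = complex_of_real ((cmod c)\<^sup>2)"
    by (metis complex_norm_square mult.commute)
  have "cinner (mul_l2 (\<lambda>_. c) \<phi>) (mul_l2 (\<lambda>_. c) \<phi>) = cnj c * c * cinner \<phi> \<phi>"
    by (simp add: cinner_const_left cinner_const_right mult_ac)
  then have "complex_of_real ((norm (mul_l2 (\<lambda>_. c) \<phi>))\<^sup>2) = complex_of_real ((cmod c * norm \<phi>)\<^sup>2)"
    unfolding cinner_self cc by (simp add: power_mult_distrib)
  then have "(norm (mul_l2 (\<lambda>_. c) \<phi>))\<^sup>2 = (cmod c * norm \<phi>)\<^sup>2"
    by (simp only: of_real_eq_iff)
  then show ?thesis by (simp add: power2_eq_iff_nonneg)
qed

text \<open>The real part is the real inner product and the imaginary part is, up to sign, the real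
  inner product with i times the second vector. Cauchy-Schwarz for each of the two gives the
  constant 2.\<close>

lemma bounded_bilinear_cinner: "bounded_bilinear cinner"
proof
  fix \<phi> \<phi>' \<psi> \<psi>' :: "'a l2" and r :: real
  show "cinner (\<phi> + \<phi>') \<psi> = cinner \<phi> \<psi> + cinner \<phi>' \<psi>" by (rule cinner_add_left)
  show "cinner \<phi> (\<psi> + \<psi>') = cinner \<phi> \<psi> + cinner \<phi> \<psi>'" by (rule cinner_add_right)
  show "cinner (r *\<^sub>R \<phi>) \<psi> = r *\<^sub>R cinner \<phi> \<psi>" by (rule cinner_scaleR_left)
  show "cinner \<phi> (r *\<^sub>R \<psi>) = r *\<^sub>R cinner \<phi> \<psi>" by (rule cinner_scaleR_right)
  have "cmod (cinner \<phi> \<psi>) \<le> norm \<phi> * norm \<psi> * 2" for \<phi> \<psi> :: "'a l2"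
  proof -
    have "\<bar>Im (cinner \<phi> \<psi>)\<bar> = \<bar>inner \<phi> (mul_l2 (\<lambda>_. \<i>) \<psi>)\<bar>"
      by (simp add: Re_cinner[symmetric] cinner_const_right)
    also have "\<dots> \<le> norm \<phi> * norm \<psi>"
      using Cauchy_Schwarz_ineq2[of \<phi> "mul_l2 (\<lambda>_. \<i>) \<psi>"] by (simp add: norm_const_mul)
    finally show ?thesis
      using cmod_le[of "cinner \<phi> \<psi>"] Cauchy_Schwarz_ineq2[of \<phi> \<psi>] by (simp add: Re_cinner)
  qed
  then show "\<exists>K. \<forall>a b :: 'a l2. cmod (cinner a b) \<le> norm a * norm b * K" by blast
qed

lemmas continuous_on_cinner [continuous_intros] = bounded_bilinear.continuous_on[OF bounded_bilinear_cinner]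
lemmas bounded_linear_cinner_right = bounded_bilinear.bounded_linear_right[OF bounded_bilinear_cinner]
lemmas cinner_diff_left = bounded_bilinear.diff_left[OF bounded_bilinear_cinner]
lemmas cinner_diff_right = bounded_bilinear.diff_right[OF bounded_bilinear_cinner]
lemmas cinner_zero_left [simp] = bounded_bilinear.zero_left[OF bounded_bilinear_cinner]
lemmas cinner_zero_right [simp] = bounded_bilinear.zero_right[OF bounded_bilinear_cinner]
lemmas cinner_minus_left [simp] = bounded_bilinear.minus_left[OF bounded_bilinear_cinner]
lemmas cinner_minus_right [simp] = bounded_bilinear.minus_right[OF bounded_bilinear_cinner]

section \<open>Norm convergence, almost everywhere convergence, completeness\<close>

lemma tendsto_l2_dominated:
  fixes X :: "nat \<Rightarrow> 'a::euclidean_space l2"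
  assumes lim: "AE x in lborel. (\<lambda>n. rep_l2 (X n) x) \<longlonglongrightarrow> rep_l2 \<phi> x"
    and bound: "\<And>n. AE x in lborel. (cmod (rep_l2 (X n) x))\<^sup>2 \<le> h x"
    and h: "integrable lborel h"
  shows "X \<longlonglongrightarrow> \<phi>"
proof -
  have "(\<lambda>n. \<integral>x. (cmod (rep_l2 (X n - \<phi>) x))\<^sup>2 \<partial>lborel) \<longlonglongrightarrow> (\<integral>x. 0 \<partial>(lborel::'a measure))"
  proof (rule integral_dominated_convergence)
    show "integrable lborel (\<lambda>x. 2 * h x + 2 * (cmod (rep_l2 \<phi> x))\<^sup>2)"
      by (intro Bochner_Integration.integrable_add integrable_mult_right h integrable_rep)
    have "AE x in lborel. \<forall>n. rep_l2 (X n - \<phi>) x = rep_l2 (X n) x - rep_l2 \<phi> x"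
      using AE_rep_diff by (subst AE_all_countable) auto
    with lim show "AE x in lborel. (\<lambda>n. (cmod (rep_l2 (X n - \<phi>) x))\<^sup>2) \<longlonglongrightarrow> 0"
    proof eventually_elim
      case (elim x)
      have "(\<lambda>n. (cmod (rep_l2 (X n) x - rep_l2 \<phi> x))\<^sup>2) \<longlonglongrightarrow> (cmod (rep_l2 \<phi> x - rep_l2 \<phi> x))\<^sup>2"
        by (intro tendsto_intros elim)
      then show ?case by (simp add: elim)
    qed
    show "AE x in lborel. norm ((cmod (rep_l2 (X n - \<phi>) x))\<^sup>2) \<le> 2 * h x + 2 * (cmod (rep_l2 \<phi> x))\<^sup>2" for n
      using AE_rep_diff[of "X n" \<phi>] bound[of n]
    proof eventually_elim
      case (elim x)
      have "(cmod (a - b))\<^sup>2 \<le> 2 * (cmod a)\<^sup>2 + 2 * (cmod b)\<^sup>2" for a b :: complex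
      proof -
        have "(cmod (a - b))\<^sup>2 \<le> (cmod a + cmod b)\<^sup>2"
          by (simp add: norm_triangle_ineq4 power_mono)
        also have "\<dots> \<le> 2 * (cmod a)\<^sup>2 + 2 * (cmod b)\<^sup>2"
          using sum_squares_bound[of "cmod a" "cmod b"] by (simp add: power2_sum)
        finally show ?thesis .
      qed
      from this[of "rep_l2 (X n) x" "rep_l2 \<phi> x"] elim show ?case by simp
    qed
  qed measurable
  then have "(\<lambda>n. (norm (X n - \<phi>))\<^sup>2) \<longlonglongrightarrow> 0"
    by (simp add: norm_l2_sq)
  then have "(\<lambda>n. norm (X n - \<phi>)) \<longlonglongrightarrow> 0"
    using tendsto_real_sqrt[of "\<lambda>n. (norm (X n - \<phi>))\<^sup>2" 0] by simp
  then show ?thesis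
    by (simp add: LIM_zero_iff tendsto_norm_zero_iff)
qed

text \<open>Relations that are defined almost everywhere are shown to be closed by passing to such a
  subsequence, once for the arguments and once more for the values.\<close>

lemma l2_tendsto_AE_subseq:
  fixes X :: "nat \<Rightarrow> 'a::euclidean_space l2"
  assumes "X \<longlonglongrightarrow> \<phi>"
  obtains r :: "nat \<Rightarrow> nat" where "strict_mono r"
    "AE x in lborel. (\<lambda>n. rep_l2 (X (r n)) x) \<longlonglongrightarrow> rep_l2 \<phi> x"
proof -
  have "(\<lambda>n. norm (X n - \<phi>)) \<longlonglongrightarrow> 0"
    using assms by (simp add: LIM_zero tendsto_norm_zero)
  from tendsto_power[OF this, of 2]
  have "(\<lambda>n. \<integral>x. norm ((cmod (rep_l2 (X n - \<phi>) x))\<^sup>2) \<partial>lborel) \<longlonglongrightarrow> 0"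
    by (simp add: norm_l2_sq)
  from tendsto_L1_AE_subseq[OF integrable_rep this] obtain r :: "nat \<Rightarrow> nat" where r: "strict_mono r"
    and *: "AE x in lborel. (\<lambda>n. (cmod (rep_l2 (X (r n) - \<phi>) x))\<^sup>2) \<longlonglongrightarrow> 0"
    by blast
  have "AE x in lborel. \<forall>n. rep_l2 (X n - \<phi>) x = rep_l2 (X n) x - rep_l2 \<phi> x"
    using AE_rep_diff by (subst AE_all_countable) auto
  with * have "AE x in lborel. (\<lambda>n. rep_l2 (X (r n)) x) \<longlonglongrightarrow> rep_l2 \<phi> x"
  proof eventually_elim
    case (elim x)
    then have "(\<lambda>n. cmod (rep_l2 (X (r n)) x - rep_l2 \<phi> x)) \<longlonglongrightarrow> 0"
      using tendsto_real_sqrt[OF elim(1)] by simp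
    then show ?case
      by (simp add: LIM_zero_cancel tendsto_norm_zero_iff)
  qed
  with r that show ?thesis by blast
qed

lemma subspace_closure:
  fixes S :: "'a::real_normed_vector set"
  assumes "subspace S"
  shows "subspace (closure S)"
proof (rule subspaceI)
  show "0 \<in> closure S"
    using assms subspace_0 closure_subset by blast
  fix x y and c :: real assume x: "x \<in> closure S" and y: "y \<in> closure S"
  obtain X Y where X: "\<And>n. X n \<in> S" "X \<longlonglongrightarrow> x" and Y: "\<And>n. Y n \<in> S" "Y \<longlonglongrightarrow> y"
    using x y unfolding closure_sequential by metis
  show "x + y \<in> closure S"
    unfolding closure_sequential
    by (intro exI[of _ "\<lambda>n. X n + Y n"]) (auto intro!: tendsto_add X Y subspace_add[OF assms])
  show "c *\<^sub>R x \<in> closure S"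
    unfolding closure_sequential
    by (intro exI[of _ "\<lambda>n. c *\<^sub>R X n"]) (auto intro!: tendsto_intros X subspace_scale[OF assms])
qed

lemma closed_closure_span_subset:
  fixes S :: "'a::real_normed_vector set"
  assumes "S \<subseteq> T" "subspace T" "closed T"
  shows "closure (span S) \<subseteq> T"
  using assms by (intro closure_minimal span_minimal)

lemma subspace_closure_span: "subspace (closure (span S))"
  for S :: "'a::real_normed_vector set"
  by (intro subspace_closure subspace_span)

lemma closure_span_superset: "x \<in> S \<Longrightarrow> x \<in> closure (span S)"
  for S :: "'a::real_normed_vector set"
  using closure_subset span_superset by blast

lemma bounded_linear_eq_on_closure_span:
  assumes "bounded_linear f" "bounded_linear g" "\<And>x. x \<in> S \<Longrightarrow> f x = g x"
    and "x \<in> closure (span S)"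
  shows "f x = g x"
proof -
  interpret f: bounded_linear f by fact
  interpret g: bounded_linear g by fact
  have "closure (span S) \<subseteq> {x. f x = g x}"
  proof (rule closed_closure_span_subset)
    show "subspace {x. f x = g x}"
      by (rule subspaceI) (auto simp: f.add g.add f.scaleR g.scaleR f.zero g.zero)
    show "closed {x. f x = g x}"
      by (intro closed_Collect_eq linear_continuous_on assms)
  qed (use assms in auto)
  then show ?thesis using assms by blast
qed

text \<open>Riesz-Fischer. Along a fast subsequence the increments have squared norms at most 4^-n;
  summability of their weighted squares makes them decay geometrically at almost every point, and
  Fatou's lemma shows that the pointwise limit is also the limit in norm.\<close>

lemma l2_Cauchy_convergent:
  fixes X :: "nat \<Rightarrow> 'a::euclidean_space l2"
  assumes "Cauchy X"
  shows "convergent X"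
proof -
  have "\<exists>M. \<forall>m\<ge>M. \<forall>n\<ge>M. norm (X m - X n) < (1 / 2) ^ k" for k
    using assms unfolding Cauchy_iff by simp
  then obtain M where M: "\<And>k m n. m \<ge> M k \<Longrightarrow> n \<ge> M k \<Longrightarrow> norm (X m - X n) < (1 / 2) ^ k"
    by metis
  \<comment> \<open>The partial sums dominate every \<open>M k\<close>, and the summand k makes the
    indices strictly increasing.\<close>
  define r where "r k = (\<Sum>i\<le>k. M i) + k" for k
  have rM: "r k \<ge> M k" for k
    unfolding r_def by (simp add: trans_le_add1 member_le_sum)
  have rr: "strict_mono r"
    by (rule strict_monoI_Suc) (simp add: r_def)
  define f where "f n = rep_l2 (X (r n))" for n
  have fm [measurable]: "f n \<in> borel_measurable borel" for n by (simp add: f_def)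
  define a where "a n x = cmod (f (Suc n) x - f n x)" for n x
  have nn: "(\<integral>\<^sup>+x. ennreal ((a n x)\<^sup>2) \<partial>lborel) \<le> ennreal ((1 / 4) ^ n)" for n
  proof -
    have "(\<integral>\<^sup>+x. ennreal ((a n x)\<^sup>2) \<partial>lborel) = ennreal ((norm (X (r (Suc n)) - X (r n)))\<^sup>2)"
      unfolding norm_l2_sq_nn a_def f_def
      by (rule nn_integral_cong_AE)
        (use AE_rep_diff[of "X (r (Suc n))" "X (r n)"] in eventually_elim, simp)
    also have "\<dots> \<le> ennreal (((1 / 2) ^ n)\<^sup>2)"
    proof (intro ennreal_leI power_mono)
      have "r (Suc n) \<ge> r n" using rr by (simp add: strict_mono_less_eq)
      then show "norm (X (r (Suc n)) - X (r n)) \<le> (1 / 2) ^ n"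
        using M[of n "r (Suc n)" "r n"] rM[of n] by linarith
    qed simp
    also have "((1 / 2) ^ n)\<^sup>2 = (1 / 4 :: real) ^ n"
      unfolding power2_eq_square power_mult_distrib[symmetric] by simp
    finally show ?thesis .
  qed
  \<comment> \<open>The weight 2^n still leaves the convergent series of 2^-n, while finiteness of
    the weighted sum S at a point forces a_n <= sqrt(S) 2^(-n/2) there.\<close>
  have "(\<integral>\<^sup>+x. (\<Sum>n. ennreal (2 ^ n * (a n x)\<^sup>2)) \<partial>lborel) = (\<Sum>n. \<integral>\<^sup>+x. ennreal (2 ^ n * (a n x)\<^sup>2) \<partial>lborel)"
    unfolding a_def by (rule nn_integral_suminf) measurable
  also have "\<dots> \<le> (\<Sum>n. ennreal ((1 / 2) ^ n))"
  proof (intro suminf_le)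
    fix n
    have "(\<integral>\<^sup>+x. ennreal (2 ^ n * (a n x)\<^sup>2) \<partial>lborel) = (\<integral>\<^sup>+x. ennreal (2 ^ n) * ennreal ((a n x)\<^sup>2) \<partial>lborel)"
      by (intro nn_integral_cong ennreal_mult) (rule zero_le_power, simp, rule zero_le_power2)
    also have "\<dots> = ennreal (2 ^ n) * (\<integral>\<^sup>+x. ennreal ((a n x)\<^sup>2) \<partial>lborel)"
      unfolding a_def by (rule nn_integral_cmult) measurable
    also have "\<dots> \<le> ennreal (2 ^ n) * ennreal ((1 / 4) ^ n)"
      by (intro mult_left_mono nn zero_le)
    also have "\<dots> = ennreal (2 ^ n * (1 / 4) ^ n)"
      by (rule ennreal_mult[symmetric]) (rule zero_le_power, simp)+
    also have "2 ^ n * (1 / 4) ^ n = (1 / 2 :: real) ^ n"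
      unfolding power_mult_distrib[symmetric] by simp
    finally show "(\<integral>\<^sup>+x. ennreal (2 ^ n * (a n x)\<^sup>2) \<partial>lborel) \<le> ennreal ((1 / 2) ^ n)" .
  qed (rule summableI)+
  also have "\<dots> < \<infinity>"
  proof -
    have "(\<Sum>n. ennreal ((1 / 2) ^ n)) = ennreal (\<Sum>n. (1 / 2) ^ n)"
      by (rule suminf_ennreal2) (rule zero_le_power, simp, rule summable_geometric, simp)
    then show ?thesis by (simp only: ennreal_less_top infinity_ennreal_def)
  qed
  finally have fin: "(\<integral>\<^sup>+x. (\<Sum>n. ennreal (2 ^ n * (a n x)\<^sup>2)) \<partial>lborel) \<noteq> \<infinity>" by simp
  have "AE x in lborel. (\<Sum>n. ennreal (2 ^ n * (a n x)\<^sup>2)) \<noteq> \<infinity>"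
    by (rule nn_integral_PInf_AE[OF _ fin]) (simp add: a_def)
  then have conv: "AE x in lborel. convergent (\<lambda>n. f n x)"
  proof eventually_elim
    case (elim x)
    define S where "S = enn2real (\<Sum>n. ennreal (2 ^ n * (a n x)\<^sup>2))"
    have S: "(\<Sum>n. ennreal (2 ^ n * (a n x)\<^sup>2)) = ennreal S"
      unfolding S_def using elim by (simp add: top.not_eq_extremum)
    have S0: "S \<ge> 0" by (simp add: S_def)
    have ab: "a n x \<le> sqrt S * (1 / sqrt 2) ^ n" for n
    proof -
      have "ennreal (2 ^ n * (a n x)\<^sup>2) \<le> ennreal S"
        unfolding S[symmetric]
        by (rule order_trans[OF _ sum_le_suminf[of _ "{n}"]]) auto
      then have "2 ^ n * (a n x)\<^sup>2 \<le> S" using S0 by (simp only: ennreal_le_iff)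
      then have "sqrt (2 ^ n * (a n x)\<^sup>2) \<le> sqrt S" by (rule real_sqrt_le_mono)
      then have "sqrt 2 ^ n * a n x \<le> sqrt S"
        by (simp add: real_sqrt_mult real_sqrt_power a_def)
      then show ?thesis by (simp add: power_divide field_simps)
    qed
    have "summable (\<lambda>n. sqrt S * (1 / sqrt 2) ^ n)"
      by (intro summable_mult summable_geometric) simp
    then have "summable (\<lambda>n. f (Suc n) x - f n x)"
      by (rule summable_comparison_test') (use ab in \<open>simp add: a_def\<close>)
    from summable_LIMSEQ[OF this] have "(\<lambda>n. f n x - f 0 x) \<longlonglongrightarrow> (\<Sum>n. f (Suc n) x - f n x)"
      unfolding sum_lessThan_telescope[of "\<lambda>n. f n x"] .
    from tendsto_add[OF this tendsto_const[of "f 0 x"]]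
    show ?case by (auto simp: convergent_def)
  qed
  define F where "F x = lim (\<lambda>n. f n x)" for x
  have Fm [measurable]: "F \<in> borel_measurable borel" unfolding F_def by measurable
  have lim: "AE x in lborel. (\<lambda>n. f n x) \<longlonglongrightarrow> F x"
    using conv by eventually_elim (simp add: F_def convergent_LIMSEQ_iff)
  have fat: "(\<integral>\<^sup>+x. ennreal ((cmod (f n x - F x))\<^sup>2) \<partial>lborel) \<le> ennreal (((1 / 2) ^ n)\<^sup>2)" for n
  proof -
    have "(\<integral>\<^sup>+x. ennreal ((cmod (f n x - F x))\<^sup>2) \<partial>lborel) =
        (\<integral>\<^sup>+x. liminf (\<lambda>m. ennreal ((cmod (f n x - f m x))\<^sup>2)) \<partial>lborel)"
    proof (rule nn_integral_cong_AE, use lim in eventually_elim)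
      case (elim x)
      have "(\<lambda>m. ennreal ((cmod (f n x - f m x))\<^sup>2)) \<longlonglongrightarrow> ennreal ((cmod (f n x - F x))\<^sup>2)"
        by (intro tendsto_intros elim)
      then show ?case using lim_imp_Liminf[OF sequentially_bot] by metis
    qed
    also have "\<dots> \<le> liminf (\<lambda>m. \<integral>\<^sup>+x. ennreal ((cmod (f n x - f m x))\<^sup>2) \<partial>lborel)"
      by (rule nn_integral_liminf) measurable
    also have "\<dots> \<le> ennreal (((1 / 2) ^ n)\<^sup>2)"
    proof (rule order_trans[OF Liminf_mono Liminf_const[OF sequentially_bot, THEN eq_refl]],
        rule eventually_sequentiallyI[of n])
      fix m assume "n \<le> m"
      have "(\<integral>\<^sup>+x. ennreal ((cmod (f n x - f m x))\<^sup>2) \<partial>lborel) = ennreal ((norm (X (r n) - X (r m)))\<^sup>2)"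
        unfolding norm_l2_sq_nn f_def
        by (rule nn_integral_cong_AE)
          (use AE_rep_diff[of "X (r n)" "X (r m)"] in eventually_elim, simp)
      also have "\<dots> \<le> ennreal (((1 / 2) ^ n)\<^sup>2)"
      proof (intro ennreal_leI power_mono)
        have "r m \<ge> r n" using rr \<open>n \<le> m\<close> by (simp add: strict_mono_less_eq)
        then show "norm (X (r n) - X (r m)) \<le> (1 / 2) ^ n"
          using M[of n "r n" "r m"] rM[of n] by linarith
      qed simp
      finally show "(\<integral>\<^sup>+x. ennreal ((cmod (f n x - f m x))\<^sup>2) \<partial>lborel) \<le> ennreal (((1 / 2) ^ n)\<^sup>2)" .
    qed
    finally show ?thesis .
  qed
  have sqd: "square_integrable (\<lambda>x. f 0 x - F x)"
    unfolding square_integrable_def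
  proof
    show "(\<lambda>x. f 0 x - F x) \<in> borel_measurable lborel" by measurable
    show "integrable lborel (\<lambda>x. (cmod (f 0 x - F x))\<^sup>2)"
    proof (rule integrableI_bounded)
      show "(\<lambda>x. (cmod (f 0 x - F x))\<^sup>2) \<in> borel_measurable lborel" by measurable
      have "(\<integral>\<^sup>+x. ennreal (norm ((cmod (f 0 x - F x))\<^sup>2)) \<partial>lborel) \<le> ennreal (((1 / 2) ^ 0)\<^sup>2)"
        using fat[of 0] by (simp only: real_norm_def abs_power2)
      also have "\<dots> < \<infinity>" by simp
      finally show "(\<integral>\<^sup>+x. ennreal (norm ((cmod (f 0 x - F x))\<^sup>2)) \<partial>lborel) < \<infinity>" .
    qed
  qed
  have "square_integrable (\<lambda>x. f 0 x + - 1 * (f 0 x - F x))"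
    by (rule square_integrable_add[OF _ square_integrable_scale[OF sqd]]) (simp add: f_def)
  then have sqF: "square_integrable F" by simp
  have "norm (X (r n) - abs_l2 F) \<le> (1 / 2) ^ n" for n
  proof -
    have "ennreal ((norm (X (r n) - abs_l2 F))\<^sup>2) = (\<integral>\<^sup>+x. ennreal ((cmod (f n x - F x))\<^sup>2) \<partial>lborel)"
      unfolding norm_l2_sq_nn f_def
      by (rule nn_integral_cong_AE)
        (use AE_rep_diff[of "X (r n)" "abs_l2 F"] AE_rep_abs[OF sqF] in eventually_elim, simp)
    then have "ennreal ((norm (X (r n) - abs_l2 F))\<^sup>2) \<le> ennreal (((1 / 2) ^ n)\<^sup>2)"
      using fat[of n] by (simp only:)
    then have "(norm (X (r n) - abs_l2 F))\<^sup>2 \<le> ((1 / 2) ^ n)\<^sup>2"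
      by (rule ennreal_le_iff[OF zero_le_power2, THEN iffD1])
    then show ?thesis by (rule power2_le_imp_le) simp
  qed
  then have "\<forall>\<^sub>F n in sequentially. norm (X (r n) - abs_l2 F) \<le> (1 / 2) ^ n"
    by (intro always_eventually allI)
  from Lim_null_comparison[OF this] have "(\<lambda>n. X (r n) - abs_l2 F) \<longlonglongrightarrow> 0"
    by (simp add: LIMSEQ_power_zero)
  then have "(X \<circ> r) \<longlonglongrightarrow> abs_l2 F"
    using LIM_zero_iff[of "\<lambda>n. X (r n)"] by (simp only: o_def)
  from Cauchy_converges_subseq[OF assms rr this] show ?thesis
    by (rule convergentI)
qed

instance l2 :: (euclidean_space) complete_space
  by standard (rule l2_Cauchy_convergent)

subsection \<open>Density, isometries, and independence of the functional calculus\<close>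

lemma AE_rep_sum:
  assumes "finite I"
  shows "AE x in lborel. rep_l2 (\<Sum>i\<in>I. X i) x = (\<Sum>i\<in>I. rep_l2 (X i) x)"
  using assms
proof (induction I)
  case empty
  then show ?case using AE_rep_zero by simp
next
  case (insert i I)
  show ?case
    using insert.IH AE_rep_add[of "X i" "\<Sum>i\<in>I. X i"] by eventually_elim (simp add: insert.hyps)
qed

definition ind_l2 :: "'a::euclidean_space set \<Rightarrow> complex \<Rightarrow> 'a l2" where
  "ind_l2 A c = abs_l2 (\<lambda>x. c * indicator A x)"

lemma square_integrable_indicator:
  assumes "A \<in> sets borel" "emeasure lborel A < \<infinity>"
  shows "square_integrable (\<lambda>x. c * indicator A x)"
proof (rule square_integrable_scale, rule square_integrable_bound)
  show "integrable lborel (indicator A :: _ \<Rightarrow> real)"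
    using assms by simp
qed (use assms in \<open>auto simp: indicator_def\<close>)

lemma AE_rep_ind:
  assumes "A \<in> sets borel" "emeasure lborel A < \<infinity>"
  shows "AE x in lborel. rep_l2 (ind_l2 A c) x = c * indicator A x"
  unfolding ind_l2_def by (rule AE_rep_abs[OF square_integrable_indicator[OF assms]])

lemma emeasure_Int_box_finite: "A \<in> sets borel \<Longrightarrow> emeasure lborel (A \<inter> box a b) < \<infinity>"
  using emeasure_mono[of "A \<inter> box a b" "box a b" lborel] emeasure_lborel_box_finite[of a b]
  by (auto intro: le_less_trans)

lemma ind_l2_Un:
  assumes "A \<in> sets borel" "emeasure lborel A < \<infinity>" "B \<in> sets borel" "emeasure lborel B < \<infinity>"
    "A \<inter> B = {}"
  shows "ind_l2 (A \<union> B) c = ind_l2 A c + ind_l2 B c"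
  unfolding ind_l2_def[of "A \<union> B"]
proof (rule abs_l2_eqI)
  have "emeasure lborel (A \<union> B) \<le> emeasure lborel A + emeasure lborel B"
    using assms by (intro emeasure_subadditive) auto
  also have "\<dots> < \<infinity>" using assms by simp
  finally show "square_integrable (\<lambda>x. c * indicator (A \<union> B) x)"
    using assms by (intro square_integrable_indicator) auto
  show "AE x in lborel. c * indicator (A \<union> B) x = rep_l2 (ind_l2 A c + ind_l2 B c) x"
    using AE_rep_add[of "ind_l2 A c" "ind_l2 B c"] AE_rep_ind[OF assms(1,2), of c] AE_rep_ind[OF assms(3,4), of c]
    by eventually_elim (use assms(5) in \<open>auto simp: indicator_def\<close>)
qed

text \<open>Dynkin's argument: boxes are stable under intersection and generate the Borel sets.
  Everything is intersected with one fixed box, so all measures are finite, complements become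
  differences of vectors, and disjoint unions become norm limits.\<close>

lemma ind_l2_closure_span_boxes:
  fixes A :: "'a::euclidean_space set"
  assumes "A \<in> sets borel"
  shows "ind_l2 (A \<inter> box k l) c \<in> closure (span {ind_l2 (box a b) c |a b c. True})"
    (is "_ \<in> ?M")
proof -
  let ?K = "box k l"
  note sub = subspace_closure_span[of "{ind_l2 (box a b :: 'a set) c |a b c. True}"]
  have fin: "A \<inter> ?K \<in> sets borel" "emeasure lborel (A \<inter> ?K) < \<infinity>"
    if "A \<in> sets borel" for A :: "'a set"
    using that emeasure_Int_box_finite by auto
  have bx: "ind_l2 (box a b) c \<in> ?M" for a b :: 'a and c
    by (rule closure_span_superset) blast
  have "Int_stable (range (\<lambda>(a, b). box a b :: 'a set))"
    by (auto simp: Int_stable_def box_Int_box)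
  moreover have "range (\<lambda>(a, b). box a b :: 'a set) \<subseteq> Pow UNIV" by simp
  moreover have "A \<in> sigma_sets UNIV (range (\<lambda>(a, b). box a b))"
    using assms unfolding borel_eq_box by simp
  ultimately show ?thesis
  proof (induction arbitrary: rule: sigma_sets_induct_disjoint)
    case (basic A)
    then show ?case using bx by (auto simp: box_Int_box)
  next
    case empty
    have "ind_l2 ({} \<inter> ?K) c = 0"
      unfolding ind_l2_def
      by (rule abs_l2_eqI) (use AE_rep_zero in \<open>auto simp: square_integrable_zero\<close>)
    then show ?case using subspace_0[OF sub] by simp
  next
    case (compl A)
    then have A: "A \<in> sets borel" unfolding borel_eq_box by simp
    have "ind_l2 (A \<inter> ?K \<union> (UNIV - A) \<inter> ?K) c = ind_l2 (A \<inter> ?K) c + ind_l2 ((UNIV - A) \<inter> ?K) c"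
      using A by (intro ind_l2_Un fin) auto
    moreover have "A \<inter> ?K \<union> (UNIV - A) \<inter> ?K = ?K" by auto
    ultimately have "ind_l2 ((UNIV - A) \<inter> ?K) c = ind_l2 ?K c - ind_l2 (A \<inter> ?K) c" by simp
    then show ?case using subspace_diff[OF sub bx compl(2)] by simp
  next
    case (union A)
    then have A: "A i \<in> sets borel" for i unfolding borel_eq_box by auto
    have un: "(\<Union>i<n. A i) \<in> sets borel" for n using A by auto
    have "ind_l2 ((\<Union>i<n. A i) \<inter> ?K) c \<in> ?M" for n
    proof (induction n)
      case 0
      have "ind_l2 ({} \<inter> ?K) c = 0"
        unfolding ind_l2_def
        by (rule abs_l2_eqI) (use AE_rep_zero in \<open>auto simp: square_integrable_zero\<close>)
      then show ?case using subspace_0[OF sub] by simp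
    next
      case (Suc n)
      have "(\<Union>i<n. A i) \<inter> ?K \<inter> (A n \<inter> ?K) = {}"
        using \<open>disjoint_family A\<close> unfolding disjoint_family_on_def by (auto 4 3 dest: less_imp_neq)
      then have "ind_l2 ((\<Union>i<n. A i) \<inter> ?K \<union> A n \<inter> ?K) c =
          ind_l2 ((\<Union>i<n. A i) \<inter> ?K) c + ind_l2 (A n \<inter> ?K) c"
        by (intro ind_l2_Un fin un A)
      moreover have "(\<Union>i<n. A i) \<inter> ?K \<union> A n \<inter> ?K = (\<Union>i<Suc n. A i) \<inter> ?K"
        by (auto simp: lessThan_Suc)
      ultimately show ?case using subspace_add[OF sub Suc union(3)[of n]] by simp
    qed
    moreover have "(\<lambda>n. ind_l2 ((\<Union>i<n. A i) \<inter> ?K) c) \<longlonglongrightarrow> ind_l2 ((\<Union>i. A i) \<inter> ?K) c"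
    proof (rule tendsto_l2_dominated)
      have "AE x in lborel. \<forall>n. rep_l2 (ind_l2 ((\<Union>i<n. A i) \<inter> ?K) c) x = c * indicator ((\<Union>i<n. A i) \<inter> ?K) x"
        by (subst AE_all_countable) (intro allI AE_rep_ind fin un)
      moreover have "AE x in lborel. rep_l2 (ind_l2 ((\<Union>i. A i) \<inter> ?K) c) x = c * indicator ((\<Union>i. A i) \<inter> ?K) x"
        using A by (intro AE_rep_ind fin) auto
      ultimately show "AE x in lborel. (\<lambda>n. rep_l2 (ind_l2 ((\<Union>i<n. A i) \<inter> ?K) c) x) \<longlonglongrightarrow>
          rep_l2 (ind_l2 ((\<Union>i. A i) \<inter> ?K) c) x"
        by eventually_elim (simp add: indicator_inter_arith, intro tendsto_intros LIMSEQ_indicator_UN)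
      show "integrable lborel (\<lambda>x. (cmod c)\<^sup>2 * indicator ?K x :: real)"
        by (intro integrable_mult_right integrable_real_indicator emeasure_lborel_box_finite) simp
      show "AE x in lborel. (cmod (rep_l2 (ind_l2 ((\<Union>i<n. A i) \<inter> ?K) c) x))\<^sup>2 \<le> (cmod c)\<^sup>2 * indicator ?K x" for n
        using AE_rep_ind[OF fin[OF un], of n c] by eventually_elim (auto simp: indicator_def)
    qed
    ultimately show ?case
      by (meson closed_closure closed_sequentially)
  qed
qed

text \<open>Simple functions bounded by 2|\<phi>| converge pointwise to \<phi>; cutting them off to
  growing boxes gives their level sets finite measure. The common majorant is 4|\<phi>|^2.\<close>

lemma ind_box_dense:
  "closure (span {ind_l2 (box a b :: 'a::euclidean_space set) c |a b c. True}) = UNIV" (is "?M = _")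
proof (intro set_eqI iffI UNIV_I)
  fix \<phi> :: "'a l2"
  note sub = subspace_closure_span[of "{ind_l2 (box a b :: 'a set) c |a b c. True}"]
  have m: "rep_l2 \<phi> \<in> borel_measurable lborel" by simp
  obtain F where F: "\<And>i. simple_function lborel (F i)" "\<And>x. (\<lambda>i. F i x) \<longlonglongrightarrow> rep_l2 \<phi> x"
    and Fb: "\<And>i x. dist (F i x) 0 \<le> 2 * dist (rep_l2 \<phi> x) 0"
    using borel_measurable_implies_sequence_metric[OF m, of 0] by auto
  define K where "K i = box (- (real i *\<^sub>R One)) (real i *\<^sub>R One :: 'a)" for i
  have Fm [measurable]: "F i \<in> borel_measurable borel" for i
    using borel_measurable_simple_function[OF F(1)[of i]] by simp
  have Km [measurable]: "K i \<in> sets borel" for i by (simp add: K_def)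
  have sq: "square_integrable (\<lambda>x. F i x * indicator (K i) x)" for i
  proof (rule square_integrable_bound)
    show "integrable lborel (\<lambda>x. 4 * (cmod (rep_l2 \<phi> x))\<^sup>2)"
      by (intro integrable_mult_right integrable_rep)
    show "AE x in lborel. (cmod (F i x * indicator (K i) x))\<^sup>2 \<le> 4 * (cmod (rep_l2 \<phi> x))\<^sup>2"
    proof (intro AE_I2)
      fix x
      have "(cmod (F i x))\<^sup>2 \<le> (2 * cmod (rep_l2 \<phi> x))\<^sup>2"
        using Fb[of i x] by (intro power_mono) auto
      then show "(cmod (F i x * indicator (K i) x))\<^sup>2 \<le> 4 * (cmod (rep_l2 \<phi> x))\<^sup>2"
        by (auto simp: indicator_def power_mult_distrib)
    qed
  qed measurable
  define X where "X i = abs_l2 (\<lambda>x. F i x * indicator (K i) x)" for i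
  have X: "AE x in lborel. rep_l2 (X i) x = F i x * indicator (K i) x" for i
    unfolding X_def by (rule AE_rep_abs[OF sq])
  have "X i \<in> ?M" for i
  proof -
    have fin: "finite (range (F i))" using F(1)[of i] by (simp add: simple_function_def)
    have mm: "F i -` {y} \<in> sets borel" for y
      using measurable_sets[OF Fm, of "{y}" i] by simp
    have "X i = (\<Sum>y\<in>range (F i). ind_l2 (F i -` {y} \<inter> K i) y)"
      unfolding X_def
    proof (rule abs_l2_eqI[OF sq])
      have "AE x in lborel. \<forall>y\<in>range (F i). rep_l2 (ind_l2 (F i -` {y} \<inter> K i) y) x = y * indicator (F i -` {y} \<inter> K i) x"
        using fin mm unfolding K_def by (intro AE_finite_allI AE_rep_ind emeasure_Int_box_finite) auto
      then show "AE x in lborel. F i x * indicator (K i) x = rep_l2 (\<Sum>y\<in>range (F i). ind_l2 (F i -` {y} \<inter> K i) y) x"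
        using AE_rep_sum[OF fin, of "\<lambda>y. ind_l2 (F i -` {y} \<inter> K i) y"]
      proof eventually_elim
        case (elim x)
        have "(\<Sum>y\<in>range (F i). y * indicator (F i -` {y} \<inter> K i) x) =
            (\<Sum>y\<in>range (F i). if y = F i x then F i x * indicator (K i) x else 0)"
          by (intro sum.cong) (auto simp: indicator_def)
        also have "\<dots> = F i x * indicator (K i) x"
          using fin by simp
        also have "(\<Sum>y\<in>range (F i). y * indicator (F i -` {y} \<inter> K i) x) =
            (\<Sum>y\<in>range (F i). rep_l2 (ind_l2 (F i -` {y} \<inter> K i) y) x)"
          using elim(1)[rule_format] by (intro sum.cong refl) metis
        finally show ?case unfolding elim(2) ..
      qed
    qed
    then show ?thesis
      using subspace_sum[OF sub, of "range (F i)"] ind_l2_closure_span_boxes[OF mm]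
      by (simp add: K_def)
  qed
  moreover have "X \<longlonglongrightarrow> \<phi>"
  proof (rule tendsto_l2_dominated)
    have "AE x in lborel. \<forall>i. rep_l2 (X i) x = F i x * indicator (K i) x"
      using X by (subst AE_all_countable) auto
    then show "AE x in lborel. (\<lambda>i. rep_l2 (X i) x) \<longlonglongrightarrow> rep_l2 \<phi> x"
    proof eventually_elim
      case (elim x)
      obtain N :: nat where N: "norm x < real N" using reals_Archimedean2 by blast
      have "x \<in> K i" if "i \<ge> N" for i
        unfolding K_def mem_box
        using N that Basis_le_norm[of _ x] by (force simp: abs_le_iff)
      then have "\<forall>\<^sub>F i in sequentially. F i x = rep_l2 (X i) x"
        by (intro eventually_sequentiallyI[of N]) (simp add: elim)
      with F(2)[of x] show ?case by (rule Lim_transform_eventually)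
    qed
    show "integrable lborel (\<lambda>x. 4 * (cmod (rep_l2 \<phi> x))\<^sup>2)"
      by (intro integrable_mult_right integrable_rep)
    show "AE x in lborel. (cmod (rep_l2 (X i) x))\<^sup>2 \<le> 4 * (cmod (rep_l2 \<phi> x))\<^sup>2" for i
      using X[of i]
    proof eventually_elim
      case (elim x)
      have "(cmod (F i x))\<^sup>2 \<le> (2 * cmod (rep_l2 \<phi> x))\<^sup>2"
        using Fb[of i x] by (intro power_mono) auto
      then show ?case
        unfolding elim by (auto simp: indicator_def power_mult_distrib)
    qed
  qed
  ultimately show "\<phi> \<in> ?M" by (meson closed_closure closed_sequentially)
qed

section \<open>Isometries, unitaries, and their construction on a dense set\<close>

definition isometry_map :: "('a::euclidean_space l2 \<Rightarrow> 'b::euclidean_space l2) \<Rightarrow> bool" where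
  "isometry_map U \<longleftrightarrow> (\<forall>\<phi> \<psi>. cinner (U \<phi>) (U \<psi>) = cinner \<phi> \<psi>)"

lemma unitary_isometry: "unitary_map U \<Longrightarrow> isometry_map U"
  by (simp add: unitary_map_def isometry_map_def)

lemma isometry_norm: "isometry_map U \<Longrightarrow> norm (U \<phi>) = norm \<phi>"
  by (simp add: norm_eq_sqrt_inner Re_cinner[symmetric] isometry_map_def)

text \<open>Expanding the inner products, a defect of additivity or homogeneity has the same norm as
  the corresponding expression in the source, which is zero.\<close>

lemma isometry_bounded_linear:
  assumes "isometry_map U"
  shows "bounded_linear U"
proof (rule bounded_linear_intro[where K=1])
  have i: "inner (U \<phi>) (U \<psi>) = inner \<phi> \<psi>" for \<phi> \<psi>
    using assms by (simp add: Re_cinner[symmetric] isometry_map_def)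
  fix \<phi> \<psi> :: "'a l2" and r :: real
  have "inner (U (\<phi> + \<psi>) - U \<phi> - U \<psi>) (U (\<phi> + \<psi>) - U \<phi> - U \<psi>) =
      inner (\<phi> + \<psi> - \<phi> - \<psi>) (\<phi> + \<psi> - \<phi> - \<psi>)"
    unfolding inner_diff_left inner_diff_right i ..
  also have "\<phi> + \<psi> - \<phi> - \<psi> = 0" by simp
  finally have "U (\<phi> + \<psi>) - U \<phi> - U \<psi> = 0" by (simp only: inner_zero_left inner_eq_zero_iff)
  then show "U (\<phi> + \<psi>) = U \<phi> + U \<psi>" by (simp add: algebra_simps)
  have "inner (U (r *\<^sub>R \<phi>) - r *\<^sub>R U \<phi>) (U (r *\<^sub>R \<phi>) - r *\<^sub>R U \<phi>) =
      inner (r *\<^sub>R \<phi> - r *\<^sub>R \<phi>) (r *\<^sub>R \<phi> - r *\<^sub>R \<phi>)"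
    by (simp only: inner_diff_left inner_diff_right inner_scaleR_left inner_scaleR_right i)
      (simp add: algebra_simps)
  also have "r *\<^sub>R \<phi> - r *\<^sub>R \<phi> = 0" by simp
  finally have "U (r *\<^sub>R \<phi>) - r *\<^sub>R U \<phi> = 0" by (simp only: inner_zero_left inner_eq_zero_iff)
  then show "U (r *\<^sub>R \<phi>) = r *\<^sub>R U \<phi>" by simp
  show "norm (U \<phi>) \<le> norm \<phi> * 1" by (simp add: isometry_norm[OF assms])
qed

lemma isometry_inj: "isometry_map U \<Longrightarrow> inj U"
proof (rule injI)
  fix \<phi> \<psi> assume U: "isometry_map U" and eq: "U \<phi> = U \<psi>"
  interpret bounded_linear U by (rule isometry_bounded_linear[OF U])
  have "norm (U (\<phi> - \<psi>)) = 0" using eq by (simp add: diff)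
  then show "\<phi> = \<psi>" by (simp add: isometry_norm[OF U])
qed

lemma isometry_const:
  assumes "isometry_map U"
  shows "U (mul_l2 (\<lambda>_. c) \<phi>) = mul_l2 (\<lambda>_. c) (U \<phi>)"
proof -
  have i: "cinner (U \<phi>) (U \<psi>) = cinner \<phi> \<psi>" for \<phi> \<psi>
    using assms by (simp add: isometry_map_def)
  let ?d = "U (mul_l2 (\<lambda>_. c) \<phi>) - mul_l2 (\<lambda>_. c) (U \<phi>)"
  have "cinner ?d ?d = cinner (mul_l2 (\<lambda>_. c) \<phi> - mul_l2 (\<lambda>_. c) \<phi>) (mul_l2 (\<lambda>_. c) \<phi> - mul_l2 (\<lambda>_. c) \<phi>)"
    by (simp only: cinner_diff_left cinner_diff_right cinner_const_left cinner_const_right i)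
      (simp add: algebra_simps)
  then show ?thesis by (simp add: cinner_self)
qed

lemma unitary_bij: "unitary_map U \<Longrightarrow> bij U"
  by (simp add: bij_def isometry_inj unitary_isometry) (simp add: unitary_map_def)

lemma unitary_inv: "unitary_map U \<Longrightarrow> unitary_map (inv U)"
  using unitary_bij[of U]
  by (metis bij_imp_bij_inv bij_inv_eq_iff bij_is_surj unitary_map_def)

lemma unitary_comp: "unitary_map U \<Longrightarrow> unitary_map V \<Longrightarrow> unitary_map (U \<circ> V)"
  unfolding unitary_map_def by (intro conjI comp_surj) simp_all

lemma unitary_inv_apply [simp]:
  assumes "unitary_map U"
  shows "inv U (U \<phi>) = \<phi>" "U (inv U \<phi>) = \<phi>"
  using unitary_bij[OF assms] by (auto simp: bij_is_inj bij_is_surj surj_f_inv_f)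

lemma unitary_cinner: "unitary_map U \<Longrightarrow> cinner (U \<phi>) (U \<psi>) = cinner \<phi> \<psi>"
  by (simp add: unitary_map_def)

lemma cinner_closure_span:
  assumes S: "\<And>p q. p \<in> S \<Longrightarrow> q \<in> S \<Longrightarrow> cinner (fst p) (fst q) = cinner (snd p) (snd q)"
    and p: "p \<in> closure (span S)" and q: "q \<in> closure (span S)"
  shows "cinner (fst p) (fst q) = cinner (snd p) (snd q)"
proof -
  have 1: "cinner (fst p) (fst q) = cinner (snd p) (snd q)" if "q \<in> S" "p \<in> closure (span S)" for p q
  proof -
    have "closure (span S) \<subseteq> {p. cinner (fst p) (fst q) = cinner (snd p) (snd q)}"
    proof (rule closed_closure_span_subset)
      show "S \<subseteq> {p. cinner (fst p) (fst q) = cinner (snd p) (snd q)}" using S that by blast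
      show "subspace {p. cinner (fst p) (fst q) = cinner (snd p) (snd q)}"
        by (rule subspaceI) (auto simp: cinner_add_left cinner_scaleR_left)
      show "closed {p. cinner (fst p) (fst q) = cinner (snd p) (snd q)}"
        by (intro closed_Collect_eq continuous_intros)
    qed
    then show ?thesis using that by blast
  qed
  have "closure (span S) \<subseteq> {q. cinner (fst p) (fst q) = cinner (snd p) (snd q)}"
  proof (rule closed_closure_span_subset)
    show "S \<subseteq> {q. cinner (fst p) (fst q) = cinner (snd p) (snd q)}" using 1 p by blast
    show "subspace {q. cinner (fst p) (fst q) = cinner (snd p) (snd q)}"
      by (rule subspaceI) (auto simp: cinner_add_right cinner_scaleR_right)
    show "closed {q. cinner (fst p) (fst q) = cinner (snd p) (snd q)}"
      by (intro closed_Collect_eq continuous_intros)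
  qed
  then show ?thesis using q by blast
qed

text \<open>Equal inner products on \<open>S\<close> extend to the closed span, so the two
  components of a pair there have equal norms. Hence this closed subspace is single-valued, and by
  density and completeness it is total. The second conclusion records that the closed span is itself
  the graph, which is the form that tensor products of operators need.\<close>

lemma isometry_exists:
  fixes S :: "('a::euclidean_space l2 \<times> 'b::euclidean_space l2) set"
  assumes S: "\<And>p q. p \<in> S \<Longrightarrow> q \<in> S \<Longrightarrow> cinner (fst p) (fst q) = cinner (snd p) (snd q)"
    and dense: "closure (span (fst ` S)) = UNIV"
  obtains U where "isometry_map U" "closure (span S) = {(\<phi>, U \<phi>) |\<phi>. True}"
proof -
  let ?G = "closure (span S)"
  have G: "subspace ?G" by (rule subspace_closure_span)
  have nrm: "norm (fst p) = norm (snd p)" if "p \<in> ?G" for p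
    using cinner_closure_span[OF S that that] by (simp add: norm_eq_sqrt_inner Re_cinner[symmetric])
  have ex: "\<exists>\<psi>. (\<phi>, \<psi>) \<in> ?G" for \<phi>
  proof -
    have "span (fst ` S) = fst ` span S"
      by (rule linear_span_image) (rule linear_fst)
    then have "\<phi> \<in> closure (fst ` span S)" using dense by simp
    then obtain x where x: "\<And>n. x n \<in> fst ` span S" "x \<longlonglongrightarrow> \<phi>"
      unfolding closure_sequential by blast
    then obtain p where p: "\<And>n. p n \<in> span S" "\<And>n. fst (p n) = x n"
      unfolding image_iff by metis
    have "Cauchy (\<lambda>n. snd (p n))"
    proof -
      have "Cauchy x" using x(2) by (rule LIMSEQ_imp_Cauchy)
      moreover have "norm (snd (p m) - snd (p n)) = norm (x m - x n)" for m n
      proof -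
        have "p m - p n \<in> ?G"
          using span_diff[OF p(1)[of m] p(1)[of n]] closure_subset by blast
        from nrm[OF this] show ?thesis by (simp add: p(2))
      qed
      ultimately show ?thesis by (simp add: Cauchy_iff)
    qed
    then obtain \<psi> where "(\<lambda>n. snd (p n)) \<longlonglongrightarrow> \<psi>"
      using Cauchy_convergent convergent_def by blast
    then have "(\<lambda>n. (x n, snd (p n))) \<longlonglongrightarrow> (\<phi>, \<psi>)"
      using x(2) by (intro tendsto_Pair)
    moreover have "(x n, snd (p n)) \<in> span S" for n
      using p[of n] by (metis prod.collapse)
    ultimately show ?thesis unfolding closure_sequential by fast
  qed
  have un: "\<psi> = \<psi>'" if "(\<phi>, \<psi>) \<in> ?G" "(\<phi>, \<psi>') \<in> ?G" for \<phi> \<psi> \<psi>'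
    using nrm[OF subspace_diff[OF G that]] by simp
  from ex obtain U where U: "\<And>\<phi>. (\<phi>, U \<phi>) \<in> ?G" by metis
  show ?thesis
  proof
    show "isometry_map U"
      unfolding isometry_map_def using cinner_closure_span[OF S U U] by simp
    show "?G = {(\<phi>, U \<phi>) |\<phi>. True}" using U un by fast
  qed
qed

section \<open>Unitaries commuting with position are multiplications\<close>

lemma mult_op_iff: "(\<phi>, \<psi>) \<in> mult_op m \<longleftrightarrow> (AE x in lborel. rep_l2 \<psi> x = m x * rep_l2 \<phi> x)"
  by (simp add: mult_op_def)

definition supported_in :: "real set \<Rightarrow> real l2 \<Rightarrow> bool" where
  "supported_in A \<phi> \<longleftrightarrow> (AE x in lborel. x \<notin> A \<longrightarrow> rep_l2 \<phi> x = 0)"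

text \<open>A vector is supported in \<open>[c - r, c + r]\<close> iff \<open>\<parallel>(\<Q> - c)\<^sup>n \<phi>\<parallel> \<le> r\<^sup>n \<parallel>\<phi>\<parallel>\<close> for all \<open>n\<close>, which is
  a property preserved by isometries that commute with \<open>\<Q>\<close>.\<close>

lemma commutes_position_supported:
  assumes U: "isometry_map W" and Q: "\<And>\<xi> \<eta>. (\<xi>, \<eta>) \<in> \<Q> \<Longrightarrow> (W \<xi>, W \<eta>) \<in> \<Q>"
    and \<phi>: "supported_in {c - r..c + r} \<phi>" and r: "0 \<le> r"
  shows "supported_in {c - r..c + r} (W \<phi>)"
proof -
  interpret W: bounded_linear W by (rule isometry_bounded_linear[OF U])
  define g where "g n x = (if \<bar>x - c\<bar> \<le> r then complex_of_real ((x - c) ^ n) else 0)" for n x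
  have g: "bdd_fun (g n)" and gb: "cmod (g n x) \<le> r ^ n" for n x
  proof -
    show *: "cmod (g n x) \<le> r ^ n" for x
      using r by (auto simp: g_def power_abs simp del: of_real_power of_real_diff intro!: power_mono)
    show "bdd_fun (g n)"
      by (rule bdd_funI[OF _ *]) (unfold g_def, measurable)
  qed
  define p where "p n = mul_l2 (g n) \<phi>" for n
  have p: "AE x in lborel. rep_l2 (p n) x = g n x * rep_l2 \<phi> x" for n
    unfolding p_def by (rule AE_rep_mul[OF g])
  have p0: "p 0 = \<phi>"
    unfolding p_def
  proof (rule mul_l2_eqI[OF g])
    show "AE x in lborel. rep_l2 \<phi> x = g 0 x * rep_l2 \<phi> x"
      using \<phi> unfolding supported_in_def by eventually_elim (auto simp: g_def abs_le_iff)
  qed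
  \<comment> \<open>This is the relation (\<Q> - c) p_n = p_{n+1}, solved for \<Q> p_n so that it
    can be stated with the graph of \<Q> and transported by \<open>W\<close>.\<close>
  have pQ: "(p n, p (Suc n) + c *\<^sub>R p n) \<in> \<Q>" for n
    unfolding position_op_def mult_op_iff
    using p[of n] p[of "Suc n"] AE_rep_add[of "p (Suc n)" "c *\<^sub>R p n"] AE_rep_scaleR[of c "p n"]
    by eventually_elim (auto simp: g_def algebra_simps)
  have WQ: "AE x in lborel. rep_l2 (W (p n)) x = of_real ((x - c) ^ n) * rep_l2 (W \<phi>) x" for n
  proof (induction n)
    case 0
    show ?case by (simp add: p0)
  next
    case (Suc n)
    have "(W (p n), W (p (Suc n)) + c *\<^sub>R W (p n)) \<in> \<Q>"
      using Q[OF pQ[of n]] by (simp add: W.add W.scaleR)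
    then have "AE x in lborel. rep_l2 (W (p (Suc n)) + c *\<^sub>R W (p n)) x = of_real x * rep_l2 (W (p n)) x"
      unfolding position_op_def mult_op_iff .
    then show ?case
      using AE_rep_add[of "W (p (Suc n))" "c *\<^sub>R W (p n)"] AE_rep_scaleR[of c "W (p n)"] Suc
    proof eventually_elim
      case (elim x)
      then have "rep_l2 (W (p (Suc n))) x = of_real x * rep_l2 (W (p n)) x - of_real c * rep_l2 (W (p n)) x"
        by (simp add: algebra_simps)
      also have "\<dots> = of_real (x - c) * rep_l2 (W (p n)) x" by (simp add: algebra_simps)
      finally show ?case using elim by simp
    qed
  qed
  \<comment> \<open>On |x - c| >= s the n-th power is at least s^n, while the norm of W(p_n) is at
    most r^n times that of \<phi>. As s > r, letting n grow leaves only zero.\<close>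
  have vanish: "AE x in lborel. \<bar>x - c\<bar> \<ge> s \<longrightarrow> rep_l2 (W \<phi>) x = 0" if s: "s > r" for s
  proof -
    have A: "{x. \<bar>x - c\<bar> \<ge> s} \<in> sets borel" by measurable
    let ?z = "mul_l2 (indicator {x. \<bar>x - c\<bar> \<ge> s}) (W \<phi>)"
    have "norm ?z \<le> (r / s) ^ n * norm \<phi>" for n
    proof -
      have "norm ?z \<le> (1 / s ^ n) * norm (W (p n))"
      proof (rule norm_le_of_AE)
        show "AE x in lborel. cmod (rep_l2 ?z x) \<le> 1 / s ^ n * cmod (rep_l2 (W (p n)) x)"
          using AE_rep_mul[OF bdd_fun_indicator[OF A], of "W \<phi>"] WQ[of n]
        proof eventually_elim
          case (elim x)
          show ?case
          proof (cases "\<bar>x - c\<bar> \<ge> s")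
            case True
            then have "s ^ n \<le> \<bar>x - c\<bar> ^ n" using r s by (intro power_mono) auto
            then have "s ^ n * cmod (rep_l2 (W \<phi>) x) \<le> \<bar>x - c\<bar> ^ n * cmod (rep_l2 (W \<phi>) x)"
              by (rule mult_right_mono) simp
            then show ?thesis
              using elim True r s by (simp add: norm_mult norm_power field_simps power_abs flip: of_real_diff)
          qed (use elim r s in simp)
        qed
      qed (use r s in simp)
      also have "norm (W (p n)) = norm (p n)" by (rule isometry_norm[OF U])
      also have "norm (p n) \<le> r ^ n * norm \<phi>"
        by (rule norm_le_of_AE, use p[of n] in eventually_elim)
          (use r gb in \<open>auto simp: norm_mult intro!: mult_right_mono\<close>)
      finally show ?thesis using r s by (simp add: power_divide field_simps mult_left_mono)
    qed
    moreover have "(\<lambda>n. (r / s) ^ n * norm \<phi>) \<longlonglongrightarrow> 0 * norm \<phi>"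
      using r s by (intro tendsto_mult LIMSEQ_power_zero tendsto_const) auto
    ultimately have "norm ?z \<le> 0 * norm \<phi>"
      by (intro LIMSEQ_le_const) auto
    then have "?z = 0" by simp
    then show ?thesis
      using AE_rep_mul[OF bdd_fun_indicator[OF A], of "W \<phi>"] AE_rep_zero[where 'a=real]
      by (auto elim!: eventually_elim2 simp: indicator_def)
  qed
  have "AE x in lborel. \<forall>k::nat. \<bar>x - c\<bar> \<ge> r + 1 / Suc k \<longrightarrow> rep_l2 (W \<phi>) x = 0"
    using vanish by (subst AE_all_countable) auto
  then show ?thesis
    unfolding supported_in_def
  proof eventually_elim
    case (elim x)
    show ?case
    proof
      assume "x \<notin> {c - r..c + r}"
      then have "\<bar>x - c\<bar> - r > 0" by auto
      then obtain k where "1 / Suc k < \<bar>x - c\<bar> - r" using nat_approx_posE by blast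
      then show "rep_l2 (W \<phi>) x = 0" using elim[rule_format, of k] by simp
    qed
  qed
qed

text \<open>Both \<open>W\<close> and its inverse preserve the range of the projection onto
  [c - r, c + r]. The projection being self-adjoint and \<open>W\<close> unitary, \<open>W\<close>
  also preserves the orthogonal complement, and so commutes with the projection.\<close>

lemma commutes_position_indicator:
  assumes U: "unitary_map W" and Q: "\<And>\<xi> \<eta>. (\<xi>, \<eta>) \<in> \<Q> \<longleftrightarrow> (W \<xi>, W \<eta>) \<in> \<Q>" and r: "0 \<le> r"
  shows "W (mul_l2 (indicator {c - r..c + r}) \<phi>) = mul_l2 (indicator {c - r..c + r}) (W \<phi>)"
proof -
  let ?I = "indicator {c - r..c + r} :: real \<Rightarrow> complex"
  interpret W: bounded_linear W by (rule isometry_bounded_linear[OF unitary_isometry[OF U]])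
  have I: "bdd_fun ?I" by (rule bdd_fun_indicator) simp
  interpret m: bounded_linear "mul_l2 ?I" by (rule bounded_linear_mul[OF I])
  have II: "mul_l2 ?I (mul_l2 ?I \<phi>) = mul_l2 ?I \<phi>" for \<phi>
    by (simp add: mul_l2_mul_l2 I indicator_inter_arith[symmetric])
  have supp: "supported_in {c - r..c + r} \<psi> \<longleftrightarrow> mul_l2 ?I \<psi> = \<psi>" for \<psi>
  proof
    assume "supported_in {c - r..c + r} \<psi>"
    then show "mul_l2 ?I \<psi> = \<psi>"
      unfolding supported_in_def
      by (intro mul_l2_eqI[OF I]) (auto elim!: eventually_mono simp: indicator_def)
  next
    assume "mul_l2 ?I \<psi> = \<psi>"
    then show "supported_in {c - r..c + r} \<psi>"
      using AE_rep_mul[OF I, of \<psi>] unfolding supported_in_def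
      by (auto elim!: eventually_mono)
  qed
  have W1: "mul_l2 ?I (W (mul_l2 ?I \<phi>)) = W (mul_l2 ?I \<phi>)" for \<phi>
    using commutes_position_supported[OF unitary_isometry[OF U] _ _ r, of c] Q II by (simp add: supp)
  have Q': "(inv W \<xi>, inv W \<eta>) \<in> \<Q>" if "(\<xi>, \<eta>) \<in> \<Q>" for \<xi> \<eta>
    using that Q[of "inv W \<xi>" "inv W \<eta>"] U by simp
  have W2: "mul_l2 ?I (inv W (mul_l2 ?I \<phi>)) = inv W (mul_l2 ?I \<phi>)" for \<phi>
    using commutes_position_supported[OF unitary_isometry[OF unitary_inv[OF U]] Q' _ r, of c] II
    by (simp add: supp)
  define d where "d = \<phi> - mul_l2 ?I \<phi>"
  define \<zeta> where "\<zeta> = mul_l2 ?I (W d)"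
  have Id: "mul_l2 ?I d = 0" by (simp add: d_def m.diff II)
  have Icnj: "(\<lambda>x. cnj (?I x)) = ?I" by (auto simp: indicator_def fun_eq_iff)
  have "cinner \<zeta> \<zeta> = cinner (W d) \<zeta>"
    unfolding \<zeta>_def by (simp add: cinner_mul_left I Icnj II)
  also have "\<dots> = cinner d (inv W \<zeta>)"
    using unitary_cinner[OF U, of d "inv W \<zeta>"] U by simp
  also have "inv W \<zeta> = mul_l2 ?I (inv W \<zeta>)"
    using W2[of "W d"] by (simp add: \<zeta>_def)
  also have "cinner d (mul_l2 ?I (inv W \<zeta>)) = cinner (mul_l2 ?I d) (inv W \<zeta>)"
    by (simp add: cinner_mul_left I Icnj)
  finally have "\<zeta> = 0" by (simp add: Id cinner_self)
  moreover have "W \<phi> = W (mul_l2 ?I \<phi>) + W d"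
    by (simp add: d_def W.diff)
  ultimately show ?thesis
    by (simp add: m.add W1 \<zeta>_def)
qed

lemma box_real_eq: "box a b = {a<..<b::real}"
  by (auto simp: mem_box)

text \<open>The multiplier is read off from the images of the indicators of [-n, n]; these images
  are restrictions of one another because \<open>W\<close> commutes with restriction to intervals.
  The formula then holds for box indicators and passes to limits along almost everywhere convergent
  subsequences.\<close>

lemma commutes_position_mult:
  assumes U: "unitary_map W" and Q: "\<And>\<xi> \<eta>. (\<xi>, \<eta>) \<in> \<Q> \<longleftrightarrow> (W \<xi>, W \<eta>) \<in> \<Q>"
  obtains \<omega> where "\<And>\<phi>. AE x in lborel. rep_l2 (W \<phi>) x = \<omega> x * rep_l2 \<phi> x"
proof -
  interpret W: bounded_linear W by (rule isometry_bounded_linear[OF unitary_isometry[OF U]])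
  define e where "e n = ind_l2 {- real n..real n} 1" for n
  have e: "AE x in lborel. rep_l2 (e n) x = indicator {- real n..real n} x" for n
    unfolding e_def using AE_rep_ind[of "{- real n..real n}" 1] by simp
  have I: "bdd_fun (indicator {a..b::real})" for a b by (rule bdd_fun_indicator) simp
  have Wab: "W (mul_l2 (indicator {a..b}) \<phi>) = mul_l2 (indicator {a..b}) (W \<phi>)" if "a \<le> b" for a b \<phi>
    using commutes_position_indicator[OF U Q, of "(b - a) / 2" "(a + b) / 2" \<phi>] that
    by (simp add: field_simps)
  have cons: "AE x in lborel. \<bar>x\<bar> \<le> real m \<longrightarrow> rep_l2 (W (e n)) x = rep_l2 (W (e m)) x" if "m \<le> n" for m n
  proof -
    have "mul_l2 (indicator {- real m..real m}) (e n) = e m"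
      by (rule mul_l2_eqI[OF I], use e[of n] e[of m] in eventually_elim)
        (use that in \<open>auto simp: indicator_def\<close>)
    then have "W (e m) = mul_l2 (indicator {- real m..real m}) (W (e n))"
      using Wab[of "- real m" "real m" "e n"] by simp
    then show ?thesis
      using AE_rep_mul[OF I, of "- real m" "real m" "W (e n)"]
      by (auto elim!: eventually_mono simp: indicator_def abs_le_iff)
  qed
  \<comment> \<open>At x the least n with |x| <= n is used; every larger n gives the same value
    almost everywhere.\<close>
  define \<omega> where "\<omega> x = rep_l2 (W (e (nat \<lceil>\<bar>x\<bar>\<rceil>))) x" for x
  have \<omega>: "AE x in lborel. \<bar>x\<bar> \<le> real n \<longrightarrow> rep_l2 (W (e n)) x = \<omega> x" for n
  proof -
    have "AE x in lborel. \<forall>m\<in>{..n}. \<bar>x\<bar> \<le> real m \<longrightarrow> rep_l2 (W (e n)) x = rep_l2 (W (e m)) x"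
      using cons by (intro AE_finite_allI) auto
    then show ?thesis
    proof eventually_elim
      case (elim x)
      show ?case
      proof
        assume "\<bar>x\<bar> \<le> real n"
        then have "nat \<lceil>\<bar>x\<bar>\<rceil> \<le> n" by linarith
        moreover have "\<bar>x\<bar> \<le> real (nat \<lceil>\<bar>x\<bar>\<rceil>)" by linarith
        ultimately show "rep_l2 (W (e n)) x = \<omega> x"
          unfolding \<omega>_def using elim by auto
      qed
    qed
  qed
  define G where "G = {\<phi>. AE x in lborel. rep_l2 (W \<phi>) x = \<omega> x * rep_l2 \<phi> x}"
  have gen: "ind_l2 (box a b) c \<in> G" for a b c
  proof (cases "a < b")
    case True
    obtain n :: nat where n: "\<bar>a\<bar> + \<bar>b\<bar> \<le> real n" using real_arch_simple by blast
    let ?i = "ind_l2 (box a b) c"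
    have i: "AE x in lborel. rep_l2 ?i x = c * indicator (box a b) x"
      by (rule AE_rep_ind[OF _ emeasure_lborel_box_finite]) simp
    have ab: "AE x in lborel. x \<noteq> a \<and> x \<noteq> b"
      using AE_lborel_singleton[of a] AE_lborel_singleton[of b] by eventually_elim simp
    have "?i = mul_l2 (\<lambda>_. c) (mul_l2 (indicator {a..b}) (e n))"
      by (rule mul_l2_eqI[OF bdd_fun_const, symmetric],
          use i ab e[of n] AE_rep_mul[OF I[of a b], of "e n"] in eventually_elim)
        (use n in \<open>auto simp: indicator_def box_real_eq\<close>)
    then have "W ?i = mul_l2 (\<lambda>_. c) (mul_l2 (indicator {a..b}) (W (e n)))"
      using True by (simp add: isometry_const[OF unitary_isometry[OF U]] Wab)
    then have "AE x in lborel. rep_l2 (W ?i) x = c * (indicator {a..b} x * rep_l2 (W (e n)) x)"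
      using AE_rep_mul[OF bdd_fun_const, of c "mul_l2 (indicator {a..b}) (W (e n))"]
        AE_rep_mul[OF I[of a b], of "W (e n)"] by (auto elim!: eventually_elim2)
    then show ?thesis
      unfolding G_def mem_Collect_eq using \<omega>[of n] i ab
      by eventually_elim (use n in \<open>auto simp: indicator_def box_real_eq\<close>)
  next
    case False
    then have "ind_l2 (box a b) c = 0"
      unfolding ind_l2_def
      by (intro abs_l2_eqI) (use AE_rep_zero[where 'a=real] in \<open>auto simp: square_integrable_zero box_real_eq\<close>)
    then show ?thesis
      using AE_rep_zero[where 'a=real] by (auto simp: G_def W.zero)
  qed
  have subG: "subspace G"
  proof (rule subspaceI)
    show "0 \<in> G" using AE_rep_zero[where 'a=real] by (auto simp: G_def W.zero)
    fix \<phi> \<psi> and t :: real assume *: "\<phi> \<in> G" "\<psi> \<in> G"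
    show "\<phi> + \<psi> \<in> G"
      using * AE_rep_add[of \<phi> \<psi>] AE_rep_add[of "W \<phi>" "W \<psi>"] unfolding G_def mem_Collect_eq W.add
      by eventually_elim (simp add: distrib_left)
    show "t *\<^sub>R \<phi> \<in> G"
      using *(1) AE_rep_scaleR[of t \<phi>] AE_rep_scaleR[of t "W \<phi>"] unfolding G_def mem_Collect_eq W.scaleR
      by eventually_elim simp
  qed
  have clG: "\<phi> \<in> G" if X: "\<And>n. X n \<in> G" "X \<longlonglongrightarrow> \<phi>" for X \<phi>
  proof -
    obtain r where r: "strict_mono r" "AE x in lborel. (\<lambda>n. rep_l2 (X (r n)) x) \<longlonglongrightarrow> rep_l2 \<phi> x"
      using l2_tendsto_AE_subseq[OF X(2)] .
    have "(\<lambda>n. W (X (r n))) \<longlonglongrightarrow> W \<phi>"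
      using W.tendsto[OF LIMSEQ_subseq_LIMSEQ[OF X(2) r(1)]] by (simp add: o_def)
    from l2_tendsto_AE_subseq[OF this] obtain s where s: "strict_mono s" "AE x in lborel. (\<lambda>n. rep_l2 (W (X (r (s n)))) x) \<longlonglongrightarrow> rep_l2 (W \<phi>) x"
      by blast
    have "AE x in lborel. \<forall>n. rep_l2 (W (X n)) x = \<omega> x * rep_l2 (X n) x"
      using X(1) unfolding G_def by (subst AE_all_countable) auto
    then show ?thesis
      unfolding G_def mem_Collect_eq using r(2) s(2)
    proof eventually_elim
      case (elim x)
      have "(\<lambda>n. rep_l2 (X (r (s n))) x) \<longlonglongrightarrow> rep_l2 \<phi> x"
        using LIMSEQ_subseq_LIMSEQ[OF elim(2) s(1)] by (simp add: o_def)
      then have "(\<lambda>n. rep_l2 (W (X (r (s n)))) x) \<longlonglongrightarrow> \<omega> x * rep_l2 \<phi> x"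
        unfolding elim(1)[rule_format] by (intro tendsto_intros)
      with elim(3) show ?case using LIMSEQ_unique by blast
    qed
  qed
  have "closed G" unfolding closed_sequential_limits using clG by blast
  then have "closure (span {ind_l2 (box a b :: real set) c |a b c. True}) \<subseteq> G"
    using gen subG by (intro closed_closure_span_subset) auto
  then have "G = UNIV" unfolding ind_box_dense by blast
  then show ?thesis using that unfolding G_def by blast
qed

text \<open>If U and V both diagonalise T, then U composed with the inverse of V commutes with \<Q>,
  so it is a multiplication and preserves the graph of every multiplication operator, bounded or
  not. One convenient U therefore computes all of the functional calculus.\<close>

lemma fun_calc_eq:
  assumes U: "unitary_map U" and T: "T = {(\<xi>, \<eta>). (U \<xi>, U \<eta>) \<in> \<Q>}"
  shows "fun_calc m T = {(\<phi>, \<psi>). (U \<phi>, U \<psi>) \<in> mult_op m}"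
proof (intro set_eqI iffI; clarify)
  fix \<phi> \<psi> assume "(\<phi>, \<psi>) \<in> fun_calc m T"
  then obtain V where V: "unitary_map V" and TV: "T = {(\<xi>, \<eta>). (V \<xi>, V \<eta>) \<in> \<Q>}"
    and m: "(V \<phi>, V \<psi>) \<in> mult_op m" by (auto simp: fun_calc_def)
  have "(\<xi>, \<eta>) \<in> \<Q> \<longleftrightarrow> ((U \<circ> inv V) \<xi>, (U \<circ> inv V) \<eta>) \<in> \<Q>" for \<xi> \<eta>
  proof -
    have "(inv V \<xi>, inv V \<eta>) \<in> T \<longleftrightarrow> (U (inv V \<xi>), U (inv V \<eta>)) \<in> \<Q>" unfolding T by simp
    moreover have "(inv V \<xi>, inv V \<eta>) \<in> T \<longleftrightarrow> (\<xi>, \<eta>) \<in> \<Q>" unfolding TV using V by simp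
    ultimately show ?thesis by simp
  qed
  from commutes_position_mult[OF unitary_comp[OF U unitary_inv[OF V]] this]
  obtain \<omega> where \<omega>: "\<And>\<phi>. AE x in lborel. rep_l2 ((U \<circ> inv V) \<phi>) x = \<omega> x * rep_l2 \<phi> x" by blast
  show "(U \<phi>, U \<psi>) \<in> mult_op m"
    using m \<omega>[of "V \<phi>"] \<omega>[of "V \<psi>"] V unfolding mult_op_iff
    by (auto elim!: eventually_elim2)
next
  fix \<phi> \<psi> assume "(U \<phi>, U \<psi>) \<in> mult_op m"
  then show "(\<phi>, \<psi>) \<in> fun_calc m T" unfolding fun_calc_def using U T by blast
qed

lemma fun_calc_position: "fun_calc m \<Q> = mult_op m"
proof -
  have "unitary_map (\<lambda>\<phi>. \<phi>)" by (auto simp: unitary_map_def)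
  from fun_calc_eq[OF this, of \<Q> m] show ?thesis by simp
qed

subsection \<open>The Fourier transform\<close>

lemma borel_measurable_cis [measurable]: "cis \<in> borel_measurable borel"
  by (intro borel_measurable_continuous_onI continuous_intros)

lemma AE_lborel_affine:
  assumes "AE x in lborel. P x" "c \<noteq> 0"
  shows "AE x in lborel. P (t + c * x :: real)"
proof -
  obtain N where N: "N \<in> sets lborel" "emeasure lborel N = 0" "{x \<in> space lborel. \<not> P x} \<subseteq> N"
    using AE_E[OF assms(1)] by blast
  then have "AE x in lborel. x \<notin> N" by (intro AE_not_in) auto
  with N(1) have "AE x in lborel. t + c * x \<notin> N"
    by (intro AE_borel_affine[OF assms(2), of "\<lambda>x. x \<notin> N"]) auto
  then show ?thesis by eventually_elim (use N(3) in auto)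
qed

lemma AE_lborel_uminus: "AE x in lborel. P x \<Longrightarrow> AE x in lborel. P (- x :: real)"
  using AE_lborel_affine[of P "- 1" 0] by simp

lemma square_integrable_affine:
  assumes "square_integrable f" "c \<noteq> 0"
  shows "square_integrable (\<lambda>x. f (t + c * x :: real))"
  using assms lborel_integrable_real_affine[of "\<lambda>x. (cmod (f x))\<^sup>2" c t]
  by (auto simp: square_integrable_def)

lemma integral_uminus:
  fixes f :: "real \<Rightarrow> 'a::{banach, second_countable_topology}"
  shows "(\<integral>x. f (- x) \<partial>lborel) = (\<integral>x. f x \<partial>lborel)"
  using lborel_integral_real_affine[of "- 1" f 0] by simp

definition refl_l2 :: "real l2 \<Rightarrow> real l2" where
  "refl_l2 \<phi> = abs_l2 (\<lambda>x. rep_l2 \<phi> (- x))"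

lemma AE_rep_refl: "AE x in lborel. rep_l2 (refl_l2 \<phi>) x = rep_l2 \<phi> (- x)"
  unfolding refl_l2_def
  using square_integrable_affine[of "rep_l2 \<phi>" "- 1" 0] by (intro AE_rep_abs) simp

lemma refl_l2_eqI:
  assumes "AE x in lborel. rep_l2 \<psi> x = rep_l2 \<phi> (- x)"
  shows "refl_l2 \<phi> = \<psi>"
  by (rule l2_eqI, use AE_rep_refl[of \<phi>] assms in eventually_elim) simp

lemma refl_refl [simp]: "refl_l2 (refl_l2 \<phi>) = \<phi>"
  by (rule refl_l2_eqI, use AE_lborel_uminus[OF AE_rep_refl[of \<phi>]] in eventually_elim) simp

lemma isometry_refl: "isometry_map refl_l2"
  unfolding isometry_map_def
proof (intro allI)
  fix \<phi> \<psi>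
  have "cinner (refl_l2 \<phi>) (refl_l2 \<psi>) = (\<integral>x. cnj (rep_l2 \<phi> (- x)) * rep_l2 \<psi> (- x) \<partial>lborel)"
    by (rule cinner_AE[OF AE_rep_refl AE_rep_refl]) measurable
  also have "\<dots> = cinner \<phi> \<psi>"
    unfolding cinner_rep by (rule integral_uminus[of "\<lambda>x. cnj (rep_l2 \<phi> x) * rep_l2 \<psi> x"])
  finally show "cinner (refl_l2 \<phi>) (refl_l2 \<psi>) = cinner \<phi> \<psi>" .
qed

lemma unitary_refl: "unitary_map refl_l2"
  using isometry_refl unfolding unitary_map_def isometry_map_def by (metis refl_refl surjI)

text \<open>Translation by the fixed step 1, used to read off the Fourier transform of a derivative
  from unit increments.\<close>

definition trans_l2 :: "real l2 \<Rightarrow> real l2" where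
  "trans_l2 \<phi> = abs_l2 (\<lambda>x. rep_l2 \<phi> (1 + x))"

lemma AE_rep_trans: "AE x in lborel. rep_l2 (trans_l2 \<phi>) x = rep_l2 \<phi> (1 + x)"
  unfolding trans_l2_def
  using square_integrable_affine[of "rep_l2 \<phi>" 1 1] by (intro AE_rep_abs) simp

lemma isometry_trans: "isometry_map trans_l2"
  unfolding isometry_map_def
proof (intro allI)
  fix \<phi> \<psi>
  have "cinner (trans_l2 \<phi>) (trans_l2 \<psi>) = (\<integral>x. cnj (rep_l2 \<phi> (1 + x)) * rep_l2 \<psi> (1 + x) \<partial>lborel)"
    by (rule cinner_AE[OF AE_rep_trans AE_rep_trans]) measurable
  also have "\<dots> = cinner \<phi> \<psi>"
    unfolding cinner_rep
    using lborel_integral_real_affine[of 1 "\<lambda>x. cnj (rep_l2 \<phi> x) * rep_l2 \<psi> x" 1] by simp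
  finally show "cinner (trans_l2 \<phi>) (trans_l2 \<psi>) = cinner \<phi> \<psi>" .
qed

text \<open>The kernel e^(-2 pi i p x) is normalised so that \<P> becomes multiplication by p and
  the transform is isometric, both without extra constants.\<close>

definition fint :: "(real \<Rightarrow> complex) \<Rightarrow> real \<Rightarrow> complex" where
  "fint f p = (\<integral>x. cis (- (2 * pi * p * x)) * f x \<partial>lborel)"

lemma integrable_cis_mult:
  assumes "integrable lborel f" and [measurable]: "g \<in> borel_measurable borel"
  shows "integrable lborel (\<lambda>x. cis (g x) * f x)"
  by (rule Bochner_Integration.integrable_bound[OF assms(1)])
    (use assms(1) in \<open>auto simp: norm_mult dest: borel_measurable_integrable\<close>)

lemma fint_measurable [measurable]:
  assumes [measurable]: "f \<in> borel_measurable borel"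
  shows "fint f \<in> borel_measurable borel"
  unfolding fint_def by measurable

lemma fint_bound:
  assumes "integrable lborel f"
  shows "cmod (fint f p) \<le> (\<integral>x. cmod (f x) \<partial>lborel)"
proof -
  have "cmod (fint f p) \<le> (\<integral>x. cmod (cis (- (2 * pi * p * x)) * f x) \<partial>lborel)"
    unfolding fint_def by (rule integral_norm_bound)
  then show ?thesis by (simp add: norm_mult)
qed

lemma bdd_fun_fint: "integrable lborel f \<Longrightarrow> bdd_fun (fint f)"
  using fint_bound[of f] borel_measurable_integrable[of lborel f] by (intro bdd_funI) auto

lemma fint_multiplication:
  assumes f: "integrable lborel f" and g: "integrable lborel g"
  shows "(\<integral>p. fint f p * g p \<partial>lborel) = (\<integral>x. f x * fint g x \<partial>lborel)"
proof -
  have [measurable]: "f \<in> borel_measurable borel" "g \<in> borel_measurable borel"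
    using f g by (auto dest: borel_measurable_integrable)
  let ?F = "\<lambda>x p. cis (- (2 * pi * p * x)) * f x * g p"
  have "integrable (lborel \<Otimes>\<^sub>M lborel) (case_prod ?F)"
  proof (rule lborel_pair.Fubini_integrable)
    show "case_prod ?F \<in> borel_measurable (lborel \<Otimes>\<^sub>M lborel)" by measurable
    have "(\<lambda>x. \<integral>p. norm (case_prod ?F (x, p)) \<partial>lborel) = (\<lambda>x. cmod (f x) * (\<integral>p. cmod (g p) \<partial>lborel))"
      by (auto simp: norm_mult)
    then show "integrable lborel (\<lambda>x. \<integral>p. norm (case_prod ?F (x, p)) \<partial>lborel)"
      using f by simp
    show "AE x in lborel. integrable lborel (\<lambda>p. case_prod ?F (x, p))"
    proof (rule AE_I2)
      fix x
      have "integrable lborel (\<lambda>p. f x * (cis (- (2 * pi * p * x)) * g p))"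
        by (intro integrable_mult_right integrable_cis_mult g) measurable
      then show "integrable lborel (\<lambda>p. case_prod ?F (x, p))" by (simp add: mult_ac)
    qed
  qed
  from lborel_pair.Fubini_integral[OF this]
  have "(\<integral>p. (\<integral>x. ?F x p \<partial>lborel) \<partial>lborel) = (\<integral>x. (\<integral>p. ?F x p \<partial>lborel) \<partial>lborel)" .
  moreover have "(\<integral>x. ?F x p \<partial>lborel) = fint f p * g p" for p
    unfolding fint_def by (rule integral_mult_left_zero)
  moreover have "(\<integral>p. ?F x p \<partial>lborel) = f x * fint g x" for x
    unfolding fint_def by (subst integral_mult_right_zero[symmetric]) (simp add: mult_ac)
  ultimately show ?thesis by (simp only:)
qed

section \<open>Signed interval indicators and their Fourier integrals\<close>

definition sgi :: "real \<Rightarrow> real \<Rightarrow> complex" where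
  "sgi t x = indicator {0..t} x - indicator {t..0} x"

lemma sgi_measurable [measurable]: "sgi t \<in> borel_measurable borel"
  unfolding sgi_def by measurable

lemma cnj_sgi [simp]: "cnj (sgi t x) = sgi t x"
  by (auto simp: sgi_def indicator_def)

lemma sgi_uminus: "sgi t (- x) = - sgi (- t) x"
  by (auto simp: sgi_def indicator_def)

lemma integrable_indicator_Icc: "integrable lborel (indicator {a..b} :: real \<Rightarrow> complex)"
proof -
  have "integrable lborel (\<lambda>x. complex_of_real (indicator {a..b} x))"
    by (intro integrable_of_real integrable_real_indicator) (auto simp: emeasure_lborel_Icc_eq)
  moreover have "(\<lambda>x. complex_of_real (indicator {a..b} x)) = indicator {a..b}"
    by (auto simp: indicator_def)
  ultimately show ?thesis by simp
qed

lemma integrable_sgi: "integrable lborel (sgi t)"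
  unfolding sgi_def by (intro Bochner_Integration.integrable_diff integrable_indicator_Icc)

lemma sgi_le_1: "cmod (sgi t x) \<le> 1"
  by (auto simp: sgi_def indicator_def)

lemma square_integrable_bdd_integrable:
  assumes "integrable lborel f" "\<And>x. cmod (f x) \<le> B"
  shows "square_integrable f"
proof (rule square_integrable_bound)
  show "f \<in> borel_measurable borel" using assms(1) by (auto dest: borel_measurable_integrable)
  show "integrable lborel (\<lambda>x. B * cmod (f x))"
    using assms(1) by simp
  show "AE x in lborel. (cmod (f x))\<^sup>2 \<le> B * cmod (f x)"
    unfolding power2_eq_square by (intro AE_I2 mult_right_mono assms) auto
qed

lemma square_integrable_sgi: "square_integrable (sgi t)"
  by (rule square_integrable_bdd_integrable[OF integrable_sgi sgi_le_1])

text \<open>The vectors \<open>sgl t\<close> form a one-parameter family whose squared distances are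
  |t - r|, whose differences are interval indicators, and whose complex multiples span a dense
  subspace. The Fourier transform is defined by prescribing it on them.\<close>

definition sgl :: "real \<Rightarrow> real l2" where "sgl t = abs_l2 (sgi t)"

lemma AE_rep_sgl: "AE x in lborel. rep_l2 (sgl t) x = sgi t x"
  unfolding sgl_def by (rule AE_rep_abs[OF square_integrable_sgi])

lemma integral_cis_Icc:
  assumes "a \<le> b" "p \<noteq> 0"
  shows "(\<integral>x. indicator {a..b} x *\<^sub>R cis (- (2 * pi * p * x)) \<partial>lborel) =
    (cis (- (2 * pi * p * a)) - cis (- (2 * pi * p * b))) / (2 * pi * \<i> * p)"
proof -
  let ?F = "\<lambda>x. \<i> / (2 * pi * p) * cis (- (2 * pi * p * x))"
  have "(\<integral>x. indicator {a..b} x *\<^sub>R cis (- (2 * pi * p * x)) \<partial>lborel) = ?F b - ?F a"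
  proof (rule integral_FTC_Icc[OF assms(1)])
    fix x
    have "(?F has_vector_derivative \<i> / (2 * pi * p) * (- (2 * pi * p) *\<^sub>R (\<i> * cis (- (2 * pi * p * x))))) (at x within {a..b})"
      unfolding has_vector_derivative_def
      by (auto intro!: derivative_eq_intros simp: algebra_simps scaleR_conv_of_real)
    also have "\<i> / (2 * pi * p) * (- (2 * pi * p) *\<^sub>R (\<i> * cis (- (2 * pi * p * x)))) = cis (- (2 * pi * p * x))"
      using assms(2) by (simp add: scaleR_conv_of_real field_simps)
    finally show "(?F has_vector_derivative cis (- (2 * pi * p * x))) (at x within {a..b})" .
  qed (intro continuous_intros)
  also have "\<dots> = (cis (- (2 * pi * p * a)) - cis (- (2 * pi * p * b))) / (2 * pi * \<i> * p)"
    using assms(2) by (simp add: field_simps)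
  finally show ?thesis .
qed

lemma fint_sgi:
  assumes "p \<noteq> 0"
  shows "fint (sgi t) p = (1 - cis (- (2 * pi * p * t))) / (2 * pi * \<i> * p)"
proof -
  have ind: "fint (indicator {a..b}) p = (cis (- (2 * pi * p * a)) - cis (- (2 * pi * p * b))) / (2 * pi * \<i> * p)"
    if "a \<le> b" for a b
    unfolding fint_def integral_cis_Icc[OF that assms, symmetric]
    by (rule Bochner_Integration.integral_cong) (auto simp: indicator_def)
  have "fint (sgi t) p = fint (indicator {0..t}) p - fint (indicator {t..0}) p"
    unfolding fint_def sgi_def right_diff_distrib
    by (rule Bochner_Integration.integral_diff) (intro integrable_cis_mult integrable_indicator_Icc; measurable)+
  moreover have "fint (indicator {}) p = 0"
    by (simp add: fint_def)
  ultimately show ?thesis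
    using ind[of 0 t] ind[of t 0] assms
    by (cases "t < 0"; cases "t = 0") (auto simp: field_simps)
qed

text \<open>The interval between r and t is a translate of the one between 0 and t - r, and
  translation becomes a unimodular factor. Hence distances of transforms depend on t - r
  alone.\<close>

lemma fint_sgi_diff:
  assumes "p \<noteq> 0"
  shows "fint (sgi t) p - fint (sgi r) p = cis (- (2 * pi * p * r)) * fint (sgi (t - r)) p"
proof -
  have "cis (- (2 * pi * p * t)) = cis (- (2 * pi * p * r)) * cis (- (2 * pi * p * (t - r)))"
    by (simp add: cis_mult algebra_simps)
  then show ?thesis
    by (simp add: fint_sgi[OF assms] diff_divide_distrib[symmetric] right_diff_distrib)
qed

lemma fint_sgi_cnj: "cnj (fint (sgi t) p) = fint (sgi t) (- p)"
proof -
  have "integrable lborel (\<lambda>x. cis (- (2 * pi * p * x)) * sgi t x)"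
    by (intro integrable_cis_mult integrable_sgi) measurable
  from integral_bounded_linear[OF bounded_linear_cnj this]
  show ?thesis by (simp add: fint_def cis_cnj)
qed

text \<open>Integration by parts gives the antiderivative Si(2x) - x sinc(x)^2: the derivative of
  sin(x)^2 / x is sin(2x) / x - sinc(x)^2, and that of Si(2x) is sin(2x) / x. At infinity the value
  is pi / 2; evenness doubles it.\<close>

lemma integral_sinc_sq:
  "integrable lborel (\<lambda>x. (sinc x)\<^sup>2)" "(\<integral>x. (sinc x)\<^sup>2 \<partial>lborel) = pi"
proof -
  let ?F = "\<lambda>x. Si (2 * x) - x * (sinc x)\<^sup>2"
  have m [measurable]: "(\<lambda>x. (sinc x)\<^sup>2) \<in> borel_measurable borel" by measurable
  have half: "(\<integral>\<^sup>+x. ennreal ((sinc x)\<^sup>2) * indicator {0..} x \<partial>lborel) = ennreal (pi / 2 - ?F 0)"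
  proof (rule nn_integral_FTC_atLeast[where F = ?F and T = "pi / 2" and a = 0, OF m])
    fix x :: real assume "0 \<le> x"
    have Si: "((\<lambda>x. Si (2 * x)) has_real_derivative 2 * sinc (2 * x)) (at x)"
    proof -
      have "((\<lambda>x. 2 * x) has_real_derivative 2) (at x)" by (auto intro!: derivative_eq_intros)
      from DERIV_chain2[OF DERIV_Si this] show ?thesis by (simp only: mult.commute)
    qed
    show "(?F has_real_derivative (sinc x)\<^sup>2) (at x)"
    proof (cases "x = 0")
      case True
      have "((\<lambda>x. x * (sinc x)\<^sup>2) has_real_derivative 1) (at 0)"
        unfolding has_field_derivative_iff
      proof (rule Lim_transform_eventually)
        have "isCont (\<lambda>x. (sinc x)\<^sup>2) 0" by (intro continuous_intros isCont_sinc)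
        then show "((\<lambda>x. (sinc x)\<^sup>2) \<longlongrightarrow> 1) (at 0)" by (simp add: isCont_def)
        show "\<forall>\<^sub>F x in at 0. (sinc x)\<^sup>2 = (x * (sinc x)\<^sup>2 - 0 * (sinc 0)\<^sup>2) / (x - 0)"
          using eventually_at_ball'[of 1 0 UNIV] by (auto elim!: eventually_mono)
      qed
      from DERIV_diff[OF Si[unfolded True] this] show ?thesis
        using True by simp
    next
      case False
      have "((\<lambda>x. (sin x)\<^sup>2 / x) has_real_derivative 2 * sin x * cos x / x - (sinc x)\<^sup>2) (at x)"
        using False by (auto intro!: derivative_eq_intros simp: power2_eq_square field_simps)
      moreover have "\<forall>\<^sub>F y in nhds x. y * (sinc y)\<^sup>2 = (sin y)\<^sup>2 / y"
        using t1_space_nhds[OF False] by (auto elim!: eventually_mono simp: power2_eq_square)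
      ultimately have "((\<lambda>x. x * (sinc x)\<^sup>2) has_real_derivative 2 * sin x * cos x / x - (sinc x)\<^sup>2) (at x)"
        by (subst DERIV_cong_ev[OF refl _ refl]) 
      from DERIV_diff[OF Si this] show ?thesis using False by (simp add: sin_double)
    qed
  next
    have 1: "((\<lambda>x. Si (2 * x)) \<longlongrightarrow> pi / 2) at_top"
      by (rule filterlim_compose[OF Si_at_top])
        (auto intro!: filterlim_tendsto_pos_mult_at_top[OF tendsto_const] filterlim_ident)
    have "((\<lambda>x. x * (sinc x)\<^sup>2) \<longlongrightarrow> 0) at_top"
    proof (rule Lim_null_comparison)
      show "\<forall>\<^sub>F x in at_top. norm (x * (sinc x)\<^sup>2) \<le> inverse x"
        using eventually_gt_at_top[of 0]
      proof eventually_elim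
        case (elim x)
        have "(sin x)\<^sup>2 \<le> 1" by (simp add: abs_square_le_1)
        then show ?case using elim by (simp add: power2_eq_square abs_mult field_simps)
      qed
      show "((\<lambda>x. inverse x) \<longlongrightarrow> (0::real)) at_top" by (rule tendsto_inverse_0_at_top[OF filterlim_ident])
    qed
    from tendsto_diff[OF 1 this] show "(?F \<longlongrightarrow> pi / 2) at_top" by simp
  qed simp
  have "Si 0 = 0" by (simp add: Si_def flip: zero_ereal_def)
  with half have half: "(\<integral>\<^sup>+x. ennreal ((sinc x)\<^sup>2) * indicator {0..} x \<partial>lborel) = ennreal (pi / 2)" by simp
  have "(\<integral>\<^sup>+x. ennreal ((sinc x)\<^sup>2) * indicator {..0} x \<partial>lborel) =
      (\<integral>\<^sup>+x. ennreal ((sinc x)\<^sup>2) * indicator {0..} x \<partial>lborel)"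
    by (subst nn_integral_real_affine[of _ "- 1" 0]) (auto intro!: nn_integral_cong simp: indicator_def)
  moreover have "(\<integral>\<^sup>+x. ennreal ((sinc x)\<^sup>2) \<partial>lborel) =
      (\<integral>\<^sup>+x. ennreal ((sinc x)\<^sup>2) * indicator {0..} x + ennreal ((sinc x)\<^sup>2) * indicator {..0} x \<partial>lborel)"
    by (rule nn_integral_cong_AE, use AE_lborel_singleton[of "0::real"] in eventually_elim)
      (auto simp: indicator_def)
  moreover have "\<dots> = (\<integral>\<^sup>+x. ennreal ((sinc x)\<^sup>2) * indicator {0..} x \<partial>lborel) +
      (\<integral>\<^sup>+x. ennreal ((sinc x)\<^sup>2) * indicator {..0} x \<partial>lborel)"
    by (rule nn_integral_add) measurable
  ultimately have nn: "(\<integral>\<^sup>+x. ennreal ((sinc x)\<^sup>2) \<partial>lborel) = ennreal pi"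
    by (simp add: half ennreal_plus[symmetric] del: ennreal_plus)
  show "integrable lborel (\<lambda>x. (sinc x)\<^sup>2)"
    by (rule integrableI_nonneg) (use nn in auto)
  show "(\<integral>x. (sinc x)\<^sup>2 \<partial>lborel) = pi"
    by (subst integral_eq_nn_integral) (use nn in auto)
qed

lemma cmod_fint_sgi_sq:
  assumes "p \<noteq> 0"
  shows "(cmod (fint (sgi t) p))\<^sup>2 = t\<^sup>2 * (sinc (pi * t * p))\<^sup>2"
proof -
  have "(cmod (1 - cis \<theta>))\<^sup>2 = 4 * (sin (\<theta> / 2))\<^sup>2" for \<theta>
  proof -
    have "(cmod (1 - cis \<theta>))\<^sup>2 = 2 - 2 * cos \<theta>"
      unfolding cmod_power2 using sin_cos_squared_add[of \<theta>] by (simp add: power2_eq_square algebra_simps)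
    also have "cos \<theta> = 1 - 2 * (sin (\<theta> / 2))\<^sup>2"
      using cos_double_sin[of "\<theta> / 2"] by simp
    finally show ?thesis by simp
  qed
  from this[of "- (2 * pi * p * t)"]
  have "(cmod (fint (sgi t) p))\<^sup>2 = (sin (pi * t * p))\<^sup>2 / (pi * p)\<^sup>2"
    using assms by (simp add: fint_sgi norm_divide norm_mult power_divide power_mult_distrib mult_ac)
  then show ?thesis
    using assms by (cases "t = 0") (auto simp: power_divide power_mult_distrib)
qed

text \<open>Plancherel for a single interval, obtained by substitution from the integral of sinc^2.
  It is the only norm of a transform that is computed by hand.\<close>

lemma square_integrable_fint_sgi: "square_integrable (fint (sgi t))"
  and integral_fint_sgi_sq: "(\<integral>p. (cmod (fint (sgi t) p))\<^sup>2 \<partial>lborel) = \<bar>t\<bar>"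
proof -
  have AE: "AE p in lborel. (cmod (fint (sgi t) p))\<^sup>2 = t\<^sup>2 * (sinc (pi * t * p))\<^sup>2"
    using AE_lborel_singleton[of "0::real"] by eventually_elim (rule cmod_fint_sgi_sq)
  have i: "integrable lborel (\<lambda>p. t\<^sup>2 * (sinc (pi * t * p))\<^sup>2)"
  proof (cases "t = 0")
    case False
    have "integrable lborel (\<lambda>p. (sinc (0 + pi * t * p))\<^sup>2)"
      by (rule lborel_integrable_real_affine[OF integral_sinc_sq(1)]) (use False in simp)
    then show ?thesis unfolding add_0 by (rule integrable_mult_right)
  qed simp
  show "square_integrable (fint (sgi t))"
    by (rule square_integrable_bound[OF _ i], measurable, use AE in eventually_elim) (simp only: order_refl)
  have "(\<integral>p. (cmod (fint (sgi t) p))\<^sup>2 \<partial>lborel) = (\<integral>p. t\<^sup>2 * (sinc (pi * t * p))\<^sup>2 \<partial>lborel)"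
    by (rule integral_cong_AE[OF _ _ AE]) measurable
  also have "\<dots> = \<bar>t\<bar>"
  proof (cases "t = 0")
    case False
    have "pi = \<bar>pi * t\<bar> * (\<integral>p. (sinc (pi * t * p))\<^sup>2 \<partial>lborel)"
      using lborel_integral_real_affine[of "pi * t" "\<lambda>x. (sinc x)\<^sup>2" 0] False integral_sinc_sq(2)
      unfolding add_0 real_scaleR_def by simp
    then have "(\<integral>p. (sinc (pi * t * p))\<^sup>2 \<partial>lborel) = 1 / \<bar>t\<bar>"
      using False by (simp add: abs_mult field_simps)
    then show ?thesis using False by (simp add: power2_eq_square abs_if)
  qed simp
  finally show "(\<integral>p. (cmod (fint (sgi t) p))\<^sup>2 \<partial>lborel) = \<bar>t\<bar>" .
qed

definition epl :: "real \<Rightarrow> real l2" where "epl t = abs_l2 (fint (sgi t))"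

lemma AE_rep_epl: "AE x in lborel. rep_l2 (epl t) x = fint (sgi t) x"
  unfolding epl_def by (rule AE_rep_abs[OF square_integrable_fint_sgi])

lemma norm_epl_diff: "(norm (epl t - epl r))\<^sup>2 = \<bar>t - r\<bar>"
proof -
  have "(norm (epl t - epl r))\<^sup>2 = (\<integral>p. (cmod (fint (sgi (t - r)) p))\<^sup>2 \<partial>lborel)"
    unfolding norm_l2_sq
  proof (rule integral_cong_AE)
    show "AE p in lborel. (cmod (rep_l2 (epl t - epl r) p))\<^sup>2 = (cmod (fint (sgi (t - r)) p))\<^sup>2"
      using AE_lborel_singleton[of "0::real"] AE_rep_diff[of "epl t" "epl r"] AE_rep_epl[of t] AE_rep_epl[of r]
      by eventually_elim (simp add: fint_sgi_diff norm_mult)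
  qed measurable
  then show ?thesis by (simp add: integral_fint_sgi_sq)
qed

lemma norm_sgl_diff: "(norm (sgl t - sgl r))\<^sup>2 = \<bar>t - r\<bar>"
proof -
  have "(norm (sgl t - sgl r))\<^sup>2 = (\<integral>x. indicator {min t r..max t r} x \<partial>lborel)"
    unfolding norm_l2_sq
  proof (rule integral_cong_AE)
    show "AE x in lborel. (cmod (rep_l2 (sgl t - sgl r) x))\<^sup>2 = indicator {min t r..max t r} x"
      using AE_lborel_singleton[of 0] AE_lborel_singleton[of t] AE_lborel_singleton[of r]
        AE_rep_diff[of "sgl t" "sgl r"] AE_rep_sgl[of t] AE_rep_sgl[of r]
      by eventually_elim (auto simp: sgi_def indicator_def)
  qed measurable
  then show ?thesis by (simp add: max_def min_def)
qed

lemma sgl_0 [simp]: "sgl 0 = 0" and epl_0 [simp]: "epl 0 = 0"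
proof -
  show "sgl 0 = 0"
    by (rule l2_eqI, use AE_rep_sgl[of 0] AE_rep_zero[where 'a=real] in eventually_elim) (simp add: sgi_def)
  show "epl 0 = 0"
    by (rule l2_eqI, use AE_rep_epl[of 0] AE_rep_zero[where 'a=real] in eventually_elim)
      (simp add: sgi_def fint_def)
qed

text \<open>Real parts agree by polarisation, since the norms and distances of both families agree.
  Imaginary parts vanish: \<open>sgi\<close> is real, and conjugating its transform amounts to
  replacing p by -p, which does not change the integral.\<close>

lemma cinner_epl: "cinner (epl t) (epl r) = cinner (sgl t) (sgl r)"
proof -
  have n: "(norm (epl t))\<^sup>2 = \<bar>t\<bar>" "(norm (sgl t))\<^sup>2 = \<bar>t\<bar>" for t
    using norm_epl_diff[of t 0] norm_sgl_diff[of t 0] by simp_all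
  have pol: "inner x y = ((norm x)\<^sup>2 + (norm y)\<^sup>2 - (norm (x - y))\<^sup>2) / 2" for x y :: "real l2"
    by (simp add: power2_norm_eq_inner algebra_simps inner_commute)
  have "inner (epl t) (epl r) = inner (sgl t) (sgl r)"
    unfolding pol n norm_epl_diff norm_sgl_diff ..
  moreover have "cnj (cinner (epl t) (epl r)) = cinner (epl t) (epl r)"
  proof -
    have e: "cinner (epl t) (epl r) = (\<integral>p. cnj (fint (sgi t) p) * fint (sgi r) p \<partial>lborel)" for t r
      by (rule cinner_AE[OF AE_rep_epl AE_rep_epl]) measurable
    have "cnj (cinner (epl t) (epl r)) = cinner (epl r) (epl t)"
      by (rule cinner_commute[symmetric])
    also have "\<dots> = (\<integral>p. cnj (fint (sgi t) (- p)) * fint (sgi r) (- p) \<partial>lborel)"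
      unfolding e by (intro Bochner_Integration.integral_cong refl) (simp add: fint_sgi_cnj[symmetric])
    also have "\<dots> = cinner (epl t) (epl r)"
      unfolding e by (rule integral_uminus[of "\<lambda>p. cnj (fint (sgi t) p) * fint (sgi r) p"])
    finally show ?thesis .
  qed
  moreover have "cnj (cinner (sgl t) (sgl r)) = cinner (sgl t) (sgl r)"
  proof -
    have e: "cinner (sgl t) (sgl r) = (\<integral>p. sgi t p * sgi r p \<partial>lborel)" for t r
      using cinner_AE[OF AE_rep_sgl AE_rep_sgl, of t r] by simp
    have "cnj (cinner (sgl t) (sgl r)) = cinner (sgl r) (sgl t)"
      by (rule cinner_commute[symmetric])
    then show ?thesis unfolding e by (simp add: mult.commute)
  qed
  ultimately show ?thesis
    by (simp add: complex_eq_iff Re_cinner)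
qed

lemma ind_l2_eq_sgl:
  assumes "a \<le> b"
  shows "ind_l2 {a..b} c = mul_l2 (\<lambda>_. c) (sgl b - sgl a)"
    and "ind_l2 (box a b) c = mul_l2 (\<lambda>_. c) (sgl b - sgl a)"
proof -
  have AE: "AE x in lborel. rep_l2 (sgl b - sgl a) x = indicator {a..b} x" "AE x in lborel. x \<noteq> a \<and> x \<noteq> b"
    using AE_lborel_singleton[of 0] AE_lborel_singleton[of a] AE_lborel_singleton[of b]
      AE_rep_diff[of "sgl b" "sgl a"] AE_rep_sgl[of b] AE_rep_sgl[of a]
    by (eventually_elim; use assms in \<open>auto simp: sgi_def indicator_def\<close>)+
  have i: "AE x in lborel. rep_l2 (ind_l2 {a..b} c) x = c * indicator {a..b} x"
    by (rule AE_rep_ind) (auto simp: emeasure_lborel_Icc_eq)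
  have i': "AE x in lborel. rep_l2 (ind_l2 (box a b) c) x = c * indicator (box a b) x"
    by (rule AE_rep_ind[OF _ emeasure_lborel_box_finite]) simp
  show "ind_l2 {a..b} c = mul_l2 (\<lambda>_. c) (sgl b - sgl a)"
    by (rule mul_l2_eqI[OF bdd_fun_const, symmetric], use AE i in eventually_elim) simp
  show "ind_l2 (box a b) c = mul_l2 (\<lambda>_. c) (sgl b - sgl a)"
    by (rule mul_l2_eqI[OF bdd_fun_const, symmetric], use AE i' in eventually_elim)
      (auto simp: indicator_def box_real_eq)
qed

lemma sgl_dense: "closure (span {mul_l2 (\<lambda>_. c) (sgl t) |c t. True}) = UNIV" (is "closure (span ?S) = _")
proof -
  have "{ind_l2 (box a b :: real set) c |a b c. True} \<subseteq> span ?S"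
  proof clarify
    fix a b :: real and c
    show "ind_l2 (box a b) c \<in> span ?S"
    proof (cases "a \<le> b")
      case True
      have "mul_l2 (\<lambda>_. c) (sgl b - sgl a) = mul_l2 (\<lambda>_. c) (sgl b) - mul_l2 (\<lambda>_. c) (sgl a)"
        by (rule linear_diff[OF bounded_linear.linear[OF bounded_linear_mul]]) simp
      moreover have "mul_l2 (\<lambda>_. c) (sgl b) \<in> span ?S" "mul_l2 (\<lambda>_. c) (sgl a) \<in> span ?S"
        by (auto intro!: span_base)
      ultimately show ?thesis
        unfolding ind_l2_eq_sgl(2)[OF True] by (simp add: span_diff)
    next
      case False
      then have "box a b = {}" by (simp add: box_real_eq)
      then have "ind_l2 (box a b) c = 0"
        unfolding ind_l2_def
        by (intro abs_l2_eqI) (use AE_rep_zero[where 'a=real] in \<open>auto simp: square_integrable_zero\<close>)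
      then show ?thesis by (simp add: span_zero)
    qed
  qed
  then have "span {ind_l2 (box a b :: real set) c |a b c. True} \<subseteq> span ?S"
    by (intro span_minimal subspace_span)
  from closure_mono[OF this] show ?thesis unfolding ind_box_dense by blast
qed

lemma bounded_linear_eq_on_sgl:
  assumes "bounded_linear f" "bounded_linear g" "\<And>c t. f (mul_l2 (\<lambda>_. c) (sgl t)) = g (mul_l2 (\<lambda>_. c) (sgl t))"
  shows "f x = g x"
proof (rule bounded_linear_eq_on_closure_span[OF assms(1,2)])
  show "x \<in> closure (span {mul_l2 (\<lambda>_. c) (sgl t) |c t. True})" unfolding sgl_dense by (rule UNIV_I)
qed (use assms(3) in blast)

lemma fst_image_pairs: "fst ` {(g c t, h c t) |c t. True} = {g c t |c t. True}"
  by force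

section \<open>The Plancherel transform and its inversion\<close>

definition ft :: "real l2 \<Rightarrow> real l2" where
  "ft = (SOME U. isometry_map U \<and> (\<forall>t. U (sgl t) = epl t))"

text \<open>The generating pairs include all complex multiples of the \<open>sgl t\<close>, so their
  real span is already dense and the extension theorem for isometries applies.\<close>

lemma isometry_ft: "isometry_map ft" and ft_sgl: "ft (sgl t) = epl t"
proof -
  let ?S = "{(mul_l2 (\<lambda>_. c) (sgl t), mul_l2 (\<lambda>_. c) (epl t)) |c t. True}"
  have "fst ` ?S = {mul_l2 (\<lambda>_. c) (sgl t) |c t. True}"
    by (rule fst_image_pairs)
  then have d: "closure (span (fst ` ?S)) = UNIV" by (simp only: sgl_dense)
  have c: "cinner (fst p) (fst q) = cinner (snd p) (snd q)" if "p \<in> ?S" "q \<in> ?S" for p q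
    using that by (auto simp: cinner_const_left cinner_const_right cinner_epl)
  obtain U where U: "isometry_map U" "closure (span ?S) = {(\<phi>, U \<phi>) |\<phi>. True}"
    using isometry_exists[OF c d] by blast
  have one: "mul_l2 (\<lambda>_. 1) \<phi> = \<phi>" for \<phi> :: "real l2"
    by (rule mul_l2_eqI) auto
  have "U (sgl t) = epl t" for t
  proof -
    have "(mul_l2 (\<lambda>_. 1) (sgl t), mul_l2 (\<lambda>_. 1) (epl t)) \<in> closure (span ?S)"
      by (rule closure_span_superset) blast
    then show ?thesis unfolding U(2) one by auto
  qed
  with U(1) have "\<exists>U. isometry_map U \<and> (\<forall>t. U (sgl t) = epl t)" by blast
  from someI_ex[OF this] have "isometry_map ft \<and> (\<forall>t. ft (sgl t) = epl t)"
    unfolding ft_def .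
  then show "isometry_map ft" "ft (sgl t) = epl t" by auto
qed

lemma refl_sgl: "refl_l2 (sgl t) = - sgl (- t)"
  by (rule refl_l2_eqI, use AE_rep_sgl[of "- t"] AE_lborel_uminus[OF AE_rep_sgl[of t]] AE_rep_uminus[of "sgl (- t)"] in eventually_elim)
    (simp add: sgi_uminus)

text \<open>The adjoint of the transform is the transform after reflection. On signed indicators
  this is the multiplication formula, because conjugating the transform reflects p and
  \<open>sgi r\<close> reflected is -\<open>sgi (- r)\<close>. It extends by density in one argument
  at a time.\<close>

lemma cinner_ft_left: "cinner (ft \<phi>) \<psi> = cinner \<phi> (ft (refl_l2 \<psi>))"
proof -
  interpret ft: bounded_linear ft by (rule isometry_bounded_linear[OF isometry_ft])
  have bl: "bounded_linear (\<lambda>\<psi>. ft (refl_l2 \<psi>))"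
    by (intro bounded_linear_compose[OF isometry_bounded_linear[OF isometry_ft]] isometry_bounded_linear isometry_refl)
  have 1: "cinner (ft (sgl t)) (sgl r) = cinner (sgl t) (ft (refl_l2 (sgl r)))" for t r
  proof -
    have "cinner (ft (sgl t)) (sgl r) = (\<integral>p. cnj (fint (sgi t) p) * sgi r p \<partial>lborel)"
      unfolding ft_sgl by (rule cinner_AE[OF AE_rep_epl AE_rep_sgl]) measurable
    also have "\<dots> = (\<integral>p. fint (sgi t) (- p) * - sgi (- r) (- p) \<partial>lborel)"
      by (simp add: fint_sgi_cnj sgi_uminus)
    also have "\<dots> = (\<integral>p. fint (sgi t) p * - sgi (- r) p \<partial>lborel)"
      by (rule integral_uminus[of "\<lambda>p. fint (sgi t) p * - sgi (- r) p"])
    also have "\<dots> = - (\<integral>p. fint (sgi t) p * sgi (- r) p \<partial>lborel)" by simp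
    also have "\<dots> = - (\<integral>x. sgi t x * fint (sgi (- r)) x \<partial>lborel)"
      by (simp add: fint_multiplication integrable_sgi)
    also have "\<dots> = - cinner (sgl t) (epl (- r))"
      using cinner_AE[OF AE_rep_sgl AE_rep_epl, of t "- r"] by simp
    finally show ?thesis by (simp add: refl_sgl ft.neg ft_sgl)
  qed
  note const = isometry_const[OF isometry_ft] isometry_const[OF isometry_refl]
  have 2: "cinner (ft (sgl t)) \<psi> = cinner (sgl t) (ft (refl_l2 \<psi>))" for t \<psi>
  proof (rule bounded_linear_eq_on_sgl[of "cinner (ft (sgl t))" "\<lambda>\<psi>. cinner (sgl t) (ft (refl_l2 \<psi>))"])
    show "cinner (ft (sgl t)) (mul_l2 (\<lambda>_. c) (sgl r)) = cinner (sgl t) (ft (refl_l2 (mul_l2 (\<lambda>_. c) (sgl r))))" for c r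
      unfolding const cinner_const_right 1 ..
  qed (rule bounded_linear_cinner_right bounded_linear_compose[OF bounded_linear_cinner_right bl])+
  show ?thesis
  proof (rule bounded_linear_eq_on_sgl[of "\<lambda>\<phi>. cinner (ft \<phi>) \<psi>" "\<lambda>\<phi>. cinner \<phi> (ft (refl_l2 \<psi>))"])
    note left = bounded_bilinear.bounded_linear_left[OF bounded_bilinear_cinner]
    show "bounded_linear (\<lambda>\<phi>. cinner (ft \<phi>) \<psi>)"
      by (rule bounded_linear_compose[OF left ft.bounded_linear_axioms])
    show "bounded_linear (\<lambda>\<phi>. cinner \<phi> (ft (refl_l2 \<psi>)))" by (rule left)
    show "cinner (ft (mul_l2 (\<lambda>_. c) (sgl t))) \<psi> = cinner (mul_l2 (\<lambda>_. c) (sgl t)) (ft (refl_l2 \<psi>))" for c t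
      unfolding const cinner_const_left 2 ..
  qed
qed

text \<open>Inversion without integrability: for e, the double transform of the reflected \<phi>,
  the adjoint formula gives <e, \<phi>> = |\<phi>|^2 = |e|^2, so e - \<phi> has norm zero.\<close>

lemma ft_ft: "ft (ft \<phi>) = refl_l2 \<phi>"
proof -
  have "ft (ft (refl_l2 \<phi>)) = \<phi>" for \<phi>
  proof -
    let ?e = "ft (ft (refl_l2 \<phi>))"
    have n: "cinner (ft \<xi>) (ft \<eta>) = cinner \<xi> \<eta>" "cinner (refl_l2 \<xi>) (refl_l2 \<eta>) = cinner \<xi> \<eta>" for \<xi> \<eta>
      using isometry_ft isometry_refl by (simp_all add: isometry_map_def)
    have 1: "cinner ?e \<phi> = cinner \<phi> \<phi>"
      unfolding cinner_ft_left[of "ft (refl_l2 \<phi>)"] n ..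
    have 2: "cinner \<phi> ?e = cinner \<phi> \<phi>"
      using cinner_commute[of \<phi> ?e] cinner_commute[of \<phi> \<phi>] 1 by presburger
    have "cinner (?e - \<phi>) (?e - \<phi>) = 0"
      unfolding cinner_diff_left cinner_diff_right 1 2 n by simp
    then show ?thesis by (simp add: cinner_self)
  qed
  from this[of "refl_l2 \<phi>"] show ?thesis by simp
qed

lemma ft_refl: "ft (refl_l2 \<phi>) = refl_l2 (ft \<phi>)"
  by (simp only: ft_ft[symmetric])

lemma unitary_ft: "unitary_map ft"
  unfolding unitary_map_def
proof
  show "surj ft" by (rule surjI[of _ "\<lambda>\<phi>. ft (refl_l2 \<phi>)"]) (simp add: ft_ft)
qed (use isometry_ft in \<open>simp add: isometry_map_def\<close>)

lemma inv_ft: "inv ft \<phi> = refl_l2 (ft \<phi>)"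
proof -
  have "ft (refl_l2 (ft \<phi>)) = \<phi>" by (simp add: ft_refl ft_ft)
  then show ?thesis by (metis unitary_inv_apply(1)[OF unitary_ft])
qed

lemma orth_boxes_zero:
  assumes "\<And>a b c. cinner (ind_l2 (box a b) c) \<phi> = 0"
  shows "\<phi> = 0"
proof -
  have "cinner \<phi> \<phi> = (\<lambda>_. 0) \<phi>"
  proof (rule bounded_linear_eq_on_closure_span[of "\<lambda>\<psi>. cinner \<psi> \<phi>"])
    show "bounded_linear (\<lambda>\<psi>. cinner \<psi> \<phi>)"
      by (rule bounded_bilinear.bounded_linear_left[OF bounded_bilinear_cinner])
    show "\<phi> \<in> closure (span {ind_l2 (box a b) c |a b c. True})" unfolding ind_box_dense by (rule UNIV_I)
  qed (use assms in auto)
  then show ?thesis by (simp add: cinner_self)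
qed

text \<open>The function is square integrable only after truncation, so density of box indicators is
  applied to its truncations to (-n, n), each of which is orthogonal to all of them.\<close>

lemma AE_zero_of_integral_sgi:
  fixes h :: "real \<Rightarrow> complex"
  assumes [measurable]: "h \<in> borel_measurable borel"
    and sq: "\<And>n. square_integrable (\<lambda>x. indicator (box (- real n) (real n)) x * h x)"
    and z: "\<And>t. integrable lborel (\<lambda>x. sgi t x * h x)" "\<And>t. (\<integral>x. sgi t x * h x \<partial>lborel) = 0"
  shows "AE x in lborel. h x = 0"
proof -
  have box0: "(\<integral>x. indicator (box a b) x * h x \<partial>lborel) = 0" for a b
  proof (cases "a \<le> b")
    case True
    have "(\<integral>x. indicator (box a b) x * h x \<partial>lborel) = (\<integral>x. sgi b x * h x - sgi a x * h x \<partial>lborel)"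
    proof (rule integral_cong_AE)
      show "AE x in lborel. indicator (box a b) x * h x = sgi b x * h x - sgi a x * h x"
        using AE_lborel_singleton[of 0] AE_lborel_singleton[of a] AE_lborel_singleton[of b]
        by eventually_elim (use True in \<open>auto simp: sgi_def indicator_def box_real_eq\<close>)
    qed measurable
    also have "\<dots> = 0" using z by simp
    finally show ?thesis .
  qed (simp add: box_real_eq)
  have "AE x in lborel. \<bar>x\<bar> < real n \<longrightarrow> h x = 0" for n
  proof -
    define \<phi> where "\<phi> = abs_l2 (\<lambda>x. indicator (box (- real n) (real n)) x * h x)"
    have \<phi>: "AE x in lborel. rep_l2 \<phi> x = indicator (box (- real n) (real n)) x * h x"
      unfolding \<phi>_def by (rule AE_rep_abs[OF sq])
    have "\<phi> = 0"
    proof (rule orth_boxes_zero)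
      fix a b :: real and c
      have "AE x in lborel. rep_l2 (ind_l2 (box a b) c) x = c * indicator (box a b) x"
        by (rule AE_rep_ind[OF _ emeasure_lborel_box_finite]) simp
      from cinner_AE[OF this \<phi>]
      have "cinner (ind_l2 (box a b) c) \<phi> =
          (\<integral>x. cnj (c * indicator (box a b) x) * (indicator (box (- real n) (real n)) x * h x) \<partial>lborel)"
        by measurable
      also have "\<dots> = (\<integral>x. cnj c * (indicator (box (max a (- real n)) (min b (real n))) x * h x) \<partial>lborel)"
        by (rule Bochner_Integration.integral_cong) (auto simp: indicator_def box_real_eq)
      also have "\<dots> = 0" by (simp only: integral_mult_right_zero box0 mult_zero_right)
      finally show "cinner (ind_l2 (box a b) c) \<phi> = 0" .
    qed
    then show ?thesis
      using \<phi> AE_rep_zero[where 'a=real]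
      by (auto elim!: eventually_elim2 simp: indicator_def box_real_eq abs_less_iff)
  qed
  then have "AE x in lborel. \<forall>n::nat. \<bar>x\<bar> < real n \<longrightarrow> h x = 0"
    by (subst AE_all_countable) auto
  then show ?thesis by eventually_elim (use reals_Archimedean2 in blast)
qed

text \<open>Paired with a signed indicator, the abstract transform moves to the explicit
  \<open>fint (sgi t)\<close> through the adjoint formula and back to \<open>fint f\<close> through
  the multiplication formula. The difference then pairs to zero with every signed indicator.\<close>

lemma ft_integrable:
  assumes f: "integrable lborel f" and sq: "square_integrable f"
  shows "AE p in lborel. rep_l2 (ft (abs_l2 f)) p = fint f p"
proof -
  have [measurable]: "f \<in> borel_measurable borel" using f by (auto dest: borel_measurable_integrable)
  let ?R = "rep_l2 (ft (abs_l2 f))"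
  have Rf: "AE x in lborel. rep_l2 (abs_l2 f) x = f x" by (rule AE_rep_abs[OF sq])
  have i1: "integrable lborel (\<lambda>x. sgi t x * ?R x)" for t
    using square_integrable_prod[OF square_integrable_sgi square_integrable_rep, of t] by simp
  have i2: "integrable lborel (\<lambda>x. sgi t x * fint f x)" for t
  proof (rule Bochner_Integration.integrable_bound)
    show "integrable lborel (\<lambda>x. (\<integral>x. cmod (f x) \<partial>lborel) * cmod (sgi t x))"
      using integrable_sgi by simp
    show "AE x in lborel. norm (sgi t x * fint f x) \<le> norm ((\<integral>x. cmod (f x) \<partial>lborel) * cmod (sgi t x))"
    proof (rule AE_I2)
      fix x
      have "cmod (sgi t x) * cmod (fint f x) \<le> cmod (sgi t x) * (\<integral>x. cmod (f x) \<partial>lborel)"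
        by (intro mult_left_mono fint_bound f) simp
      then show "norm (sgi t x * fint f x) \<le> norm ((\<integral>x. cmod (f x) \<partial>lborel) * cmod (sgi t x))"
        by (simp add: norm_mult abs_mult mult.commute)
    qed
  qed measurable
  have eq: "(\<integral>x. sgi t x * ?R x \<partial>lborel) = (\<integral>x. sgi t x * fint f x \<partial>lborel)" for t
  proof -
    have r: "AE x in lborel. rep_l2 (refl_l2 (abs_l2 f)) x = f (- x)"
      using AE_rep_refl[of "abs_l2 f"] AE_lborel_uminus[OF Rf] by eventually_elim simp
    have "(\<integral>x. sgi t x * ?R x \<partial>lborel) = cinner (sgl t) (ft (refl_l2 (refl_l2 (abs_l2 f))))"
      using cinner_AE[OF AE_rep_sgl, of "ft (abs_l2 f)" ?R t] by simp
    also have "\<dots> = cinner (epl t) (refl_l2 (abs_l2 f))"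
      by (simp only: cinner_ft_left[symmetric] ft_sgl)
    also have "\<dots> = (\<integral>p. cnj (fint (sgi t) p) * f (- p) \<partial>lborel)"
      by (rule cinner_AE[OF AE_rep_epl r]) measurable
    also have "\<dots> = (\<integral>p. fint (sgi t) p * f p \<partial>lborel)"
      using integral_uminus[of "\<lambda>p. fint (sgi t) p * f p"] by (simp add: fint_sgi_cnj)
    also have "\<dots> = (\<integral>x. sgi t x * fint f x \<partial>lborel)"
      by (rule fint_multiplication[OF integrable_sgi f])
    finally show ?thesis .
  qed
  have "AE x in lborel. ?R x - fint f x = 0"
  proof (rule AE_zero_of_integral_sgi)
    show "integrable lborel (\<lambda>x. sgi t x * (?R x - fint f x))" for t
      using i1 i2 by (simp add: right_diff_distrib)
    show "(\<integral>x. sgi t x * (?R x - fint f x) \<partial>lborel) = 0" for t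
      using i1 i2 by (simp add: right_diff_distrib eq)
    fix n
    let ?I = "indicator (box (- real n) (real n)) :: real \<Rightarrow> complex"
    have I: "bdd_fun ?I" by (rule bdd_fun_indicator) simp
    have "square_integrable (\<lambda>x. ?I x * ?R x)" "square_integrable (\<lambda>x. - fint f x * (1 * ?I x))"
      by (intro square_integrable_mul I square_integrable_rep)
        (intro square_integrable_mul square_integrable_indicator emeasure_lborel_box_finite,
          use bdd_fun_mult[OF bdd_fun_const[of "- 1"] bdd_fun_fint[OF f]] in auto)
    from square_integrable_add[OF this]
    show "square_integrable (\<lambda>x. ?I x * (?R x - fint f x))" by (simp add: algebra_simps)
  qed measurable
  then show ?thesis by eventually_elim simp
qed

subsection \<open>Momentum, Gaussians, and contour shifts\<close>

lemma cinner_cong_AE: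
  assumes "AE x in lborel. cnj (rep_l2 \<phi> x) * rep_l2 \<psi> x = cnj (rep_l2 \<phi>' x) * rep_l2 \<psi>' x"
  shows "cinner \<phi> \<psi> = cinner \<phi>' \<psi>'"
  unfolding cinner_rep by (rule integral_cong_AE[OF _ _ assms]) measurable

lemma cinner_sgl_diff:
  "cinner (sgl b - sgl a) \<psi> = (\<integral>p. cnj (fint (sgi b) p - fint (sgi a) p) * rep_l2 (ft \<psi>) p \<partial>lborel)"
proof -
  interpret ft: bounded_linear ft by (rule isometry_bounded_linear[OF isometry_ft])
  have "cinner (sgl b - sgl a) \<psi> = cinner (epl b - epl a) (ft \<psi>)"
    using unitary_cinner[OF unitary_ft, of "sgl b - sgl a" \<psi>] by (simp add: ft.diff ft_sgl)
  also have "\<dots> = (\<integral>p. cnj (fint (sgi b) p - fint (sgi a) p) * rep_l2 (ft \<psi>) p \<partial>lborel)"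
  proof (rule cinner_AE)
    show "AE x in lborel. rep_l2 (epl b - epl a) x = fint (sgi b) x - fint (sgi a) x"
      using AE_rep_diff[of "epl b" "epl a"] AE_rep_epl[of a] AE_rep_epl[of b] by eventually_elim simp
  qed (auto intro!: borel_measurable_diff)
  finally show ?thesis .
qed

text \<open>Translates the gauge integral in the definition of \<P> into an inner product, which the
  unitarity of the transform can move to the Fourier side.\<close>

lemma has_integral_rep:
  assumes "a \<le> b"
  shows "(rep_l2 \<psi> has_integral cinner (sgl b - sgl a) \<psi>) {a..b}"
proof -
  have "square_integrable (\<lambda>x. 1 * indicator {a..b::real} x)"
    by (rule square_integrable_indicator) (auto simp: emeasure_lborel_Icc_eq)
  from square_integrable_prod[OF this square_integrable_rep[of \<psi>]]
  have "integrable lborel (\<lambda>x. cnj (1 * indicator {a..b} x) * rep_l2 \<psi> x)" .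
  also have "(\<lambda>x. cnj (1 * indicator {a..b} x) * rep_l2 \<psi> x) = (\<lambda>x. indicator {a..b} x *\<^sub>R rep_l2 \<psi> x)"
    by (auto simp: indicator_def)
  finally have "set_integrable lborel {a..b} (rep_l2 \<psi>)" by (simp add: set_integrable_def)
  from set_borel_integral_eq_integral[OF this]
  have "(rep_l2 \<psi> has_integral (LINT x:{a..b}|lborel. rep_l2 \<psi> x)) {a..b}"
    by (simp add: has_integral_integral)
  moreover have "cinner (sgl b - sgl a) \<psi> = (LINT x:{a..b}|lborel. rep_l2 \<psi> x)"
  proof -
    have "AE x in lborel. rep_l2 (sgl b - sgl a) x = indicator {a..b} x"
      using AE_lborel_singleton[of 0] AE_lborel_singleton[of a] AE_lborel_singleton[of b]
        AE_rep_diff[of "sgl b" "sgl a"] AE_rep_sgl[of b] AE_rep_sgl[of a]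
      by eventually_elim (use assms in \<open>auto simp: sgi_def indicator_def\<close>)
    then have "cinner (sgl b - sgl a) \<psi> = (\<integral>x. cnj (indicator {a..b} x) * rep_l2 \<psi> x \<partial>lborel)"
      by (rule cinner_AE) simp_all
    also have "\<dots> = (LINT x:{a..b}|lborel. rep_l2 \<psi> x)"
      unfolding set_lebesgue_integral_def
      by (rule Bochner_Integration.integral_cong[OF refl]) (simp add: indicator_def)
    finally show ?thesis .
  qed
  ultimately show ?thesis by simp
qed

lemma rep_ft_integrable:
  assumes "integrable lborel (rep_l2 \<phi>)"
  shows "AE p in lborel. rep_l2 (ft \<phi>) p = fint (rep_l2 \<phi>) p"
  using ft_integrable[OF assms square_integrable_rep] by simp

text \<open>Writing |A| as (1 + x^2)^(-1/2) times (1 + x^2)^(1/2) |A| and using 2st <= s^2 + t^2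
  gives the majorant. Thus vectors in the domain of \<Q> have convergent Fourier integrals.\<close>

lemma integrable_of_position:
  assumes "(A, B) \<in> \<Q>"
  shows "integrable lborel (rep_l2 A)"
proof (rule Bochner_Integration.integrable_bound)
  have "integrable lborel (\<lambda>x::real. inverse (1 + x\<^sup>2))"
    using integrable_inverse_1_plus_square by (simp add: set_integrable_def einterval_def)
  then show "integrable lborel (\<lambda>x. inverse (1 + x\<^sup>2) + ((cmod (rep_l2 A x))\<^sup>2 + (cmod (rep_l2 B x))\<^sup>2))"
    by (intro Bochner_Integration.integrable_add integrable_rep)
  have "AE x in lborel. rep_l2 B x = of_real x * rep_l2 A x"
    using assms unfolding position_op_def mult_op_iff .
  then show "AE x in lborel. norm (rep_l2 A x) \<le>
      norm (inverse (1 + x\<^sup>2) + ((cmod (rep_l2 A x))\<^sup>2 + (cmod (rep_l2 B x))\<^sup>2))"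
  proof eventually_elim
    case (elim x)
    let ?a = "cmod (rep_l2 A x)" and ?s = "sqrt (1 + x\<^sup>2)"
    have s: "?s > 0" "?s\<^sup>2 = 1 + x\<^sup>2" by (auto simp: add_pos_nonneg)
    have "2 * (1 / ?s) * (?s * ?a) \<le> (1 / ?s)\<^sup>2 + (?s * ?a)\<^sup>2" by (rule sum_squares_bound)
    then have "2 * ?a \<le> inverse (1 + x\<^sup>2) + (1 + x\<^sup>2) * ?a\<^sup>2"
      using s by (simp add: power_divide power_mult_distrib inverse_eq_divide)
    also have "(1 + x\<^sup>2) * ?a\<^sup>2 = ?a\<^sup>2 + (cmod (rep_l2 B x))\<^sup>2"
      by (simp add: elim norm_mult power_mult_distrib algebra_simps)
    finally have "2 * ?a \<le> inverse (1 + x\<^sup>2) + (?a\<^sup>2 + (cmod (rep_l2 B x))\<^sup>2)" .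
    moreover have "0 \<le> ?a" by simp
    ultimately show ?case unfolding real_norm_def by linarith
  qed
qed measurable

text \<open>The absolutely continuous representative is the inverse Fourier integral of the
  transform. Its increments are the inner products of \<psi> with intervals, because the factor p
  from \<Q> cancels the denominator 2 pi i p in the transform of an interval.\<close>

lemma ft_position_momentum:
  assumes "(ft \<phi>, ft \<psi>) \<in> \<Q>"
  shows "(\<phi>, \<psi>) \<in> \<P>"
proof -
  let ?A = "rep_l2 (ft \<phi>)"
  have i: "integrable lborel ?A" by (rule integrable_of_position[OF assms])
  have B: "AE p in lborel. rep_l2 (ft \<psi>) p = of_real p * ?A p"
    using assms unfolding position_op_def mult_op_iff .
  have 1: "AE x in lborel. rep_l2 \<phi> x = fint ?A (- x)"
  proof -
    have "\<phi> = refl_l2 (ft (ft \<phi>))" by (simp add: ft_ft)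
    then have "AE x in lborel. rep_l2 \<phi> x = rep_l2 (ft (ft \<phi>)) (- x)"
      using AE_rep_refl[of "ft (ft \<phi>)"] by simp
    then show ?thesis
      using AE_lborel_uminus[OF rep_ft_integrable[OF i]] by eventually_elim simp
  qed
  have 2: "((\<lambda>x. 2 * complex_of_real pi * \<i> * rep_l2 \<psi> x) has_integral fint ?A (- b) - fint ?A (- a)) {a..b}"
    if "a \<le> b" for a b
  proof -
    have "2 * complex_of_real pi * \<i> * cinner (sgl b - sgl a) \<psi> =
        (\<integral>p. 2 * complex_of_real pi * \<i> * (cnj (fint (sgi b) p - fint (sgi a) p) * rep_l2 (ft \<psi>) p) \<partial>lborel)"
      unfolding cinner_sgl_diff by simp
    also have "\<dots> = (\<integral>p. cis (- (2 * pi * (- b) * p)) * ?A p - cis (- (2 * pi * (- a) * p)) * ?A p \<partial>lborel)"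
    proof (rule integral_cong_AE)
      show "AE p in lborel. 2 * complex_of_real pi * \<i> * (cnj (fint (sgi b) p - fint (sgi a) p) * rep_l2 (ft \<psi>) p) =
          cis (- (2 * pi * (- b) * p)) * ?A p - cis (- (2 * pi * (- a) * p)) * ?A p"
        using B AE_lborel_singleton[of "0::real"]
        by eventually_elim (simp add: fint_sgi cis_cnj field_simps)
    qed measurable
    also have "\<dots> = fint ?A (- b) - fint ?A (- a)"
      unfolding fint_def
      by (rule Bochner_Integration.integral_diff) (intro integrable_cis_mult i; measurable)+
    finally show ?thesis
      using has_integral_mult_right[OF has_integral_rep[OF that, of \<psi>], of "2 * complex_of_real pi * \<i>"] by simp
  qed
  show ?thesis
    unfolding momentum_op_def by (auto intro!: exI[of _ "\<lambda>x. fint ?A (- x)"] 1 2)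
qed

lemma bdd_fun_cis: "g \<in> borel_measurable borel \<Longrightarrow> bdd_fun (\<lambda>p. cis (g p))"
  by (rule bdd_funI[of _ 1]) auto

lemma ft_trans: "ft (trans_l2 \<phi>) = mul_l2 (\<lambda>p. cis (2 * pi * p)) (ft \<phi>)"
proof (rule bounded_linear_eq_on_sgl[of "\<lambda>\<phi>. ft (trans_l2 \<phi>)"])
  have c: "bdd_fun (\<lambda>p. cis (2 * pi * p))" by (rule bdd_fun_cis) measurable
  interpret ft: bounded_linear ft by (rule isometry_bounded_linear[OF isometry_ft])
  show "bounded_linear (\<lambda>\<phi>. ft (trans_l2 \<phi>))"
    by (rule bounded_linear_compose[OF ft.bounded_linear_axioms isometry_bounded_linear[OF isometry_trans]])
  show "bounded_linear (\<lambda>\<phi>. mul_l2 (\<lambda>p. cis (2 * pi * p)) (ft \<phi>))"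
    by (rule bounded_linear_compose[OF bounded_linear_mul[OF c] ft.bounded_linear_axioms])
  fix d t
  \<comment> \<open>The translate of the interval from 0 to t is the one from -1 to t - 1, expressed
    by two members of the family.\<close>
  have "trans_l2 (sgl t) = sgl (t - 1) - sgl (- 1)"
  proof (rule l2_eqI)
    have s: "AE x in lborel. rep_l2 (sgl t) (1 + x) = sgi t (1 + x)"
      using AE_lborel_affine[OF AE_rep_sgl[of t], of 1 1] by simp
    show "AE x in lborel. rep_l2 (trans_l2 (sgl t)) x = rep_l2 (sgl (t - 1) - sgl (- 1)) x"
      using s AE_rep_trans[of "sgl t"] AE_rep_diff[of "sgl (t - 1)" "sgl (- 1)"]
        AE_rep_sgl[of "t - 1"] AE_rep_sgl[of "- 1"]
        AE_lborel_singleton[of "- 1"] AE_lborel_singleton[of "t - 1"] AE_lborel_singleton[of 0]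
      by eventually_elim (auto simp: sgi_def indicator_def)
  qed
  moreover have "epl (t - 1) - epl (- 1) = mul_l2 (\<lambda>p. cis (2 * pi * p)) (epl t)"
    by (rule mul_l2_eqI[OF c, symmetric], use AE_rep_diff[of "epl (t - 1)" "epl (- 1)"]
        AE_rep_epl[of t] AE_rep_epl[of "t - 1"] AE_rep_epl[of "- 1"] AE_lborel_singleton[of "0::real"] in eventually_elim)
      (simp add: fint_sgi_diff)
  ultimately show "ft (trans_l2 (mul_l2 (\<lambda>_. d) (sgl t))) = mul_l2 (\<lambda>p. cis (2 * pi * p)) (ft (mul_l2 (\<lambda>_. d) (sgl t)))"
    unfolding isometry_const[OF isometry_trans] isometry_const[OF isometry_ft] ft_sgl
    by (simp only: ft.diff ft_sgl mul_l2_commute[OF bdd_fun_const[of d] c])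
qed

text \<open>Both sides of \<open>f(x + 1) - f(x) = 2 \<pi> i \<integral>\<^bsub>[x, x + 1]\<^esub> \<psi>\<close> have explicit Fourier transforms, and
  comparing them determines the transform of \<open>\<psi>\<close> off the integers.\<close>

lemma momentum_ft_position:
  assumes "(\<phi>, \<psi>) \<in> \<P>"
  shows "(ft \<phi>, ft \<psi>) \<in> \<Q>"
proof -
  obtain f where f: "AE x in lborel. rep_l2 \<phi> x = f x"
    and I: "\<And>a b. a \<le> b \<Longrightarrow> ((\<lambda>x. 2 * complex_of_real pi * \<i> * rep_l2 \<psi> x) has_integral f b - f a) {a..b}"
    using assms unfolding momentum_op_def by auto
  let ?B = "rep_l2 (ft \<psi>)"
  \<comment> \<open>The transform of \<psi> need not be integrable, but its product with the square
    integrable transform of the unit interval is. This is what unit increments gain: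
    \<open>g\<close> has a pointwise defined Fourier integral.\<close>
  define g where "g p = cnj (fint (sgi 1) p) * ?B p" for p
  have bs: "bdd_fun (\<lambda>p. cnj (fint (sgi 1) p))"
    by (intro bdd_fun_cnj bdd_fun_fint integrable_sgi)
  have gi: "integrable lborel g"
    unfolding g_def by (rule square_integrable_prod[OF square_integrable_fint_sgi square_integrable_rep])
  have gs: "square_integrable g"
    unfolding g_def by (rule square_integrable_mul[OF bs square_integrable_rep])
  define X where "X = abs_l2 g"
  have X: "AE p in lborel. rep_l2 X p = g p" unfolding X_def by (rule AE_rep_abs[OF gs])
  have diff: "f (1 + x) - f x = 2 * complex_of_real pi * \<i> * fint g (- x)" for x
  proof -
    have "f (1 + x) - f x = 2 * complex_of_real pi * \<i> * cinner (sgl (1 + x) - sgl x) \<psi>"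
      by (rule has_integral_unique[OF I has_integral_mult_right[OF has_integral_rep]]) auto
    also have "cinner (sgl (1 + x) - sgl x) \<psi> = fint g (- x)"
      unfolding cinner_sgl_diff fint_def[of g]
    proof (rule integral_cong_AE)
      show "AE p in lborel. cnj (fint (sgi (1 + x)) p - fint (sgi x) p) * ?B p = cis (- (2 * pi * - x * p)) * g p"
        using AE_lborel_singleton[of "0::real"]
        by eventually_elim (simp add: fint_sgi_diff g_def cis_cnj mult_ac)
    qed (use bs gs in \<open>auto simp: square_integrable_def intro!: borel_measurable_times measurable_compose[OF _ borel_measurable_cnj]\<close>)
    finally show ?thesis .
  qed
  have "trans_l2 \<phi> = \<phi> + mul_l2 (\<lambda>_. 2 * complex_of_real pi * \<i>) (refl_l2 (ft X))"
  proof (rule l2_eqI)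
    have "AE x in lborel. rep_l2 (refl_l2 (ft X)) x = fint g (- x)"
      using AE_rep_refl[of "ft X"] AE_lborel_uminus[OF ft_integrable[OF gi gs]] unfolding X_def
      by eventually_elim simp
    moreover have "AE x in lborel. rep_l2 \<phi> (1 + x) = f (1 + x)"
      using AE_lborel_affine[OF f, of 1 1] by simp
    ultimately show "AE x in lborel. rep_l2 (trans_l2 \<phi>) x =
        rep_l2 (\<phi> + mul_l2 (\<lambda>_. 2 * complex_of_real pi * \<i>) (refl_l2 (ft X))) x"
      using f AE_rep_trans[of \<phi>] AE_rep_add[of \<phi> "mul_l2 (\<lambda>_. 2 * complex_of_real pi * \<i>) (refl_l2 (ft X))"]
        AE_rep_mul[OF bdd_fun_const, of "2 * complex_of_real pi * \<i>" "refl_l2 (ft X)"]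
    proof eventually_elim
      case (elim x)
      then show ?case using diff[of x] by (simp add: algebra_simps)
    qed
  qed
  then have "ft (trans_l2 \<phi>) = ft \<phi> + mul_l2 (\<lambda>_. 2 * complex_of_real pi * \<i>) X"
    using linear_add[OF bounded_linear.linear[OF isometry_bounded_linear[OF isometry_ft]]]
    by (simp add: isometry_const[OF isometry_ft] ft_refl ft_ft)
  then have eq: "mul_l2 (\<lambda>p. cis (2 * pi * p)) (ft \<phi>) = ft \<phi> + mul_l2 (\<lambda>_. 2 * complex_of_real pi * \<i>) X"
    by (simp only: ft_trans)
  have c: "bdd_fun (\<lambda>p. cis (2 * pi * p))" by (rule bdd_fun_cis) measurable
  \<comment> \<open>At integers e^(2 pi i p) = 1 and the common factor could not be cancelled; they
    form a null set.\<close>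
  have "AE p in lborel. (p::real) \<notin> \<int>"
    by (intro AE_not_in countable_imp_null_set_lborel) (simp add: Ints_def)
  then show ?thesis
    unfolding position_op_def mult_op_iff
    using X AE_rep_mul[OF c, of "ft \<phi>"] AE_rep_mul[OF bdd_fun_const, of "2 * complex_of_real pi * \<i>" X]
      AE_rep_add[of "ft \<phi>" "mul_l2 (\<lambda>_. 2 * complex_of_real pi * \<i>) X"]
  proof eventually_elim
    case (elim p)
    have p0: "p \<noteq> 0" using elim(1) by auto
    have c1: "cis (2 * pi * p) \<noteq> 1"
    proof
      assume "cis (2 * pi * p) = 1"
      then have "cos (2 * pi * p) = 1" by (simp add: complex_eq_iff)
      then obtain k :: int where "2 * pi * p = of_int k * 2 * pi"
        unfolding cos_one_2pi_int by blast
      then have "p = of_int k" by simp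
      with elim(1) show False by simp
    qed
    have "cis (2 * pi * p) * rep_l2 (ft \<phi>) p = rep_l2 (ft \<phi>) p + 2 * complex_of_real pi * \<i> * g p"
      using elim eq by simp
    also have "2 * complex_of_real pi * \<i> * g p = (cis (2 * pi * p) - 1) / p * ?B p"
      using p0 by (simp add: g_def fint_sgi cis_cnj field_simps)
    finally have "(cis (2 * pi * p) - 1) * (of_real p * rep_l2 (ft \<phi>) p) = (cis (2 * pi * p) - 1) * ?B p"
      using p0 by (simp add: field_simps)
    then show ?case using c1 by simp
  qed
qed

lemma fun_calc_momentum: "fun_calc m \<P> = {(\<phi>, \<psi>). (ft \<phi>, ft \<psi>) \<in> mult_op m}"
  by (rule fun_calc_eq[OF unitary_ft]) (auto intro: ft_position_momentum momentum_ft_position)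

section \<open>Gaussians and their transforms\<close>

lemma integrable_gaussian: "integrable lborel (\<lambda>x::real. exp (- pi * x\<^sup>2))"
  and fint_gaussian0: "fint (\<lambda>x. of_real (exp (- pi * x\<^sup>2))) p = of_real (exp (- pi * p\<^sup>2))"
proof -
  let ?c = "sqrt (2 * pi)"
  have c0: "?c \<noteq> 0" by simp
  have d: "std_normal_density (?c * x) = exp (- pi * x\<^sup>2) / ?c" for x
    by (simp add: std_normal_density_def power_mult_distrib)
  have "integrable lborel (\<lambda>x. std_normal_density (0 + ?c * x))"
    by (rule lborel_integrable_real_affine[OF _ c0]) simp
  then have "integrable lborel (\<lambda>x. ?c * (exp (- pi * x\<^sup>2) / ?c))"
    unfolding add_0 d by (rule integrable_mult_right)
  then show i: "integrable lborel (\<lambda>x::real. exp (- pi * x\<^sup>2))" using c0 by simp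
  \<comment> \<open>The characteristic function of the standard normal law is e^(-t^2/2). Scaling
    the variable by sqrt(2 pi) turns its kernel into e^(-2 pi i p x) at this t, and its value into
    e^(-pi p^2).\<close>
  let ?t = "- ?c * p"
  have "of_real (exp (- (?t\<^sup>2) / 2)) = char std_normal_distribution ?t"
    by (simp add: char_std_normal_distribution)
  also have "\<dots> = (\<integral>x. std_normal_density x *\<^sub>R iexp (?t * x) \<partial>lborel)"
    unfolding char_def by (rule integral_density) auto
  also have "\<dots> = \<bar>?c\<bar> *\<^sub>R (\<integral>x. std_normal_density (0 + ?c * x) *\<^sub>R iexp (?t * (0 + ?c * x)) \<partial>lborel)"
    by (rule lborel_integral_real_affine[OF c0])
  also have "\<dots> = (\<integral>x. \<bar>?c\<bar> *\<^sub>R (std_normal_density (0 + ?c * x) *\<^sub>R iexp (?t * (0 + ?c * x))) \<partial>lborel)"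
    by (rule integral_scaleR_right[symmetric])
  also have "\<dots> = fint (\<lambda>x. of_real (exp (- pi * x\<^sup>2))) p"
    unfolding fint_def
  proof (rule Bochner_Integration.integral_cong[OF refl])
    fix x
    have "?t * (0 + ?c * x) = - (?c\<^sup>2 * p * x)" by (simp add: power2_eq_square)
    also have "\<dots> = - (2 * pi * p * x)" by simp
    finally have "iexp (?t * (0 + ?c * x)) = cis (- (2 * pi * p * x))"
      by (simp only: cis_conv_exp)
    then show "\<bar>?c\<bar> *\<^sub>R (std_normal_density (0 + ?c * x) *\<^sub>R iexp (?t * (0 + ?c * x))) =
        cis (- (2 * pi * p * x)) * complex_of_real (exp (- pi * x\<^sup>2))"
      unfolding add_0 d using c0 by (simp add: scaleR_conv_of_real)
  qed
  finally show "fint (\<lambda>x. of_real (exp (- pi * x\<^sup>2))) p = of_real (exp (- pi * p\<^sup>2))"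
    by (simp add: power_mult_distrib)
qed

text \<open>The standard Gaussian times e^(2 pi c x). Since \<open>gss c\<close> is e^(2 pi c x)
  times \<open>gss 0\<close>, testing one vector with \<open>gss c\<close> and another with
  \<open>gss 0\<close> detects the multiplication by e^(2 pi c x).\<close>

definition gss :: "real \<Rightarrow> real \<Rightarrow> real" where "gss c x = exp (- pi * x\<^sup>2 + 2 * pi * c * x)"

lemma gss_measurable [measurable]: "gss c \<in> borel_measurable borel"
  unfolding gss_def by measurable

lemma gss_eq: "gss c x = exp (pi * c\<^sup>2) * exp (- pi * (x - c)\<^sup>2)"
  unfolding gss_def exp_add[symmetric] by (simp add: power2_eq_square algebra_simps)

lemma gss_bound: "gss c x \<le> exp (pi * c\<^sup>2)"
  unfolding gss_eq by (rule mult_left_le) simp_all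

lemma integrable_gss: "integrable lborel (\<lambda>x. complex_of_real (gss c x))"
proof -
  have "integrable lborel (\<lambda>x. exp (- pi * (- c + 1 * x)\<^sup>2))"
    by (rule lborel_integrable_real_affine[OF integrable_gaussian]) simp
  then show ?thesis unfolding gss_eq by (intro integrable_of_real integrable_mult_right) simp
qed

lemma bdd_gss: "bdd_fun (\<lambda>x. complex_of_real (gss c x))"
  by (rule bdd_funI[of _ "exp (pi * c\<^sup>2)"]) (measurable, use gss_bound in \<open>simp add: gss_def\<close>)

lemma square_integrable_gss_cis: "square_integrable (\<lambda>x. cis (b * x) * complex_of_real (gss c x))"
proof (rule square_integrable_mul)
  show "bdd_fun (\<lambda>x. cis (b * x))" by (rule bdd_fun_cis) measurable
  show "square_integrable (\<lambda>x. complex_of_real (gss c x))"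
    by (rule square_integrable_bdd_integrable[OF integrable_gss, of _ "exp (pi * c\<^sup>2)"])
      (use gss_bound[of c] in \<open>simp add: gss_def\<close>)
qed

text \<open>Completing the square for real c moves the centre to c, so a real translation reduces
  the integral to the standard Gaussian. The resulting factors e^(pi c^2) and e^(-2 pi i (p - b) c)
  recombine to the Gaussian at the complex point p - b + i c.\<close>

lemma fint_gss:
  "fint (\<lambda>x. cis (2 * pi * b * x) * complex_of_real (gss c x)) p = exp (- pi * (complex_of_real (p - b) + \<i> * c)\<^sup>2)"
proof -
  have "fint (\<lambda>x. cis (2 * pi * b * x) * complex_of_real (gss c x)) p =
      (\<integral>x. cis (- (2 * pi * (p - b) * x)) * complex_of_real (gss c x) \<partial>lborel)"
    unfolding fint_def
  proof (rule Bochner_Integration.integral_cong[OF refl])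
    fix x
    have "cis (- (2 * pi * (p - b) * x)) = cis (- (2 * pi * p * x)) * cis (2 * pi * b * x)"
      by (simp add: cis_mult algebra_simps)
    then show "cis (- (2 * pi * p * x)) * (cis (2 * pi * b * x) * complex_of_real (gss c x)) =
        cis (- (2 * pi * (p - b) * x)) * complex_of_real (gss c x)"
      by (simp only: mult.assoc)
  qed
  also have "\<dots> = (\<integral>x. cis (- (2 * pi * (p - b) * (c + 1 * x))) * complex_of_real (gss c (c + 1 * x)) \<partial>lborel)"
    by (subst lborel_integral_real_affine[of 1 _ c]) auto
  also have "\<dots> = (\<integral>x. cis (- (2 * pi * (p - b) * c)) * of_real (exp (pi * c\<^sup>2)) *
      (cis (- (2 * pi * (p - b) * x)) * complex_of_real (exp (- pi * x\<^sup>2))) \<partial>lborel)"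
  proof (rule Bochner_Integration.integral_cong[OF refl])
    fix x
    have "cis (- (2 * pi * (p - b) * (c + 1 * x))) = cis (- (2 * pi * (p - b) * c)) * cis (- (2 * pi * (p - b) * x))"
      by (simp add: cis_mult algebra_simps)
    then show "cis (- (2 * pi * (p - b) * (c + 1 * x))) * complex_of_real (gss c (c + 1 * x)) =
      cis (- (2 * pi * (p - b) * c)) * of_real (exp (pi * c\<^sup>2)) *
      (cis (- (2 * pi * (p - b) * x)) * complex_of_real (exp (- pi * x\<^sup>2)))"
      by (simp add: gss_eq)
  qed
  also have "\<dots> = cis (- (2 * pi * (p - b) * c)) * of_real (exp (pi * c\<^sup>2)) * of_real (exp (- pi * (p - b)\<^sup>2))"
    unfolding integral_mult_right_zero fint_def[symmetric] fint_gaussian0 ..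
  also have "\<dots> = exp (- pi * (complex_of_real (p - b) + \<i> * c)\<^sup>2)"
    unfolding cis_conv_exp exp_of_real[symmetric] exp_add[symmetric]
    by (simp add: power2_eq_square algebra_simps)
  finally show ?thesis .
qed

text \<open>No decay of F on individual vertical segments is given, only a uniform L^1 bound on
  horizontal lines. By Tonelli the integral over a vertical segment is itself an integrable function
  of its abscissa, so arbitrarily far out there are abscissas r at which the segments over r and -r
  both contribute little. Rectangles with those sides suffice.\<close>

lemma strip_integral_shift:
  assumes F: "F holomorphic_on {z. a < Im z \<and> Im z < b}"
    and C: "\<And>y. a < y \<Longrightarrow> y < b \<Longrightarrow> (\<integral>\<^sup>+x. ennreal (cmod (F (Complex x y))) \<partial>lborel) \<le> ennreal C"
    and y: "a < y1" "y1 < y2" "y2 < b"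
  shows "(\<integral>x. F (Complex x y1) \<partial>lborel) = (\<integral>x. F (Complex x y2) \<partial>lborel)"
proof -
  let ?S = "{z. a < Im z \<and> Im z < b}"
  have S: "?S = {z. a < Im z} \<inter> {z. Im z < b}" by auto
  have oS: "open ?S" unfolding S by (intro open_Int open_halfspace_Im_gt open_halfspace_Im_lt)
  have cS: "convex ?S" unfolding S by (intro convex_Int convex_halfspace_Im_gt convex_halfspace_Im_lt)
  \<comment> \<open>A primitive on the convex strip replaces a contour integral: horizontal and
    vertical integrals are differences of its values, and the four corners cancel.\<close>
  obtain G where "\<And>z. z \<in> ?S \<Longrightarrow> (G has_field_derivative F z) (at z within ?S)"
    using holomorphic_convex_primitive'[OF cS oS F] by blast
  then have G: "(G has_field_derivative F z) (at z)" if "z \<in> ?S" for z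
    using that at_within_open[OF that oS] by metis
  have cF: "continuous_on ?S F" by (rule holomorphic_on_imp_continuous_on[OF F])
  have cplx: "continuous_on A (\<lambda>p. Complex (fst p) (snd p))" for A :: "(real \<times> real) set"
    unfolding Complex_eq by (intro continuous_intros)
  have contx: "continuous_on A (\<lambda>x. F (Complex x y))" if "a < y" "y < b" for y A
    by (rule continuous_on_compose2[OF cF]) (use that in \<open>auto simp: Complex_eq intro!: continuous_intros\<close>)
  have conty: "continuous_on {y1..y2} (\<lambda>y. F (Complex x y))" for x
    by (rule continuous_on_compose2[OF cF]) (use y in \<open>auto simp: Complex_eq intro!: continuous_intros\<close>)
  have horiz: "(\<integral>x. indicator {- R..R} x *\<^sub>R F (Complex x y) \<partial>lborel) = G (Complex R y) - G (Complex (- R) y)"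
    if "0 \<le> R" "a < y" "y < b" for R y
  proof (rule integral_FTC_Icc)
    fix x assume "- R \<le> x" "x \<le> R"
    have "((\<lambda>x. Complex x y) has_vector_derivative 1) (at x within {- R..R})"
      unfolding Complex_eq by (auto intro!: derivative_eq_intros)
    from field_vector_diff_chain_within[OF this, of G "F (Complex x y)"]
    have "(G \<circ> (\<lambda>x. Complex x y) has_vector_derivative 1 * F (Complex x y)) (at x within {- R..R})"
      using has_field_derivative_at_within[OF G[of "Complex x y"]] that by simp
    then show "((\<lambda>x. G (Complex x y)) has_vector_derivative F (Complex x y)) (at x within {- R..R})"
      by (simp add: o_def)
  qed (use that contx in auto)
  have vert: "cmod (G (Complex r y2) - G (Complex r y1)) \<le> (\<integral>y. indicator {y1..y2} y * cmod (F (Complex r y)) \<partial>lborel)" for r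
  proof -
    have "(\<integral>y. indicator {y1..y2} y *\<^sub>R (\<i> * F (Complex r y)) \<partial>lborel) = G (Complex r y2) - G (Complex r y1)"
    proof (rule integral_FTC_Icc)
      fix t assume "y1 \<le> t" "t \<le> y2"
      have "((\<lambda>y. Complex r y) has_vector_derivative \<i>) (at t within {y1..y2})"
        unfolding Complex_eq by (auto intro!: derivative_eq_intros)
      from field_vector_diff_chain_within[OF this, of G "F (Complex r t)"]
      have "(G \<circ> (\<lambda>y. Complex r y) has_vector_derivative \<i> * F (Complex r t)) (at t within {y1..y2})"
        using has_field_derivative_at_within[OF G[of "Complex r t"]] \<open>y1 \<le> t\<close> \<open>t \<le> y2\<close> y by simp
      then show "((\<lambda>y. G (Complex r y)) has_vector_derivative \<i> * F (Complex r t)) (at t within {y1..y2})"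
        by (simp add: o_def)
    qed (use y conty in \<open>auto intro!: continuous_intros\<close>)
    then have "cmod (G (Complex r y2) - G (Complex r y1)) \<le> (\<integral>y. cmod (indicator {y1..y2} y *\<^sub>R (\<i> * F (Complex r y))) \<partial>lborel)"
      by (metis integral_norm_bound)
    then show ?thesis by (simp add: norm_mult)
  qed
  define J where "J r = (\<integral>\<^sup>+y. ennreal (indicator {y1..y2} y * cmod (F (Complex r y))) \<partial>lborel)" for r
  have Jeq: "J r = ennreal (\<integral>y. indicator {y1..y2} y * cmod (F (Complex r y)) \<partial>lborel)" for r
    unfolding J_def
  proof (rule nn_integral_eq_integral)
    have "set_integrable lborel {y1..y2} (\<lambda>y. cmod (F (Complex r y)))"
      by (intro borel_integrable_atLeastAtMost' continuous_on_norm conty)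
    then show "integrable lborel (\<lambda>y. indicator {y1..y2} y * cmod (F (Complex r y)))"
      by (simp add: set_integrable_def)
  qed simp
  let ?H = "\<lambda>p. indicator (UNIV \<times> {y1..y2}) p *\<^sub>R F (Complex (fst p) (snd p))"
  have "?H \<in> borel_measurable borel"
  proof (rule borel_measurable_continuous_on_indicator)
    show "continuous_on (UNIV \<times> {y1..y2}) (\<lambda>p. F (Complex (fst p) (snd p)))"
      by (rule continuous_on_compose2[OF cF cplx]) (use y in auto)
    show "UNIV \<times> {y1..y2} \<in> sets (borel :: (real \<times> real) measure)"
      by (intro borel_closed closed_Times) auto
  qed
  then have Hm [measurable]: "?H \<in> borel_measurable (lborel \<Otimes>\<^sub>M lborel)"
    unfolding lborel_prod measurable_lborel2 .
  have JH: "J r = (\<integral>\<^sup>+y. ennreal (cmod (?H (r, y))) \<partial>lborel)" for r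
    unfolding J_def by (intro nn_integral_cong) (auto simp: indicator_def)
  have Jm [measurable]: "J \<in> borel_measurable borel"
    unfolding JH by measurable
  have "(\<integral>\<^sup>+r. J r \<partial>lborel) = (\<integral>\<^sup>+y. (\<integral>\<^sup>+r. ennreal (cmod (?H (r, y))) \<partial>lborel) \<partial>lborel)"
    unfolding JH by (rule lborel_pair.Fubini'[symmetric]) measurable
  also have "\<dots> \<le> (\<integral>\<^sup>+y. ennreal C * indicator {y1..y2} y \<partial>lborel)"
  proof (rule nn_integral_mono)
    fix t
    show "(\<integral>\<^sup>+r. ennreal (cmod (?H (r, t))) \<partial>lborel) \<le> ennreal C * indicator {y1..y2} t"
      using C[of t] y by (cases "t \<in> {y1..y2}") auto
  qed
  also have "\<dots> < \<infinity>"
    using y by (simp add: nn_integral_cmult emeasure_lborel_Icc_eq ennreal_mult_less_top)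
  finally have Jfin: "(\<integral>\<^sup>+r. J r \<partial>lborel) < \<infinity>" .
  have Jfin': "(\<integral>\<^sup>+r. J r + J (- r) \<partial>lborel) < \<infinity>"
  proof -
    have "(\<integral>\<^sup>+r. J (- r) \<partial>lborel) = (\<integral>\<^sup>+r. J r \<partial>lborel)"
      using nn_integral_real_affine[OF Jm, of "- 1" 0] by simp
    then show ?thesis using Jfin by (simp add: nn_integral_add)
  qed
  have "\<exists>r\<ge>real n. J r + J (- r) < ennreal (1 / Suc n)" for n
  proof (rule ccontr)
    assume "\<not> (\<exists>r\<ge>real n. J r + J (- r) < ennreal (1 / Suc n))"
    then have J: "ennreal (1 / Suc n) \<le> J r + J (- r)" if "r \<ge> real n" for r
      using that by (meson not_less)
    obtain T where T: "(\<integral>\<^sup>+r. J r + J (- r) \<partial>lborel) = ennreal T" "0 \<le> T"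
      using Jfin' by (cases "\<integral>\<^sup>+r. J r + J (- r) \<partial>lborel") auto
    \<comment> \<open>The length is chosen so that the assumed lower bound 1 / (n + 1) integrates to
      T + 1, more than the total T.\<close>
    let ?K = "{real n..real n + (T + 1) * Suc n}"
    have "ennreal (T + 1) = ennreal (1 / Suc n) * ennreal ((T + 1) * Suc n)"
      using T(2) by (subst ennreal_mult[symmetric]) auto
    also have "\<dots> = ennreal (1 / Suc n) * emeasure lborel ?K"
      using T(2) by (subst emeasure_lborel_Icc) auto
    also have "\<dots> = (\<integral>\<^sup>+r. ennreal (1 / Suc n) * indicator ?K r \<partial>lborel)"
      by (rule nn_integral_cmult_indicator[symmetric]) simp
    also have "\<dots> \<le> (\<integral>\<^sup>+r. J r + J (- r) \<partial>lborel)"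
      by (rule nn_integral_mono) (use J in \<open>auto simp: indicator_def\<close>)
    finally have "ennreal (T + 1) \<le> ennreal T" unfolding T(1) .
    then show False using T(2) by (simp add: ennreal_le_iff)
  qed
  then obtain r where r: "\<And>n. r n \<ge> real n" "\<And>n. J (r n) + J (- r n) < ennreal (1 / Suc n)" by metis
  have r0: "r n \<ge> 0" for n using r(1)[of n] by linarith
  define I where "I y n = (\<integral>x. indicator {- r n..r n} x *\<^sub>R F (Complex x y) \<partial>lborel)" for y n
  have lim: "I y \<longlonglongrightarrow> (\<integral>x. F (Complex x y) \<partial>lborel)" if "a < y" "y < b" for y
    unfolding I_def
  proof (rule integral_dominated_convergence)
    have [measurable]: "(\<lambda>x. F (Complex x y)) \<in> borel_measurable borel"
      by (intro borel_measurable_continuous_onI contx that)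
    show "(\<lambda>x. F (Complex x y)) \<in> borel_measurable lborel" by simp
    show "(\<lambda>x. indicator {- r n..r n} x *\<^sub>R F (Complex x y)) \<in> borel_measurable lborel" for n by measurable
    show "integrable lborel (\<lambda>x. cmod (F (Complex x y)))"
      by (intro integrable_norm integrableI_bounded) (use C[OF that] in \<open>auto intro: le_less_trans\<close>)
    show "AE x in lborel. (\<lambda>n. indicator {- r n..r n} x *\<^sub>R F (Complex x y)) \<longlonglongrightarrow> F (Complex x y)"
    proof (rule AE_I2)
      fix x
      obtain N :: nat where N: "\<bar>x\<bar> \<le> real N" using real_arch_simple by blast
      have "\<forall>\<^sub>F n in sequentially. F (Complex x y) = indicator {- r n..r n} x *\<^sub>R F (Complex x y)"
      proof (rule eventually_sequentiallyI[of N])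
        fix n assume "N \<le> n"
        then have "\<bar>x\<bar> \<le> r n" using N r(1)[of n] by linarith
        then show "F (Complex x y) = indicator {- r n..r n} x *\<^sub>R F (Complex x y)" by (auto simp: indicator_def)
      qed
      then show "(\<lambda>n. indicator {- r n..r n} x *\<^sub>R F (Complex x y)) \<longlonglongrightarrow> F (Complex x y)"
        by (rule Lim_transform_eventually[OF tendsto_const])
    qed
  qed (auto simp: indicator_def)
  have "I y2 n - I y1 n = (G (Complex (r n) y2) - G (Complex (r n) y1)) - (G (Complex (- r n) y2) - G (Complex (- r n) y1))" for n
    unfolding I_def using y by (simp add: horiz r0)
  then have "cmod (I y2 n - I y1 n) \<le> cmod (G (Complex (r n) y2) - G (Complex (r n) y1)) + cmod (G (Complex (- r n) y2) - G (Complex (- r n) y1))" for n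
    by (simp add: norm_triangle_ineq4)
  moreover have "cmod (G (Complex (r n) y2) - G (Complex (r n) y1)) + cmod (G (Complex (- r n) y2) - G (Complex (- r n) y1)) \<le> 1 / Suc n" for n
  proof -
    let ?j = "\<lambda>r. \<integral>y. indicator {y1..y2} y * cmod (F (Complex r y)) \<partial>lborel"
    have j0: "0 \<le> ?j r" for r by (intro Bochner_Integration.integral_nonneg) simp
    have "ennreal (?j (r n) + ?j (- r n)) < ennreal (1 / Suc n)"
      using r(2)[of n] j0 unfolding Jeq by (simp add: ennreal_plus)
    then have "?j (r n) + ?j (- r n) < 1 / Suc n"
      using j0 by (subst (asm) ennreal_less_iff) (auto intro: add_nonneg_nonneg)
    then show ?thesis using vert[of "r n"] vert[of "- r n"] by linarith
  qed
  ultimately have "\<forall>\<^sub>F n in sequentially. norm (I y2 n - I y1 n) \<le> 1 / Suc n"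
    by (meson always_eventually order_trans)
  from Lim_null_comparison[OF this LIMSEQ_Suc[OF lim_inverse_n'[unfolded inverse_eq_divide]]]
  have "(\<lambda>n. I y2 n - I y1 n) \<longlonglongrightarrow> 0" by simp
  moreover have "(\<lambda>n. I y2 n - I y1 n) \<longlonglongrightarrow> (\<integral>x. F (Complex x y2) \<partial>lborel) - (\<integral>x. F (Complex x y1) \<partial>lborel)"
    using y by (intro tendsto_diff lim) auto
  ultimately show ?thesis using LIMSEQ_unique by fastforce
qed

subsection \<open>Boundary values on strips\<close>

lemma open_strip: "open {z. a < Im z \<and> Im z < b}"
proof -
  have "{z. a < Im z \<and> Im z < b} = {z. a < Im z} \<inter> {z. Im z < b}" by auto
  then show ?thesis by (simp add: open_Int open_halfspace_Im_gt open_halfspace_Im_lt)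
qed

lemma holomorphic_strip_measurable:
  assumes "f holomorphic_on {z. a < Im z \<and> Im z < b}" "a < y" "y < b"
  shows "(\<lambda>x. f (Complex x y)) \<in> borel_measurable borel"
proof (rule borel_measurable_continuous_onI)
  show "continuous_on UNIV (\<lambda>x. f (Complex x y))"
    by (rule continuous_on_compose2[OF holomorphic_on_imp_continuous_on[OF assms(1)]])
      (use assms in \<open>auto simp: Complex_eq intro!: continuous_intros\<close>)
qed

lemma strip_approach:
  fixes a b c :: real
  assumes "a < b" "c \<in> {a, b}"
  obtains y :: "nat \<Rightarrow> real" where "\<And>n. a < y n" "\<And>n. y n < b" "y \<longlonglongrightarrow> c"
    "filterlim y (at c within {a<..<b}) sequentially"
proof
  \<comment> \<open>These points move from the midpoint towards c, so one formula serves both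
    edges.\<close>
  define y where "y n = c + ((a + b) / 2 - c) / real (Suc n)" for n
  have ab: "a < y n \<and> y n < b" for n
  proof -
    have d: "0 < (b - a) / 2 / real (Suc n)" using assms(1) by simp
    have le: "(b - a) / 2 / real (Suc n) \<le> (b - a) / 2"
      using assms(1) mult_left_mono[of 1 "real (Suc n)" "(b - a) / 2"]
      by (subst pos_divide_le_eq) auto
    have "a < a + (b - a) / 2 / real (Suc n) \<and> a + (b - a) / 2 / real (Suc n) < b"
      "a < b - (b - a) / 2 / real (Suc n) \<and> b - (b - a) / 2 / real (Suc n) < b"
    proof -
      define e where "e = (b - a) / 2 / real (Suc n)"
      have "e \<le> (b - a) / 2" "0 < e" "a < b" using d le assms(1) by (auto simp: e_def)
      then show "a < a + (b - a) / 2 / real (Suc n) \<and> a + (b - a) / 2 / real (Suc n) < b"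
        "a < b - (b - a) / 2 / real (Suc n) \<and> b - (b - a) / 2 / real (Suc n) < b"
        unfolding e_def[symmetric] by (auto simp: field_simps)
    qed
    moreover have "c = a \<Longrightarrow> y n = a + (b - a) / 2 / real (Suc n)"
      unfolding y_def by (simp add: field_simps)
    moreover have "c = b \<Longrightarrow> y n = b - (b - a) / 2 / real (Suc n)"
      unfolding y_def by (simp add: field_simps)
    ultimately show ?thesis using assms(2) by auto
  qed
  then show "a < y n" "y n < b" for n by auto
  have "(\<lambda>n. ((a + b) / 2 - c) * inverse (real (Suc n))) \<longlonglongrightarrow> ((a + b) / 2 - c) * 0"
    by (intro tendsto_intros LIMSEQ_inverse_real_of_nat)
  from tendsto_add[OF tendsto_const this, of c]
  show l: "y \<longlonglongrightarrow> c"
    unfolding y_def divide_inverse mult_zero_right add_0_right .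
  have ne: "y n \<noteq> c" for n using ab[of n] assms by auto
  show "filterlim y (at c within {a<..<b}) sequentially"
    unfolding filterlim_at using l ab ne by (intro conjI always_eventually allI) auto
qed

text \<open>Contour shifting shows that e^(2 pi y x) times the Fourier integral of M on the line of
  height y does not depend on y, which yields a single N for both edges. The uniform L^2 bound
  carries this to the boundary. Conjugates occur because M will stand in the conjugate-linear slot
  of the inner product, and \<open>Mc\<close> may be any function that equals the boundary limits
  almost everywhere.\<close>

lemma paley_wiener_strip:
  assumes ab: "a < b" and M: "M holomorphic_on {z. a < Im z \<and> Im z < b}"
    and C1: "\<And>y. a < y \<Longrightarrow> y < b \<Longrightarrow> (\<integral>\<^sup>+x. ennreal (cmod (M (Complex x y))) \<partial>lborel) \<le> ennreal C1"
    and C2: "\<And>y. a < y \<Longrightarrow> y < b \<Longrightarrow> (\<integral>\<^sup>+x. ennreal ((cmod (M (Complex x y)))\<^sup>2) \<partial>lborel) \<le> ennreal C2"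
  shows "\<exists>N. \<forall>c\<in>{a, b}. \<forall>Mc.
      (AE p in lborel. ((\<lambda>y. M (Complex p y)) \<longlongrightarrow> Mc p) (at c within {a<..<b})) \<longrightarrow>
      (\<exists>\<Psi>. (AE p in lborel. rep_l2 \<Psi> p = cnj (Mc p)) \<and>
          (AE x in lborel. rep_l2 (inv ft \<Psi>) x = of_real (exp (- 2 * pi * c * x)) * N x))"
proof -
  define y0 where "y0 = (a + b) / 2"
  have y0: "a < y0" "y0 < b" using ab by (auto simp: y0_def)
  note Mm = holomorphic_strip_measurable[OF M]
  have iM: "integrable lborel (\<lambda>x. M (Complex x y))" if "a < y" "y < b" for y
    by (rule integrableI_bounded) (use Mm[OF that] C1[OF that] in \<open>auto intro: le_less_trans\<close>)
  have sM: "square_integrable (\<lambda>x. M (Complex x y))" if "a < y" "y < b" for y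
    unfolding square_integrable_def
  proof
    show m: "(\<lambda>x. M (Complex x y)) \<in> borel_measurable lborel" using Mm[OF that] by simp
    show "integrable lborel (\<lambda>x. (cmod (M (Complex x y)))\<^sup>2)"
    proof (rule integrableI_bounded)
      show "(\<lambda>x. (cmod (M (Complex x y)))\<^sup>2) \<in> borel_measurable lborel" using m by measurable
      have "(\<integral>\<^sup>+x. ennreal (norm ((cmod (M (Complex x y)))\<^sup>2)) \<partial>lborel) \<le> ennreal C2"
        using C2[OF that] by simp
      then show "(\<integral>\<^sup>+x. ennreal (norm ((cmod (M (Complex x y)))\<^sup>2)) \<partial>lborel) < \<infinity>"
        by (rule le_less_trans) simp
    qed
  qed
  \<comment> \<open>The height-independent function, normalised at the arbitrary reference height
    \<open>y0\<close>; its conjugate is the \<open>N\<close> of the statement.\<close>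
  define K where "K x = of_real (exp (2 * pi * y0 * x)) * fint (\<lambda>p. M (Complex p y0)) x" for x
  have K: "fint (\<lambda>p. M (Complex p y)) x = of_real (exp (- 2 * pi * y * x)) * K x" if y: "a < y" "y < b" for y x
  proof -
    \<comment> \<open>On the line of height y this exponential is the Fourier kernel times e^(2 pi y
      x), which is bounded on the strip for fixed x. So F inherits the L^1 bound that the contour
      shift requires.\<close>
    define F where "F z = M z * exp (- (2 * pi * \<i> * x * z))" for z
    have e: "F (Complex p y) = of_real (exp (2 * pi * y * x)) * (cis (- (2 * pi * x * p)) * M (Complex p y))" for p y
    proof -
      have "exp (- (2 * pi * \<i> * x * Complex p y)) = of_real (exp (2 * pi * y * x)) * cis (- (2 * pi * x * p))"
        unfolding cis_conv_exp exp_of_real[symmetric] exp_add[symmetric] Complex_eq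
        by (simp add: algebra_simps)
      then show ?thesis by (simp add: F_def)
    qed
    have intF: "(\<integral>p. F (Complex p y) \<partial>lborel) = of_real (exp (2 * pi * y * x)) * fint (\<lambda>p. M (Complex p y)) x" for y
      unfolding e fint_def by simp
    have Fh: "F holomorphic_on {z. a < Im z \<and> Im z < b}"
      unfolding F_def by (intro holomorphic_intros M)
    define B where "B = exp (2 * pi * ((\<bar>a\<bar> + \<bar>b\<bar>) * \<bar>x\<bar>))"
    have FC: "(\<integral>\<^sup>+p. ennreal (cmod (F (Complex p y))) \<partial>lborel) \<le> ennreal (B * C1)" if "a < y" "y < b" for y
    proof -
      have [measurable]: "(\<lambda>x. M (Complex x y)) \<in> borel_measurable borel" using Mm[OF that] .
      have "y * x \<le> \<bar>y\<bar> * \<bar>x\<bar>" by (metis abs_ge_self abs_mult)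
      also have "\<dots> \<le> (\<bar>a\<bar> + \<bar>b\<bar>) * \<bar>x\<bar>" using that by (intro mult_right_mono) auto
      finally have B: "exp (2 * pi * y * x) \<le> B" unfolding B_def by (simp add: mult.assoc)
      have "(\<integral>\<^sup>+p. ennreal (cmod (F (Complex p y))) \<partial>lborel) \<le> (\<integral>\<^sup>+p. ennreal B * ennreal (cmod (M (Complex p y))) \<partial>lborel)"
        unfolding e norm_mult
        by (intro nn_integral_mono) (use B in \<open>auto simp: ennreal_mult'[symmetric] B_def intro!: ennreal_leI mult_right_mono\<close>)
      also have "\<dots> = ennreal B * (\<integral>\<^sup>+p. ennreal (cmod (M (Complex p y))) \<partial>lborel)"
        by (rule nn_integral_cmult) measurable
      also have "\<dots> \<le> ennreal B * ennreal C1"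
        by (intro mult_left_mono C1 that) simp
      also have "\<dots> = ennreal (B * C1)" by (simp add: ennreal_mult' B_def)
      finally show ?thesis .
    qed
    have "(\<integral>p. F (Complex p y) \<partial>lborel) = (\<integral>p. F (Complex p y0) \<partial>lborel)"
    proof (cases y y0 rule: linorder_cases)
      case less
      with y(1) y0(2) FC show ?thesis
        by (intro strip_integral_shift[OF Fh, where C = "B * C1"])
    next
      case equal
      then show ?thesis by simp
    next
      case greater
      with y(2) y0(1) FC show ?thesis
        by (intro strip_integral_shift[OF Fh, where C = "B * C1", symmetric])
    qed
    then have "of_real (exp (2 * pi * y * x)) * fint (\<lambda>p. M (Complex p y)) x = K x"
      unfolding intF K_def .
    moreover have "complex_of_real (exp (- 2 * pi * y * x)) * of_real (exp (2 * pi * y * x)) = 1"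
      unfolding of_real_mult[symmetric] exp_add[symmetric] by simp
    ultimately show ?thesis by (metis mult.assoc mult_1)
  qed
  have Km [measurable]: "K \<in> borel_measurable borel"
    using Mm[OF y0] unfolding K_def by measurable
  define MY where "MY y = abs_l2 (\<lambda>p. cnj (M (Complex p y)))" for y
  have iM': "integrable lborel (\<lambda>p. cnj (M (Complex p y)))"
    and sM': "square_integrable (\<lambda>p. cnj (M (Complex p y)))" if "a < y" "y < b" for y
    using iM[OF that] sM[OF that] measurable_compose[OF Mm[OF that] borel_measurable_cnj]
    by (auto simp: square_integrable_def)
  have MY: "AE p in lborel. rep_l2 (MY y) p = cnj (M (Complex p y))" if "a < y" "y < b" for y
    unfolding MY_def by (rule AE_rep_abs[OF sM'[OF that]])
  have ftMY: "AE x in lborel. rep_l2 (inv ft (MY y)) x = of_real (exp (- 2 * pi * y * x)) * cnj (K x)"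
    if y: "a < y" "y < b" for y
  proof -
    have "fint (\<lambda>p. cnj (M (Complex p y))) (- x) = cnj (fint (\<lambda>p. M (Complex p y)) x)" for x
    proof -
      have "integrable lborel (\<lambda>p. cis (- (2 * pi * x * p)) * M (Complex p y))"
        by (intro integrable_cis_mult iM y) measurable
      from integral_bounded_linear[OF bounded_linear_cnj this]
      show ?thesis by (simp add: fint_def cis_cnj)
    qed
    moreover have "AE x in lborel. rep_l2 (refl_l2 (ft (MY y))) x = fint (\<lambda>p. cnj (M (Complex p y))) (- x)"
      using AE_rep_refl[of "ft (MY y)"] AE_lborel_uminus[OF ft_integrable[OF iM'[OF y] sM'[OF y]]]
      unfolding MY_def by eventually_elim simp
    ultimately show ?thesis unfolding inv_ft by (auto elim!: eventually_mono simp: K[OF y])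
  qed
  have normMY: "ennreal ((norm (inv ft (MY y)))\<^sup>2) \<le> ennreal C2" if y: "a < y" "y < b" for y
  proof -
    have "ennreal ((norm (inv ft (MY y)))\<^sup>2) = (\<integral>\<^sup>+x. ennreal ((cmod (rep_l2 (MY y) x))\<^sup>2) \<partial>lborel)"
      unfolding isometry_norm[OF unitary_isometry[OF unitary_inv[OF unitary_ft]]] by (rule norm_l2_sq_nn)
    also have "\<dots> = (\<integral>\<^sup>+x. ennreal ((cmod (M (Complex x y)))\<^sup>2) \<partial>lborel)"
      by (rule nn_integral_cong_AE, use MY[OF y] in eventually_elim) simp
    finally show ?thesis using C2[OF y] by simp
  qed
  \<comment> \<open>Square integrability on the two edges comes from Fatou's lemma and the uniform
    bound on the interior lines, by unitarity of the transform.\<close>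
  have sq: "square_integrable (\<lambda>x. of_real (exp (- 2 * pi * c * x)) * cnj (K x))" if c: "c \<in> {a, b}" for c
  proof -
    obtain y where y: "\<And>n. a < y n" "\<And>n. y n < b" "y \<longlonglongrightarrow> c"
      using strip_approach[OF ab c] by metis
    have m: "(\<lambda>x. of_real (exp (- 2 * pi * c * x)) * cnj (K x)) \<in> borel_measurable borel" for c by measurable
    have "(\<integral>\<^sup>+x. ennreal ((cmod (of_real (exp (- 2 * pi * c * x)) * cnj (K x)))\<^sup>2) \<partial>lborel) =
        (\<integral>\<^sup>+x. liminf (\<lambda>n. ennreal ((cmod (of_real (exp (- 2 * pi * y n * x)) * cnj (K x)))\<^sup>2)) \<partial>lborel)"
    proof (rule nn_integral_cong)
      fix x
      have "(\<lambda>n. ennreal ((cmod (of_real (exp (- 2 * pi * y n * x)) * cnj (K x)))\<^sup>2)) \<longlonglongrightarrow>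
          ennreal ((cmod (of_real (exp (- 2 * pi * c * x)) * cnj (K x)))\<^sup>2)"
        by (intro tendsto_intros y)
      then show "ennreal ((cmod (of_real (exp (- 2 * pi * c * x)) * cnj (K x)))\<^sup>2) =
          liminf (\<lambda>n. ennreal ((cmod (of_real (exp (- 2 * pi * y n * x)) * cnj (K x)))\<^sup>2))"
        using lim_imp_Liminf[OF sequentially_bot] by metis
    qed
    also have "\<dots> \<le> liminf (\<lambda>n. \<integral>\<^sup>+x. ennreal ((cmod (of_real (exp (- 2 * pi * y n * x)) * cnj (K x)))\<^sup>2) \<partial>lborel)"
      by (rule nn_integral_liminf) measurable
    also have "\<dots> \<le> ennreal C2"
    proof (rule Liminf_le[OF sequentially_bot], intro always_eventually allI)
      fix n
      have "(\<integral>\<^sup>+x. ennreal ((cmod (of_real (exp (- 2 * pi * y n * x)) * cnj (K x)))\<^sup>2) \<partial>lborel) =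
          ennreal ((norm (inv ft (MY (y n))))\<^sup>2)"
        unfolding norm_l2_sq_nn
        by (rule nn_integral_cong_AE, use ftMY[OF y(1,2), of n] in eventually_elim) (simp only:)
      with normMY[OF y(1,2), of n]
      show "(\<integral>\<^sup>+x. ennreal ((cmod (of_real (exp (- 2 * pi * y n * x)) * cnj (K x)))\<^sup>2) \<partial>lborel) \<le> ennreal C2"
        by (simp only:)
    qed
    finally have le: "(\<integral>\<^sup>+x. ennreal ((cmod (of_real (exp (- 2 * pi * c * x)) * cnj (K x)))\<^sup>2) \<partial>lborel) \<le> ennreal C2" .
    show ?thesis
      unfolding square_integrable_def
    proof
      show "(\<lambda>x. of_real (exp (- 2 * pi * c * x)) * cnj (K x)) \<in> borel_measurable lborel" using m by simp
      show "integrable lborel (\<lambda>x. (cmod (of_real (exp (- 2 * pi * c * x)) * cnj (K x)))\<^sup>2)"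
      proof (rule integrableI_bounded)
        show "(\<lambda>x. (cmod (of_real (exp (- 2 * pi * c * x)) * cnj (K x)))\<^sup>2) \<in> borel_measurable lborel" by measurable
        show "(\<integral>\<^sup>+x. ennreal (norm ((cmod (of_real (exp (- 2 * pi * c * x)) * cnj (K x)))\<^sup>2)) \<partial>lborel) < \<infinity>"
          unfolding real_norm_def abs_power2 by (rule le_less_trans[OF le]) simp
      qed
    qed
  qed
  show ?thesis
  proof (intro exI[of _ "\<lambda>x. cnj (K x)"] ballI allI impI)
    fix c Mc assume c: "c \<in> {a, b}"
      and lim: "AE p in lborel. ((\<lambda>y. M (Complex p y)) \<longlongrightarrow> Mc p) (at c within {a<..<b})"
    obtain y where y: "\<And>n. a < y n" "\<And>n. y n < b" "y \<longlonglongrightarrow> c"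
      and fy: "filterlim y (at c within {a<..<b}) sequentially"
      using strip_approach[OF ab c] by metis
    define H where "H = abs_l2 (\<lambda>x. of_real (exp (- 2 * pi * c * x)) * cnj (K x))"
    have H: "AE x in lborel. rep_l2 H x = of_real (exp (- 2 * pi * c * x)) * cnj (K x)"
      unfolding H_def by (rule AE_rep_abs[OF sq[OF c]])
    \<comment> \<open>For y between a and b, e^(-2 pi y x) is at most the larger of the two edge
      exponentials, whichever sign x has. The sum of the squares at the edges is therefore a
      majorant for all heights.\<close>
    let ?h = "\<lambda>x. (cmod (of_real (exp (- 2 * pi * a * x)) * cnj (K x)))\<^sup>2 + (cmod (of_real (exp (- 2 * pi * b * x)) * cnj (K x)))\<^sup>2"
    have "(\<lambda>n. inv ft (MY (y n))) \<longlonglongrightarrow> H"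
    proof (rule tendsto_l2_dominated)
      show "integrable lborel ?h"
        using sq[of a] sq[of b] by (auto simp: square_integrable_def)
      have "AE x in lborel. \<forall>n. rep_l2 (inv ft (MY (y n))) x = of_real (exp (- 2 * pi * y n * x)) * cnj (K x)"
        using ftMY[OF y(1,2)] by (subst AE_all_countable) auto
      then show "AE x in lborel. (\<lambda>n. rep_l2 (inv ft (MY (y n))) x) \<longlonglongrightarrow> rep_l2 H x"
        using H
      proof eventually_elim
        case (elim x)
        show ?case unfolding elim(1)[rule_format] elim(2) by (intro tendsto_intros y)
      qed
      fix n
      show "AE x in lborel. (cmod (rep_l2 (inv ft (MY (y n))) x))\<^sup>2 \<le> ?h x"
        using ftMY[OF y(1,2), of n]
      proof eventually_elim
        case (elim x)
        have "exp (- 2 * pi * y n * x) \<le> max (exp (- 2 * pi * a * x)) (exp (- 2 * pi * b * x))"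
        proof (cases "x \<ge> 0")
          case True
          then have "a * x \<le> y n * x" using y(1)[of n] by (intro mult_right_mono) auto
          then have "exp (- 2 * pi * y n * x) \<le> exp (- 2 * pi * a * x)" by (simp add: mult.assoc)
          then show ?thesis by (rule max.coboundedI1)
        next
          case False
          then have "b * x \<le> y n * x" using y(2)[of n] by (intro mult_right_mono_neg) auto
          then have "exp (- 2 * pi * y n * x) \<le> exp (- 2 * pi * b * x)" by (simp add: mult.assoc)
          then show ?thesis by (rule max.coboundedI2)
        qed
        then have "(exp (- 2 * pi * y n * x))\<^sup>2 \<le> (exp (- 2 * pi * a * x))\<^sup>2 + (exp (- 2 * pi * b * x))\<^sup>2"
          using power_mono[of "exp (- 2 * pi * y n * x)" "exp (- 2 * pi * a * x)" 2]
            power_mono[of "exp (- 2 * pi * y n * x)" "exp (- 2 * pi * b * x)" 2]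
            zero_le_power2[of "exp (- 2 * pi * a * x)"] zero_le_power2[of "exp (- 2 * pi * b * x)"]
          by (smt (verit) exp_ge_zero)
        then have "(exp (- 2 * pi * y n * x))\<^sup>2 * (cmod (K x))\<^sup>2 \<le>
            ((exp (- 2 * pi * a * x))\<^sup>2 + (exp (- 2 * pi * b * x))\<^sup>2) * (cmod (K x))\<^sup>2"
          by (rule mult_right_mono) simp
        then show ?case
          unfolding elim norm_mult norm_of_real complex_mod_cnj abs_exp_cancel power_mult_distrib distrib_right .
      qed
    qed
    from bounded_linear.tendsto[OF isometry_bounded_linear[OF isometry_ft] this]
    have "(\<lambda>n. MY (y n)) \<longlonglongrightarrow> ft H" using unitary_ft by simp
    from l2_tendsto_AE_subseq[OF this] obtain r where r: "strict_mono r"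
      and rl: "AE p in lborel. (\<lambda>n. rep_l2 (MY (y (r n))) p) \<longlonglongrightarrow> rep_l2 (ft H) p" by blast
    have "AE p in lborel. \<forall>n. rep_l2 (MY (y n)) p = cnj (M (Complex p (y n)))"
      using MY[OF y(1,2)] by (subst AE_all_countable) auto
    then have "AE p in lborel. rep_l2 (ft H) p = cnj (Mc p)"
      using rl lim
    proof eventually_elim
      case (elim p)
      have "(\<lambda>n. M (Complex p (y n))) \<longlonglongrightarrow> Mc p"
        by (rule filterlim_compose[OF elim(3) fy])
      from LIMSEQ_subseq_LIMSEQ[OF this r] have "(\<lambda>n. cnj (M (Complex p (y (r n))))) \<longlonglongrightarrow> cnj (Mc p)"
        by (intro tendsto_cnj) (simp add: o_def)
      with elim(2) show ?case unfolding elim(1)[rule_format] by (rule LIMSEQ_unique)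
    qed
    then show "\<exists>\<Psi>. (AE p in lborel. rep_l2 \<Psi> p = cnj (Mc p)) \<and>
          (AE x in lborel. rep_l2 (inv ft \<Psi>) x = of_real (exp (- 2 * pi * c * x)) * cnj (K x))"
      using H unitary_ft by (intro exI[of _ "ft H"]) simp
  qed
qed

text \<open>Stated through position space instead of analytic continuation, so that its domain is by
  definition that of the exponential of \<Q>.\<close>

definition shift_rel :: "real \<Rightarrow> real l2 operator" where
  "shift_rel c = {(g0, g1). (inv ft g0, inv ft g1) \<in> mult_op (\<lambda>x. exp (complex_of_real (2 * pi * c * x)))}"

section \<open>Reflection and restriction of functions on strips\<close>

lemma strip_function_bound:
  assumes "strip_function a b f" "0 < s"
  obtains C where "0 \<le> C"
    "\<And>y. a < y \<Longrightarrow> y < b \<Longrightarrow> (\<integral>\<^sup>+x. ennreal ((cmod (f (Complex x y)))\<^sup>2 * exp (- s * x\<^sup>2)) \<partial>lborel) \<le> ennreal C"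
proof -
  let ?I = "\<lambda>y. \<integral>\<^sup>+x. ennreal ((cmod (f (Complex x y)))\<^sup>2 * exp (- s * x\<^sup>2)) \<partial>lborel"
  have "(SUP y\<in>{a<..<b}. ?I y) < \<infinity>"
    using assms unfolding strip_function_def by blast
  then obtain C where C: "(SUP y\<in>{a<..<b}. ?I y) = ennreal C" "0 \<le> C"
    unfolding infinity_ennreal_def less_top_ennreal by blast
  show ?thesis
  proof (rule that[OF C(2)])
    fix y assume "a < y" "y < b"
    then show "?I y \<le> ennreal C"
      unfolding C(1)[symmetric] by (intro SUP_upper) auto
  qed
qed

lemma strip_functionI:
  assumes "f holomorphic_on {z. a < Im z \<and> Im z < b}"
    and "\<And>s. 0 < s \<Longrightarrow> \<exists>C. \<forall>y. a < y \<and> y < b \<longrightarrow>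
      (\<integral>\<^sup>+x. ennreal ((cmod (f (Complex x y)))\<^sup>2 * exp (- s * x\<^sup>2)) \<partial>lborel) \<le> ennreal C"
    and "\<And>c. c \<in> {a, b} \<Longrightarrow> AE x in lborel. ((\<lambda>y. f (Complex x y)) \<longlongrightarrow> f (Complex x c)) (at c within {a<..<b})"
  shows "strip_function a b f"
  unfolding strip_function_def
proof (intro conjI allI impI ballI assms(1,3))
  fix s :: real assume "0 < s"
  then obtain C where C: "\<And>y. a < y \<Longrightarrow> y < b \<Longrightarrow>
      (\<integral>\<^sup>+x. ennreal ((cmod (f (Complex x y)))\<^sup>2 * exp (- s * x\<^sup>2)) \<partial>lborel) \<le> ennreal C"
    using assms(2) by blast
  have "(SUP y\<in>{a<..<b}. \<integral>\<^sup>+x. ennreal ((cmod (f (Complex x y)))\<^sup>2 * exp (- s * x\<^sup>2)) \<partial>lborel) \<le> ennreal C"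
    by (rule SUP_least) (use C in auto)
  then show "(SUP y\<in>{a<..<b}. \<integral>\<^sup>+x. ennreal ((cmod (f (Complex x y)))\<^sup>2 * exp (- s * x\<^sup>2)) \<partial>lborel) < \<infinity>"
    by (rule le_less_trans) simp
qed

lemma strip_function_limit:
  assumes "strip_function a b f" "c \<in> {a, b}"
  shows "AE x in lborel. ((\<lambda>y. f (Complex x y)) \<longlongrightarrow> f (Complex x c)) (at c within {a<..<b})"
  using assms unfolding strip_function_def by blast

lemma strip_function_holomorphic:
  "strip_function a b f \<Longrightarrow> f holomorphic_on {z. a < Im z \<and> Im z < b}"
  unfolding strip_function_def by blast

lemma filterlim_uminus_within:
  "filterlim uminus (at (- c) within {- b<..<- a}) (at c within {a<..<b})" for a b c :: real
  unfolding filterlim_at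
  by (intro conjI tendsto_intros) (auto simp: eventually_at_filter)

lemma strip_function_uminus:
  assumes "strip_function a b f"
  shows "strip_function (- b) (- a) (\<lambda>z. f (- z))"
proof (rule strip_functionI)
  note h = strip_function_holomorphic[OF assms]
  have neg: "- Complex x y = Complex (- x) (- y)" for x y by (simp add: complex_eq_iff)
  show "(\<lambda>z. f (- z)) holomorphic_on {z. - b < Im z \<and> Im z < - a}"
    by (rule holomorphic_on_compose_gen[OF _ h, of uminus, unfolded o_def]) (auto intro!: holomorphic_intros)
  show "\<exists>C. \<forall>y. - b < y \<and> y < - a \<longrightarrow>
      (\<integral>\<^sup>+x. ennreal ((cmod (f (- Complex x y)))\<^sup>2 * exp (- s * x\<^sup>2)) \<partial>lborel) \<le> ennreal C" if s: "0 < s" for s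
  proof -
    obtain C where "0 \<le> C" and C: "\<And>y. a < y \<Longrightarrow> y < b \<Longrightarrow>
        (\<integral>\<^sup>+x. ennreal ((cmod (f (Complex x y)))\<^sup>2 * exp (- s * x\<^sup>2)) \<partial>lborel) \<le> ennreal C"
      by (rule strip_function_bound[OF assms s]) blast
    have "(\<integral>\<^sup>+x. ennreal ((cmod (f (- Complex x y)))\<^sup>2 * exp (- s * x\<^sup>2)) \<partial>lborel) \<le> ennreal C"
      if "- b < y" "y < - a" for y
    proof -
      have [measurable]: "(\<lambda>x. f (Complex x (- y))) \<in> borel_measurable borel"
        by (rule holomorphic_strip_measurable[OF h]) (use that in auto)
      have "(\<integral>\<^sup>+x. ennreal ((cmod (f (Complex x (- y))))\<^sup>2 * exp (- s * x\<^sup>2)) \<partial>lborel) =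
          (\<integral>\<^sup>+x. ennreal ((cmod (f (- Complex x y)))\<^sup>2 * exp (- s * x\<^sup>2)) \<partial>lborel)"
        by (subst nn_integral_real_affine[of _ "- 1" 0]) (auto simp: neg)
      then show ?thesis using C[of "- y"] that by simp
    qed
    then show ?thesis by blast
  qed
  fix c assume "c \<in> {- b, - a}"
  then have "- c \<in> {a, b}" by auto
  from AE_lborel_uminus[OF strip_function_limit[OF assms this]]
  show "AE x in lborel. ((\<lambda>y. f (- Complex x y)) \<longlongrightarrow> f (- Complex x c)) (at c within {- b<..<- a})"
  proof eventually_elim
    case (elim x)
    from filterlim_compose[OF elim, of uminus "at c within {- b<..<- a}"] filterlim_uminus_within[of c "- a" "- b"]
    show ?case by (simp add: neg)
  qed
qed

text \<open>Schwarz reflection: conjugating both argument and value keeps holomorphy, moduli and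
  boundary limits, and exchanges the edges.\<close>

lemma strip_function_cnj:
  assumes "strip_function a b f"
  shows "strip_function (- b) (- a) (\<lambda>z. cnj (f (cnj z)))"
proof (rule strip_functionI)
  note h = strip_function_holomorphic[OF assms]
  have "f holomorphic_on cnj ` {z. - b < Im z \<and> Im z < - a}"
    by (rule holomorphic_on_subset[OF h]) auto
  from holomorphic_on_compose_cnj_cnj[OF this open_strip]
  show "(\<lambda>z. cnj (f (cnj z))) holomorphic_on {z. - b < Im z \<and> Im z < - a}"
    by (simp add: o_def)
  show "\<exists>C. \<forall>y. - b < y \<and> y < - a \<longrightarrow>
      (\<integral>\<^sup>+x. ennreal ((cmod (cnj (f (cnj (Complex x y)))))\<^sup>2 * exp (- s * x\<^sup>2)) \<partial>lborel) \<le> ennreal C" if s: "0 < s" for s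
  proof -
    obtain C where "0 \<le> C" and C: "\<And>y. a < y \<Longrightarrow> y < b \<Longrightarrow>
        (\<integral>\<^sup>+x. ennreal ((cmod (f (Complex x y)))\<^sup>2 * exp (- s * x\<^sup>2)) \<partial>lborel) \<le> ennreal C"
      by (rule strip_function_bound[OF assms s]) blast
    show ?thesis
    proof (intro exI[of _ C] allI impI)
      fix y assume "- b < y \<and> y < - a"
      then show "(\<integral>\<^sup>+x. ennreal ((cmod (cnj (f (cnj (Complex x y)))))\<^sup>2 * exp (- s * x\<^sup>2)) \<partial>lborel) \<le> ennreal C"
        using C[of "- y"] by (simp add: complex_cnj)
    qed
  qed
  fix c assume "c \<in> {- b, - a}"
  then have "- c \<in> {a, b}" by auto
  from strip_function_limit[OF assms this]
  show "AE x in lborel. ((\<lambda>y. cnj (f (cnj (Complex x y)))) \<longlongrightarrow> cnj (f (cnj (Complex x c)))) (at c within {- b<..<- a})"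
  proof eventually_elim
    case (elim x)
    from filterlim_compose[OF elim, of uminus "at c within {- b<..<- a}"] filterlim_uminus_within[of c "- a" "- b"]
    have "((\<lambda>y. f (Complex x (- y))) \<longlongrightarrow> f (Complex x (- c))) (at c within {- b<..<- a})" by simp
    then show ?case unfolding complex_cnj by (rule tendsto_cnj)
  qed
qed

text \<open>The new edge, the real line, lies inside the full strip, so the limits there follow from
  continuity. The number \<open>c\<close> may be either of the two edges.\<close>

lemma strip_function_half:
  assumes f: "strip_function (- \<bar>a\<bar>) \<bar>a\<bar> f" and c: "c \<noteq> 0" "\<bar>c\<bar> = \<bar>a\<bar>"
  shows "strip_function (min 0 c) (max 0 c) f"
proof (rule strip_functionI)
  note h = strip_function_holomorphic[OF f]
  have le: "- \<bar>a\<bar> \<le> min 0 c" "max 0 c \<le> \<bar>a\<bar>" using c by auto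
  show "f holomorphic_on {z. min 0 c < Im z \<and> Im z < max 0 c}"
    by (rule holomorphic_on_subset[OF h]) (use le in auto)
  show "\<exists>C. \<forall>y. min 0 c < y \<and> y < max 0 c \<longrightarrow>
      (\<integral>\<^sup>+x. ennreal ((cmod (f (Complex x y)))\<^sup>2 * exp (- s * x\<^sup>2)) \<partial>lborel) \<le> ennreal C" if s: "0 < s" for s
  proof -
    obtain C where "0 \<le> C" and C: "\<And>y. - \<bar>a\<bar> < y \<Longrightarrow> y < \<bar>a\<bar> \<Longrightarrow>
        (\<integral>\<^sup>+x. ennreal ((cmod (f (Complex x y)))\<^sup>2 * exp (- s * x\<^sup>2)) \<partial>lborel) \<le> ennreal C"
      by (rule strip_function_bound[OF f s]) blast
    show ?thesis
    proof (intro exI[of _ C] allI impI)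
      fix y assume "min 0 c < y \<and> y < max 0 c"
      then have "- \<bar>a\<bar> < y" "y < \<bar>a\<bar>" using le by linarith+
      then show "(\<integral>\<^sup>+x. ennreal ((cmod (f (Complex x y)))\<^sup>2 * exp (- s * x\<^sup>2)) \<partial>lborel) \<le> ennreal C"
        by (rule C)
    qed
  qed
  fix d assume "d \<in> {min 0 c, max 0 c}"
  then consider "d = 0" | "d = c" by (auto simp: min_def max_def split: if_splits)
  then show "AE x in lborel. ((\<lambda>y. f (Complex x y)) \<longlongrightarrow> f (Complex x d)) (at d within {min 0 c<..<max 0 c})"
  proof cases
    case 1
    have "isCont (\<lambda>y. f (Complex x y)) 0" for x
    proof (rule isCont_o2[where g = f])
      have "continuous_on {z. - \<bar>a\<bar> < Im z \<and> Im z < \<bar>a\<bar>} f"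
        by (rule holomorphic_on_imp_continuous_on[OF h])
      then show "isCont f (Complex x 0)"
        using c by (subst (asm) continuous_on_eq_continuous_at[OF open_strip]) auto
      show "isCont (\<lambda>y. Complex x y) 0" unfolding Complex_eq by (intro continuous_intros)
    qed
    then show ?thesis
      unfolding 1 by (intro AE_I2) (auto simp: isCont_def intro: tendsto_within_subset)
  next
    case 2
    then have "d \<in> {- \<bar>a\<bar>, \<bar>a\<bar>}" using c by (auto simp: abs_if split: if_splits)
    from strip_function_limit[OF f this] show ?thesis
      by eventually_elim (rule tendsto_within_subset, assumption, use le in auto)
  qed
qed

subsection \<open>Multipliers on strips\<close>

lemma shift_rel_iff:
  "(g0, g1) \<in> shift_rel c \<longleftrightarrow>
    (AE x in lborel. rep_l2 (inv ft g1) x = exp (complex_of_real (2 * pi * c * x)) * rep_l2 (inv ft g0) x)"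
  by (simp add: shift_rel_def mult_op_iff)

text \<open>Testing \<open>(h0, h1)\<close> against modulated Gaussians: pairing \<open>m g\<close> with a Gaussian is pairing \<open>g\<close>
  with the product of \<open>m\<close> and a Gaussian, to which the Paley-Wiener lemma on the strip applies.\<close>

lemma shift_rel_strip_multiplier:
  assumes c: "c \<noteq> 0" and m: "strip_function (min 0 c) (max 0 c) m"
    and g: "(g0, g1) \<in> shift_rel c"
    and h0: "AE x in lborel. rep_l2 h0 x = m (of_real x) * rep_l2 g0 x"
    and h1: "AE x in lborel. rep_l2 h1 x = m (Complex x c) * rep_l2 g1 x"
  shows "(h0, h1) \<in> shift_rel c"
proof -
  let ?a = "min 0 c" and ?b = "max 0 c"
  have ab: "?a < ?b" using c by auto
  note mh = strip_function_holomorphic[OF m]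
  note uft = unitary_cinner[OF unitary_ft] and uift = unitary_cinner[OF unitary_inv[OF unitary_ft]]
  define H0 where "H0 = inv ft h0"
  define H1 where "H1 = inv ft h1"
  \<comment> \<open>The weight is \<open>gss c\<close> or \<open>gss 0\<close>, and the modulation b
    ranges over all reals, so that pairing with these vectors gives a full Fourier integral.\<close>
  define \<kappa> where "\<kappa> d b = abs_l2 (\<lambda>x. cis (2 * pi * b * x) * complex_of_real (gss d x))" for d b
  have \<kappa>: "AE x in lborel. rep_l2 (\<kappa> d b) x = cis (2 * pi * b * x) * complex_of_real (gss d x)" for d b
    unfolding \<kappa>_def by (rule AE_rep_abs[OF square_integrable_gss_cis])
  have ft\<kappa>: "AE p in lborel. rep_l2 (ft (\<kappa> d b)) p = exp (- pi * (complex_of_real (p - b) + \<i> * d)\<^sup>2)" for d b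
  proof -
    have "integrable lborel (\<lambda>x. cis (2 * pi * b * x) * complex_of_real (gss d x))"
      by (intro integrable_cis_mult integrable_gss) measurable
    from ft_integrable[OF this square_integrable_gss_cis] show ?thesis
      unfolding fint_gss \<kappa>_def .
  qed
  have key: "cinner (\<kappa> c b) H0 = cinner (\<kappa> 0 b) H1" for b
  proof -
    \<comment> \<open>This entire function joins the two test vectors: on the real line it is the
      conjugate transform of \<kappa> c b, and on the line of height c that of \<kappa> 0 b.\<close>
    define E where "E z = exp (- pi * (z - b - \<i> * c)\<^sup>2)" for z :: complex
    define M where "M z = m z * E z" for z
    define D where "D = exp (pi * c\<^sup>2 + pi * b\<^sup>2)"
    have Ebound: "cmod (E (Complex x y)) \<le> D * exp (- (pi / 2) * x\<^sup>2)" if "?a < y" "y < ?b" for x y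
    proof -
      have "\<bar>y - c\<bar> \<le> \<bar>c\<bar>" using that by (auto simp: min_def max_def split: if_splits)
      then have yc: "(y - c)\<^sup>2 \<le> c\<^sup>2" by (simp only: abs_le_square_iff)
      have xb: "x\<^sup>2 / 2 - b\<^sup>2 \<le> (x - b)\<^sup>2"
        using zero_le_power2[of "x - 2 * b"] by (simp add: power2_eq_square algebra_simps)
      have "Re (- pi * (Complex x y - b - \<i> * c)\<^sup>2) = pi * ((y - c)\<^sup>2 - (x - b)\<^sup>2)"
        by (simp add: power2_eq_square algebra_simps)
      also have "\<dots> \<le> pi * (c\<^sup>2 - (x\<^sup>2 / 2 - b\<^sup>2))"
        using yc xb by (intro mult_left_mono) auto
      also have "\<dots> = (pi * c\<^sup>2 + pi * b\<^sup>2) + - (pi / 2) * x\<^sup>2" by (simp add: algebra_simps)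
      finally show ?thesis
        unfolding E_def D_def exp_add[symmetric] norm_exp_eq_Re by (simp only: exp_le_cancel_iff)
    qed
    have D0: "0 < D" by (simp add: D_def)
    have Mh: "M holomorphic_on {z. ?a < Im z \<and> Im z < ?b}"
      unfolding M_def E_def by (intro holomorphic_intros mh)
    \<comment> \<open>The L^2 bound needs the growth condition with s = pi, because the bound
      e^(-(pi/2) x^2) on E is squared. The L^1 bound uses s = pi / 2 together with |m| <= |m|^2 +
      1.\<close>
    obtain Cp where Cp: "0 \<le> Cp" "\<And>y. ?a < y \<Longrightarrow> y < ?b \<Longrightarrow>
        (\<integral>\<^sup>+x. ennreal ((cmod (m (Complex x y)))\<^sup>2 * exp (- pi * x\<^sup>2)) \<partial>lborel) \<le> ennreal Cp"
      by (rule strip_function_bound[OF m pi_gt_zero]) blast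
    obtain Cq where Cq: "0 \<le> Cq" "\<And>y. ?a < y \<Longrightarrow> y < ?b \<Longrightarrow>
        (\<integral>\<^sup>+x. ennreal ((cmod (m (Complex x y)))\<^sup>2 * exp (- (pi / 2) * x\<^sup>2)) \<partial>lborel) \<le> ennreal Cq"
      by (rule strip_function_bound[OF m pi_half_gt_zero]) blast
    have gi: "integrable lborel (\<lambda>x. exp (- (pi / 2) * x\<^sup>2))"
      using lborel_integrable_real_affine[OF integrable_gaussian, of "1 / sqrt 2" 0]
      by (simp add: power_divide)
    define T where "T = (\<integral>x. exp (- (pi / 2) * x\<^sup>2) \<partial>lborel)"
    have T: "(\<integral>\<^sup>+x. ennreal (exp (- (pi / 2) * x\<^sup>2)) \<partial>lborel) = ennreal T" "0 \<le> T"
      unfolding T_def using gi by (auto intro!: nn_integral_eq_integral Bochner_Integration.integral_nonneg)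
    have C2: "(\<integral>\<^sup>+x. ennreal ((cmod (M (Complex x y)))\<^sup>2) \<partial>lborel) \<le> ennreal (D\<^sup>2 * Cp)" if y: "?a < y" "y < ?b" for y
    proof -
      have [measurable]: "(\<lambda>x. m (Complex x y)) \<in> borel_measurable borel"
        by (rule holomorphic_strip_measurable[OF mh y])
      have "(cmod (M (Complex x y)))\<^sup>2 \<le> D\<^sup>2 * ((cmod (m (Complex x y)))\<^sup>2 * exp (- pi * x\<^sup>2))" for x
      proof -
        have "cmod (M (Complex x y)) \<le> cmod (m (Complex x y)) * (D * exp (- (pi / 2) * x\<^sup>2))"
          unfolding M_def norm_mult by (intro mult_left_mono Ebound y) simp
        then have "(cmod (M (Complex x y)))\<^sup>2 \<le> (cmod (m (Complex x y)) * (D * exp (- (pi / 2) * x\<^sup>2)))\<^sup>2"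
          by (rule power_mono) simp
        also have "\<dots> = D\<^sup>2 * ((cmod (m (Complex x y)))\<^sup>2 * (exp (- (pi / 2) * x\<^sup>2))\<^sup>2)"
          by (simp only: power_mult_distrib mult_ac)
        also have "(exp (- (pi / 2) * x\<^sup>2))\<^sup>2 = exp (- pi * x\<^sup>2)"
          by (simp only: exp_double[symmetric]) simp
        finally show ?thesis .
      qed
      then have "(\<integral>\<^sup>+x. ennreal ((cmod (M (Complex x y)))\<^sup>2) \<partial>lborel) \<le>
          (\<integral>\<^sup>+x. ennreal (D\<^sup>2) * ennreal ((cmod (m (Complex x y)))\<^sup>2 * exp (- pi * x\<^sup>2)) \<partial>lborel)"
        by (intro nn_integral_mono) (simp only: ennreal_mult'[symmetric, OF zero_le_power2] ennreal_leI)
      also have "\<dots> = ennreal (D\<^sup>2) * (\<integral>\<^sup>+x. ennreal ((cmod (m (Complex x y)))\<^sup>2 * exp (- pi * x\<^sup>2)) \<partial>lborel)"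
        by (rule nn_integral_cmult) measurable
      also have "\<dots> \<le> ennreal (D\<^sup>2) * ennreal Cp" by (intro mult_left_mono Cp y) simp
      also have "\<dots> = ennreal (D\<^sup>2 * Cp)" by (rule ennreal_mult'[symmetric]) simp
      finally show ?thesis .
    qed
    have C1: "(\<integral>\<^sup>+x. ennreal (cmod (M (Complex x y))) \<partial>lborel) \<le> ennreal (D * (Cq + T))" if y: "?a < y" "y < ?b" for y
    proof -
      have [measurable]: "(\<lambda>x. m (Complex x y)) \<in> borel_measurable borel"
        by (rule holomorphic_strip_measurable[OF mh y])
      have "cmod (M (Complex x y)) \<le> D * ((cmod (m (Complex x y)))\<^sup>2 * exp (- (pi / 2) * x\<^sup>2) + exp (- (pi / 2) * x\<^sup>2))" for x
      proof -
        let ?m = "cmod (m (Complex x y))"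
        have "2 * ?m \<le> ?m\<^sup>2 + 1" "0 \<le> ?m"
          using sum_squares_bound[of ?m 1] by simp_all
        then have "?m \<le> ?m\<^sup>2 + 1" by linarith
        have "cmod (M (Complex x y)) \<le> ?m * (D * exp (- (pi / 2) * x\<^sup>2))"
          unfolding M_def norm_mult by (intro mult_left_mono Ebound y) simp
        also have "\<dots> \<le> (?m\<^sup>2 + 1) * (D * exp (- (pi / 2) * x\<^sup>2))"
          using \<open>?m \<le> ?m\<^sup>2 + 1\<close> D0 by (intro mult_right_mono) auto
        finally show ?thesis by (simp add: algebra_simps)
      qed
      then have "(\<integral>\<^sup>+x. ennreal (cmod (M (Complex x y))) \<partial>lborel) \<le>
          (\<integral>\<^sup>+x. ennreal D * (ennreal ((cmod (m (Complex x y)))\<^sup>2 * exp (- (pi / 2) * x\<^sup>2)) + ennreal (exp (- (pi / 2) * x\<^sup>2))) \<partial>lborel)"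
        using D0 by (intro nn_integral_mono) (simp add: ennreal_mult'[symmetric] ennreal_plus[symmetric] ennreal_leI del: ennreal_plus)
      also have "\<dots> = ennreal D * ((\<integral>\<^sup>+x. ennreal ((cmod (m (Complex x y)))\<^sup>2 * exp (- (pi / 2) * x\<^sup>2)) \<partial>lborel) + ennreal T)"
        unfolding T(1)[symmetric] by (subst nn_integral_cmult, measurable, subst nn_integral_add, measurable)
      also have "\<dots> \<le> ennreal D * (ennreal Cq + ennreal T)"
        by (intro mult_left_mono add_right_mono Cq y) simp
      also have "\<dots> = ennreal (D * (Cq + T))"
        using D0 T(2) Cq(1) by (simp add: ennreal_mult' ennreal_plus)
      finally show ?thesis .
    qed
    obtain N where N: "\<forall>d\<in>{?a, ?b}. \<forall>Mc.
        (AE p in lborel. ((\<lambda>y. M (Complex p y)) \<longlongrightarrow> Mc p) (at d within {?a<..<?b})) \<longrightarrow>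
        (\<exists>\<Psi>. (AE p in lborel. rep_l2 \<Psi> p = cnj (Mc p)) \<and>
            (AE x in lborel. rep_l2 (inv ft \<Psi>) x = of_real (exp (- 2 * pi * d * x)) * N x))"
      using paley_wiener_strip[OF ab Mh C1 C2] by blast
    have ex: "\<exists>\<Psi>. (AE p in lborel. rep_l2 \<Psi> p = cnj (M (Complex p d))) \<and>
            (AE x in lborel. rep_l2 (inv ft \<Psi>) x = of_real (exp (- 2 * pi * d * x)) * N x)" if d: "d \<in> {0, c}" for d
    proof (rule N[rule_format])
      show d': "d \<in> {?a, ?b}" using d by auto
      show "AE p in lborel. ((\<lambda>y. M (Complex p y)) \<longlongrightarrow> M (Complex p d)) (at d within {?a<..<?b})"
        using strip_function_limit[OF m d']
      proof eventually_elim
        case (elim p)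
        have "((\<lambda>y. E (Complex p y)) \<longlongrightarrow> E (Complex p d)) (at d within {?a<..<?b})"
          unfolding E_def Complex_eq by (intro tendsto_intros)
        with elim show ?case unfolding M_def by (rule tendsto_mult)
      qed
    qed
    obtain \<Psi>0 where \<Psi>0: "AE p in lborel. rep_l2 \<Psi>0 p = cnj (M (Complex p 0))"
      "AE x in lborel. rep_l2 (inv ft \<Psi>0) x = of_real (exp (- 2 * pi * 0 * x)) * N x"
      using ex[of 0] by blast
    obtain \<Psi>c where \<Psi>c: "AE p in lborel. rep_l2 \<Psi>c p = cnj (M (Complex p c))"
      "AE x in lborel. rep_l2 (inv ft \<Psi>c) x = of_real (exp (- 2 * pi * c * x)) * N x"
      using ex[of c] by blast
    have cexp: "cnj (exp z) = exp (cnj z)" for z by (simp add: exp_cnj)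
    have "cinner (\<kappa> c b) H0 = cinner (ft (\<kappa> c b)) h0"
      using uft[of "\<kappa> c b" H0] unitary_ft by (simp add: H0_def)
    also have "\<dots> = cinner \<Psi>0 g0"
    proof (rule cinner_cong_AE, use ft\<kappa>[of c b] h0 \<Psi>0(1) in eventually_elim)
      case (elim p)
      have "cnj (exp (- pi * (complex_of_real (p - b) + \<i> * c)\<^sup>2)) = E (Complex p 0)"
        unfolding E_def cexp Complex_eq by (simp add: algebra_simps)
      then show ?case using elim by (simp add: M_def complex_of_real_def)
    qed
    also have "\<dots> = cinner (inv ft \<Psi>0) (inv ft g0)" by (simp add: uift)
    also have "\<dots> = cinner (inv ft \<Psi>c) (inv ft g1)"
    proof (rule cinner_cong_AE, use \<Psi>0(2) \<Psi>c(2) g[unfolded shift_rel_iff] in eventually_elim)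
      case (elim x)
      have "complex_of_real (exp (- 2 * pi * c * x)) * exp (complex_of_real (2 * pi * c * x)) = 1"
        unfolding exp_of_real of_real_mult[symmetric] exp_add[symmetric] by simp
      moreover have "cnj (rep_l2 (inv ft \<Psi>c) x) * rep_l2 (inv ft g1) x =
          (complex_of_real (exp (- 2 * pi * c * x)) * exp (complex_of_real (2 * pi * c * x))) * (cnj (N x) * rep_l2 (inv ft g0) x)"
        unfolding elim complex_cnj_mult complex_cnj_complex_of_real by (simp only: mult_ac)
      ultimately show ?case unfolding elim(1) by simp
    qed
    also have "\<dots> = cinner \<Psi>c g1" by (simp add: uift)
    also have "\<dots> = cinner (ft (\<kappa> 0 b)) h1"
    proof (rule cinner_cong_AE, use ft\<kappa>[of 0 b] h1 \<Psi>c(1) in eventually_elim)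
      case (elim p)
      have "cnj (exp (- pi * (complex_of_real (p - b) + \<i> * 0)\<^sup>2)) = E (Complex p c)"
        unfolding E_def cexp Complex_eq by (simp add: algebra_simps)
      then show ?case using elim by (simp add: M_def)
    qed
    also have "\<dots> = cinner (\<kappa> 0 b) H1"
      using uft[of "\<kappa> 0 b" H1] unitary_ft by (simp add: H1_def)
    finally show ?thesis .
  qed
  \<comment> \<open>The equality of pairings for all b says that the Fourier integral of
    \<open>Y\<close> vanishes identically, so \<open>Y\<close> is zero almost everywhere. Dividing
    by \<open>gss 0\<close> gives the relation between \<open>H0\<close> and
    \<open>H1\<close>.\<close>
  define Y where "Y x = complex_of_real (gss c x) * rep_l2 H0 x + - 1 * (complex_of_real (gss 0 x) * rep_l2 H1 x)" for x
  have Ysq: "square_integrable Y"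
    unfolding Y_def by (intro square_integrable_add square_integrable_scale square_integrable_mul bdd_gss square_integrable_rep)
  have gsq: "square_integrable (\<lambda>x. complex_of_real (gss d x))" for d
    using square_integrable_gss_cis[of 0 d] by simp
  have gin: "integrable lborel (\<lambda>x. complex_of_real (gss d x) * rep_l2 H x)" for d H
    using square_integrable_prod[OF gsq[of d] square_integrable_rep[of H]] by simp
  have Yi: "integrable lborel Y"
    unfolding Y_def by (intro Bochner_Integration.integrable_add integrable_mult_right gin)
  have "fint Y b = 0" for b
  proof -
    have ci: "cinner (\<kappa> d b) H = (\<integral>x. cis (- (2 * pi * b * x)) * (complex_of_real (gss d x) * rep_l2 H x) \<partial>lborel)" for d H
    proof -
      have "cinner (\<kappa> d b) H = (\<integral>x. cnj (cis (2 * pi * b * x) * complex_of_real (gss d x)) * rep_l2 H x \<partial>lborel)"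
        by (rule cinner_AE[OF \<kappa> AE_I2]) simp_all
      then show ?thesis by (simp add: cis_cnj mult.assoc)
    qed
    have ii: "integrable lborel (\<lambda>x. cis (- (2 * pi * b * x)) * (complex_of_real (gss d x) * rep_l2 H x))" for d H
      by (intro integrable_cis_mult gin) measurable
    have "fint Y b = cinner (\<kappa> c b) H0 - cinner (\<kappa> 0 b) H1"
      unfolding ci Bochner_Integration.integral_diff[OF ii ii, symmetric] fint_def Y_def
      by (simp add: algebra_simps)
    then show ?thesis using key by simp
  qed
  then have F0: "AE p in lborel. rep_l2 (ft (abs_l2 Y)) p = 0"
    using ft_integrable[OF Yi Ysq] by simp
  have "ft (abs_l2 Y) = 0"
    by (rule l2_eqI, use F0 AE_rep_zero[where 'a=real] in eventually_elim) simp
  then have "norm (abs_l2 Y) = 0"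
    using isometry_norm[OF isometry_ft, of "abs_l2 Y"] by simp
  then have Y0: "AE x in lborel. Y x = 0"
    using AE_rep_abs[OF Ysq] AE_rep_zero[where 'a=real] by (auto elim!: eventually_elim2)
  then show ?thesis
    unfolding shift_rel_iff H0_def[symmetric] H1_def[symmetric]
  proof eventually_elim
    case (elim x)
    have "gss c x = gss 0 x * exp (2 * pi * c * x)"
      by (simp add: gss_def exp_add[symmetric])
    moreover have "gss 0 x \<noteq> 0" by (simp add: gss_def)
    ultimately show ?case using elim unfolding Y_def exp_of_real by simp
  qed
qed

lemma inv_ft_refl: "inv ft (refl_l2 \<phi>) = refl_l2 (inv ft \<phi>)"
  by (simp add: inv_ft ft_refl)

lemma shift_rel_refl: "(refl_l2 g0, refl_l2 g1) \<in> shift_rel c \<longleftrightarrow> (g0, g1) \<in> shift_rel (- c)"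
proof -
  have "(refl_l2 g0, refl_l2 g1) \<in> shift_rel c" if "(g0, g1) \<in> shift_rel (- c)" for g0 g1 c
    unfolding shift_rel_iff inv_ft_refl
    using AE_rep_refl[of "inv ft g0"] AE_rep_refl[of "inv ft g1"] AE_lborel_uminus[OF that[unfolded shift_rel_iff]]
    by eventually_elim simp
  from this[of g0 g1 c] this[of "refl_l2 g0" "refl_l2 g1" "- c"] show ?thesis by auto
qed

section \<open>The functions f and the unitaries made from w and v\<close>

lemma f_fun_cnj: "cnj (f_fun a b x) = f_fun (- a) b x"
proof -
  have "cnj (sinh z) = sinh (cnj z)" for z :: complex by (simp add: sinh_def exp_cnj)
  moreover have "cnj (complex_of_real (pi * b) * Complex (2 * x) a) = complex_of_real (pi * b) * Complex (2 * x) (- a)"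
    by (simp add: complex_eq_iff)
  moreover have "cnj (- 2 * z) = - 2 * cnj z" for z by simp
  ultimately show ?thesis by (simp only: f_fun_def)
qed

lemma f_fun_uminus: "f_fun a b (- x) = - f_fun (- a) b x"
proof -
  have "complex_of_real (pi * b) * Complex (2 * - x) a = - (complex_of_real (pi * b) * Complex (2 * x) (- a))"
    by (simp add: complex_eq_iff)
  then show ?thesis unfolding f_fun_def by (simp only: sinh_minus mult_minus_right)
qed

text \<open>The imaginary part of sinh(s + i t) is cosh(s) sin(t), of modulus at least |sin t|. This
  uniform lower bound makes 1 / f a bounded multiplier.\<close>

lemma f_fun_ge: "cmod (f_fun a b x) \<ge> 2 * \<bar>sin (pi * b * a)\<bar>"
proof -
  have "\<bar>Im (sinh z)\<bar> \<ge> \<bar>sin (Im z)\<bar>" for z :: complex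
  proof -
    have "Im (sinh z) = cosh (Re z) * sin (Im z)"
      by (simp add: sinh_def cosh_def Im_exp algebra_simps)
    moreover have "1 * \<bar>sin (Im z)\<bar> \<le> cosh (Re z) * \<bar>sin (Im z)\<bar>"
      by (intro mult_right_mono cosh_real_ge_1) simp
    ultimately show ?thesis by (simp add: abs_mult)
  qed
  from this[of "complex_of_real (pi * b) * Complex (2 * x) a"]
  have "\<bar>sin (pi * b * a)\<bar> \<le> cmod (sinh (complex_of_real (pi * b) * Complex (2 * x) a))"
    using abs_Im_le_cmod order_trans by fastforce
  then show ?thesis by (simp add: f_fun_def norm_mult)
qed

lemma f_fun_measurable [measurable]: "f_fun a b \<in> borel_measurable borel"
  unfolding f_fun_def sinh_def Complex_eq
  by (intro borel_measurable_continuous_onI continuous_intros)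

text \<open>A function on the strip is constrained at an edge only through limits at almost every
  point. Its edge values are recovered as pointwise limits along a sequence of interior lines, where
  it is continuous.\<close>

lemma strip_function_boundary_measurable:
  assumes f: "strip_function a b f" and ab: "a < b" "c \<in> {a, b}"
  obtains g where "g \<in> borel_measurable borel" "AE x in lborel. f (Complex x c) = g x"
proof -
  obtain y where y: "\<And>n. a < y n" "\<And>n. y n < b" "filterlim y (at c within {a<..<b}) sequentially"
    using strip_approach[OF ab] by metis
  have [measurable]: "(\<lambda>x. f (Complex x (y n))) \<in> borel_measurable borel" for n
    by (rule holomorphic_strip_measurable[OF strip_function_holomorphic[OF f] y(1,2)])
  show ?thesis
  proof (rule that)
    show "(\<lambda>x. lim (\<lambda>n. f (Complex x (y n)))) \<in> borel_measurable borel" by measurable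
    show "AE x in lborel. f (Complex x c) = lim (\<lambda>n. f (Complex x (y n)))"
      using strip_function_limit[OF f ab(2)]
    proof eventually_elim
      case (elim x)
      show ?case by (rule limI[symmetric, OF filterlim_compose[OF elim y(3)]])
    qed
  qed
qed

lemma mul_l2_unimodular_unitary:
  assumes [measurable]: "g \<in> borel_measurable borel" and g: "\<And>x. cmod (g x) = 1"
  shows "unitary_map (mul_l2 g)"
proof -
  have b: "bdd_fun g" by (rule bdd_funI[of _ 1]) (use g in auto)
  have c: "bdd_fun (\<lambda>x. cnj (g x))" by (rule bdd_fun_cnj[OF b])
  have 1: "cnj (g x) * g x = 1" "g x * cnj (g x) = 1" for x
    using g[of x] complex_norm_square[of "g x"] by (simp_all add: mult.commute)
  have one: "mul_l2 (\<lambda>_. 1) \<phi> = \<phi>" for \<phi> :: "'a l2" by (rule mul_l2_eqI) auto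
  show ?thesis
    unfolding unitary_map_def
  proof
    show "surj (mul_l2 g)"
      by (rule surjI[of _ "mul_l2 (\<lambda>x. cnj (g x))"]) (simp add: mul_l2_mul_l2 b c 1 one)
    show "\<forall>\<phi> \<psi>. cinner (mul_l2 g \<phi>) (mul_l2 g \<psi>) = cinner \<phi> \<psi>"
      by (simp add: cinner_mul_left b mul_l2_mul_l2 c 1 one)
  qed
qed

lemma reflection_op_eq: "reflection_op = {(\<phi>, refl_l2 \<phi>) |\<phi>. True}"
  unfolding reflection_op_def using AE_rep_refl refl_l2_eqI by fastforce

text \<open>The functional calculus does not distinguish \<open>w\<close> from its measurable
  unimodular version \<open>W\<close>, which makes the multiplication unitary. Since the reflection
  commutes with the transform, on the Fourier side the conjugate of \<open>w\<close> is evaluated at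
  -p.\<close>

lemma u_conj_unitary:
  assumes W: "W \<in> borel_measurable borel" "\<And>x. cmod (W x) = 1"
    and w: "AE x in lborel. w (complex_of_real x) = W x"
  obtains U where "unitary_map U" "u_conj w = {(\<phi>, U \<phi>) |\<phi>. True}"
    "\<And>\<phi>. AE p in lborel. rep_l2 (ft (U \<phi>)) p = cnj (w (complex_of_real (- p))) * rep_l2 (ft \<phi>) (- p)"
proof -
  have W': "(\<lambda>x. cnj (W x)) \<in> borel_measurable borel" "cmod (cnj (W x)) = 1" for x
    using W by auto
  have b: "bdd_fun (\<lambda>x. cnj (W x))" by (rule bdd_funI[of _ 1]) (use W' in auto)
  define U where "U = refl_l2 \<circ> (inv ft \<circ> (mul_l2 (\<lambda>x. cnj (W x)) \<circ> ft))"
  show ?thesis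
  proof (rule that[of U])
    show "unitary_map U"
      unfolding U_def
      by (intro unitary_comp unitary_refl unitary_inv unitary_ft mul_l2_unimodular_unitary W')
    have "(\<phi>, \<xi>) \<in> fun_calc (\<lambda>x. cnj (w (complex_of_real x))) \<P> \<longleftrightarrow> \<xi> = inv ft (mul_l2 (\<lambda>x. cnj (W x)) (ft \<phi>))" for \<phi> \<xi>
    proof -
      have "(\<phi>, \<xi>) \<in> fun_calc (\<lambda>x. cnj (w (complex_of_real x))) \<P> \<longleftrightarrow>
          (AE p in lborel. rep_l2 (ft \<xi>) p = cnj (w (complex_of_real p)) * rep_l2 (ft \<phi>) p)"
        by (simp add: fun_calc_momentum mult_op_iff)
      also have "\<dots> \<longleftrightarrow> (AE p in lborel. rep_l2 (ft \<xi>) p = cnj (W p) * rep_l2 (ft \<phi>) p)"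
        by (rule eventually_cong[OF w]) simp
      also have "\<dots> \<longleftrightarrow> ft \<xi> = mul_l2 (\<lambda>x. cnj (W x)) (ft \<phi>)"
        using AE_rep_mul[OF b, of "ft \<phi>"] mul_l2_eqI[OF b, of "ft \<xi>" "ft \<phi>"] by auto
      also have "\<dots> \<longleftrightarrow> \<xi> = inv ft (mul_l2 (\<lambda>x. cnj (W x)) (ft \<phi>))"
        using unitary_inv_apply[OF unitary_ft] by metis
      finally show ?thesis .
    qed
    then show "u_conj w = {(\<phi>, U \<phi>) |\<phi>. True}"
      unfolding u_conj_def reflection_op_eq U_def by (auto simp: relcomp_unfold)
    fix \<phi>
    have "ft (U \<phi>) = refl_l2 (mul_l2 (\<lambda>x. cnj (W x)) (ft \<phi>))"
      unfolding U_def by (simp add: ft_refl unitary_ft)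
    then show "AE p in lborel. rep_l2 (ft (U \<phi>)) p = cnj (w (complex_of_real (- p))) * rep_l2 (ft \<phi>) (- p)"
      using AE_rep_refl[of "mul_l2 (\<lambda>x. cnj (W x)) (ft \<phi>)"] AE_lborel_uminus[OF AE_rep_mul[OF b, of "ft \<phi>"]]
        AE_lborel_uminus[OF w] by (auto elim!: eventually_elim2)
  qed
qed

section \<open>The operators on the Fourier side and the intertwining relations\<close>

lemma exp_op_position_iff:
  "(\<phi>, \<psi>) \<in> exp_op (2 * pi * a) \<Q> \<longleftrightarrow> (ft \<phi>, ft \<psi>) \<in> shift_rel a"
  unfolding fun_calc_position shift_rel_def using unitary_ft by simp

text \<open>The witness is the vector between the two factors of L; its existence encodes the
  natural domain of the product.\<close>

lemma L_op_iff:
  "(\<phi>, \<psi>) \<in> L_op a b \<longleftrightarrow> (\<exists>\<xi>. (ft \<phi>, \<xi>) \<in> shift_rel (- a) \<and>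
    (AE p in lborel. rep_l2 (ft \<psi>) p = cnj (f_fun a b p) * rep_l2 \<xi> p))"
proof -
  have "- 2 * pi * a = 2 * pi * (- a)" by simp
  then have "(\<phi>, \<psi>) \<in> L_op a b \<longleftrightarrow> (\<exists>\<xi>. (ft \<phi>, ft \<xi>) \<in> shift_rel (- a) \<and>
    (AE p in lborel. rep_l2 (ft \<psi>) p = cnj (f_fun a b p) * rep_l2 (ft \<xi>) p))"
    unfolding L_op_def relcomp_unfold fun_calc_momentum
    by (simp only: exp_op_position_iff) (simp add: mult_op_iff)
  also have "\<dots> \<longleftrightarrow> (\<exists>\<xi>. (ft \<phi>, \<xi>) \<in> shift_rel (- a) \<and>
    (AE p in lborel. rep_l2 (ft \<psi>) p = cnj (f_fun a b p) * rep_l2 \<xi> p))"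
  proof (intro iffI; elim exE)
    fix \<xi> assume "(ft \<phi>, \<xi>) \<in> shift_rel (- a) \<and>
      (AE p in lborel. rep_l2 (ft \<psi>) p = cnj (f_fun a b p) * rep_l2 \<xi> p)"
    then show "\<exists>\<xi>. (ft \<phi>, ft \<xi>) \<in> shift_rel (- a) \<and>
      (AE p in lborel. rep_l2 (ft \<psi>) p = cnj (f_fun a b p) * rep_l2 (ft \<xi>) p)"
      using unitary_inv_apply(2)[OF unitary_ft, of \<xi>] by (intro exI[of _ "inv ft \<xi>"]) simp
  qed (rule exI)
  finally show ?thesis .
qed

text \<open>The sine condition is the form in which the restriction on \<gamma> enters: it keeps f_a
  and f_{-a} bounded away from zero.\<close>

locale wv =
  fixes a b :: real and w v :: "complex \<Rightarrow> complex"
  assumes wv: "wv_pair a b w v" and a0: "a \<noteq> 0" and sin0: "sin (pi * b * a) \<noteq> 0"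
begin

lemma v_strip: "strip_function (- \<bar>a\<bar>) \<bar>a\<bar> v"
  and w_strip: "strip_function (min 0 a) (max 0 a) w"
  using wv by (auto simp: wv_pair_def)

lemma unimodular:
  "AE x in lborel. w (of_real x) * cnj (w (of_real x)) = 1"
  "AE x in lborel. v (of_real x) * cnj (v (of_real x)) = 1"
proof -
  have *: "AE x in lborel. cmod (w (of_real x)) = 1 \<and> cmod (v (of_real x)) = 1"
    using wv by (simp add: wv_pair_def)
  have "z * cnj z = 1" if "cmod z = 1" for z
    using that complex_norm_square[of z] by simp
  then show "AE x in lborel. w (of_real x) * cnj (w (of_real x)) = 1"
    "AE x in lborel. v (of_real x) * cnj (v (of_real x)) = 1"
    by (rule eventually_mono[OF *], blast)+
qed

lemma f_nonzero: "f_fun c b x \<noteq> 0" if "\<bar>c\<bar> = \<bar>a\<bar>"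
proof -
  have "\<bar>sin (pi * b * c)\<bar> = \<bar>sin (pi * b * a)\<bar>"
    using that by (auto simp: abs_if split: if_splits)
  then show ?thesis using f_fun_ge[of b c x] sin0 by auto
qed

lemma v_shift_minus: "AE x in lborel. v (Complex x (- a)) = w (of_real x) / f_fun (- a) b x"
proof -
  have "AE x in lborel. w (of_real x) = f_fun (- a) b x * v (Complex x (- a))"
    using wv by (simp add: wv_pair_def)
  then show ?thesis by eventually_elim (simp add: f_nonzero)
qed

lemma v_shift_plus: "AE x in lborel. v (Complex x a) = f_fun a b x * w (of_real x)"
  using wv by (simp add: wv_pair_def)

lemma bdd_inverse_f:
  assumes "\<bar>c\<bar> = \<bar>a\<bar>"
  shows "bdd_fun (\<lambda>x. 1 / f_fun c b x)"
proof (rule bdd_funI[of _ "1 / (2 * \<bar>sin (pi * b * c)\<bar>)"])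
  have "\<bar>sin (pi * b * c)\<bar> = \<bar>sin (pi * b * a)\<bar>"
    using assms by (auto simp: abs_if split: if_splits)
  then have "0 < 2 * \<bar>sin (pi * b * c)\<bar>" using sin0 by simp
  then show "cmod (1 / f_fun c b x) \<le> 1 / (2 * \<bar>sin (pi * b * c)\<bar>)" for x
    using f_fun_ge[of b c x] by (simp add: norm_divide frac_le)
qed measurable

lemma strip_v_uminus: "\<bar>c\<bar> = \<bar>a\<bar> \<Longrightarrow> strip_function (min 0 c) (max 0 c) (\<lambda>z. v (- z))"
  using strip_function_half[OF strip_function_uminus[OF v_strip, unfolded minus_minus], of c] a0 by auto

text \<open>By unimodularity this function and v(-z) are inverse to each other on the real line.
  They are the multipliers for applying and for undoing the unitary \<open>Uv\<close>, and each
  serves shifts by a and by -a.\<close>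

lemma strip_v_cnj: "\<bar>c\<bar> = \<bar>a\<bar> \<Longrightarrow> strip_function (min 0 c) (max 0 c) (\<lambda>z. cnj (v (- cnj z)))"
  using strip_function_half[OF strip_function_cnj[OF strip_function_uminus[OF v_strip, unfolded minus_minus], unfolded minus_minus], of c] a0
  by auto

text \<open>Replacing the exceptional values by 1 gives modulus one everywhere, as required of a
  unitary multiplication.\<close>

lemma unimodular_representative:
  assumes "strip_function c d f" "c < d" "AE x in lborel. cmod (f (of_real x)) = 1" "0 \<in> {c, d}"
  obtains W where "W \<in> borel_measurable borel" "\<And>x. cmod (W x) = 1"
    "AE x in lborel. f (complex_of_real x) = W x"
proof -
  obtain g where g [measurable]: "g \<in> borel_measurable borel" and eq: "AE x in lborel. f (Complex x 0) = g x"
    using strip_function_boundary_measurable[OF assms(1,2,4)] .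
  show ?thesis
  proof (rule that)
    show "(\<lambda>x. if cmod (g x) = 1 then g x else 1) \<in> borel_measurable borel" by measurable
    show "AE x in lborel. f (complex_of_real x) = (if cmod (g x) = 1 then g x else 1)"
      using eq assms(3) by eventually_elim (simp add: complex_of_real_def)
  qed simp
qed

end

locale wv_ops = wv +
  fixes Uw Uv :: "real l2 \<Rightarrow> real l2"
  assumes Uw: "unitary_map Uw" and Uv: "unitary_map Uv"
    and ftUw: "\<And>\<phi>. AE p in lborel. rep_l2 (ft (Uw \<phi>)) p = cnj (w (complex_of_real (- p))) * rep_l2 (ft \<phi>) (- p)"
    and ftUv: "\<And>\<phi>. AE p in lborel. rep_l2 (ft (Uv \<phi>)) p = cnj (v (complex_of_real (- p))) * rep_l2 (ft \<phi>) (- p)"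
begin

text \<open>The arguments carry \<open>Uv\<close> and the values \<open>Uw\<close>, because
  multiplication by values of v becomes multiplication by values of w after the shift. Undoing the
  reflection reverses the shift to -a, the one contained in L, and the sign is that of f_a(-x) =
  -f_{-a}(x).\<close>

lemma exp_position_conj_L:
  "(\<phi>, \<psi>) \<in> exp_op (2 * pi * a) \<Q> \<longleftrightarrow> (Uv \<phi>, - Uw \<psi>) \<in> L_op a b"
proof
  assume "(\<phi>, \<psi>) \<in> exp_op (2 * pi * a) \<Q>"
  then have sh: "(refl_l2 (ft \<phi>), refl_l2 (ft \<psi>)) \<in> shift_rel (- a)"
    by (simp only: exp_op_position_iff shift_rel_refl minus_minus)
  obtain W where W: "W \<in> borel_measurable borel" "\<And>x. cmod (W x) = 1" "AE x in lborel. w (complex_of_real x) = W x"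
    by (rule unimodular_representative[OF w_strip]) (use a0 wv in \<open>auto simp: wv_pair_def min_def max_def elim!: eventually_mono\<close>)
  have Wm: "(\<lambda>x. cnj (W (- x))) \<in> borel_measurable borel" using W(1) by measurable
  have bk: "bdd_fun (\<lambda>x. cnj (W (- x)) * (1 / f_fun a b (- x)))"
  proof (rule bdd_fun_mult)
    show "bdd_fun (\<lambda>x. cnj (W (- x)))" by (rule bdd_funI[of _ 1]) (use W Wm in auto)
    have "(\<lambda>x. 1 / f_fun a b (- x)) = (\<lambda>x. (- 1) * (1 / f_fun (- a) b x))"
      by (simp add: f_fun_uminus)
    then show "bdd_fun (\<lambda>x. 1 / f_fun a b (- x))"
      using bdd_fun_mult[OF bdd_fun_const bdd_inverse_f, of "- a" "- 1"] by simp
  qed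
  \<comment> \<open>The intermediate vector for L. Its coefficient is conj(v(-x - i a)) =
    conj(w(-x)) / f_a(-x), so the functional equation at height -a identifies it and the lower bound
    on f keeps it square integrable.\<close>
  define h1 where "h1 = mul_l2 (\<lambda>x. cnj (W (- x)) * (1 / f_fun a b (- x))) (refl_l2 (ft \<psi>))"
  have h1: "AE x in lborel. rep_l2 h1 x = cnj (w (of_real (- x))) / f_fun a b (- x) * rep_l2 (ft \<psi>) (- x)"
    unfolding h1_def
    using AE_rep_mul[OF bk, of "refl_l2 (ft \<psi>)"] AE_lborel_uminus[OF W(3)] AE_rep_refl[of "ft \<psi>"]
    by eventually_elim simp
  have "(ft (Uv \<phi>), h1) \<in> shift_rel (- a)"
  proof (rule shift_rel_strip_multiplier[OF _ strip_v_cnj sh])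
    show "AE x in lborel. rep_l2 (ft (Uv \<phi>)) x = cnj (v (- cnj (of_real x))) * rep_l2 (refl_l2 (ft \<phi>)) x"
      using ftUv[of \<phi>] AE_rep_refl[of "ft \<phi>"] by eventually_elim simp
    show "AE x in lborel. rep_l2 h1 x = cnj (v (- cnj (Complex x (- a)))) * rep_l2 (refl_l2 (ft \<psi>)) x"
      using h1 AE_rep_refl[of "ft \<psi>"] AE_lborel_uminus[OF v_shift_minus]
    proof eventually_elim
      case (elim x)
      have "- cnj (Complex x (- a)) = Complex (- x) (- a)" by (simp add: complex_eq_iff)
      then show ?case using elim by (simp add: f_fun_cnj)
    qed
  qed (use a0 in auto)
  moreover have "AE p in lborel. rep_l2 (ft (- Uw \<psi>)) p = cnj (f_fun a b p) * rep_l2 h1 p"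
  proof -
    have neg: "ft (- Uw \<psi>) = - ft (Uw \<psi>)"
      by (rule linear_neg[OF bounded_linear.linear[OF isometry_bounded_linear[OF isometry_ft]]])
    show ?thesis
      unfolding neg using h1 AE_rep_uminus[of "ft (Uw \<psi>)"] ftUw[of \<psi>]
    proof eventually_elim
      case (elim p)
      have "f_fun (- a) b p \<noteq> 0" by (rule f_nonzero) simp
      then show ?case using elim by (simp add: f_fun_cnj f_fun_uminus)
    qed
  qed
  ultimately show "(Uv \<phi>, - Uw \<psi>) \<in> L_op a b" unfolding L_op_iff by blast
next
  assume "(Uv \<phi>, - Uw \<psi>) \<in> L_op a b"
  then obtain \<xi> where \<xi>: "(ft (Uv \<phi>), \<xi>) \<in> shift_rel (- a)"
    and L: "AE p in lborel. rep_l2 (ft (- Uw \<psi>)) p = cnj (f_fun a b p) * rep_l2 \<xi> p"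
    unfolding L_op_iff by blast
  have L': "AE p in lborel. - rep_l2 (ft (Uw \<psi>)) p = cnj (f_fun a b p) * rep_l2 \<xi> p"
  proof -
    have "ft (- Uw \<psi>) = - ft (Uw \<psi>)"
      by (rule linear_neg[OF bounded_linear.linear[OF isometry_bounded_linear[OF isometry_ft]]])
    then show ?thesis using L AE_rep_uminus[of "ft (Uw \<psi>)"] by (auto elim!: eventually_elim2)
  qed
  \<comment> \<open>The inverse multiplier v(-z) removes the unimodular factor of \<open>Uv\<close>;
    at height -a it takes the value v(-x + i a) = f_a(-x) w(-x), which turns \<xi> back into the
    transform of \<psi>.\<close>
  have "(refl_l2 (ft \<phi>), refl_l2 (ft \<psi>)) \<in> shift_rel (- a)"
  proof (rule shift_rel_strip_multiplier[OF _ strip_v_uminus \<xi>])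
    show "AE x in lborel. rep_l2 (refl_l2 (ft \<phi>)) x = v (- complex_of_real x) * rep_l2 (ft (Uv \<phi>)) x"
      using ftUv[of \<phi>] AE_rep_refl[of "ft \<phi>"] AE_lborel_uminus[OF unimodular(2)]
      by eventually_elim (simp flip: mult.assoc)
    show "AE x in lborel. rep_l2 (refl_l2 (ft \<psi>)) x = v (- Complex x (- a)) * rep_l2 \<xi> x"
      using L' ftUw[of \<psi>] AE_rep_refl[of "ft \<psi>"] AE_lborel_uminus[OF unimodular(1)] AE_lborel_uminus[OF v_shift_plus]
    proof eventually_elim
      case (elim x)
      have "- Complex x (- a) = Complex (- x) a" by (simp add: complex_eq_iff)
      then have "v (- Complex x (- a)) * rep_l2 \<xi> x = w (of_real (- x)) * - (cnj (f_fun a b x) * rep_l2 \<xi> x)"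
        using elim(5) by (simp add: f_fun_cnj f_fun_uminus)
      also have "\<dots> = (w (of_real (- x)) * cnj (w (of_real (- x)))) * rep_l2 (ft \<psi>) (- x)"
        unfolding elim(1)[symmetric] elim(2) by simp
      finally show ?case using elim by simp
    qed
  qed (use a0 in auto)
  then show "(\<phi>, \<psi>) \<in> exp_op (2 * pi * a) \<Q>"
    by (simp only: exp_op_position_iff shift_rel_refl minus_minus)
qed

text \<open>Here the reflection turns the shift by -a in L into the shift by a. The boundary value
  of the multiplier contains conj(f_a(-x)), exactly the reflected factor of L, so no sign
  appears.\<close>

lemma L_conj_exp_position:
  "(\<phi>, \<psi>) \<in> L_op a b \<longleftrightarrow> (Uv \<phi>, Uw \<psi>) \<in> exp_op (2 * pi * a) \<Q>"
proof
  assume "(\<phi>, \<psi>) \<in> L_op a b"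
  then obtain \<xi> where \<xi>: "(ft \<phi>, \<xi>) \<in> shift_rel (- a)"
    and L: "AE p in lborel. rep_l2 (ft \<psi>) p = cnj (f_fun a b p) * rep_l2 \<xi> p"
    unfolding L_op_iff by blast
  have sh: "(refl_l2 (ft \<phi>), refl_l2 \<xi>) \<in> shift_rel a" using \<xi> by (simp add: shift_rel_refl)
  have "(ft (Uv \<phi>), ft (Uw \<psi>)) \<in> shift_rel a"
  proof (rule shift_rel_strip_multiplier[OF a0 strip_v_cnj sh])
    show "AE x in lborel. rep_l2 (ft (Uv \<phi>)) x = cnj (v (- cnj (of_real x))) * rep_l2 (refl_l2 (ft \<phi>)) x"
      using ftUv[of \<phi>] AE_rep_refl[of "ft \<phi>"] by eventually_elim simp
    show "AE x in lborel. rep_l2 (ft (Uw \<psi>)) x = cnj (v (- cnj (Complex x a))) * rep_l2 (refl_l2 \<xi>) x"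
      using ftUw[of \<psi>] AE_lborel_uminus[OF L] AE_rep_refl[of \<xi>] AE_lborel_uminus[OF v_shift_plus]
    proof eventually_elim
      case (elim x)
      have "- cnj (Complex x a) = Complex (- x) a" by (simp add: complex_eq_iff)
      then show ?case using elim by simp
    qed
  qed simp
  then show "(Uv \<phi>, Uw \<psi>) \<in> exp_op (2 * pi * a) \<Q>" by (simp only: exp_op_position_iff)
next
  assume "(Uv \<phi>, Uw \<psi>) \<in> exp_op (2 * pi * a) \<Q>"
  then have sh: "(ft (Uv \<phi>), ft (Uw \<psi>)) \<in> shift_rel a" by (simp only: exp_op_position_iff)
  have "(\<lambda>x. 1 / f_fun (- a) b (- x)) = (\<lambda>x. (- 1) * (1 / f_fun a b x))"
    by (simp add: f_fun_uminus)
  then have bk: "bdd_fun (\<lambda>x. 1 / f_fun (- a) b (- x))"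
    using bdd_fun_mult[OF bdd_fun_const bdd_inverse_f, of a "- 1"] by simp
  define h1 where "h1 = mul_l2 (\<lambda>x. 1 / f_fun (- a) b (- x)) (refl_l2 (ft \<psi>))"
  have h1: "AE x in lborel. rep_l2 h1 x = 1 / f_fun (- a) b (- x) * rep_l2 (ft \<psi>) (- x)"
    unfolding h1_def
    using AE_rep_mul[OF bk, of "refl_l2 (ft \<psi>)"] AE_rep_refl[of "ft \<psi>"] by eventually_elim simp
  have "(refl_l2 (ft \<phi>), h1) \<in> shift_rel a"
  proof (rule shift_rel_strip_multiplier[OF a0 strip_v_uminus sh])
    show "AE x in lborel. rep_l2 (refl_l2 (ft \<phi>)) x = v (- complex_of_real x) * rep_l2 (ft (Uv \<phi>)) x"
      using ftUv[of \<phi>] AE_rep_refl[of "ft \<phi>"] AE_lborel_uminus[OF unimodular(2)]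
      by eventually_elim (simp flip: mult.assoc)
    show "AE x in lborel. rep_l2 h1 x = v (- Complex x a) * rep_l2 (ft (Uw \<psi>)) x"
      using h1 ftUw[of \<psi>] AE_lborel_uminus[OF unimodular(1)] AE_lborel_uminus[OF v_shift_minus]
    proof eventually_elim
      case (elim x)
      have "- Complex x a = Complex (- x) (- a)" by (simp add: complex_eq_iff)
      then have "v (- Complex x a) * rep_l2 (ft (Uw \<psi>)) x =
          (w (of_real (- x)) * cnj (w (of_real (- x)))) * (1 / f_fun (- a) b (- x) * rep_l2 (ft \<psi>) (- x))"
        using elim by simp
      also have "\<dots> = 1 / f_fun (- a) b (- x) * rep_l2 (ft \<psi>) (- x)"
        using elim(3) by (simp only: mult_1)
      finally show ?case using elim(1) by simp
    qed
  qed simp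
  then have "(ft \<phi>, refl_l2 h1) \<in> shift_rel (- a)"
    using shift_rel_refl[of "refl_l2 (ft \<phi>)" h1 "- a"] by simp
  moreover have "AE p in lborel. rep_l2 (ft \<psi>) p = cnj (f_fun a b p) * rep_l2 (refl_l2 h1) p"
    using AE_rep_refl[of h1] AE_lborel_uminus[OF h1]
  proof eventually_elim
    case (elim p)
    have "f_fun (- a) b p \<noteq> 0" by (rule f_nonzero) simp
    then show ?case using elim by (simp add: f_fun_cnj)
  qed
  ultimately show "(\<phi>, \<psi>) \<in> L_op a b" unfolding L_op_iff by blast
qed

text \<open>On the Fourier side both operators are multiplications, so the unimodular factor cancels
  and only the reflection of p remains, which changes the sign of t.\<close>

lemma exp_momentum_conj_aux:
  assumes u: "AE x in lborel. u (complex_of_real x) * cnj (u (complex_of_real x)) = 1"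
    and U: "\<And>\<phi>. AE p in lborel. rep_l2 (ft (U \<phi>)) p = cnj (u (complex_of_real (- p))) * rep_l2 (ft \<phi>) (- p)"
  shows "(\<phi>, \<psi>) \<in> exp_op t \<P> \<longleftrightarrow> (U \<phi>, U \<psi>) \<in> exp_op (- t) \<P>"
proof -
  have "(\<phi>, \<psi>) \<in> exp_op t \<P> \<longleftrightarrow> (AE p in lborel. rep_l2 (ft \<psi>) p = exp (complex_of_real (t * p)) * rep_l2 (ft \<phi>) p)"
    by (simp add: fun_calc_momentum mult_op_iff)
  also have "\<dots> \<longleftrightarrow> (AE p in lborel. rep_l2 (ft \<psi>) (- p) = exp (complex_of_real (t * (- p))) * rep_l2 (ft \<phi>) (- p))"
  proof
    assume "AE p in lborel. rep_l2 (ft \<psi>) (- p) = exp (complex_of_real (t * (- p))) * rep_l2 (ft \<phi>) (- p)"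
    from AE_lborel_uminus[OF this]
    show "AE p in lborel. rep_l2 (ft \<psi>) p = exp (complex_of_real (t * p)) * rep_l2 (ft \<phi>) p" by simp
  qed (rule AE_lborel_uminus)
  also have "\<dots> \<longleftrightarrow> (AE p in lborel. rep_l2 (ft (U \<psi>)) p = exp (complex_of_real (- t * p)) * rep_l2 (ft (U \<phi>)) p)"
  proof -
    have "AE p in lborel. (rep_l2 (ft \<psi>) (- p) = exp (complex_of_real (t * (- p))) * rep_l2 (ft \<phi>) (- p)) =
        (rep_l2 (ft (U \<psi>)) p = exp (complex_of_real (- t * p)) * rep_l2 (ft (U \<phi>)) p)"
      using U[of \<phi>] U[of \<psi>] AE_lborel_uminus[OF u]
    proof eventually_elim
      case (elim p)
      have "cnj (u (complex_of_real (- p))) \<noteq> 0" using elim(3) by force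
      then show ?case unfolding elim(1,2) by (simp add: mult.left_commute)
    qed
    then show ?thesis by (rule eventually_cong) simp
  qed
  also have "\<dots> \<longleftrightarrow> (U \<phi>, U \<psi>) \<in> exp_op (- t) \<P>"
    by (simp add: fun_calc_momentum mult_op_iff)
  finally show ?thesis .
qed

lemmas exp_momentum_conj_w = exp_momentum_conj_aux[OF unimodular(1) ftUw]
lemmas exp_momentum_conj_v = exp_momentum_conj_aux[OF unimodular(2) ftUv]

end

lemma (in wv) obtain_ops:
  obtains Uw Uv where "wv_ops a b w v Uw Uv"
    "u_conj w = {(\<phi>, Uw \<phi>) |\<phi>. True}" "u_conj v = {(\<phi>, Uv \<phi>) |\<phi>. True}"
proof -
  obtain W where W: "W \<in> borel_measurable borel" "\<And>x. cmod (W x) = 1" "AE x in lborel. w (complex_of_real x) = W x"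
    by (rule unimodular_representative[OF w_strip]) (use a0 wv in \<open>auto simp: wv_pair_def min_def max_def elim!: eventually_mono\<close>)
  obtain V where V: "V \<in> borel_measurable borel" "\<And>x. cmod (V x) = 1" "AE x in lborel. v (complex_of_real x) = V x"
    by (rule unimodular_representative[OF strip_function_half[OF v_strip a0 refl]])
      (use a0 wv in \<open>auto simp: wv_pair_def min_def max_def elim!: eventually_mono\<close>)
  obtain Uw where Uw: "unitary_map Uw" "u_conj w = {(\<phi>, Uw \<phi>) |\<phi>. True}"
    "\<And>\<phi>. AE p in lborel. rep_l2 (ft (Uw \<phi>)) p = cnj (w (complex_of_real (- p))) * rep_l2 (ft \<phi>) (- p)"
    by (rule u_conj_unitary[OF W]) blast
  obtain Uv where Uv: "unitary_map Uv" "u_conj v = {(\<phi>, Uv \<phi>) |\<phi>. True}"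
    "\<And>\<phi>. AE p in lborel. rep_l2 (ft (Uv \<phi>)) p = cnj (v (complex_of_real (- p))) * rep_l2 (ft \<phi>) (- p)"
    by (rule u_conj_unitary[OF V]) blast
  have "wv_ops a b w v Uw Uv"
    by unfold_locales (rule Uw(1) Uv(1) Uw(3) Uv(3))+
  then show ?thesis by (rule that[OF _ Uw(2) Uv(2)])
qed

subsection \<open>Tensor products\<close>

lemma AE_fst:
  assumes "AE x in lborel. P (x :: real)"
  shows "AE p in (lborel :: (real \<times> real) measure). P (fst p)"
proof -
  obtain N where N: "N \<in> sets lborel" "emeasure lborel N = 0" "{x \<in> space lborel. \<not> P x} \<subseteq> N"
    using AE_E[OF assms(1)] by blast
  have [measurable]: "N \<in> sets borel" using N(1) by simp
  have "AE x in lborel. x \<notin> N" using N by (intro AE_not_in) auto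
  then have N': "AE x in lborel. AE y in (lborel :: real measure). fst (x :: real, y) \<notin> N"
    by (auto elim!: eventually_mono)
  have "AE p in lborel \<Otimes>\<^sub>M (lborel :: real measure). fst p \<notin> N"
  proof (rule lborel_pair.AE_pair_measure)
    show "{p \<in> space ((lborel :: real measure) \<Otimes>\<^sub>M (lborel :: real measure)). fst p \<notin> N} \<in> sets (lborel \<Otimes>\<^sub>M lborel)"
      by measurable
  qed (rule N')
  then show ?thesis
    unfolding lborel_prod by eventually_elim (use N(3) in auto)
qed

lemma AE_snd:
  assumes "AE x in lborel. P (x :: real)"
  shows "AE p in (lborel :: (real \<times> real) measure). P (snd p)"
proof -
  obtain N where N: "N \<in> sets lborel" "emeasure lborel N = 0" "{x \<in> space lborel. \<not> P x} \<subseteq> N"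
    using AE_E[OF assms(1)] by blast
  have [measurable]: "N \<in> sets borel" using N(1) by simp
  have "AE x in lborel. x \<notin> N" using N by (intro AE_not_in) auto
  then have N': "AE x in lborel. AE y in (lborel :: real measure). snd (x :: real, y) \<notin> N"
    by (auto elim!: eventually_mono)
  have "AE p in (lborel :: real measure) \<Otimes>\<^sub>M lborel. snd p \<notin> N"
  proof (rule lborel_pair.AE_pair_measure)
    show "{p \<in> space ((lborel :: real measure) \<Otimes>\<^sub>M (lborel :: real measure)). snd p \<notin> N} \<in> sets (lborel \<Otimes>\<^sub>M lborel)"
      by measurable
  qed (rule N')
  then show ?thesis
    unfolding lborel_prod by eventually_elim (use N(3) in auto)
qed

lemma AE_rep_tensor: "AE p in lborel. rep_l2 (tensor_vec f g) p = rep_l2 f (fst p) * rep_l2 g (snd p)"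
proof -
  have eq: "tensor_vec f g = abs_l2 (\<lambda>p. rep_l2 f (fst p) * rep_l2 g (snd p))"
    using tensor_vec.abs_eq[of "rep_l2 f" "rep_l2 g"] by simp
  have "square_integrable (\<lambda>p. rep_l2 f (fst p) * rep_l2 g (snd p))"
  proof -
    have "integrable (lborel \<Otimes>\<^sub>M lborel) (\<lambda>p. (cmod (rep_l2 f (fst p)))\<^sup>2 * (cmod (rep_l2 g (snd p)))\<^sup>2)"
    proof (rule lborel_pair.Fubini_integrable)
      show "(\<lambda>p. (cmod (rep_l2 f (fst p)))\<^sup>2 * (cmod (rep_l2 g (snd p)))\<^sup>2)
          \<in> borel_measurable (lborel \<Otimes>\<^sub>M lborel)" by measurable
    qed (use integrable_rep in auto)
    moreover have "(\<lambda>p. rep_l2 f (fst p) * rep_l2 g (snd p)) \<in> borel_measurable (lborel \<Otimes>\<^sub>M lborel)"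
      by measurable
    ultimately show ?thesis
      unfolding square_integrable_def lborel_prod by (simp add: norm_mult power_mult_distrib)
  qed
  then show ?thesis unfolding eq by (rule AE_rep_abs)
qed

lemma cinner_tensor: "cinner (tensor_vec f g) (tensor_vec f' g') = cinner f f' * cinner g g'"
proof -
  let ?h = "\<lambda>x y. (cnj (rep_l2 f x) * rep_l2 f' x) * (cnj (rep_l2 g y) * rep_l2 g' y)"
  have m: "case_prod ?h \<in> borel_measurable (lborel \<Otimes>\<^sub>M lborel)" by measurable
  have AE: "AE p in lborel. cnj (rep_l2 (tensor_vec f g) p) * rep_l2 (tensor_vec f' g') p = case_prod ?h p"
    using AE_rep_tensor[of f g] AE_rep_tensor[of f' g'] by eventually_elim (simp add: case_prod_beta)
  have m': "case_prod ?h \<in> borel_measurable lborel" using m unfolding lborel_prod .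
  have "integrable lborel (case_prod ?h)"
    using integrable_cong_AE[THEN iffD1, OF _ m' AE integrable_cinner] by simp
  then have i: "integrable (lborel \<Otimes>\<^sub>M lborel) (case_prod ?h)" unfolding lborel_prod .
  have "cinner (tensor_vec f g) (tensor_vec f' g') = (\<integral>p. case_prod ?h p \<partial>lborel)"
    unfolding cinner_rep by (rule integral_cong_AE[OF _ m' AE]) simp
  also have "\<dots> = (\<integral>p. case_prod ?h p \<partial>(lborel \<Otimes>\<^sub>M lborel))" unfolding lborel_prod ..
  also have "\<dots> = (\<integral>x. (\<integral>y. ?h x y \<partial>lborel) \<partial>lborel)"
    by (rule lborel_pair.integral_fst[OF i, symmetric])
  also have "\<dots> = cinner f f' * cinner g g'"
    unfolding integral_mult_right_zero integral_mult_left_zero cinner_rep ..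
  finally show ?thesis .
qed

text \<open>The indicator of a planar box is a product of two interval indicators, and its complex
  coefficient can be absorbed into the first.\<close>

lemma tensor_dense: "closure (span {tensor_vec f g |f g. True}) = UNIV"
proof -
  have "{ind_l2 (box a b :: (real \<times> real) set) c |a b c. True} \<subseteq> {tensor_vec f g |f g. True}"
  proof
    fix x assume "x \<in> {ind_l2 (box a b :: (real \<times> real) set) c |a b c. True}"
    then obtain a1 a2 b1 b2 :: real and c where x: "x = ind_l2 (box (a1, a2) (b1, b2)) c"
      by (auto simp: split_paired_Ex)
    have i: "AE x in lborel. rep_l2 (ind_l2 (box a b) d) x = d * indicator (box a b) x" for a b :: "'a::euclidean_space" and d
      by (rule AE_rep_ind[OF _ emeasure_lborel_box_finite]) simp
    have box: "p \<in> box (a1, a2) (b1, b2) \<longleftrightarrow> fst p \<in> box a1 b1 \<and> snd p \<in> box a2 b2" for p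
      by (cases p) (auto simp: mem_box Basis_prod_def)
    have "ind_l2 (box (a1, a2) (b1, b2)) c = tensor_vec (ind_l2 (box a1 b1) c) (ind_l2 (box a2 b2) 1)"
      by (rule l2_eqI, use i[of "(a1, a2)" "(b1, b2)" c] AE_fst[OF i[of a1 b1 c]] AE_snd[OF i[of a2 b2 1]]
          AE_rep_tensor[of "ind_l2 (box a1 b1) c" "ind_l2 (box a2 b2) 1"] in eventually_elim)
        (simp add: indicator_def box)
    then show "x \<in> {tensor_vec f g |f g. True}" unfolding x by blast
  qed
  from closure_mono[OF span_mono[OF this]] show ?thesis unfolding ind_box_dense by blast
qed

text \<open>A tensor product of operators over an arbitrary bilinear-type map \<open>T\<close>, to
  be instantiated by \<open>tensor_vec\<close> and by its flip. Results on a distinguished first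
  factor then hold for either factor.\<close>

definition gten :: "(real l2 \<Rightarrow> real l2 \<Rightarrow> l2_2) \<Rightarrow> real l2 operator \<Rightarrow> real l2 operator \<Rightarrow> l2_2 operator" where
  "gten T A B = closure (span {(T f g, T f' g') |f g f' g'. (f, f') \<in> A \<and> (g, g') \<in> B})"

lemma tensor_op_gten1: "A \<otimes>\<^sub>o B = gten tensor_vec A B"
  by (simp add: tensor_op_def gten_def)

lemma tensor_op_gten2: "A \<otimes>\<^sub>o B = gten (\<lambda>f g. tensor_vec g f) B A"
proof -
  have "{(tensor_vec f g, tensor_vec f' g') |f g f' g'. (f, f') \<in> A \<and> (g, g') \<in> B} =
      {(tensor_vec g f, tensor_vec g' f') |f g f' g'. (f, f') \<in> B \<and> (g, g') \<in> A}"
    by blast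
  then show ?thesis by (simp add: tensor_op_def gten_def)
qed

lemma closed_gten: "closed (gten T A B)"
  by (simp add: gten_def)

section \<open>Closed graphs and their images under isomorphisms\<close>

lemma mult_op_subspace: "subspace (mult_op m)"
proof (rule subspaceI)
  show "0 \<in> mult_op m"
    using AE_rep_zero by (auto simp: zero_prod_def mult_op_iff elim!: eventually_mono)
  fix p q :: "'a l2 \<times> 'a l2" and r :: real assume *: "p \<in> mult_op m" "q \<in> mult_op m"
  obtain a b c d where pq: "p = (a, b)" "q = (c, d)" by fastforce
  show "p + q \<in> mult_op m"
    using * AE_rep_add[of a c] AE_rep_add[of b d] unfolding pq add_Pair mult_op_iff
    by eventually_elim (simp add: distrib_left)
  show "r *\<^sub>R p \<in> mult_op m"
    using *(1) AE_rep_scaleR[of r a] AE_rep_scaleR[of r b] unfolding pq scaleR_Pair mult_op_iff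
    by eventually_elim simp
qed

lemma mult_op_closed: "closed (mult_op m)"
  unfolding closed_sequential_limits
proof (intro allI impI, elim conjE)
  fix x :: "nat \<Rightarrow> 'a l2 \<times> 'a l2" and l
  assume x: "\<forall>n. x n \<in> mult_op m" and l: "x \<longlonglongrightarrow> l"
  obtain \<phi> \<psi> where lp: "l = (\<phi>, \<psi>)" by fastforce
  have lf: "(\<lambda>n. fst (x n)) \<longlonglongrightarrow> \<phi>" and ls: "(\<lambda>n. snd (x n)) \<longlonglongrightarrow> \<psi>"
    using tendsto_fst[OF l] tendsto_snd[OF l] by (simp_all add: lp)
  from l2_tendsto_AE_subseq[OF lf] obtain r where r: "strict_mono r"
    "AE p in lborel. (\<lambda>n. rep_l2 (fst (x (r n))) p) \<longlonglongrightarrow> rep_l2 \<phi> p" by blast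
  have "(\<lambda>n. snd (x (r n))) \<longlonglongrightarrow> \<psi>"
    using LIMSEQ_subseq_LIMSEQ[OF ls r(1)] by (simp add: o_def)
  from l2_tendsto_AE_subseq[OF this] obtain s where s: "strict_mono s"
    "AE p in lborel. (\<lambda>n. rep_l2 (snd (x (r (s n)))) p) \<longlonglongrightarrow> rep_l2 \<psi> p" by blast
  have "AE p in lborel. rep_l2 (snd (x n)) p = m p * rep_l2 (fst (x n)) p" for n
    using x by (metis mult_op_iff prod.collapse)
  then have "AE p in lborel. \<forall>n. rep_l2 (snd (x n)) p = m p * rep_l2 (fst (x n)) p"
    by (subst AE_all_countable) auto
  then have "AE p in lborel. rep_l2 \<psi> p = m p * rep_l2 \<phi> p"
    using r(2) s(2)
  proof eventually_elim
    case (elim p)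
    have "(\<lambda>n. rep_l2 (fst (x (r (s n)))) p) \<longlonglongrightarrow> rep_l2 \<phi> p"
      using LIMSEQ_subseq_LIMSEQ[OF elim(2) s(1)] by (simp add: o_def)
    then have "(\<lambda>n. rep_l2 (snd (x (r (s n)))) p) \<longlonglongrightarrow> m p * rep_l2 \<phi> p"
      unfolding elim(1)[rule_format] by (intro tendsto_mult tendsto_const)
    with elim(3) show ?case by (rule LIMSEQ_unique)
  qed
  then show "l \<in> mult_op m" by (simp add: lp mult_op_iff)
qed

lemma closure_span_image:
  fixes L :: "'a::real_normed_vector \<Rightarrow> 'b::real_normed_vector"
  assumes L: "bounded_linear L" and K: "bounded_linear K" and inv: "\<And>x. K (L x) = x" "\<And>y. L (K y) = y"
  shows "L ` closure (span X) = closure (span (L ` X))"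
proof
  have sp: "span (L ` X) = L ` span X"
    by (rule linear_span_image[OF bounded_linear.linear[OF L]])
  show "L ` closure (span X) \<subseteq> closure (span (L ` X))"
    unfolding sp by (rule closure_bounded_linear_image_subset[OF L])
  have "K ` closure (span (L ` X)) \<subseteq> closure (K ` span (L ` X))"
    by (rule closure_bounded_linear_image_subset[OF K])
  also have "K ` span (L ` X) = span X" unfolding sp image_image inv by simp
  finally have "L ` K ` closure (span (L ` X)) \<subseteq> L ` closure (span X)" by (rule image_mono)
  then show "closure (span (L ` X)) \<subseteq> L ` closure (span X)" by (simp add: image_image inv)
qed

lemma bounded_linear_map_prod:
  assumes "bounded_linear f" "bounded_linear g"
  shows "bounded_linear (map_prod f g)"
proof -
  have "bounded_linear (\<lambda>p. (f (fst p), g (snd p)))"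
    by (intro bounded_linear_Pair bounded_linear_compose[OF assms(1) bounded_linear_fst]
        bounded_linear_compose[OF assms(2) bounded_linear_snd])
  then show ?thesis by (simp add: map_prod_def case_prod_unfold)
qed

lemma unitary_bounded_linear: "unitary_map U \<Longrightarrow> bounded_linear U"
  by (intro isometry_bounded_linear unitary_isometry)

lemma mem_map_prod:
  assumes "unitary_map U" "unitary_map V"
  shows "(x, y) \<in> map_prod U V ` R \<longleftrightarrow> (inv U x, inv V y) \<in> R"
proof
  assume "(inv U x, inv V y) \<in> R"
  then have "map_prod U V (inv U x, inv V y) \<in> map_prod U V ` R" by (rule imageI)
  then show "(x, y) \<in> map_prod U V ` R" using assms by simp
qed (use assms in auto)

text \<open>The projection \<pi> selects the variable of the distinguished factor, so that a
  multiplication in that factor becomes a multiplication by a function of \<pi>.\<close>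

locale tensor_like =
  fixes T :: "real l2 \<Rightarrow> real l2 \<Rightarrow> l2_2" and \<pi> :: "real \<times> real \<Rightarrow> real"
  assumes cinner_T: "cinner (T f g) (T f' g') = cinner f f' * cinner g g'"
    and dense_T: "closure (span {T f g |f g. True}) = UNIV"
    and mult_T: "(f, f') \<in> mult_op m \<Longrightarrow> (T f g, T f' g) \<in> mult_op (\<lambda>p. m (\<pi> p))"
    and measurable_pi [measurable]: "\<pi> \<in> borel_measurable borel"
begin

lemma bdd_fun_pi: "bdd_fun h \<Longrightarrow> bdd_fun (\<lambda>p. h (\<pi> p))"
  using measurable_compose[OF measurable_pi, of h borel] by (auto simp: bdd_fun_def)

lemma mul_T:
  assumes "bdd_fun h"
  shows "mul_l2 (\<lambda>p. h (\<pi> p)) (T f g) = T (mul_l2 h f) g"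
proof (rule mul_l2_eqI[OF bdd_fun_pi[OF assms]])
  have "(f, mul_l2 h f) \<in> mult_op h" unfolding mult_op_iff by (rule AE_rep_mul[OF assms])
  from mult_T[OF this] show "AE p in lborel. rep_l2 (T (mul_l2 h f) g) p = h (\<pi> p) * rep_l2 (T f g) p"
    unfolding mult_op_iff .
qed

lemma T_uminus: "T (- f) g = - T f g"
proof -
  have neg: "mul_l2 (\<lambda>_. - 1) \<phi> = - \<phi>" for \<phi> :: "'b::euclidean_space l2"
    by (rule mul_l2_eqI[OF bdd_fun_const], use AE_rep_uminus[of \<phi>] in eventually_elim) simp
  show ?thesis using mul_T[OF bdd_fun_const, of "- 1" f g] by (simp only: neg)
qed

lemma bounded_linear_eq_on_T:
  assumes "bounded_linear F" "bounded_linear G" "\<And>f g. F (T f g) = G (T f g)"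
  shows "F x = G x"
proof (rule bounded_linear_eq_on_closure_span[OF assms(1,2)])
  show "x \<in> closure (span {T f g |f g. True})" unfolding dense_T by (rule UNIV_I)
qed (use assms(3) in blast)

definition ext :: "(real l2 \<Rightarrow> real l2) \<Rightarrow> l2_2 \<Rightarrow> l2_2" where
  "ext A = (SOME U. isometry_map U \<and> (\<forall>f g. U (T f g) = T (A f) g) \<and>
     gten T {(\<phi>, A \<phi>) |\<phi>. True} Id = {(\<phi>, U \<phi>) |\<phi>. True})"

text \<open>\<open>ext A\<close> is A tensored with the identity. On simple tensors inner products
  factor, so the extension theorem yields an isometry whose graph is the closed span defining the
  tensor operator; the equality includes domains.\<close>

lemma ext_isometry:
  assumes A: "isometry_map A"
  shows "isometry_map (ext A)" "ext A (T f g) = T (A f) g"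
    "gten T {(\<phi>, A \<phi>) |\<phi>. True} Id = {(\<phi>, ext A \<phi>) |\<phi>. True}"
proof -
  let ?S = "{(T f g, T (A f) g) |f g. True}"
  have d: "closure (span (fst ` ?S)) = UNIV"
    unfolding fst_image_pairs by (rule dense_T)
  have c: "cinner (fst p) (fst q) = cinner (snd p) (snd q)" if "p \<in> ?S" "q \<in> ?S" for p q
    using that A by (auto simp: cinner_T isometry_map_def)
  obtain U where U: "isometry_map U" "closure (span ?S) = {(\<phi>, U \<phi>) |\<phi>. True}"
    using isometry_exists[OF c d] by blast
  have "U (T f g) = T (A f) g" for f g
  proof -
    have "(T f g, T (A f) g) \<in> closure (span ?S)"
      by (rule closure_span_superset) blast
    then show ?thesis unfolding U(2) by auto
  qed
  moreover have "gten T {(\<phi>, A \<phi>) |\<phi>. True} Id = {(\<phi>, U \<phi>) |\<phi>. True}"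
  proof -
    have "{(T f g, T f' g') |f g f' g'. (f, f') \<in> {(\<phi>, A \<phi>) |\<phi>. True} \<and> (g, g') \<in> Id} = ?S" by auto
    then show ?thesis unfolding gten_def using U(2) by simp
  qed
  ultimately have "\<exists>U. isometry_map U \<and> (\<forall>f g. U (T f g) = T (A f) g) \<and>
     gten T {(\<phi>, A \<phi>) |\<phi>. True} Id = {(\<phi>, U \<phi>) |\<phi>. True}" using U(1) by blast
  from someI_ex[OF this, folded ext_def]
  show "isometry_map (ext A)" "ext A (T f g) = T (A f) g"
    "gten T {(\<phi>, A \<phi>) |\<phi>. True} Id = {(\<phi>, ext A \<phi>) |\<phi>. True}" by blast+
qed

lemma ext_unitary:
  assumes A: "unitary_map A"
  shows "unitary_map (ext A)" "inv (ext A) (T f g) = T (inv A f) g"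
proof -
  note i = ext_isometry[OF unitary_isometry[OF A]] ext_isometry[OF unitary_isometry[OF unitary_inv[OF A]]]
  have id: "ext A (ext (inv A) \<phi>) = \<phi>" for \<phi>
    by (rule bounded_linear_eq_on_T[of "\<lambda>\<phi>. ext A (ext (inv A) \<phi>)" "\<lambda>\<phi>. \<phi>"])
      (auto intro!: bounded_linear_compose[OF isometry_bounded_linear[OF i(1)] isometry_bounded_linear[OF i(4)]]
        bounded_linear_ident simp: i(2,5) A)
  show u: "unitary_map (ext A)"
    using i(1) surjI[of "ext A" "ext (inv A)", OF id] by (simp add: unitary_map_def isometry_map_def)
  have "inv (ext A) (ext A (T (inv A f) g)) = T (inv A f) g" by (rule unitary_inv_apply(1)[OF u])
  then show "inv (ext A) (T f g) = T (inv A f) g" by (simp add: i(2) A)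
qed

lemma ext_T: "unitary_map A \<Longrightarrow> ext A (T f g) = T (A f) g"
  by (rule ext_isometry(2)[OF unitary_isometry])

lemma gten_graph: "unitary_map A \<Longrightarrow> gten T {(\<phi>, A \<phi>) |\<phi>. True} Id = {(\<phi>, ext A \<phi>) |\<phi>. True}"
  by (rule ext_isometry(3)[OF unitary_isometry])

text \<open>A bounded isomorphism of pairs commutes with closed spans, so it is enough that it maps
  simple tensors to simple tensors. The relation in the other factor stays arbitrary, and its domain
  never has to be examined.\<close>

lemma gten_image:
  assumes L: "bounded_linear L" and K: "bounded_linear K" and inv: "\<And>x. K (L x) = x" "\<And>y. L (K y) = y"
    and T: "\<And>f f' g g'. L (T f g, T f' g') = (T (h f) g, T (h' f') g')"
  shows "L ` gten T R S = gten T (map_prod h h' ` R) S"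
proof -
  have "L ` {(T f g, T f' g') |f g f' g'. (f, f') \<in> R \<and> (g, g') \<in> S} =
      {(T f g, T f' g') |f g f' g'. (f, f') \<in> map_prod h h' ` R \<and> (g, g') \<in> S}" (is "L ` ?l = ?r")
  proof
    show "L ` ?l \<subseteq> ?r"
    proof
      fix p assume "p \<in> L ` ?l"
      then obtain f g f' g' where p: "p = L (T f g, T f' g')" "(f, f') \<in> R" "(g, g') \<in> S" by blast
      from imageI[OF p(2), of "map_prod h h'"] have "(h f, h' f') \<in> map_prod h h' ` R" by simp
      with p(3) have "\<exists>e d e' d'. p = (T e d, T e' d') \<and> (e, e') \<in> map_prod h h' ` R \<and> (d, d') \<in> S"
        unfolding p(1) T by metis
      then show "p \<in> ?r" by (rule CollectI)
    qed
    show "?r \<subseteq> L ` ?l"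
    proof
      fix p assume "p \<in> ?r"
      then obtain f g f' g' where p: "p = (T f g, T f' g')" "(f, f') \<in> map_prod h h' ` R" "(g, g') \<in> S" by blast
      from p(2) obtain x where x: "(f, f') = map_prod h h' x" "x \<in> R" by (rule imageE)
      obtain e e' where e: "f = h e" "f' = h' e'" "(e, e') \<in> R"
        using x by (cases x) auto
      have "(T e g, T e' g') \<in> ?l" using e(3) p(3) by blast
      then have "L (T e g, T e' g') \<in> L ` ?l" by (rule imageI)
      then show "p \<in> L ` ?l" unfolding T p(1) e(1,2) .
    qed
  qed
  then show ?thesis unfolding gten_def by (simp only: closure_span_image[OF L K inv])
qed

lemma gten_map_prod:
  assumes A: "unitary_map A" and B: "unitary_map B"
  shows "map_prod (ext A) (ext B) ` gten T R S = gten T (map_prod A B ` R) S"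
proof (rule gten_image[where K = "map_prod (inv (ext A)) (inv (ext B))"])
  note u = ext_unitary(1)[OF A] ext_unitary(1)[OF B]
  show "bounded_linear (map_prod (ext A) (ext B))" "bounded_linear (map_prod (inv (ext A)) (inv (ext B)))"
    by (intro bounded_linear_map_prod unitary_bounded_linear unitary_inv u)+
  show "map_prod (inv (ext A)) (inv (ext B)) (map_prod (ext A) (ext B) x) = x"
    "map_prod (ext A) (ext B) (map_prod (inv (ext A)) (inv (ext B)) x) = x" for x
    by (cases x; simp add: u)+
  show "map_prod (ext A) (ext B) (T f g, T f' g') = (T (A f) g, T (B f') g')" for f f' g g'
    by (simp add: ext_T A B)
qed

lemma gten_uminus: "map_prod id uminus ` gten T R S = gten T (map_prod id uminus ` R) S"
proof (rule gten_image[where K = "map_prod id uminus"])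
  show "bounded_linear (map_prod id uminus :: l2_2 \<times> l2_2 \<Rightarrow> _)"
    "bounded_linear (map_prod id uminus :: l2_2 \<times> l2_2 \<Rightarrow> _)"
    by (intro bounded_linear_map_prod bounded_linear_minus bounded_linear_ident;
      simp add: id_def bounded_linear_ident)+
  show "map_prod id uminus (map_prod id uminus x) = x" "map_prod id uminus (map_prod id uminus x) = x"
    for x :: "l2_2 \<times> l2_2"
    by (cases x; simp)+
qed (simp add: T_uminus)

lemma cutoff_tendsto:
  assumes [measurable]: "\<And>n. A n \<in> sets borel" and ev: "\<And>x. \<forall>\<^sub>F n in sequentially. x \<in> A n"
  shows "(\<lambda>n. mul_l2 (\<lambda>p. indicator (A n) (\<pi> p)) \<Phi>) \<longlonglongrightarrow> \<Phi>"
proof (rule tendsto_l2_dominated)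
  have b: "bdd_fun (\<lambda>p. indicator (A n) (\<pi> p))" for n
    by (rule bdd_fun_pi[OF bdd_fun_indicator]) simp
  have "AE p in lborel. \<forall>n. rep_l2 (mul_l2 (\<lambda>p. indicator (A n) (\<pi> p)) \<Phi>) p = indicator (A n) (\<pi> p) * rep_l2 \<Phi> p"
    by (subst AE_all_countable) (intro allI AE_rep_mul b)
  then show "AE p in lborel. (\<lambda>n. rep_l2 (mul_l2 (\<lambda>p. indicator (A n) (\<pi> p)) \<Phi>) p) \<longlonglongrightarrow> rep_l2 \<Phi> p"
  proof eventually_elim
    case (elim p)
    have "\<forall>\<^sub>F n in sequentially. rep_l2 \<Phi> p = rep_l2 (mul_l2 (\<lambda>p. indicator (A n) (\<pi> p)) \<Phi>) p"
      using ev[of "\<pi> p"] by eventually_elim (simp add: elim)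
    then show ?case by (rule Lim_transform_eventually[OF tendsto_const])
  qed
  show "AE p in lborel. (cmod (rep_l2 (mul_l2 (\<lambda>p. indicator (A n) (\<pi> p)) \<Phi>) p))\<^sup>2 \<le> (cmod (rep_l2 \<Phi> p))\<^sup>2" for n
    using AE_rep_mul[OF b[of n], of \<Phi>] by eventually_elim (auto simp: indicator_def)
qed (rule integrable_rep)

text \<open>Where |m| <= n the multiplier is bounded, and density of simple tensors puts every
  truncated pair into the closed tensor operator. Letting n grow recovers the maximal domain of
  multiplication by m.\<close>

lemma gten_mult_op:
  assumes [measurable]: "m \<in> borel_measurable borel"
  shows "gten T (mult_op m) Id = mult_op (\<lambda>p. m (\<pi> p))"
proof
  show "gten T (mult_op m) Id \<subseteq> mult_op (\<lambda>p. m (\<pi> p))"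
    unfolding gten_def
    by (rule closed_closure_span_subset[OF _ mult_op_subspace mult_op_closed]) (auto intro: mult_T)
  show "mult_op (\<lambda>p. m (\<pi> p)) \<subseteq> gten T (mult_op m) Id"
  proof clarify
    fix \<Phi> \<Psi> assume PP: "(\<Phi>, \<Psi>) \<in> mult_op (\<lambda>p. m (\<pi> p))"
    define A where "A n = {x. cmod (m x) \<le> real n}" for n
    have Am [measurable]: "A n \<in> sets borel" for n unfolding A_def by measurable
    have Aev: "\<forall>\<^sub>F n in sequentially. x \<in> A n" for x
    proof -
      obtain N :: nat where "cmod (m x) \<le> real N" using real_arch_simple by blast
      then show ?thesis unfolding A_def mem_Collect_eq by (intro eventually_sequentiallyI[of N]) linarith
    qed
    have c: "bdd_fun (indicator (A n))" for n by (rule bdd_fun_indicator) simp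
    have mc: "bdd_fun (\<lambda>x. m x * indicator (A n) x)" for n
      by (rule bdd_funI[of _ "real n"]) (auto simp: A_def indicator_def norm_mult)
    have G: "(mul_l2 (\<lambda>p. indicator (A n) (\<pi> p)) \<Phi>, mul_l2 (\<lambda>p. m (\<pi> p) * indicator (A n) (\<pi> p)) \<Phi>) \<in> gten T (mult_op m) Id" for n
    proof -
      let ?G = "\<lambda>\<Phi>. (mul_l2 (\<lambda>p. indicator (A n) (\<pi> p)) \<Phi>, mul_l2 (\<lambda>p. m (\<pi> p) * indicator (A n) (\<pi> p)) \<Phi>)"
      have bl: "bounded_linear ?G"
        by (intro bounded_linear_Pair bounded_linear_mul bdd_fun_pi[OF c] bdd_fun_pi[OF mc])
      have "closure (span {T f g |f g. True}) \<subseteq> ?G -` gten T (mult_op m) Id"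
      proof (rule closed_closure_span_subset)
        show "subspace (?G -` gten T (mult_op m) Id)"
          unfolding gten_def by (rule linear_subspace_vimage[OF bounded_linear.linear[OF bl] subspace_closure_span])
        show "closed (?G -` gten T (mult_op m) Id)"
          by (rule continuous_closed_vimage[OF closed_gten]) (rule linear_continuous_at[OF bl])
        show "{T f g |f g. True} \<subseteq> ?G -` gten T (mult_op m) Id"
        proof clarify
          fix f g
          have "(mul_l2 (indicator (A n)) f, mul_l2 (\<lambda>x. m x * indicator (A n) x) f) \<in> mult_op m"
            unfolding mult_op_iff using AE_rep_mul[OF c, of n f] AE_rep_mul[OF mc, of n f]
            by eventually_elim simp
          then have "(T (mul_l2 (indicator (A n)) f) g, T (mul_l2 (\<lambda>x. m x * indicator (A n) x) f) g) \<in> gten T (mult_op m) Id"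
            unfolding gten_def by (intro closure_span_superset) blast
          then show "T f g \<in> ?G -` gten T (mult_op m) Id"
            by (simp add: mul_T[OF c] mul_T[OF mc])
        qed
      qed
      then show ?thesis unfolding dense_T by blast
    qed
    have eq: "mul_l2 (\<lambda>p. m (\<pi> p) * indicator (A n) (\<pi> p)) \<Phi> = mul_l2 (\<lambda>p. indicator (A n) (\<pi> p)) \<Psi>" for n
      by (rule mul_l2_eqI[OF bdd_fun_pi[OF mc]],
          use PP[unfolded mult_op_iff] AE_rep_mul[OF bdd_fun_pi[OF c], of n \<Psi>] in eventually_elim) simp
    have "(\<lambda>n. (mul_l2 (\<lambda>p. indicator (A n) (\<pi> p)) \<Phi>, mul_l2 (\<lambda>p. m (\<pi> p) * indicator (A n) (\<pi> p)) \<Phi>)) \<longlonglongrightarrow> (\<Phi>, \<Psi>)"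
      unfolding eq by (intro tendsto_Pair cutoff_tendsto Am Aev)
    from closed_sequentially[OF closed_gten G this]
    show "(\<Phi>, \<Psi>) \<in> gten T (mult_op m) Id" .
  qed
qed

end

interpretation T1: tensor_like tensor_vec fst
proof
  show "(tensor_vec f g, tensor_vec f' g) \<in> mult_op (\<lambda>p. m (fst p))" if "(f, f') \<in> mult_op m" for f f' m g
    unfolding mult_op_iff
    using AE_rep_tensor[of f g] AE_rep_tensor[of f' g] AE_fst[OF that[unfolded mult_op_iff]]
    by eventually_elim simp
  show "closure (span {tensor_vec f g |f g. True}) = UNIV" by (rule tensor_dense)
  show "(fst :: real \<times> real \<Rightarrow> real) \<in> borel_measurable borel"
    by (intro borel_measurable_continuous_onI continuous_intros)
qed (rule cinner_tensor)

interpretation T2: tensor_like "\<lambda>f g. tensor_vec g f" snd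
proof
  show "(tensor_vec g f, tensor_vec g f') \<in> mult_op (\<lambda>p. m (snd p))" if "(f, f') \<in> mult_op m" for f f' m g
    unfolding mult_op_iff
    using AE_rep_tensor[of g f] AE_rep_tensor[of g f'] AE_snd[OF that[unfolded mult_op_iff]]
    by eventually_elim simp
  have "{tensor_vec g f |f g. True} = {tensor_vec f g |f g. True}" by blast
  then show "closure (span {tensor_vec g f |f g. True}) = UNIV" by (simp only: tensor_dense)
  show "(snd :: real \<times> real \<Rightarrow> real) \<in> borel_measurable borel"
    by (intro borel_measurable_continuous_onI continuous_intros)
qed (simp add: cinner_tensor)

subsection \<open>Diagonalisation in one tensor factor\<close>

lemma closed_adjoint: "closed (adjoint_op A)"
proof -
  have "adjoint_op A = (\<Inter>(\<xi>, \<eta>)\<in>A. {p. cinner (fst p) \<eta> = cinner (snd p) \<xi>})"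
    by (auto simp: adjoint_op_def)
  moreover have "closed {p. cinner (fst p) \<eta> = cinner (snd p) \<xi>}" for \<xi> \<eta> :: "'a l2"
    by (intro closed_Collect_eq continuous_intros)
  ultimately show ?thesis by (auto intro!: closed_INT)
qed

text \<open>The adjoint exchanges source and target, hence also the two unitaries.\<close>

lemma adjoint_map_prod:
  assumes A: "unitary_map A" and B: "unitary_map B"
  shows "adjoint_op (map_prod A B ` z) = map_prod B A ` adjoint_op z"
proof (intro set_eqI)
  fix p :: "'a l2 \<times> 'a l2"
  obtain x y where p: "p = (x, y)" by fastforce
  have 1: "cinner x (B \<eta>) = cinner (inv B x) \<eta>" "cinner y (A \<xi>) = cinner (inv A y) \<xi>" for \<xi> \<eta>
    using unitary_cinner[OF B, of "inv B x" \<eta>] unitary_cinner[OF A, of "inv A y" \<xi>] A B by simp_all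
  have "(x, y) \<in> adjoint_op (map_prod A B ` z) \<longleftrightarrow> (\<forall>(\<xi>, \<eta>)\<in>z. cinner x (B \<eta>) = cinner y (A \<xi>))"
    by (auto simp: adjoint_op_def)
  also have "\<dots> \<longleftrightarrow> (inv B x, inv A y) \<in> adjoint_op z"
    unfolding 1 by (auto simp: adjoint_op_def)
  finally show "p \<in> adjoint_op (map_prod A B ` z) \<longleftrightarrow> p \<in> map_prod B A ` adjoint_op z"
    unfolding p mem_map_prod[OF B A] .
qed

lemma mem_uminus: "(x, y) \<in> map_prod id uminus ` A \<longleftrightarrow> (x, - y) \<in> A" for y :: "'b::group_add"
  by (force simp: image_iff)

lemma op_minus_eq: "op_minus A = map_prod id uminus ` A"
  by (force simp: op_minus_def)

lemma adjoint_uminus: "adjoint_op (map_prod id uminus ` z) = map_prod id uminus ` adjoint_op z"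
proof (intro set_eqI)
  fix p :: "'a l2 \<times> 'a l2"
  obtain x y where p: "p = (x, y)" by fastforce
  have "(x, y) \<in> adjoint_op (map_prod id uminus ` z) \<longleftrightarrow> (\<forall>(\<xi>, \<eta>)\<in>z. - cinner x \<eta> = cinner y \<xi>)"
    by (auto simp: adjoint_op_def)
  also have "\<dots> \<longleftrightarrow> (x, - y) \<in> adjoint_op z"
    unfolding adjoint_op_def by (simp add: eq_neg_iff_add_eq_0 neg_eq_iff_add_eq_0)
  finally show "p \<in> adjoint_op (map_prod id uminus ` z) \<longleftrightarrow> p \<in> map_prod id uminus ` adjoint_op z"
    unfolding p mem_uminus .
qed

context tensor_like
begin

text \<open>The exponential of s times the momentum in the distinguished factor, in diagonal form;
  K_1 and K_2 have components of this kind.\<close>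

definition N :: "real \<Rightarrow> l2_2 operator" where
  "N s = {(\<Phi>, \<Psi>). (ext ft \<Phi>, ext ft \<Psi>) \<in> mult_op (\<lambda>p. exp (complex_of_real (s * \<pi> p)))}"

lemmas unitary_ext_ft = ext_unitary(1)[OF unitary_ft]

lemma N_iff:
  "(\<Phi>, \<Psi>) \<in> N s \<longleftrightarrow> (AE p in lborel. rep_l2 (ext ft \<Psi>) p = exp (complex_of_real (s * \<pi> p)) * rep_l2 (ext ft \<Phi>) p)"
  by (simp add: N_def mult_op_iff)

lemma gten_exp_momentum: "gten T (exp_op s \<P>) Id = N s"
proof -
  have 1: "map_prod ft ft ` exp_op s \<P> = mult_op (\<lambda>x. exp (complex_of_real (s * x)))"
  proof (intro set_eqI)
    fix p :: "real l2 \<times> real l2"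
    obtain x y where p: "p = (x, y)" by fastforce
    show "p \<in> map_prod ft ft ` exp_op s \<P> \<longleftrightarrow> p \<in> mult_op (\<lambda>x. exp (complex_of_real (s * x)))"
      unfolding p mem_map_prod[OF unitary_ft unitary_ft] fun_calc_momentum using unitary_ft by simp
  qed
  have "map_prod (ext ft) (ext ft) ` gten T (exp_op s \<P>) Id = mult_op (\<lambda>p. exp (complex_of_real (s * \<pi> p)))"
    unfolding gten_map_prod[OF unitary_ft unitary_ft] 1 by (rule gten_mult_op) measurable
  then have "(\<Phi>, \<Psi>) \<in> gten T (exp_op s \<P>) Id \<longleftrightarrow> (\<Phi>, \<Psi>) \<in> N s" for \<Phi> \<Psi>
    using mem_map_prod[OF unitary_ext_ft unitary_ext_ft, of "ext ft \<Phi>" "ext ft \<Psi>" "gten T (exp_op s \<P>) Id"]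
    by (simp add: unitary_ext_ft N_def)
  then show ?thesis by auto
qed

lemma N_inverse: "(N s)\<inverse> = N (- s)"
proof -
  have "(\<Phi>, \<Psi>) \<in> N s \<Longrightarrow> (\<Psi>, \<Phi>) \<in> N (- s)" for \<Phi> \<Psi> s
    unfolding N_iff
  proof (elim eventually_mono)
    fix p assume "rep_l2 (ext ft \<Psi>) p = exp (complex_of_real (s * \<pi> p)) * rep_l2 (ext ft \<Phi>) p"
    moreover have "exp (complex_of_real (- s * \<pi> p)) * exp (complex_of_real (s * \<pi> p)) = 1"
      unfolding exp_add[symmetric] by simp
    ultimately show "rep_l2 (ext ft \<Phi>) p = exp (complex_of_real (- s * \<pi> p)) * rep_l2 (ext ft \<Psi>) p"
      by (simp only: mult.assoc[symmetric] mult_1)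
  qed
  from this[of _ _ s] this[of _ _ "- s"] show ?thesis by auto
qed

text \<open>The point is the domain: a vector in the domain of \<open>N (2 * s)\<close> also lies in
  that of \<open>N s\<close>, since e^2 <= 1 + e^4 bounds the intermediate vector by the two given
  ones.\<close>

lemma N_square: "N s O N s = N (2 * s)"
proof -
  have e: "exp (complex_of_real (s * x)) * exp (complex_of_real (s * x)) = exp (complex_of_real (2 * s * x))" for x
    unfolding exp_add[symmetric] by (simp add: mult.assoc)
  show ?thesis
  proof
    show "N s O N s \<subseteq> N (2 * s)"
    proof
      fix q assume "q \<in> N s O N s"
      then obtain \<Phi> \<Xi> \<Psi> where q: "q = (\<Phi>, \<Psi>)" and h: "(\<Phi>, \<Xi>) \<in> N s" "(\<Xi>, \<Psi>) \<in> N s" by blast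
      from h show "q \<in> N (2 * s)"
        unfolding q N_iff by eventually_elim (simp only: e mult.assoc[symmetric])
    qed
    show "N (2 * s) \<subseteq> N s O N s"
    proof clarify
      fix \<Phi> \<Psi> assume P: "(\<Phi>, \<Psi>) \<in> N (2 * s)"
      let ?f = "rep_l2 (ext ft \<Phi>)" and ?g = "rep_l2 (ext ft \<Psi>)"
      have sq: "square_integrable (\<lambda>p. exp (complex_of_real (s * \<pi> p)) * ?f p)"
      proof (rule square_integrable_bound)
        show "integrable lborel (\<lambda>p. (cmod (?f p))\<^sup>2 + (cmod (?g p))\<^sup>2)"
          by (intro Bochner_Integration.integrable_add integrable_rep)
        show "AE p in lborel. (cmod (exp (complex_of_real (s * \<pi> p)) * ?f p))\<^sup>2 \<le> (cmod (?f p))\<^sup>2 + (cmod (?g p))\<^sup>2"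
          using P unfolding N_iff
        proof eventually_elim
          case (elim p)
          let ?e = "cmod (exp (complex_of_real (s * \<pi> p)))"
          have "?e\<^sup>2 \<le> 1 + (?e\<^sup>2)\<^sup>2"
            using sum_squares_bound[of 1 "?e\<^sup>2"] zero_le_power2[of ?e]
            unfolding power_one mult_1_right by linarith
          then have "?e\<^sup>2 * (cmod (?f p))\<^sup>2 \<le> (1 + (?e\<^sup>2)\<^sup>2) * (cmod (?f p))\<^sup>2"
            by (rule mult_right_mono) simp
          also have "\<dots> = (cmod (?f p))\<^sup>2 + (cmod (?g p))\<^sup>2"
            unfolding elim e[symmetric] norm_mult by (simp add: power2_eq_square algebra_simps)
          finally show ?case by (simp only: norm_mult power_mult_distrib)
        qed
      qed measurable
      define \<Xi> where "\<Xi> = inv (ext ft) (abs_l2 (\<lambda>p. exp (complex_of_real (s * \<pi> p)) * ?f p))"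
      have X: "AE p in lborel. rep_l2 (ext ft \<Xi>) p = exp (complex_of_real (s * \<pi> p)) * ?f p"
        using AE_rep_abs[OF sq] by (simp add: \<Xi>_def unitary_ext_ft)
      have "(\<Phi>, \<Xi>) \<in> N s" unfolding N_iff by (rule X)
      moreover have "(\<Xi>, \<Psi>) \<in> N s"
        using P X unfolding N_iff by eventually_elim (simp only: e mult.assoc[symmetric])
      ultimately show "(\<Phi>, \<Psi>) \<in> N s O N s" by blast
    qed
  qed
qed

text \<open>A bounded function g of the momentum in the distinguished factor, as an everywhere
  defined operator.\<close>

definition G :: "(real \<Rightarrow> complex) \<Rightarrow> l2_2 \<Rightarrow> l2_2" where
  "G g \<Phi> = inv (ext ft) (mul_l2 (\<lambda>p. g (\<pi> p)) (ext ft \<Phi>))"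

lemma ext_ft_G: "ext ft (G g \<Phi>) = mul_l2 (\<lambda>p. g (\<pi> p)) (ext ft \<Phi>)"
  by (simp add: G_def unitary_ext_ft)

lemma G_T:
  assumes "bdd_fun g"
  shows "G g (T f h) = T (inv ft (mul_l2 g (ft f))) h"
  by (simp add: G_def ext_T unitary_ft mul_T[OF assms] ext_unitary(2))

lemma bounded_linear_G: "bdd_fun g \<Longrightarrow> bounded_linear (G g)"
  unfolding G_def
  by (intro bounded_linear_compose[OF unitary_bounded_linear[OF unitary_inv[OF unitary_ext_ft]]]
      bounded_linear_compose[OF bounded_linear_mul[OF bdd_fun_pi]] unitary_bounded_linear unitary_ext_ft)

lemma cinner_G:
  assumes "bdd_fun g" "\<And>x. cnj (g x) = g x"
  shows "cinner (G g \<Phi>) \<Psi> = cinner \<Phi> (G g \<Psi>)"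
proof -
  note u = unitary_cinner[OF unitary_ext_ft, symmetric]
  show ?thesis
    unfolding u[of "G g \<Phi>" \<Psi>] u[of \<Phi> "G g \<Psi>"] ext_ft_G cinner_mul_left[OF bdd_fun_pi[OF assms(1)]] assms(2) ..
qed

text \<open>Functions of the momentum act on the distinguished factor only, so the scalar identity
  \<open>eq\<close> converts pairs of e^(s\<P>) into pairs of e^(t\<P>) whatever the relation
  \<open>B\<close> is. Boundedness of g1 and g2 carries this through the closed span.\<close>

lemma gten_transfer:
  assumes g: "bdd_fun g1" "bdd_fun g2"
    and eq: "\<And>x. g2 x * exp (complex_of_real (s * x)) = exp (complex_of_real (t * x)) * g1 x"
    and z: "(\<Phi>, \<Psi>) \<in> gten T (exp_op s \<P>) B"
  shows "(G g1 \<Phi>, G g2 \<Psi>) \<in> gten T (exp_op t \<P>) B"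
proof -
  let ?L = "map_prod (G g1) (G g2)"
  have bl: "bounded_linear ?L" by (intro bounded_linear_map_prod bounded_linear_G g)
  have "gten T (exp_op s \<P>) B \<subseteq> ?L -` gten T (exp_op t \<P>) B"
    unfolding gten_def[of T "exp_op s \<P>"]
  proof (rule closed_closure_span_subset)
    show "subspace (?L -` gten T (exp_op t \<P>) B)"
      unfolding gten_def by (rule linear_subspace_vimage[OF bounded_linear.linear[OF bl] subspace_closure_span])
    show "closed (?L -` gten T (exp_op t \<P>) B)"
      by (rule continuous_closed_vimage[OF closed_gten]) (rule linear_continuous_at[OF bl])
    show "{(T f h, T f' h') |f h f' h'. (f, f') \<in> exp_op s \<P> \<and> (h, h') \<in> B} \<subseteq> ?L -` gten T (exp_op t \<P>) B"
    proof
      fix q assume "q \<in> {(T f h, T f' h') |f h f' h'. (f, f') \<in> exp_op s \<P> \<and> (h, h') \<in> B}"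
      then obtain f h f' h' where q: "q = (T f h, T f' h')" and f: "(f, f') \<in> exp_op s \<P>" and h: "(h, h') \<in> B" by blast
      have "(inv ft (mul_l2 g1 (ft f)), inv ft (mul_l2 g2 (ft f'))) \<in> exp_op t \<P>"
        using f AE_rep_mul[OF g(1), of "ft f"] AE_rep_mul[OF g(2), of "ft f'"]
        unfolding fun_calc_momentum mem_Collect_eq case_prod_conv mult_op_iff unitary_inv_apply(2)[OF unitary_ft]
      proof eventually_elim
        case (elim x)
        show ?case unfolding elim by (simp only: mult.assoc[symmetric] eq)
      qed
      with h have "(T (inv ft (mul_l2 g1 (ft f))) h, T (inv ft (mul_l2 g2 (ft f'))) h') \<in> gten T (exp_op t \<P>) B"
        unfolding gten_def by (intro closure_span_superset) blast
      then show "q \<in> ?L -` gten T (exp_op t \<P>) B" by (simp add: q G_T g)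
    qed
  qed
  then show ?thesis using z by auto
qed

text \<open>Real g give self-adjoint \<open>G g\<close>, which can be moved onto the test pair.
  There the roles of g1 and g2 and of s and t are exchanged, and the same identity is used from
  right to left.\<close>

lemma adjoint_transfer:
  assumes g: "bdd_fun g1" "bdd_fun g2" and real: "\<And>x. cnj (g1 x) = g1 x" "\<And>x. cnj (g2 x) = g2 x"
    and eq: "\<And>x. g2 x * exp (complex_of_real (s * x)) = exp (complex_of_real (t * x)) * g1 x"
    and z: "(\<Phi>, \<Psi>) \<in> adjoint_op (gten T (exp_op s \<P>) B)"
  shows "(G g1 \<Phi>, G g2 \<Psi>) \<in> adjoint_op (gten T (exp_op t \<P>) B)"
  unfolding adjoint_op_def
proof clarify
  fix \<xi> \<eta> assume "(\<xi>, \<eta>) \<in> gten T (exp_op t \<P>) B"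
  then have "(G g2 \<xi>, G g1 \<eta>) \<in> gten T (exp_op s \<P>) B"
    by (rule gten_transfer[OF g(2,1), rotated]) (metis eq mult.commute)
  then show "cinner (G g1 \<Phi>) \<eta> = cinner (G g2 \<Psi>) \<xi>"
    using z unfolding cinner_G[OF g(1) real(1)] cinner_G[OF g(2) real(2)] adjoint_op_def by blast
qed

text \<open>Bounded truncations of e^(s\<P>) to momenta in [-n, n]. With n fixed their exponents add
  up, which is all that the transfer lemmas require.\<close>

definition cut :: "nat \<Rightarrow> real \<Rightarrow> real \<Rightarrow> complex" where
  "cut n s x = complex_of_real (exp (s * x) * indicator {- real n..real n} x)"

lemma cut_real: "cnj (cut n s x) = cut n s x"
  by (simp add: cut_def)

lemma cut_bdd: "bdd_fun (cut n s)"
proof (rule bdd_funI[of _ "exp (\<bar>s\<bar> * real n)"])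
  show "cut n s \<in> borel_measurable borel" unfolding cut_def by measurable
  fix x
  have "s * x \<le> \<bar>s\<bar> * real n" if "\<bar>x\<bar> \<le> real n"
  proof -
    have "s * x \<le> \<bar>s\<bar> * \<bar>x\<bar>" by (metis abs_ge_self abs_mult)
    also have "\<dots> \<le> \<bar>s\<bar> * real n" using that by (intro mult_left_mono) auto
    finally show ?thesis .
  qed
  then show "cmod (cut n s x) \<le> exp (\<bar>s\<bar> * real n)"
    by (auto simp: cut_def indicator_def norm_mult)
qed

lemma cut_exp: "cut n r x * exp (complex_of_real (s * x)) = exp (complex_of_real (t * x)) * cut n q x" if "r + s = t + q"
proof -
  have "exp (r * x) * exp (s * x) = exp (t * x) * exp (q * x)"
    unfolding exp_add[symmetric] distrib_right[symmetric] that ..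
  then show ?thesis
    unfolding cut_def exp_of_real of_real_mult[symmetric] of_real_eq_iff by (simp add: mult.assoc mult.left_commute mult.commute)
qed

lemma G_cut_tendsto: "(\<lambda>n. G (cut n 0) \<Phi>) \<longlonglongrightarrow> \<Phi>"
proof -
  have eq: "cut n 0 = indicator {- real n..real n}" for n
    by (auto simp: cut_def indicator_def)
  have "(\<lambda>n. mul_l2 (\<lambda>p. indicator {- real n..real n} (\<pi> p)) (ext ft \<Phi>)) \<longlonglongrightarrow> ext ft \<Phi>"
  proof (rule cutoff_tendsto)
    show "\<forall>\<^sub>F n in sequentially. x \<in> {- real n..real n}" for x
    proof -
      obtain m :: nat where m: "\<bar>x\<bar> \<le> real m" using real_arch_simple by blast
      show ?thesis by (rule eventually_sequentiallyI[of m]) (use m in auto)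
    qed
  qed simp
  from bounded_linear.tendsto[OF unitary_bounded_linear[OF unitary_inv[OF unitary_ext_ft]] this]
  show ?thesis unfolding G_def eq by (simp add: unitary_ext_ft)
qed

lemma N_G:
  assumes "(\<Xi>, \<Psi>) \<in> N r"
  shows "G (cut n r) \<Xi> = G (cut n 0) \<Psi>"
proof -
  have "mul_l2 (\<lambda>p. cut n r (\<pi> p)) (ext ft \<Xi>) = mul_l2 (\<lambda>p. cut n 0 (\<pi> p)) (ext ft \<Psi>)"
  proof (rule mul_l2_eqI[OF bdd_fun_pi[OF cut_bdd]], use assms[unfolded N_iff]
      AE_rep_mul[OF bdd_fun_pi[OF cut_bdd], of n 0 "ext ft \<Psi>"] in eventually_elim)
    case (elim p)
    show ?case
      unfolding elim mult.assoc[symmetric] using cut_exp[of 0 r 0 r n "\<pi> p"] by simp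
  qed
  then show ?thesis unfolding G_def by simp
qed

lemma G_N: "(G (cut n (- r)) \<Psi>, G (cut n 0) \<Psi>) \<in> N r"
  unfolding N_iff ext_ft_G
  using AE_rep_mul[OF bdd_fun_pi[OF cut_bdd], of n 0 "ext ft \<Psi>"] AE_rep_mul[OF bdd_fun_pi[OF cut_bdd], of n "- r" "ext ft \<Psi>"]
proof eventually_elim
  case (elim p)
  show ?case
    unfolding elim mult.assoc[symmetric] using cut_exp[of 0 0 r "- r" n "\<pi> p"] by simp
qed

text \<open>On momenta in [-n, n], \<open>N (2 * s)\<close> is the bounded function
  \<open>cut n (2 * s)\<close>, so the truncated pair is a transfer from exponent -s to s.
  Closedness of the tensor operator and of its adjoint removes the truncation.\<close>

lemma absorb_N:
  assumes "(\<xi>, \<psi>) \<in> N (2 * s)"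
  shows "(\<phi>, \<xi>) \<in> gten T (exp_op (- s) \<P>) B \<Longrightarrow> (\<phi>, \<psi>) \<in> gten T (exp_op s \<P>) B"
    and "(\<phi>, \<xi>) \<in> adjoint_op (gten T (exp_op (- s) \<P>) B) \<Longrightarrow> (\<phi>, \<psi>) \<in> adjoint_op (gten T (exp_op s \<P>) B)"
proof -
  have lim: "(\<lambda>n. (G (cut n 0) \<phi>, G (cut n 0) \<psi>)) \<longlonglongrightarrow> (\<phi>, \<psi>)"
    by (intro tendsto_Pair G_cut_tendsto)
  have eq: "cut n (2 * s) x * exp (complex_of_real (- s * x)) = exp (complex_of_real (s * x)) * cut n 0 x" for n x
    by (rule cut_exp) simp
  show "(\<phi>, \<psi>) \<in> gten T (exp_op s \<P>) B" if "(\<phi>, \<xi>) \<in> gten T (exp_op (- s) \<P>) B"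
  proof (rule closed_sequentially[OF closed_gten _ lim])
    show "(G (cut n 0) \<phi>, G (cut n 0) \<psi>) \<in> gten T (exp_op s \<P>) B" for n
      using gten_transfer[OF cut_bdd cut_bdd eq that] unfolding N_G[OF assms] .
  qed
  show "(\<phi>, \<psi>) \<in> adjoint_op (gten T (exp_op s \<P>) B)" if "(\<phi>, \<xi>) \<in> adjoint_op (gten T (exp_op (- s) \<P>) B)"
  proof (rule closed_sequentially[OF closed_adjoint _ lim])
    show "(G (cut n 0) \<phi>, G (cut n 0) \<psi>) \<in> adjoint_op (gten T (exp_op s \<P>) B)" for n
      using adjoint_transfer[OF cut_bdd cut_bdd cut_real cut_real eq that] unfolding N_G[OF assms] .
  qed
qed

text \<open>Only truncated vectors are guaranteed to factor through \<open>N (2 * s)\<close>; this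
  is why the closure of the product has to be taken.\<close>

lemma split_N:
  shows "(\<phi>, \<psi>) \<in> gten T (exp_op s \<P>) B \<Longrightarrow>
      (G (cut n 0) \<phi>, G (cut n (- (2 * s))) \<psi>) \<in> gten T (exp_op (- s) \<P>) B"
    and "(\<phi>, \<psi>) \<in> adjoint_op (gten T (exp_op s \<P>) B) \<Longrightarrow>
      (G (cut n 0) \<phi>, G (cut n (- (2 * s))) \<psi>) \<in> adjoint_op (gten T (exp_op (- s) \<P>) B)"
proof -
  have eq: "cut n (- (2 * s)) x * exp (complex_of_real (s * x)) = exp (complex_of_real (- s * x)) * cut n 0 x" for x
    by (rule cut_exp) simp
  show "(G (cut n 0) \<phi>, G (cut n (- (2 * s))) \<psi>) \<in> gten T (exp_op (- s) \<P>) B"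
    if "(\<phi>, \<psi>) \<in> gten T (exp_op s \<P>) B"
    by (rule gten_transfer[OF cut_bdd cut_bdd eq that])
  show "(G (cut n 0) \<phi>, G (cut n (- (2 * s))) \<psi>) \<in> adjoint_op (gten T (exp_op (- s) \<P>) B)"
    if "(\<phi>, \<psi>) \<in> adjoint_op (gten T (exp_op s \<P>) B)"
    by (rule adjoint_transfer[OF cut_bdd cut_bdd cut_real cut_real eq that])
qed

end

section \<open>The block operators theta and diag\<close>

lemma theta1_iff: "((a, b, c, d), (a', b', c', d')) \<in> theta1 z \<longleftrightarrow>
    (b, a') \<in> z \<and> (a, b') \<in> adjoint_op z \<and> (d, c') \<in> z \<and> (c, d') \<in> adjoint_op z"
  by (simp add: theta1_def)

lemma theta2_iff: "((a, b, c, d), (a', b', c', d')) \<in> theta2 z \<longleftrightarrow>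
    (c, a') \<in> z \<and> (d, b') \<in> z \<and> (a, c') \<in> adjoint_op z \<and> (b, d') \<in> adjoint_op z"
  by (simp add: theta2_def)

lemma diag_iff: "((a, b, c, d), (a', b', c', d')) \<in> diag_op z1 z2 z3 z4 \<longleftrightarrow>
    (a, a') \<in> z1 \<and> (b, b') \<in> z2 \<and> (c, c') \<in> z3 \<and> (d, d') \<in> z4"
  by (simp add: diag_op_def)

lemma closed_theta1:
  assumes "closed z"
  shows "closed (theta1 z)"
proof -
  have "theta1 z = (\<lambda>p. (fst (snd (fst p)), fst (snd p))) -` z \<inter>
      (\<lambda>p. (fst (fst p), fst (snd (snd p)))) -` adjoint_op z \<inter>
      (\<lambda>p. (snd (snd (snd (fst p))), fst (snd (snd (snd p))))) -` z \<inter>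
      (\<lambda>p. (fst (snd (snd (fst p))), snd (snd (snd (snd p))))) -` adjoint_op z"
    by (auto simp: theta1_def)
  then show ?thesis
    using assms closed_adjoint by (auto intro!: closed_Int continuous_closed_vimage continuous_intros)
qed

lemma closed_theta2:
  assumes "closed z"
  shows "closed (theta2 z)"
proof -
  have "theta2 z = (\<lambda>p. (fst (snd (snd (fst p))), fst (snd p))) -` z \<inter>
      (\<lambda>p. (snd (snd (snd (fst p))), fst (snd (snd p)))) -` z \<inter>
      (\<lambda>p. (fst (fst p), fst (snd (snd (snd p))))) -` adjoint_op z \<inter>
      (\<lambda>p. (fst (snd (fst p)), snd (snd (snd (snd p))))) -` adjoint_op z"
    by (auto simp: theta2_def)
  then show ?thesis
    using assms closed_adjoint by (auto intro!: closed_Int continuous_closed_vimage continuous_intros)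
qed

context tensor_like
begin

lemma tendsto_cut_quad:
  "(\<lambda>n. ((G (cut n 0) a, G (cut n 0) b, G (cut n 0) c, G (cut n 0) d),
      (G (cut n 0) a', G (cut n 0) b', G (cut n 0) c', G (cut n 0) d'))) \<longlonglongrightarrow> ((a, b, c, d), (a', b', c', d'))"
  by (intro tendsto_Pair G_cut_tendsto)

text \<open>The four components involve the tensor operator and its adjoint, and
  \<open>absorb_N\<close> and \<open>split_N\<close> cover both. Products lie in the closed
  right-hand side; conversely the truncations of a pair there factor through the diagonal operator
  and converge to the pair.\<close>

lemma closure_theta1:
  "closure (theta1 (gten T (exp_op (- s) \<P>) B) O diag_op (N (2 * s)) (N (2 * s)) (N (2 * s)) (N (2 * s))) =
    theta1 (gten T (exp_op s \<P>) B)" (is "closure ?R = ?Q")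
proof
  have "?R \<subseteq> ?Q"
  proof
    fix p assume "p \<in> ?R"
    then obtain a b c d e f g h a' b' c' d' where p: "p = ((a, b, c, d), (a', b', c', d'))"
      and 1: "((a, b, c, d), (e, f, g, h)) \<in> theta1 (gten T (exp_op (- s) \<P>) B)"
      and 2: "((e, f, g, h), (a', b', c', d')) \<in> diag_op (N (2 * s)) (N (2 * s)) (N (2 * s)) (N (2 * s))"
      by (elim relcompE) (metis prod_cases4)
    show "p \<in> ?Q"
      using 1 2 unfolding p theta1_iff diag_iff by (blast intro: absorb_N)
  qed
  then show "closure ?R \<subseteq> ?Q" by (rule closure_minimal[OF _ closed_theta1[OF closed_gten]])
  show "?Q \<subseteq> closure ?R"
  proof
    fix p assume p: "p \<in> ?Q"
    obtain a b c d a' b' c' d' where pe: "p = ((a, b, c, d), (a', b', c', d'))"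
      by (metis prod.exhaust)
    have "((G (cut n 0) a, G (cut n 0) b, G (cut n 0) c, G (cut n 0) d),
      (G (cut n 0) a', G (cut n 0) b', G (cut n 0) c', G (cut n 0) d')) \<in> ?R" for n
    proof (rule relcompI)
      show "((G (cut n 0) a, G (cut n 0) b, G (cut n 0) c, G (cut n 0) d),
          (G (cut n (- (2 * s))) a', G (cut n (- (2 * s))) b', G (cut n (- (2 * s))) c', G (cut n (- (2 * s))) d'))
          \<in> theta1 (gten T (exp_op (- s) \<P>) B)"
        using p unfolding pe theta1_iff by (blast intro: split_N)
    qed (simp only: diag_iff G_N)
    then show "p \<in> closure ?R"
      unfolding pe by (rule closed_sequentially[OF closed_closure subsetD[OF closure_subset] tendsto_cut_quad])
  qed
qed

lemma closure_theta2:
  "closure (theta2 (gten T (exp_op (- s) \<P>) B) O diag_op (N (2 * s)) (N (2 * s)) (N (2 * s)) (N (2 * s))) =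
    theta2 (gten T (exp_op s \<P>) B)" (is "closure ?R = ?Q")
proof
  have "?R \<subseteq> ?Q"
  proof
    fix p assume "p \<in> ?R"
    then obtain a b c d e f g h a' b' c' d' where p: "p = ((a, b, c, d), (a', b', c', d'))"
      and 1: "((a, b, c, d), (e, f, g, h)) \<in> theta2 (gten T (exp_op (- s) \<P>) B)"
      and 2: "((e, f, g, h), (a', b', c', d')) \<in> diag_op (N (2 * s)) (N (2 * s)) (N (2 * s)) (N (2 * s))"
      by (elim relcompE) (metis prod_cases4)
    show "p \<in> ?Q"
      using 1 2 unfolding p theta2_iff diag_iff by (blast intro: absorb_N)
  qed
  then show "closure ?R \<subseteq> ?Q" by (rule closure_minimal[OF _ closed_theta2[OF closed_gten]])
  show "?Q \<subseteq> closure ?R"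
  proof
    fix p assume p: "p \<in> ?Q"
    obtain a b c d a' b' c' d' where pe: "p = ((a, b, c, d), (a', b', c', d'))"
      by (metis prod.exhaust)
    have "((G (cut n 0) a, G (cut n 0) b, G (cut n 0) c, G (cut n 0) d),
      (G (cut n 0) a', G (cut n 0) b', G (cut n 0) c', G (cut n 0) d')) \<in> ?R" for n
    proof (rule relcompI)
      show "((G (cut n 0) a, G (cut n 0) b, G (cut n 0) c, G (cut n 0) d),
          (G (cut n (- (2 * s))) a', G (cut n (- (2 * s))) b', G (cut n (- (2 * s))) c', G (cut n (- (2 * s))) d'))
          \<in> theta2 (gten T (exp_op (- s) \<P>) B)"
        using p unfolding pe theta2_iff by (blast intro: split_N)
    qed (simp only: diag_iff G_N)
    then show "p \<in> closure ?R"
      unfolding pe by (rule closed_sequentially[OF closed_closure subsetD[OF closure_subset] tendsto_cut_quad])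
  qed
qed

end

section \<open>Conjugation by diagonal unitaries\<close>

lemma diag_relcomp: "diag_op k k k k O diag_op k k k k = diag_op (k O k) (k O k) (k O k) (k O k)"
proof -
  have "((a, b, c, d), (a', b', c', d')) \<in> diag_op k k k k O diag_op k k k k \<longleftrightarrow>
      ((a, b, c, d), (a', b', c', d')) \<in> diag_op (k O k) (k O k) (k O k) (k O k)" for a b c d a' b' c' d'
    unfolding relcomp_unfold mem_Collect_eq case_prod_conv split_paired_Ex diag_iff by blast
  then have "p \<in> diag_op k k k k O diag_op k k k k \<longleftrightarrow> p \<in> diag_op (k O k) (k O k) (k O k) (k O k)" for p
    by (metis prod.exhaust)
  then show ?thesis by blast
qed

lemma diag_converse: "(diag_op k k k k)\<inverse> = diag_op (k\<inverse>) (k\<inverse>) (k\<inverse>) (k\<inverse>)"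
  by (auto simp: diag_op_def)

lemma (in tensor_like) diag_N_square:
  "diag_op (N s) (N s) (N s) (N s) ^^ 2 = diag_op (N (2 * s)) (N (2 * s)) (N (2 * s)) (N (2 * s))"
  by (simp add: numeral_2_eq_2 diag_relcomp N_square)

definition quad :: "('a \<Rightarrow> 'a) \<Rightarrow> ('a \<Rightarrow> 'a) \<Rightarrow> ('a \<Rightarrow> 'a) \<Rightarrow> ('a \<Rightarrow> 'a) \<Rightarrow> 'a \<times> 'a \<times> 'a \<times> 'a \<Rightarrow> 'a \<times> 'a \<times> 'a \<times> 'a" where
  "quad A B C D = (\<lambda>(a, b, c, d). (A a, B b, C c, D d))"

lemma diag_graph:
  "diag_op {(\<phi>, A \<phi>) |\<phi>. True} {(\<phi>, B \<phi>) |\<phi>. True} {(\<phi>, C \<phi>) |\<phi>. True} {(\<phi>, D \<phi>) |\<phi>. True} =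
    {(x, quad A B C D x) |x. True}"
  by (auto simp: diag_op_def quad_def)

text \<open>Conjugation of an operator by an everywhere defined map is the direct image of its
  graph, so domains are carried along automatically.\<close>

lemma graph_conj: "({(x, f x) |x. True}\<inverse> O R) O {(x, f x) |x. True} = map_prod f f ` R"
  by (force simp: relcomp_unfold image_iff)

lemma graph_comp: "{(x, f x) |x. True} O {(x, g x) |x. True} = {(x, (g \<circ> f) x) |x. True}"
  by (auto simp: relcomp_unfold)

lemma mem_map_prod_quad:
  assumes u: "unitary_map A" "unitary_map B" "unitary_map C" "unitary_map D"
  shows "((a, b, c, d), (a', b', c', d')) \<in> map_prod (quad A B C D) (quad A B C D) ` R \<longleftrightarrow>
    ((inv A a, inv B b, inv C c, inv D d), (inv A a', inv B b', inv C c', inv D d')) \<in> R"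
proof
  assume "((inv A a, inv B b, inv C c, inv D d), (inv A a', inv B b', inv C c', inv D d')) \<in> R"
  from imageI[OF this, of "map_prod (quad A B C D) (quad A B C D)"]
  show "((a, b, c, d), (a', b', c', d')) \<in> map_prod (quad A B C D) (quad A B C D) ` R"
    using u by (simp add: quad_def)
qed (use u in \<open>auto simp: quad_def\<close>)

text \<open>In \<open>theta1\<close> the entry z leads from the second component to the first and
  from the fourth to the third, hence the order B, A and D, C. The entries with the adjoint go the
  opposite way and follow from the same hypotheses.\<close>

lemma theta1_quad:
  assumes u: "unitary_map A" "unitary_map B" "unitary_map C" "unitary_map D"
    and z: "map_prod B A ` z = z'" "map_prod D C ` z = z'"
  shows "map_prod (quad A B C D) (quad A B C D) ` theta1 z = theta1 z'"
proof (intro set_eqI)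
  fix p :: "l2_2_4 \<times> l2_2_4"
  obtain a b c d a' b' c' d' where p: "p = ((a, b, c, d), (a', b', c', d'))" by (metis prod.exhaust)
  note adj = adjoint_map_prod[OF u(2,1), of z, unfolded z(1)] adjoint_map_prod[OF u(4,3), of z, unfolded z(2)]
  have 1: "(inv B x, inv A y) \<in> z \<longleftrightarrow> (x, y) \<in> z'" "(inv D x, inv C y) \<in> z \<longleftrightarrow> (x, y) \<in> z'" for x y
    using mem_map_prod[OF u(2,1), of x y z] mem_map_prod[OF u(4,3), of x y z] unfolding z by auto
  have 2: "(inv A x, inv B y) \<in> adjoint_op z \<longleftrightarrow> (x, y) \<in> adjoint_op z'"
    "(inv C x, inv D y) \<in> adjoint_op z \<longleftrightarrow> (x, y) \<in> adjoint_op z'" for x y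
    using mem_map_prod[OF u(1,2), of x y "adjoint_op z"] mem_map_prod[OF u(3,4), of x y "adjoint_op z"]
    unfolding adj[symmetric] by auto
  show "p \<in> map_prod (quad A B C D) (quad A B C D) ` theta1 z \<longleftrightarrow> p \<in> theta1 z'"
    unfolding p mem_map_prod_quad[OF u] theta1_iff 1 2 ..
qed

lemma theta2_quad:
  assumes u: "unitary_map A" "unitary_map B" "unitary_map C" "unitary_map D"
    and z: "map_prod C A ` z = z'" "map_prod D B ` z = z'"
  shows "map_prod (quad A B C D) (quad A B C D) ` theta2 z = theta2 z'"
proof (intro set_eqI)
  fix p :: "l2_2_4 \<times> l2_2_4"
  obtain a b c d a' b' c' d' where p: "p = ((a, b, c, d), (a', b', c', d'))" by (metis prod.exhaust)
  note adj = adjoint_map_prod[OF u(3,1), of z, unfolded z(1)] adjoint_map_prod[OF u(4,2), of z, unfolded z(2)]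
  have 1: "(inv C x, inv A y) \<in> z \<longleftrightarrow> (x, y) \<in> z'" "(inv D x, inv B y) \<in> z \<longleftrightarrow> (x, y) \<in> z'" for x y
    using mem_map_prod[OF u(3,1), of x y z] mem_map_prod[OF u(4,2), of x y z] unfolding z by auto
  have 2: "(inv A x, inv C y) \<in> adjoint_op z \<longleftrightarrow> (x, y) \<in> adjoint_op z'"
    "(inv B x, inv D y) \<in> adjoint_op z \<longleftrightarrow> (x, y) \<in> adjoint_op z'" for x y
    using mem_map_prod[OF u(1,3), of x y "adjoint_op z"] mem_map_prod[OF u(2,4), of x y "adjoint_op z"]
    unfolding adj[symmetric] by auto
  show "p \<in> map_prod (quad A B C D) (quad A B C D) ` theta2 z \<longleftrightarrow> p \<in> theta2 z'"
    unfolding p mem_map_prod_quad[OF u] theta2_iff 1 2 ..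
qed

lemma op_minus_theta:
  "op_minus (theta1 z) = theta1 (map_prod id uminus ` z)"
  "op_minus (theta2 z) = theta2 (map_prod id uminus ` z)"
proof -
  have "p \<in> op_minus (theta1 z) \<longleftrightarrow> p \<in> theta1 (map_prod id uminus ` z)"
    "p \<in> op_minus (theta2 z) \<longleftrightarrow> p \<in> theta2 (map_prod id uminus ` z)" for p :: "l2_2_4 \<times> l2_2_4"
  proof -
    obtain a b c d a' b' c' d' where p: "p = ((a, b, c, d), (a', b', c', d'))" by (metis prod.exhaust)
    show "p \<in> op_minus (theta1 z) \<longleftrightarrow> p \<in> theta1 (map_prod id uminus ` z)"
      "p \<in> op_minus (theta2 z) \<longleftrightarrow> p \<in> theta2 (map_prod id uminus ` z)"
      unfolding p op_minus_eq mem_uminus uminus_Pair theta1_iff theta2_iff adjoint_uminus by simp_all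
  qed
  then show "op_minus (theta1 z) = theta1 (map_prod id uminus ` z)"
    "op_minus (theta2 z) = theta2 (map_prod id uminus ` z)" by blast+
qed

lemma map_prod_quad_op_minus:
  assumes u: "unitary_map A" "unitary_map B" "unitary_map C" "unitary_map D"
  shows "map_prod (quad A B C D) (quad A B C D) ` op_minus R = op_minus (map_prod (quad A B C D) (quad A B C D) ` R)"
proof -
  have "U (- x) = - U x" if "unitary_map U" for U :: "'a l2 \<Rightarrow> 'a l2" and x
    by (rule linear_neg[OF bounded_linear.linear[OF unitary_bounded_linear[OF that]]])
  then have "quad A B C D (- x) = - quad A B C D x" for x
    using u by (cases x) (simp add: quad_def)
  then show ?thesis unfolding op_minus_eq image_image by (auto simp: map_prod_def case_prod_unfold intro!: image_cong)
qed

context wv_ops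
begin

lemma conj_exp_position: "map_prod Uv Uw ` exp_op (2 * pi * a) \<Q> = map_prod id uminus ` L_op a b"
proof (intro set_eqI)
  fix p :: "real l2 \<times> real l2"
  obtain x y where p: "p = (x, y)" by fastforce
  show "p \<in> map_prod Uv Uw ` exp_op (2 * pi * a) \<Q> \<longleftrightarrow> p \<in> map_prod id uminus ` L_op a b"
    unfolding p mem_map_prod[OF Uv Uw] exp_position_conj_L mem_uminus
      unitary_inv_apply(2)[OF Uv] unitary_inv_apply(2)[OF Uw] ..
qed

lemma conj_L: "map_prod Uv Uw ` L_op a b = exp_op (2 * pi * a) \<Q>"
proof (intro set_eqI)
  fix p :: "real l2 \<times> real l2"
  obtain x y where p: "p = (x, y)" by fastforce
  show "p \<in> map_prod Uv Uw ` L_op a b \<longleftrightarrow> p \<in> exp_op (2 * pi * a) \<Q>"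
    unfolding p mem_map_prod[OF Uv Uw] L_conj_exp_position
      unitary_inv_apply(2)[OF Uv] unitary_inv_apply(2)[OF Uw] ..
qed

lemma conj_exp_momentum:
  "map_prod Uw Uw ` exp_op t \<P> = exp_op (- t) \<P>" "map_prod Uv Uv ` exp_op t \<P> = exp_op (- t) \<P>"
proof -
  have "p \<in> map_prod Uw Uw ` exp_op t \<P> \<longleftrightarrow> p \<in> exp_op (- t) \<P>" for p
  proof -
    obtain x y where p: "p = (x, y)" by fastforce
    show ?thesis
      unfolding p mem_map_prod[OF Uw Uw] exp_momentum_conj_w[of "inv Uw x" "inv Uw y" t] unitary_inv_apply(2)[OF Uw] ..
  qed
  then show "map_prod Uw Uw ` exp_op t \<P> = exp_op (- t) \<P>" by blast
  have "p \<in> map_prod Uv Uv ` exp_op t \<P> \<longleftrightarrow> p \<in> exp_op (- t) \<P>" for p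
  proof -
    obtain x y where p: "p = (x, y)" by fastforce
    show ?thesis
      unfolding p mem_map_prod[OF Uv Uv] exp_momentum_conj_v[of "inv Uv x" "inv Uv y" t] unitary_inv_apply(2)[OF Uv] ..
  qed
  then show "map_prod Uv Uv ` exp_op t \<P> = exp_op (- t) \<P>" by blast
qed

end

theorem proposition27:
  fixes q :: complex and \<gamma> \<alpha> \<beta> :: real
    and w\<^sub>\<alpha> v\<^sub>\<alpha> w\<^sub>\<beta> v\<^sub>\<beta> :: "complex \<Rightarrow> complex"
    and F\<^sub>x F\<^sub>y F x y D\<^sub>x D\<^sub>y K\<^sub>1 K\<^sub>2 :: "l2_2_4 operator"
  assumes "cmod q = 1" "q \<noteq> 1" "q \<noteq> -1" "q = exp (2 * of_real pi * \<i> * of_real \<gamma>)"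
    and "\<alpha> * \<beta> = \<gamma>"
    and "0 < \<bar>\<gamma>\<bar>" "\<bar>\<gamma>\<bar> < 1 / 3"
    and "wv_pair \<alpha> \<beta> w\<^sub>\<alpha> v\<^sub>\<alpha>" "wv_pair \<beta> \<alpha> w\<^sub>\<beta> v\<^sub>\<beta>"
  defines "x \<equiv> x_op \<alpha>" and "y \<equiv> y_op \<beta>"
    and "D\<^sub>x \<equiv> Dx_op \<alpha> \<beta>" and "D\<^sub>y \<equiv> Dy_op \<alpha> \<beta>"
    and "K\<^sub>1 \<equiv> K1_op \<beta>" and "K\<^sub>2 \<equiv> K2_op \<alpha>"
    and "F\<^sub>x \<equiv> Fx_op w\<^sub>\<alpha> v\<^sub>\<alpha>" and "F\<^sub>y \<equiv> Fy_op w\<^sub>\<beta> v\<^sub>\<beta>"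
    and "F \<equiv> F\<^sub>x \<bullet>\<^sub>o F\<^sub>y"
  shows
    "(F\<^sub>x \<bullet>\<^sub>o x \<bullet>\<^sub>o F\<^sub>x\<inverse> = op_minus D\<^sub>x \<and>
     F\<^sub>x \<bullet>\<^sub>o D\<^sub>x \<bullet>\<^sub>o F\<^sub>x\<inverse> = x \<and>
     F\<^sub>x \<bullet>\<^sub>o y \<bullet>\<^sub>o F\<^sub>x\<inverse> = closure ((K\<^sub>1 ^^ 2)\<inverse> \<bullet>\<^sub>o y) \<and>
     F\<^sub>x \<bullet>\<^sub>o D\<^sub>y \<bullet>\<^sub>o F\<^sub>x\<inverse> = closure ((K\<^sub>1 ^^ 2)\<inverse> \<bullet>\<^sub>o D\<^sub>y)) \<and>
     (F\<^sub>y \<bullet>\<^sub>o y \<bullet>\<^sub>o F\<^sub>y\<inverse> = op_minus D\<^sub>y \<and>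
     F\<^sub>y \<bullet>\<^sub>o D\<^sub>y \<bullet>\<^sub>o F\<^sub>y\<inverse> = y \<and>
     F\<^sub>y \<bullet>\<^sub>o x \<bullet>\<^sub>o F\<^sub>y\<inverse> = closure ((K\<^sub>2 ^^ 2) \<bullet>\<^sub>o x) \<and>
     F\<^sub>y \<bullet>\<^sub>o D\<^sub>x \<bullet>\<^sub>o F\<^sub>y\<inverse> = closure ((K\<^sub>2 ^^ 2) \<bullet>\<^sub>o D\<^sub>x)) \<and>
     (F \<bullet>\<^sub>o x \<bullet>\<^sub>o F\<inverse> = op_minus (closure ((K\<^sub>2 ^^ 2) \<bullet>\<^sub>o D\<^sub>x)) \<and>
     F \<bullet>\<^sub>o y \<bullet>\<^sub>o F\<inverse> = op_minus (closure ((K\<^sub>1 ^^ 2)\<inverse> \<bullet>\<^sub>o D\<^sub>y)) \<and>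
     F \<bullet>\<^sub>o D\<^sub>x \<bullet>\<^sub>o F\<inverse> = closure ((K\<^sub>2 ^^ 2) \<bullet>\<^sub>o x) \<and>
     F \<bullet>\<^sub>o D\<^sub>y \<bullet>\<^sub>o F\<inverse> = closure ((K\<^sub>1 ^^ 2)\<inverse> \<bullet>\<^sub>o y))"
proof -
  have ne: "\<alpha> \<noteq> 0" "\<beta> \<noteq> 0" using assms(5,6) by auto
  \<comment> \<open>A zero of the sine would make \<gamma> = \<alpha> \<beta> an integer, which 0 <
    |\<gamma>| < 1/3 excludes.\<close>
  have sin: "sin (pi * (\<alpha> * \<beta>)) \<noteq> 0"
  proof
    assume "sin (pi * (\<alpha> * \<beta>)) = 0"
    then obtain i :: int where "pi * (\<alpha> * \<beta>) = of_int i * pi"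
      unfolding sin_zero_iff_int2 by blast
    then have "\<gamma> = of_int i" using assms(5) by simp
    then show False using assms(6,7) by simp
  qed
  interpret A: wv \<alpha> \<beta> w\<^sub>\<alpha> v\<^sub>\<alpha>
    by unfold_locales (use assms(8) ne sin in \<open>auto simp: mult_ac\<close>)
  interpret B: wv \<beta> \<alpha> w\<^sub>\<beta> v\<^sub>\<beta>
    by unfold_locales (use assms(9) ne sin in \<open>auto simp: mult_ac\<close>)
  obtain Wa Va where Aop: "wv_ops \<alpha> \<beta> w\<^sub>\<alpha> v\<^sub>\<alpha> Wa Va"
    and uA: "u_conj w\<^sub>\<alpha> = {(\<phi>, Wa \<phi>) |\<phi>. True}" "u_conj v\<^sub>\<alpha> = {(\<phi>, Va \<phi>) |\<phi>. True}"
    by (rule A.obtain_ops)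
  obtain Wb Vb where Bop: "wv_ops \<beta> \<alpha> w\<^sub>\<beta> v\<^sub>\<beta> Wb Vb"
    and uB: "u_conj w\<^sub>\<beta> = {(\<phi>, Wb \<phi>) |\<phi>. True}" "u_conj v\<^sub>\<beta> = {(\<phi>, Vb \<phi>) |\<phi>. True}"
    by (rule B.obtain_ops)
  \<comment> \<open>Naming the exponentials lets the rewrite rules below match on the real parameter
    instead of on the function inside the functional calculus.\<close>
  define EP where "EP s = exp_op s \<P>" for s
  define EQ where "EQ a = exp_op (2 * pi * a) \<Q>" for a
  note A1 = wv_ops.conj_exp_position[OF Aop, folded EQ_def] and A2 = wv_ops.conj_L[OF Aop, folded EQ_def]
    and A3 = wv_ops.conj_exp_momentum[OF Aop, folded EP_def]
  note B1 = wv_ops.conj_exp_position[OF Bop, folded EQ_def] and B2 = wv_ops.conj_L[OF Bop, folded EQ_def]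
    and B3 = wv_ops.conj_exp_momentum[OF Bop, folded EP_def]
  note UA = wv_ops.Uw[OF Aop] wv_ops.Uv[OF Aop] and UB = wv_ops.Uw[OF Bop] wv_ops.Uv[OF Bop]
  let ?T1 = tensor_vec and ?T2 = "\<lambda>f g. tensor_vec g f"
  note sw = tensor_op_gten1[symmetric] tensor_op_gten2[symmetric]
  define fx where "fx = quad (T1.ext Wa) (T1.ext Va) (T1.ext Wa) (T1.ext Va)"
  define fy where "fy = quad (T2.ext Wb) (T2.ext Wb) (T2.ext Vb) (T2.ext Vb)"
  note EA = T1.ext_unitary(1)[OF UA(1)] T1.ext_unitary(1)[OF UA(2)]
    and EB = T2.ext_unitary(1)[OF UB(1)] T2.ext_unitary(1)[OF UB(2)]
  have Fx: "F\<^sub>x = {(x, fx x) |x. True}"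
    unfolding F\<^sub>x_def Fx_op_def sigma1_def uA tensor_op_gten1 T1.gten_graph[OF UA(1)] T1.gten_graph[OF UA(2)] fx_def
    by (rule diag_graph)
  have Fy: "F\<^sub>y = {(x, fy x) |x. True}"
    unfolding F\<^sub>y_def Fy_op_def sigma2_def uB tensor_op_gten2 T2.gten_graph[OF UB(1)] T2.gten_graph[OF UB(2)] fy_def
    by (rule diag_graph)
  have F: "F = {(x, (fx \<circ> fy) x) |x. True}"
    unfolding F_def Fx Fy by (rule graph_comp)
  have cx: "(F\<^sub>x\<inverse> O R) O F\<^sub>x = map_prod fx fx ` R" for R unfolding Fx by (rule graph_conj)
  have cy: "(F\<^sub>y\<inverse> O R) O F\<^sub>y = map_prod fy fy ` R" for R unfolding Fy by (rule graph_conj)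
  \<comment> \<open>In F = F_x F_y the factor F_y acts first, so the image under \<open>fy\<close>
    is taken inside.\<close>
  have cF: "(F\<inverse> O R) O F = map_prod fx fx ` map_prod fy fy ` R" for R
    unfolding F graph_conj by (simp add: image_image map_prod_def case_prod_unfold)
  \<comment> \<open>The second tensor factor S is arbitrary: in the relations for F it has already
    been changed by F_y from e^(-pi \<alpha> \<P>) to e^(pi \<alpha> \<P>).\<close>
  have X1: "map_prod fx fx ` theta1 (EQ \<alpha> \<otimes>\<^sub>o S) = op_minus (theta1 (L_op \<alpha> \<beta> \<otimes>\<^sub>o S))" for S
    unfolding fx_def op_minus_theta tensor_op_gten1 T1.gten_uminus
    by (rule theta1_quad[OF EA EA]; unfold T1.gten_map_prod[OF UA(2,1)] A1; rule refl)
  have X2: "map_prod fx fx ` theta1 (L_op \<alpha> \<beta> \<otimes>\<^sub>o S) = theta1 (EQ \<alpha> \<otimes>\<^sub>o S)" for S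
    unfolding fx_def tensor_op_gten1
    by (rule theta1_quad[OF EA EA]; unfold T1.gten_map_prod[OF UA(2,1)] A2; rule refl)
  have X3: "map_prod fx fx ` theta2 (EP s \<otimes>\<^sub>o S) = theta2 (EP (- s) \<otimes>\<^sub>o S)" for s S
    unfolding fx_def tensor_op_gten1
    by (rule theta2_quad[OF EA EA]; unfold T1.gten_map_prod[OF UA(1) UA(1)] T1.gten_map_prod[OF UA(2) UA(2)] A3; rule refl)
  have Y1: "map_prod fy fy ` theta2 (S \<otimes>\<^sub>o EQ \<beta>) = op_minus (theta2 (S \<otimes>\<^sub>o L_op \<beta> \<alpha>))" for S
    unfolding fy_def op_minus_theta tensor_op_gten2 T2.gten_uminus
    by (rule theta2_quad[OF EB(1) EB(1) EB(2) EB(2)]; unfold T2.gten_map_prod[OF UB(2,1)] B1; rule refl)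
  have Y2: "map_prod fy fy ` theta2 (S \<otimes>\<^sub>o L_op \<beta> \<alpha>) = theta2 (S \<otimes>\<^sub>o EQ \<beta>)" for S
    unfolding fy_def tensor_op_gten2
    by (rule theta2_quad[OF EB(1) EB(1) EB(2) EB(2)]; unfold T2.gten_map_prod[OF UB(2,1)] B2; rule refl)
  have Y3: "map_prod fy fy ` theta1 (S \<otimes>\<^sub>o EP s) = theta1 (S \<otimes>\<^sub>o EP (- s))" for s S
    unfolding fy_def tensor_op_gten2
    by (rule theta1_quad[OF EB(1) EB(1) EB(2) EB(2)];
        unfold T2.gten_map_prod[OF UB(1) UB(1)] T2.gten_map_prod[OF UB(2) UB(2)] B3; rule refl)
  have Xm: "map_prod fx fx ` op_minus R = op_minus (map_prod fx fx ` R)" for R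
    unfolding fx_def by (rule map_prod_quad_op_minus[OF EA EA])
  \<comment> \<open>K_1^-2 has components of exponent -2 pi \<beta>, the value 2s for s = -pi
    \<beta>. It therefore carries e^(pi \<beta> \<P>) to e^(-pi \<beta> \<P>) in the first factor,
    which is also the effect of F_x.\<close>
  have C1: "closure (theta2 (EP (pi * \<beta>) \<otimes>\<^sub>o S) O (K\<^sub>1 ^^ 2)\<inverse>) = theta2 (EP (- (pi * \<beta>)) \<otimes>\<^sub>o S)" for S
  proof -
    have "(K\<^sub>1 ^^ 2)\<inverse> = diag_op (T1.N (2 * - (pi * \<beta>))) (T1.N (2 * - (pi * \<beta>))) (T1.N (2 * - (pi * \<beta>))) (T1.N (2 * - (pi * \<beta>)))"
      unfolding K\<^sub>1_def K1_op_def Let_def tensor_op_gten1 T1.gten_exp_momentum T1.diag_N_square diag_converse T1.N_inverse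
      by simp
    then show ?thesis
      using T1.closure_theta2[of "- (pi * \<beta>)" S] by (simp add: EP_def tensor_op_gten1)
  qed
  have C2: "closure (theta1 (S \<otimes>\<^sub>o EP (- (pi * \<alpha>))) O (K\<^sub>2 ^^ 2)) = theta1 (S \<otimes>\<^sub>o EP (pi * \<alpha>))" for S
  proof -
    have "K\<^sub>2 ^^ 2 = diag_op (T2.N (2 * (pi * \<alpha>))) (T2.N (2 * (pi * \<alpha>))) (T2.N (2 * (pi * \<alpha>))) (T2.N (2 * (pi * \<alpha>)))"
      unfolding K\<^sub>2_def K2_op_def Let_def tensor_op_gten2 T2.gten_exp_momentum T2.diag_N_square ..
    then show ?thesis
      using T2.closure_theta1[of "pi * \<alpha>" S] by (simp add: EP_def tensor_op_gten2)
  qed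
  have m: "- pi * \<alpha> = - (pi * \<alpha>)" by simp
  have x: "x = theta1 (EQ \<alpha> \<otimes>\<^sub>o EP (- (pi * \<alpha>)))"
    unfolding x_def x_op_def EQ_def EP_def m ..
  have y: "y = theta2 (EP (pi * \<beta>) \<otimes>\<^sub>o EQ \<beta>)"
    unfolding y_def y_op_def EQ_def EP_def ..
  have Dx: "D\<^sub>x = theta1 (L_op \<alpha> \<beta> \<otimes>\<^sub>o EP (- (pi * \<alpha>)))"
    unfolding D\<^sub>x_def Dx_op_def EP_def m ..
  have Dy: "D\<^sub>y = theta2 (EP (pi * \<beta>) \<otimes>\<^sub>o L_op \<beta> \<alpha>)"
    unfolding D\<^sub>y_def Dy_op_def EP_def ..
  show ?thesis
    \<comment> \<open>Both sides are reduced to the same theta expression: conjugations flip the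
      exponents or exchange e^(2 pi a \<Q>) with L up to sign, and the closures on the right become
      flipped exponents through \<open>C1\<close> and \<open>C2\<close>.\<close>
    unfolding cx cy cF unfolding x y Dx Dy
    by (intro conjI; simp only: X1 X2 X3 Y1 Y2 Y3 Xm C1 C2 minus_minus)
qed

end
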